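(* Let $\pi^X\propto\exp(-f)$ on $\mathbb{R}^d$, where $f:\mathbb{R}^d\to\mathbb{R}$ is $\beta$-smooth (i.e. $\nabla f$ is $\beta$-Lipschitz), $\beta>0$, and $\pi^X$ satisfies the Latała–Oleszkiewicz inequality of order $r$ and constant $\alpha>0$ ($(r,\alpha)$-LOI). Let $q\ge2$ and $\varepsilon>0$. Take the step size $\eta\asymp\frac1{\beta d}$ and, in each iteration of the proximal sampler, implement the draw from $\pi^{X\mid Y}(\cdot\mid y)$ by rejection sampling. Then, for a suitable number $k$ of iterations, the proximal sampler started from $\rho_0^X$ outputs a sample with law $\rho_k^X$ satisfying $R_{q,\pi^X}(\rho_k^X)\le\varepsilon$, and the expected total number of calls to an oracle for $f$ is $$\widetilde O\Bigl(\frac{\beta dq}{\alpha}\,\bigl(R_{q,\pi^X}(\rho_0^X)^{2/r-1}\vee\log(1/\varepsilon)\bigr)\Bigr).$$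
   Context: Probability measures are identified with their Lebesgue densities when these exist; $\pi^X$ is assumed to have finite second moment. $a\vee b=\max(a,b)$. Proximal sampler with step size $\eta>0$: let $\pi(x,y)\propto \exp(-f(x)-\frac{1}{2\eta}\|x-y\|^2)$ on $\mathbb{R}^d\times\mathbb{R}^d$, with conditionals $\pi^{Y\mid X}(\cdot\mid x)=\mathcal N(x,\eta I)$ and $\pi^{X\mid Y}(x\mid y)\propto_x \exp(-f(x)-\frac1{2\eta}\|x-y\|^2)$. Starting from $x_0\sim\rho_0^X$, for $k=0,1,\dots$: draw $y_k\mid x_k\sim\pi^{Y\mid X}(\cdot\mid x_k)$, then $x_{k+1}\mid y_k\sim \pi^{X\mid Y}(\cdot\mid y_k)$. $\rho_k^X$ denotes the law of $x_k$. Rejection sampling for $\tilde\pi\propto\exp(-\tilde f)$ with $\tilde f$ being $\tilde\alpha$-strongly convex: compute the minimizer $x^\star$ of $\tilde f$; then repeat until acceptance: draw $Z\sim\mathcal N(x^\star,\tilde\alpha^{-1}I)$ and accept it with probability $\exp(-\tilde f(Z)+\tilde f(x^\star)+\frac{\tilde\alpha}{2}\|Z-x^\star\|^2)$; output the accepted $Z$, which has law $\tilde\pi$. Here it is applied with $\tilde f(x)=f(x)+\frac1{2\eta}\|x-y\|^2$, where $\eta<1/\beta$, so that $\tilde f$ is $(\frac1\eta-\beta)$-strongly convex and $(\frac1\eta+\beta)$-smooth. An oracle for $f$ can evaluate $f$ at a point and can compute the proximity operator of $f$, i.e. the exact minimizer of $x\mapsto f(x)+\frac1{2\eta}\|x-y\|^2$.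 The notation $\eta\asymp\frac1{\beta d}$ means $\eta=\frac{c}{\beta d}$ for a suitable (sufficiently small) absolute constant $c>0$. The notation $\widetilde O(\cdot)$ hides absolute constants and factors polylogarithmic in the problem parameters ($\beta/\alpha$, $d$, $q$, $R_{q,\pi^X}(\rho_0^X)$, $1/\varepsilon$); the bound is understood in the regime where the displayed quantity is bounded below by a positive absolute constant (so that rounding $k$ to an integer is immaterial). Rényi divergence of order $q>1$: $R_{q,\pi}(\rho)=\frac1{q-1}\log\int\frac{\rho^q}{\pi^{q-1}}$. Latała–Oleszkiewicz inequality: $\pi$ satisfies $(r,\alpha)$-LOI, with $r\in[1,2]$ and $\alpha>0$, if for any smooth bounded $\psi:\mathbb{R}^d\to\mathbb{R}_+$, $$\sup_{p\in(1,2)}\frac{\mathbb{E}_\pi[\psi^2]-\mathbb{E}_\pi[\psi^p]^{2/p}}{(2-p)^{2(1-1/r)}}\le\frac1\alpha\,\mathbb{E}_\pi[\|\nabla\psi\|^2].$$ *)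

theory Defs
  imports "HOL-Probability.Probability"
begin

(* R^d is the set of extensional functions on {..<d}, so that constants independent of d
   can be quantified before d. It is the space of lebd d and the topspace of the product
   topology below. *)

abbreviation Rd :: "nat \<Rightarrow> (nat \<Rightarrow> real) set" where
  "Rd d \<equiv> PiE {..<d} (\<lambda>_. UNIV)"

abbreviation lebd :: "nat \<Rightarrow> (nat \<Rightarrow> real) measure" where
  "lebd d \<equiv> Pi\<^sub>M {..<d} (\<lambda>_. lborel)"

definition distd :: "nat \<Rightarrow> (nat \<Rightarrow> real) \<Rightarrow> (nat \<Rightarrow> real) \<Rightarrow> real" where
  "distd d x y = L2_set (\<lambda>i. x i - y i) {..<d}"

definition normd :: "nat \<Rightarrow> (nat \<Rightarrow> real) \<Rightarrow> real" where
  "normd d x = L2_set x {..<d}"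

definition has_partials :: "nat \<Rightarrow> ((nat \<Rightarrow> real) \<Rightarrow> real) \<Rightarrow> bool" where
  "has_partials d f \<longleftrightarrow>
     (\<forall>x\<in>Rd d. \<forall>i<d. (\<lambda>t. f (x(i := t))) differentiable at (x i))"

definition gradd :: "nat \<Rightarrow> ((nat \<Rightarrow> real) \<Rightarrow> real) \<Rightarrow> (nat \<Rightarrow> real) \<Rightarrow> nat \<Rightarrow> real" where
  "gradd d f x = (\<lambda>i\<in>{..<d}. deriv (\<lambda>t. f (x(i := t))) (x i))"

(* Existence of the partial derivatives together with the Lipschitz bound makes f
   continuously differentiable, so gradd is the Frechet gradient here. *)
definition smooth_grad :: "nat \<Rightarrow> real \<Rightarrow> ((nat \<Rightarrow> real) \<Rightarrow> real) \<Rightarrow> bool" where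
  "smooth_grad d \<beta> f \<longleftrightarrow> has_partials d f \<and>
     (\<forall>x\<in>Rd d. \<forall>y\<in>Rd d. distd d (gradd d f x) (gradd d f y) \<le> \<beta> * distd d x y)"

primrec Ck :: "nat \<Rightarrow> nat \<Rightarrow> ((nat \<Rightarrow> real) \<Rightarrow> real) \<Rightarrow> bool" where
  "Ck d 0 f \<longleftrightarrow>
     continuous_map (product_topology (\<lambda>_. euclideanreal) {..<d}) euclideanreal f"
| "Ck d (Suc k) f \<longleftrightarrow>
     continuous_map (product_topology (\<lambda>_. euclideanreal) {..<d}) euclideanreal f \<and>
     has_partials d f \<and> (\<forall>i<d. Ck d k (\<lambda>x. gradd d f x i))"

definition Cinf :: "nat \<Rightarrow> ((nat \<Rightarrow> real) \<Rightarrow> real) \<Rightarrow> bool" where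
  "Cinf d f \<longleftrightarrow> (\<forall>k. Ck d k f)"

definition gibbs :: "nat \<Rightarrow> ((nat \<Rightarrow> real) \<Rightarrow> real) \<Rightarrow> (nat \<Rightarrow> real) measure" where
  "gibbs d g =
     density (lebd d) (\<lambda>x. ennreal (exp (- g x) / (\<integral>z. exp (- g z) \<partial>lebd d)))"

(* N(m, v I); the second argument is the variance, whereas normal_density takes the
   standard deviation. *)
definition gauss :: "nat \<Rightarrow> (nat \<Rightarrow> real) \<Rightarrow> real \<Rightarrow> (nat \<Rightarrow> real) measure" where
  "gauss d m v =
     density (lebd d) (\<lambda>z. ennreal (\<Prod>i<d. normal_density (m i) (sqrt v) (z i)))"

(* The quotient is nonnegative by monotonicity of L^p norms, so ennreal does not truncate
   it; the right-hand side may be infinite. *)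
definition LOI ::
  "nat \<Rightarrow> real \<Rightarrow> real \<Rightarrow> (nat \<Rightarrow> real) measure \<Rightarrow> bool" where
  "LOI d r \<alpha> \<pi> \<longleftrightarrow> 1 \<le> r \<and> r \<le> 2 \<and> 0 < \<alpha> \<and>
     (\<forall>\<psi>. Cinf d \<psi> \<and> (\<forall>x\<in>Rd d. 0 \<le> \<psi> x) \<and> (\<exists>B. \<forall>x\<in>Rd d. \<psi> x \<le> B) \<longrightarrow>
       (SUP p\<in>{1<..<2}.
          ennreal (((\<integral>x. (\<psi> x)\<^sup>2 \<partial>\<pi>) - (\<integral>x. \<psi> x powr p \<partial>\<pi>) powr (2 / p))
                     / (2 - p) powr (2 * (1 - 1 / r))))
       \<le> ennreal (1 / \<alpha>) * (\<integral>\<^sup>+x. ennreal ((normd d (gradd d \<psi> x))\<^sup>2) \<partial>\<pi>))"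

(* \<pi> and \<rho> are represented by their Lebesgue densities; the divergence is infinite when
   \<rho> is not absolutely continuous with respect to \<pi>. *)
definition renyi ::
  "nat \<Rightarrow> real \<Rightarrow> (nat \<Rightarrow> real) measure \<Rightarrow> (nat \<Rightarrow> real) measure \<Rightarrow> ereal" where
  "renyi d q \<pi> \<rho> =
     (let I = \<integral>\<^sup>+x. ennreal (enn2real (RN_deriv (lebd d) \<rho> x) powr q
                          / enn2real (RN_deriv (lebd d) \<pi> x) powr (q - 1)) \<partial>lebd d
      in if absolutely_continuous \<pi> \<rho> \<and> I \<noteq> \<infinity> then ereal (ln (enn2real I) / (q - 1)) else \<infinity>)"

definition tilt ::
  "nat \<Rightarrow> ((nat \<Rightarrow> real) \<Rightarrow> real) \<Rightarrow> real \<Rightarrow> (nat \<Rightarrow> real) \<Rightarrow> (nat \<Rightarrow> real) \<Rightarrow> real" where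
  "tilt d f \<eta> y x = f x + 1 / (2 * \<eta>) * (distd d x y)\<^sup>2"

primrec prox_law ::
  "nat \<Rightarrow> ((nat \<Rightarrow> real) \<Rightarrow> real) \<Rightarrow> real \<Rightarrow> (nat \<Rightarrow> real) measure \<Rightarrow> nat
     \<Rightarrow> (nat \<Rightarrow> real) measure" where
  "prox_law d f \<eta> \<rho>0 0 = \<rho>0"
| "prox_law d f \<eta> \<rho>0 (Suc k) =
     prox_law d f \<eta> \<rho>0 k \<bind> (\<lambda>x. gauss d x \<eta> \<bind> (\<lambda>y. gibbs d (tilt d f \<eta> y)))"

(* \<omega> is the sequence of pairs (proposal, uniform variable deciding its acceptance). *)
definition accepts ::
  "nat \<Rightarrow> ((nat \<Rightarrow> real) \<Rightarrow> real) \<Rightarrow> real \<Rightarrow> (nat \<Rightarrow> real)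
     \<Rightarrow> (nat \<Rightarrow> (nat \<Rightarrow> real) \<times> real) \<Rightarrow> nat \<Rightarrow> bool" where
  "accepts d g a xs \<omega> j \<longleftrightarrow>
     snd (\<omega> j) \<le> exp (- g (fst (\<omega> j)) + g xs + a / 2 * (distd d (fst (\<omega> j)) xs)\<^sup>2)"

definition num_trials ::
  "nat \<Rightarrow> ((nat \<Rightarrow> real) \<Rightarrow> real) \<Rightarrow> real \<Rightarrow> (nat \<Rightarrow> real)
     \<Rightarrow> (nat \<Rightarrow> (nat \<Rightarrow> real) \<times> real) \<Rightarrow> ennreal" where
  "num_trials d g a xs \<omega> =
     (if \<exists>j. accepts d g a xs \<omega> j
      then of_nat (Suc (LEAST j. accepts d g a xs \<omega> j)) else \<infinity>)"

(* Joint law of the accepted point and the number of proposals, for the target exp(-g), with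
   strong convexity constant a and minimizer xs of g. *)
definition rejection ::
  "nat \<Rightarrow> ((nat \<Rightarrow> real) \<Rightarrow> real) \<Rightarrow> real \<Rightarrow> (nat \<Rightarrow> real)
     \<Rightarrow> ((nat \<Rightarrow> real) \<times> ennreal) measure" where
  "rejection d g a xs =
     distr (Pi\<^sub>M (UNIV :: nat set)
              (\<lambda>_. gauss d xs (1 / a) \<Otimes>\<^sub>M uniform_measure lborel {0..1}))
           (lebd d \<Otimes>\<^sub>M borel)
           (\<lambda>\<omega>. (fst (\<omega> (LEAST j. accepts d g a xs \<omega> j)), num_trials d g a xs \<omega>))"

definition prox :: "nat \<Rightarrow> ((nat \<Rightarrow> real) \<Rightarrow> real) \<Rightarrow> real \<Rightarrow> (nat \<Rightarrow> real) \<Rightarrow> nat \<Rightarrow> real" where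
  "prox d f \<eta> y = arg_min_on (tilt d f \<eta> y) (Rd d)"

(* Joint law of x_k and of the number of oracle calls made so far. One iteration makes one
   proximity call, one evaluation of f at the minimizer, and one evaluation of f per
   proposal. *)
primrec sampler ::
  "nat \<Rightarrow> ((nat \<Rightarrow> real) \<Rightarrow> real) \<Rightarrow> real \<Rightarrow> real \<Rightarrow> (nat \<Rightarrow> real) measure \<Rightarrow> nat
     \<Rightarrow> ((nat \<Rightarrow> real) \<times> ennreal) measure" where
  "sampler d f \<beta> \<eta> \<rho>0 0 = distr \<rho>0 (lebd d \<Otimes>\<^sub>M borel) (\<lambda>x. (x, 0))"
| "sampler d f \<beta> \<eta> \<rho>0 (Suc k) =
     sampler d f \<beta> \<eta> \<rho>0 k \<bind> (\<lambda>(x, n).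
       gauss d x \<eta> \<bind> (\<lambda>y.
         distr (rejection d (tilt d f \<eta> y) (1 / \<eta> - \<beta>) (prox d f \<eta> y))
               (lebd d \<Otimes>\<^sub>M borel) (\<lambda>(z, t). (z, n + (2 + t)))))"

(* 0 powr 0 = 0, whereas the order r = 2 requires R^0 = 1 also for R = 0. *)
definition rpow :: "real \<Rightarrow> real \<Rightarrow> real" where
  "rpow R s = (if s = 0 then 1 else R powr s)"

definition complexity ::
  "nat \<Rightarrow> real \<Rightarrow> real \<Rightarrow> real \<Rightarrow> real \<Rightarrow> real \<Rightarrow> real \<Rightarrow> real" where
  "complexity d \<alpha> \<beta> r q \<epsilon> R =
     \<beta> * real d * q / \<alpha> * max (rpow R (2 / r - 1)) (ln (1 / \<epsilon>))"

definition log_factor ::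
  "nat \<Rightarrow> real \<Rightarrow> real \<Rightarrow> real \<Rightarrow> real \<Rightarrow> real \<Rightarrow> real" where
  "log_factor d \<alpha> \<beta> q \<epsilon> R = ln (exp 1 + \<beta> / \<alpha> + real d + q + R + 1 / \<epsilon>)"

end

theory Submission
  imports Defs
begin

text \<open>
  Write \<pi> for the target, Q_t for the convolution with the centred Gaussian of variance t, and
  E for the expectation under \<pi>. If the current law has density h with respect to \<pi>, then one
  iteration of the proximal sampler turns h into Q_\<eta> u, where u(y) is the mean of h under the
  conditional law of X given Y = y (step_density). The Renyi divergence of order q is
  ln (E h^q) / (q - 1), so everything rests on comparing E (Q_\<eta> u)^q with E h^q.

  Conditional Jensen gives E (Q_\<eta> (u^q)) \<le> E h^q. The gain comes from the path
  V(t) = E (Q_t ((Q_(\<eta>-t) u)^q)), which starts at E (Q_\<eta> u)^q and ends at E (Q_\<eta> (u^q)). Its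
  derivative is q (q - 1) / 2 times the mean of h_t^(q - 2) \<bar>grad h_t\<bar>^2 under \<pi> convolved with
  the Gaussian of variance t, for h_t = Q_(\<eta>-t) u. A lower bound for this energy needs a functional
  inequality for the convolved measure: it follows by applying the assumed inequality to
  (Q_t (\<psi>^p))^(1/p) and a Beckner inequality to the Gaussian kernel (heat_beckner, LOI_heat).
  With \<psi> = h_t^(q/2), interpolation between the exponents 1 and q and mass one, the inequality becomes
  V' \<ge> \<lambda> V (fisher_lower, heat_growth). The exponent p = 2 - w is free; the choice
  w = 1 / (2 max(1, R')), where R' is the divergence after the iteration, yields
  R' (1 + \<kappa>) \<le> R (renyi_decrement) and so geometric decay.

  The argument works with finite increments in place of derivatives in time: Taylor expansion bounds the change of
  V over a time e up to an error of order e^(3/2), and such errors disappear when the steps are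
  refined (increments_le). The Cameron-Martin formula supplies the regularity of Q_t u for merely
  bounded u; truncation removes the boundedness (growth_density).

  Two facts turn the decay into the stated cost. The tilted potential exceeds its minimum by at least
  (1/\<eta> - \<beta>)/2 and at most (1/\<eta> + \<beta>)/2 times the squared distance to the minimizer, so a
  Gaussian proposal is accepted with probability at least exp(- \<beta> d / (1/\<eta> - \<beta>))
  (accept_prob_lower), a constant for small \<eta> \<beta> d; the number of proposals is geometric and an
  iteration costs a bounded number of oracle calls on average (sampler_cost). And \<alpha> is at most a
  constant times \<beta>, because a \<beta>-smooth target cannot concentrate on scales below
  \<beta>^(-1/2) (alpha_le_beta), so \<alpha> \<eta> contributes only a constant to \<kappa>.
\<close>

section \<open>Gaussian measures and the heat semigroup\<close>

text \<open>The standard Gaussian on the line, from which stdg below is built as a product: every Gaussian vector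
  becomes an affine image of a single product measure, so Fubini and the change of variables apply uniformly.\<close>

definition gauss1 :: "real measure" where
  "gauss1 = density lborel (\<lambda>x. ennreal (std_normal_density x))"

definition stdg :: "nat \<Rightarrow> (nat \<Rightarrow> real) measure" where
  "stdg d = Pi\<^sub>M {..<d} (\<lambda>_. gauss1)"

text \<open>The point x + s z. The restriction to the first d coordinates keeps it in the space of extensional
  functions, on which vector addition itself is not available.\<close>

definition mv :: "nat \<Rightarrow> (nat \<Rightarrow> real) \<Rightarrow> real \<Rightarrow> (nat \<Rightarrow> real) \<Rightarrow> nat \<Rightarrow> real" where
  "mv d x s z = (\<lambda>i\<in>{..<d}. x i + s * z i)"

definition zer :: "nat \<Rightarrow> nat \<Rightarrow> real" where
  "zer d = (\<lambda>i\<in>{..<d}. 0)"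

definition dotp :: "nat \<Rightarrow> (nat \<Rightarrow> real) \<Rightarrow> (nat \<Rightarrow> real) \<Rightarrow> real" where
  "dotp d a z = (\<Sum>i<d. a i * z i)"

definition heat :: "nat \<Rightarrow> real \<Rightarrow> ((nat \<Rightarrow> real) \<Rightarrow> real) \<Rightarrow> (nat \<Rightarrow> real) \<Rightarrow> real" where
  "heat d t g x = (\<integral>z. g (mv d x (sqrt t) z) \<partial>stdg d)"

lemma sets_gauss1[simp, measurable_cong]: "sets gauss1 = sets borel"
  by (simp add: gauss1_def)

lemma space_gauss1[simp]: "space gauss1 = UNIV"
  by (simp add: gauss1_def)

lemma prob_gauss1: "prob_space gauss1"
  unfolding gauss1_def by (rule prob_space_normal_density) simp

interpretation G1: prob_space gauss1 by (rule prob_gauss1)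

interpretation PG: product_prob_space "\<lambda>_::nat. gauss1" I for I
  by unfold_locales

interpretation PL: product_sigma_finite "\<lambda>_::nat. lborel :: real measure"
  by unfold_locales

lemma space_lebd[simp]: "space (lebd d) = Rd d"
  by (simp add: space_PiM)

lemma sets_stdg[simp, measurable_cong]: "sets (stdg d) = sets (lebd d)"
  unfolding stdg_def by (intro sets_PiM_cong) auto

lemma space_stdg[simp]: "space (stdg d) = Rd d"
  using sets_eq_imp_space_eq[OF sets_stdg] by simp

lemma prob_stdg: "prob_space (stdg d)"
  unfolding stdg_def by (rule prob_space_PiM) (rule prob_gauss1)

interpretation SG: prob_space "stdg d" for d by (rule prob_stdg)

lemma sigma_finite_lebd: "sigma_finite_measure (lebd d)"
  by (rule PL.sigma_finite) simp

lemma lebd_component: "i < d \<Longrightarrow> (\<lambda>x. x i) \<in> borel_measurable (lebd d)"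
  using measurable_component_singleton[of i "{..<d}" "\<lambda>_. lborel"] by simp

lemma measurable_into_lebd:
  assumes "\<And>i. i < d \<Longrightarrow> (\<lambda>w. F w i) \<in> borel_measurable M"
  shows "(\<lambda>w. \<lambda>i\<in>{..<d}. F w i) \<in> measurable M (lebd d)"
  by (rule measurable_restrict) (use assms in auto)

lemma lebd_component_comp:
  "f \<in> measurable M (lebd d) \<Longrightarrow> i < d \<Longrightarrow> (\<lambda>x. f x i) \<in> borel_measurable M"
  using measurable_compose[OF _ lebd_component] by blast

lemma mv_measurable[measurable (raw)]:
  assumes f: "f \<in> measurable M (lebd d)" and [measurable]: "s \<in> borel_measurable M" and g: "g \<in> measurable M (lebd d)"
  shows "(\<lambda>w. mv d (f w) (s w) (g w)) \<in> measurable M (lebd d)"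
  unfolding mv_def
proof (rule measurable_into_lebd)
  fix i assume "i < d"
  note [measurable] = lebd_component_comp[OF f this] lebd_component_comp[OF g this]
  show "(\<lambda>w. f w i + s w * g w i) \<in> borel_measurable M" by measurable
qed

lemma mv_Rd[simp]: "mv d x s z \<in> Rd d"
  by (auto simp: mv_def)

lemma zer_Rd[simp]: "zer d \<in> Rd d" by (auto simp: zer_def)

lemma mv_nth: "i < d \<Longrightarrow> mv d x s z i = x i + s * z i" by (simp add: mv_def)

lemma Rd_eqI: "x \<in> Rd d \<Longrightarrow> y \<in> Rd d \<Longrightarrow> (\<And>i. i < d \<Longrightarrow> x i = y i) \<Longrightarrow> x = y"
  by (rule PiE_ext) auto

lemma mv_measurable2[measurable]: "mv d x s \<in> measurable (lebd d) (lebd d)"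
  unfolding mv_def
proof (rule measurable_into_lebd)
  fix i assume "i < d"
  note [measurable] = lebd_component[OF this]
  show "(\<lambda>w. x i + s * w i) \<in> borel_measurable (lebd d)" by measurable
qed

lemma mv_0: "x \<in> Rd d \<Longrightarrow> mv d x 0 z = x"
  by (rule Rd_eqI[of _ d]) (simp_all add: mv_nth)

lemma mv_mv: "mv d (mv d x s z) t z' = mv d x 1 (mv d (mv d (zer d) s z) t z')"
  by (rule Rd_eqI[of _ d]) (simp_all add: mv_nth zer_def)

lemma emeasure_PiM_lebd_density:
  assumes n: "\<And>i. i < d \<Longrightarrow> n i \<in> borel_measurable borel"
    and A: "\<And>i. i \<in> {..<d} \<Longrightarrow> A i \<in> sets (borel :: real measure)"
    and nn: "\<And>i x. i < d \<Longrightarrow> 0 \<le> n i x"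
  shows "emeasure (density (lebd d) (\<lambda>z. ennreal (\<Prod>i<d. n i (z i)))) (PiE {..<d} A)
     = (\<Prod>i<d. emeasure (density lborel (\<lambda>x. ennreal (n i x))) (A i))"
proof -
  have [measurable]: "i < d \<Longrightarrow> n i \<in> borel_measurable borel" for i by (rule n)
  have [measurable]: "PiE {..<d} A \<in> sets (lebd d)"
    by (rule sets_PiM_I_finite) (use A in auto)
  have "(\<lambda>z. n i (z i)) \<in> borel_measurable (lebd d)" if "i < d" for i
    using measurable_compose[OF lebd_component[OF that] n[OF that]] .
  then have m: "(\<lambda>z. ennreal (\<Prod>i<d. n i (z i))) \<in> borel_measurable (lebd d)"
    by (intro measurable_compose[OF _ measurable_ennreal] borel_measurable_prod) auto
  have "emeasure (density (lebd d) (\<lambda>z. ennreal (\<Prod>i<d. n i (z i)))) (PiE {..<d} A)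
     = (\<integral>\<^sup>+z. ennreal (\<Prod>i<d. n i (z i)) * indicator (PiE {..<d} A) z \<partial>lebd d)"
    by (rule emeasure_density[OF m]) fact
  also have "\<dots> = (\<integral>\<^sup>+z. (\<Prod>i<d. ennreal (n i (z i)) * indicator (A i) (z i)) \<partial>lebd d)"
  proof (rule nn_integral_cong)
    fix z assume z: "z \<in> space (lebd d)"
    have "indicator (PiE {..<d} A) z = (\<Prod>i<d. indicator (A i) (z i) :: ennreal)"
    proof (cases "z \<in> PiE {..<d} A")
      case True then show ?thesis by (auto simp: PiE_iff)
    next
      case False
      with z obtain i where i: "i < d" "z i \<notin> A i" by (auto simp: PiE_iff)
      then have "(\<Prod>i<d. indicator (A i) (z i) :: ennreal) = 0" by (intro prod_zero bexI[of _ i]) auto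
      with False show ?thesis by simp
    qed
    moreover have "ennreal (\<Prod>i<d. n i (z i)) = (\<Prod>i<d. ennreal (n i (z i)))"
      by (rule prod_ennreal[symmetric]) (use nn in auto)
    ultimately show "ennreal (\<Prod>i<d. n i (z i)) * indicator (PiE {..<d} A) z = (\<Prod>i<d. ennreal (n i (z i)) * indicator (A i) (z i))"
      by (simp add: prod.distrib)
  qed
  also have "\<dots> = (\<Prod>i<d. \<integral>\<^sup>+x. ennreal (n i x) * indicator (A i) x \<partial>lborel)"
    by (rule PL.product_nn_integral_prod) (use n A in auto)
  also have "\<dots> = (\<Prod>i<d. emeasure (density lborel (\<lambda>x. ennreal (n i x))) (A i))"
    by (intro prod.cong refl emeasure_density[symmetric]) (use n A in auto)
  finally show ?thesis .
qed

lemma distr_gauss1_affine: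
  assumes "0 < s"
  shows "distr gauss1 borel (\<lambda>z. m + s * z) = density lborel (\<lambda>x. ennreal (normal_density m s x))"
proof -
  have "distributed gauss1 lborel (\<lambda>z. z) (\<lambda>x. ennreal (std_normal_density x))"
    unfolding distributed_def by (auto simp: gauss1_def intro!: distr_id2)
  then have "distributed gauss1 lborel (\<lambda>z. m + s * z) (\<lambda>x. ennreal (normal_density (m + s * 0) (\<bar>s\<bar> * 1) x))"
    by (intro G1.normal_density_affine) (use assms in auto)
  then have "distr gauss1 lborel (\<lambda>z. m + s * z) = density lborel (\<lambda>x. ennreal (normal_density m s x))"
    using assms by (simp add: distributed_def)
  moreover have "distr gauss1 borel (\<lambda>z. m + s * z) = distr gauss1 lborel (\<lambda>z. m + s * z)"
    by (rule distr_cong) auto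
  ultimately show ?thesis by simp
qed

lemma emeasure_distr_stdg:
  assumes "0 < s" and A: "\<And>i. i \<in> {..<d} \<Longrightarrow> A i \<in> sets (borel :: real measure)"
  shows "emeasure (distr (stdg d) (lebd d) (mv d x s)) (PiE {..<d} A)
     = (\<Prod>i<d. emeasure (density lborel (\<lambda>y. ennreal (normal_density (x i) s y))) (A i))"
proof -
  have [measurable]: "PiE {..<d} A \<in> sets (lebd d)"
    by (rule sets_PiM_I_finite) (use A in auto)
  have "emeasure (distr (stdg d) (lebd d) (mv d x s)) (PiE {..<d} A)
     = emeasure (stdg d) (mv d x s -` (PiE {..<d} A) \<inter> space (stdg d))"
    by (subst emeasure_distr) auto
  also have "mv d x s -` (PiE {..<d} A) \<inter> space (stdg d) = PiE {..<d} (\<lambda>i. (\<lambda>z. x i + s * z) -` A i)"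
    by (auto simp: PiE_iff mv_def)
  also have "emeasure (stdg d) \<dots> = (\<Prod>i<d. emeasure gauss1 ((\<lambda>z. x i + s * z) -` A i))"
    unfolding stdg_def
  proof (rule PG.emeasure_PiM)
    fix i assume "i \<in> {..<d}"
    then have "A i \<in> sets borel" by (rule A)
    then show "(\<lambda>z. x i + s * z) -` A i \<in> sets gauss1"
      using measurable_sets[of "\<lambda>z. x i + s * z" borel borel "A i"] by simp
  qed simp
  also have "\<dots> = (\<Prod>i<d. emeasure (distr gauss1 borel (\<lambda>z. x i + s * z)) (A i))"
    by (intro prod.cong refl, subst emeasure_distr) (use A in auto)
  finally show ?thesis using assms(1) by (simp add: distr_gauss1_affine)
qed

text \<open>Boxes generate the product sigma-algebra, so a measure that factorizes on them is the product measure; two measures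
  with the same factors coincide.\<close>

lemma measure_eq_on_boxes:
  fixes M :: "nat \<Rightarrow> real measure"
  assumes P: "sets P = sets (lebd d)" "sets Q = sets (lebd d)"
    and M: "\<And>i. prob_space (M i)" "\<And>i. sets (M i) = sets borel"
    and "\<And>A. (\<And>i. i \<in> {..<d} \<Longrightarrow> A i \<in> sets borel) \<Longrightarrow> emeasure P (PiE {..<d} A) = (\<Prod>i<d. emeasure (M i) (A i))"
    and "\<And>A. (\<And>i. i \<in> {..<d} \<Longrightarrow> A i \<in> sets borel) \<Longrightarrow> emeasure Q (PiE {..<d} A) = (\<Prod>i<d. emeasure (M i) (A i))"
  shows "P = Q"
proof -
  interpret product_prob_space M by (rule product_prob_spaceI) (rule M)
  have s: "sets (lebd d) = sets (PiM {..<d} M)"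
    by (intro sets_PiM_cong) (auto simp: M)
  have "P = PiM {..<d} M"
    by (rule PiM_eqI) (use assms s in auto)
  moreover have "Q = PiM {..<d} M"
    by (rule PiM_eqI) (use assms s in auto)
  ultimately show ?thesis by simp
qed

lemma sets_gauss[simp, measurable_cong]: "sets (gauss d m v) = sets (lebd d)"
  by (simp add: gauss_def)

lemma space_gauss[simp]: "space (gauss d m v) = Rd d"
  by (simp add: gauss_def)

lemma gauss_eq_distr:
  assumes "0 < t"
  shows "gauss d x t = distr (stdg d) (lebd d) (mv d x (sqrt t))"
proof (rule measure_eq_on_boxes[where M = "\<lambda>i. density lborel (\<lambda>y. ennreal (normal_density (x i) (sqrt t) y))"])
  fix A assume "\<And>i. i \<in> {..<d} \<Longrightarrow> A i \<in> sets (borel :: real measure)"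
  then show "emeasure (gauss d x t) (PiE {..<d} A) = (\<Prod>i<d. emeasure (density lborel (\<lambda>y. ennreal (normal_density (x i) (sqrt t) y))) (A i))"
    unfolding gauss_def by (intro emeasure_PiM_lebd_density) auto
next
  show "prob_space (density lborel (\<lambda>y. ennreal (normal_density (x i) (sqrt t) y)))" for i
    using assms by (intro prob_space_normal_density) auto
qed (use assms in \<open>auto intro!: emeasure_distr_stdg\<close>)

lemma stdg_eq_density: "stdg d = density (lebd d) (\<lambda>z. ennreal (\<Prod>i<d. std_normal_density (z i)))"
proof (rule measure_eq_on_boxes[where M = "\<lambda>i. gauss1"])
  fix A assume A: "\<And>i. i \<in> {..<d} \<Longrightarrow> A i \<in> sets (borel :: real measure)"
  then show "emeasure (density (lebd d) (\<lambda>z. ennreal (\<Prod>i<d. std_normal_density (z i)))) (PiE {..<d} A) = (\<Prod>i<d. emeasure gauss1 (A i))"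
    unfolding gauss1_def by (intro emeasure_PiM_lebd_density) auto
  show "emeasure (stdg d) (PiE {..<d} A) = (\<Prod>i<d. emeasure gauss1 (A i))"
    unfolding stdg_def by (rule PG.emeasure_PiM) (use A in auto)
qed (auto simp: prob_gauss1)

lemma prob_gauss: "0 < t \<Longrightarrow> prob_space (gauss d x t)"
  by (subst gauss_eq_distr) (auto intro!: SG.prob_space_distr)

text \<open>In one dimension this is the convolution of two normal densities; the coordinates of a Gaussian vector are
  independent, so the multivariate statement reduces to it.\<close>

lemma gauss1_conv:
  assumes "0 < s" "0 < t" and [measurable]: "A \<in> sets (borel :: real measure)"
  shows "(\<integral>\<^sup>+a. emeasure (density lborel (\<lambda>x. ennreal (normal_density (sqrt s * a) (sqrt t) x))) A \<partial>gauss1)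
    = emeasure (density lborel (\<lambda>x. ennreal (normal_density 0 (sqrt (s + t)) x))) A"
proof -
  let ?n = "normal_density 0"
  have sh: "normal_density m r x = ?n r (x - m)" for m r x :: real
    by (simp add: normal_density_def)
  have "(\<integral>\<^sup>+a. emeasure (density lborel (\<lambda>x. ennreal (normal_density (sqrt s * a) (sqrt t) x))) A \<partial>gauss1)
     = (\<integral>\<^sup>+a. (\<integral>\<^sup>+x. ennreal (?n (sqrt t) (x - sqrt s * a)) * indicator A x \<partial>lborel) \<partial>gauss1)"
    by (intro nn_integral_cong) (simp add: emeasure_density sh[symmetric])
  also have "\<dots> = (\<integral>\<^sup>+y. (\<integral>\<^sup>+x. ennreal (?n (sqrt t) (x - y)) * indicator A x \<partial>lborel) \<partial>distr gauss1 borel (\<lambda>a. 0 + sqrt s * a))"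
  proof (subst nn_integral_distr)
    show "(\<lambda>a. 0 + sqrt s * a) \<in> gauss1 \<rightarrow>\<^sub>M borel" by measurable
  qed auto
  also have "\<dots> = (\<integral>\<^sup>+y. ennreal (?n (sqrt s) y) * (\<integral>\<^sup>+x. ennreal (?n (sqrt t) (x - y)) * indicator A x \<partial>lborel) \<partial>lborel)"
    using assms by (subst distr_gauss1_affine) (auto simp: nn_integral_density)
  also have "\<dots> = (\<integral>\<^sup>+y. (\<integral>\<^sup>+x. ennreal (?n (sqrt t) (x - y) * ?n (sqrt s) y) * indicator A x \<partial>lborel) \<partial>lborel)"
    by (simp add: nn_integral_cmult[symmetric] ennreal_mult mult_ac)
  also have "\<dots> = (\<integral>\<^sup>+x. (\<integral>\<^sup>+y. ennreal (?n (sqrt t) (x - y) * ?n (sqrt s) y) * indicator A x \<partial>lborel) \<partial>lborel)"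
    by (rule lborel_pair.Fubini') measurable
  also have "\<dots> = (\<integral>\<^sup>+x. ennreal (?n (sqrt (s+t)) x) * indicator A x \<partial>lborel)"
  proof (intro nn_integral_cong)
    fix x
    have "(\<integral>\<^sup>+y. ennreal (?n (sqrt t) (x - y) * ?n (sqrt s) y) \<partial>lborel) = ennreal (?n (sqrt (s + t)) x)"
      using conv_normal_density_zero_mean[of "sqrt t" "sqrt s"] assms by (simp add: fun_eq_iff add.commute)
    then show "(\<integral>\<^sup>+y. ennreal (?n (sqrt t) (x - y) * ?n (sqrt s) y) * indicator A x \<partial>lborel) = ennreal (?n (sqrt (s+t)) x) * indicator A x"
      by (simp add: nn_integral_multc)
  qed
  also have "\<dots> = emeasure (density lborel (\<lambda>x. ennreal (normal_density 0 (sqrt (s + t)) x))) A"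
    by (simp add: emeasure_density)
  finally show ?thesis .
qed

lemma stdg_sum:
  assumes s: "0 < s" and t: "0 < t"
  shows "distr (stdg d \<Otimes>\<^sub>M stdg d) (lebd d) (\<lambda>(z, z'). mv d (mv d (zer d) (sqrt s) z) (sqrt t) z')
     = distr (stdg d) (lebd d) (mv d (zer d) (sqrt (s + t)))"
proof (rule measure_eq_on_boxes[where M = "\<lambda>i. density lborel (\<lambda>y. ennreal (normal_density 0 (sqrt (s + t)) y))"])
  fix A assume A: "\<And>i. i \<in> {..<d} \<Longrightarrow> A i \<in> sets (borel :: real measure)"
  let ?P = "PiE {..<d} A"
  have [measurable]: "?P \<in> sets (lebd d)"
    by (rule sets_PiM_I_finite) (use A in auto)
  have "emeasure (distr (stdg d \<Otimes>\<^sub>M stdg d) (lebd d) (\<lambda>(z, z'). mv d (mv d (zer d) (sqrt s) z) (sqrt t) z')) ?P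
     = (\<integral>\<^sup>+w. indicator ?P w \<partial>distr (stdg d \<Otimes>\<^sub>M stdg d) (lebd d) (\<lambda>(z, z'). mv d (mv d (zer d) (sqrt s) z) (sqrt t) z'))"
    by simp
  also have "\<dots> = (\<integral>\<^sup>+w. indicator ?P (mv d (mv d (zer d) (sqrt s) (fst w)) (sqrt t) (snd w)) \<partial>(stdg d \<Otimes>\<^sub>M stdg d))"
    by (subst nn_integral_distr) (auto simp: split_beta')
  also have "\<dots> = (\<integral>\<^sup>+z. \<integral>\<^sup>+z'. indicator ?P (mv d (mv d (zer d) (sqrt s) z) (sqrt t) z') \<partial>stdg d \<partial>stdg d)"
    by (subst SG.nn_integral_fst[symmetric]) auto
  also have "\<dots> = (\<integral>\<^sup>+z. emeasure (distr (stdg d) (lebd d) (mv d (mv d (zer d) (sqrt s) z) (sqrt t))) ?P \<partial>stdg d)"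
  proof (intro nn_integral_cong)
    fix z assume "z \<in> space (stdg d)"
    show "(\<integral>\<^sup>+z'. indicator ?P (mv d (mv d (zer d) (sqrt s) z) (sqrt t) z') \<partial>stdg d)
      = emeasure (distr (stdg d) (lebd d) (mv d (mv d (zer d) (sqrt s) z) (sqrt t))) ?P"
      by (subst nn_integral_indicator[symmetric], simp, subst nn_integral_distr) auto
  qed
  also have "\<dots> = (\<integral>\<^sup>+z. (\<Prod>i<d. emeasure (density lborel (\<lambda>y. ennreal (normal_density (sqrt s * z i) (sqrt t) y))) (A i)) \<partial>stdg d)"
    using t by (intro nn_integral_cong, subst emeasure_distr_stdg) (auto simp: A mv_def zer_def)
  also have "\<dots> = (\<Prod>i<d. (\<integral>\<^sup>+a. emeasure (density lborel (\<lambda>x. ennreal (normal_density (sqrt s * a) (sqrt t) x))) (A i) \<partial>gauss1))"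
    unfolding stdg_def
  proof (rule PG.product_nn_integral_prod)
    fix i assume "i \<in> {..<d}"
    then have [measurable]: "A i \<in> sets borel" using A by auto
    have "(\<lambda>a. \<integral>\<^sup>+x. ennreal (normal_density (sqrt s * a) (sqrt t) x) * indicator (A i) x \<partial>lborel) \<in> borel_measurable borel"
      unfolding normal_density_def by measurable
    then show "(\<lambda>a. emeasure (density lborel (\<lambda>x. ennreal (normal_density (sqrt s * a) (sqrt t) x))) (A i)) \<in> borel_measurable gauss1"
      by (subst emeasure_density) (auto simp: measurable_cong_sets[OF sets_gauss1 refl])
  qed simp
  also have "\<dots> = (\<Prod>i<d. emeasure (density lborel (\<lambda>x. ennreal (normal_density 0 (sqrt (s + t)) x))) (A i))"
    by (intro prod.cong refl gauss1_conv) (use s t A in auto)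
  finally show "emeasure (distr (stdg d \<Otimes>\<^sub>M stdg d) (lebd d) (\<lambda>(z, z'). mv d (mv d (zer d) (sqrt s) z) (sqrt t) z')) ?P = \<dots>" .
  show "emeasure (distr (stdg d) (lebd d) (mv d (zer d) (sqrt (s + t)))) ?P = (\<Prod>i<d. emeasure (density lborel (\<lambda>x. ennreal (normal_density 0 (sqrt (s + t)) x))) (A i))"
    using s t A by (subst emeasure_distr_stdg) (auto simp: zer_def)
next
  show "prob_space (density lborel (\<lambda>y. ennreal (normal_density 0 (sqrt (s+t)) y)))" for i :: nat
    using s t by (intro prob_space_normal_density) auto
qed auto

lemma stdg_prob_Rd[simp]: "measure (stdg d) (Rd d) = 1"
  using SG.prob_space[of d] by simp

definition bdd_meas :: "nat \<Rightarrow> real \<Rightarrow> ((nat \<Rightarrow> real) \<Rightarrow> real) \<Rightarrow> bool" where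
  "bdd_meas d M g \<longleftrightarrow> g \<in> borel_measurable (lebd d) \<and> (\<forall>x\<in>Rd d. \<bar>g x\<bar> \<le> M)"

lemma bdd_measD: "bdd_meas d M g \<Longrightarrow> g \<in> borel_measurable (lebd d)" "bdd_meas d M g \<Longrightarrow> x \<in> Rd d \<Longrightarrow> \<bar>g x\<bar> \<le> M"
  by (auto simp: bdd_meas_def)

lemma bdd_meas_nonneg: "bdd_meas d M g \<Longrightarrow> 0 \<le> M"
  using bdd_measD(2)[of d M g "zer d"] zer_Rd[of d] by linarith

lemma bdd_meas_integrable:
  assumes g: "bdd_meas d M g" and P: "prob_space P" and X: "X \<in> measurable P (lebd d)"
  shows "integrable P (\<lambda>w. g (X w))"
proof -
  interpret prob_space P by fact
  have "(\<lambda>w. g (X w)) \<in> borel_measurable P"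
    using measurable_compose[OF X bdd_measD(1)[OF g]] .
  moreover have "AE w in P. norm (g (X w)) \<le> M"
    using measurable_space[OF X] bdd_measD(2)[OF g] by (intro AE_I2) auto
  ultimately show ?thesis by (rule integrable_const_bound[rotated])
qed

lemma bdd_meas_integral_le:
  assumes g: "bdd_meas d M g" and P: "prob_space P" and X: "X \<in> measurable P (lebd d)"
  shows "\<bar>\<integral>w. g (X w) \<partial>P\<bar> \<le> M"
proof -
  interpret prob_space P by fact
  have "\<bar>\<integral>w. g (X w) \<partial>P\<bar> \<le> (\<integral>w. \<bar>g (X w)\<bar> \<partial>P)" by (rule integral_abs_bound)
  also have "\<dots> \<le> (\<integral>w. M \<partial>P)"
    by (intro integral_mono integrable_abs bdd_meas_integrable[OF g P X])
       (use measurable_space[OF X] bdd_measD(2)[OF g] in auto)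
  finally show ?thesis by (simp add: prob_space)
qed

lemma heat_meas_pair:
  assumes "g \<in> borel_measurable (lebd d)"
  shows "(\<lambda>(x, z). g (mv d x s z)) \<in> borel_measurable (lebd d \<Otimes>\<^sub>M stdg d)"
proof -
  have "(\<lambda>w. g (mv d (fst w) s (snd w))) \<in> borel_measurable (lebd d \<Otimes>\<^sub>M stdg d)"
    by (rule measurable_compose[OF _ assms]) measurable
  then show ?thesis by (simp add: split_beta')
qed

lemma heat_measurable[measurable (raw)]:
  assumes "g \<in> borel_measurable (lebd d)"
  shows "heat d t g \<in> borel_measurable (lebd d)"
proof -
  have "(\<lambda>x. \<integral>z. g (mv d x (sqrt t) z) \<partial>stdg d) \<in> borel_measurable (lebd d)"
    by (rule SG.borel_measurable_lebesgue_integral) (rule heat_meas_pair[OF assms])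
  then show ?thesis by (simp add: heat_def[abs_def])
qed

lemma heat_bdd:
  assumes "bdd_meas d M g" shows "bdd_meas d M (heat d t g)"
  unfolding bdd_meas_def
proof (intro conjI ballI)
  show "heat d t g \<in> borel_measurable (lebd d)" using assms by (intro heat_measurable bdd_measD)
  show "\<bar>heat d t g x\<bar> \<le> M" for x
    unfolding heat_def by (rule bdd_meas_integral_le[OF assms prob_stdg]) simp
qed

lemma heat_integrable: "bdd_meas d M g \<Longrightarrow> integrable (stdg d) (\<lambda>z. g (mv d x s z))"
  using bdd_meas_integrable[OF _ prob_stdg, of d M g "mv d x s"] by simp

lemma heat_mono:
  assumes "bdd_meas d M g" "bdd_meas d M' g'" "\<And>x. x \<in> Rd d \<Longrightarrow> g x \<le> g' x"
  shows "heat d t g x \<le> heat d t g' x"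
  unfolding heat_def by (rule integral_mono) (use assms in \<open>auto intro: heat_integrable\<close>)

lemma heat_const: "heat d t (\<lambda>_. c) x = c"
  by (simp add: heat_def SG.prob_space)

lemma bdd_meas_const: "\<bar>c\<bar> \<le> M \<Longrightarrow> bdd_meas d M (\<lambda>_. c)"
  by (simp add: bdd_meas_def)

lemma heat_add: "bdd_meas d M g \<Longrightarrow> bdd_meas d M' g' \<Longrightarrow> heat d t (\<lambda>x. g x + g' x) x = heat d t g x + heat d t g' x"
  unfolding heat_def by (rule Bochner_Integration.integral_add) (auto intro: heat_integrable)

lemma heat_cmult: "heat d t (\<lambda>x. c * g x) x = c * heat d t g x"
  unfolding heat_def by simp

lemma heat_0: "x \<in> Rd d \<Longrightarrow> heat d 0 g x = g x"
  by (simp add: heat_def mv_0 SG.prob_space)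

lemma heat_cong: "(\<And>x. x \<in> Rd d \<Longrightarrow> g x = g' x) \<Longrightarrow> heat d t g x = heat d t g' x"
  unfolding heat_def by (intro Bochner_Integration.integral_cong) auto

text \<open>Adding two independent Gaussian increments of variances s and t is the same as adding one of variance
  s + t.\<close>

lemma heat_semigroup:
  assumes g: "bdd_meas d M g" and s: "0 \<le> s" and t: "0 \<le> t" and x: "x \<in> Rd d"
  shows "heat d s (heat d t g) x = heat d (s + t) g x"
proof (cases "s = 0 \<or> t = 0")
  case True
  then show ?thesis
  proof
    assume "s = 0" then show ?thesis using x by (simp add: heat_0)
  next
    assume "t = 0"
    then show ?thesis using heat_cong[of d "heat d 0 g" g s x] by (simp add: heat_0)
  qed
next
  case False
  with s t have st: "0 < s" "0 < t" by auto
  have [measurable]: "g \<in> borel_measurable (lebd d)" using g by (rule bdd_measD)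
  have gm: "(\<lambda>y. g (mv d x 1 y)) \<in> borel_measurable (lebd d)" by measurable
  have m: "(\<lambda>(z, z'). mv d (mv d (zer d) (sqrt s) z) (sqrt t) z') \<in> measurable (stdg d \<Otimes>\<^sub>M stdg d) (lebd d)"
  proof -
    have "(\<lambda>w. mv d (mv d (zer d) (sqrt s) (fst w)) (sqrt t) (snd w)) \<in> measurable (stdg d \<Otimes>\<^sub>M stdg d) (lebd d)"
      by measurable
    then show ?thesis by (simp add: split_beta')
  qed
  interpret P: pair_prob_space "stdg d" "stdg d" ..
  have "heat d (s + t) g x = (\<integral>z. g (mv d x 1 (mv d (zer d) (sqrt (s + t)) z)) \<partial>stdg d)"
    unfolding heat_def
    by (intro Bochner_Integration.integral_cong arg_cong[of _ _ g] Rd_eqI[of _ d]) (auto simp: mv_nth zer_def)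
  also have "\<dots> = (\<integral>y. g (mv d x 1 y) \<partial>distr (stdg d) (lebd d) (mv d (zer d) (sqrt (s + t))))"
    by (subst integral_distr) (auto intro: gm)
  also have "\<dots> = (\<integral>y. g (mv d x 1 y) \<partial>distr (stdg d \<Otimes>\<^sub>M stdg d) (lebd d) (\<lambda>(z, z'). mv d (mv d (zer d) (sqrt s) z) (sqrt t) z'))"
    by (simp add: stdg_sum[OF st])
  also have "\<dots> = (\<integral>w. g (mv d x 1 (case w of (z, z') \<Rightarrow> mv d (mv d (zer d) (sqrt s) z) (sqrt t) z')) \<partial>(stdg d \<Otimes>\<^sub>M stdg d))"
    by (rule integral_distr[OF m gm])
  also have "\<dots> = (\<integral>w. g (mv d (mv d x (sqrt s) (fst w)) (sqrt t) (snd w)) \<partial>(stdg d \<Otimes>\<^sub>M stdg d))"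
    by (intro Bochner_Integration.integral_cong refl) (auto simp: mv_mv[of d x, symmetric])
  also have "\<dots> = (\<integral>z. (\<integral>z'. g (mv d (mv d x (sqrt s) z) (sqrt t) z') \<partial>stdg d) \<partial>stdg d)"
  proof -
    have X: "(\<lambda>w. mv d (mv d x (sqrt s) (fst w)) (sqrt t) (snd w)) \<in> measurable (stdg d \<Otimes>\<^sub>M stdg d) (lebd d)"
      using x by measurable
    have "integrable (stdg d \<Otimes>\<^sub>M stdg d) (\<lambda>w. g (mv d (mv d x (sqrt s) (fst w)) (sqrt t) (snd w)))"
      by (rule bdd_meas_integrable[OF g _ X]) (rule P.P.prob_space_axioms)
    then show ?thesis using P.integral_fst'[of "\<lambda>w. g (mv d (mv d x (sqrt s) (fst w)) (sqrt t) (snd w))"] by simp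
  qed
  finally show ?thesis by (simp add: heat_def)
qed

section \<open>Moments and translations of Gaussian vectors\<close>

lemma normd_sq: "(normd d z)\<^sup>2 = (\<Sum>i<d. (z i)\<^sup>2)"
  by (simp add: normd_def L2_set_def sum_nonneg)

lemma normd_nonneg[simp]: "0 \<le> normd d z" by (simp add: normd_def)

lemma abs_le_normd: "i < d \<Longrightarrow> \<bar>z i\<bar> \<le> normd d z"
  using member_le_L2_set[of "{..<d}" i "\<lambda>i. \<bar>z i\<bar>"] by (simp add: normd_def L2_set_def)

lemma normd_le_sum: "normd d z \<le> (\<Sum>i<d. \<bar>z i\<bar>)"
  unfolding normd_def by (rule L2_set_le_sum_abs)

lemma dotp_le: "\<bar>dotp d a z\<bar> \<le> normd d a * normd d z"
proof -
  have "\<bar>dotp d a z\<bar> \<le> (\<Sum>i<d. \<bar>a i\<bar> * \<bar>z i\<bar>)"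
    unfolding dotp_def by (rule order_trans[OF sum_abs]) (simp add: abs_mult)
  also have "\<dots> \<le> normd d a * normd d z"
    unfolding normd_def by (rule L2_set_mult_ineq)
  finally show ?thesis .
qed

lemma normd_scale: "normd d (\<lambda>i. c * z i) = \<bar>c\<bar> * normd d z"
  by (simp add: normd_def L2_set_def power_mult_distrib sum_distrib_left[symmetric] real_sqrt_mult)

lemma dotp_scale: "dotp d a (\<lambda>i. c * z i) = c * dotp d a z" "dotp d (\<lambda>i. c * a i) z = c * dotp d a z"
  by (auto simp: dotp_def sum_distrib_left mult_ac)

lemma normd_measurable: 
  assumes "\<And>i. i < d \<Longrightarrow> (\<lambda>x. F x i) \<in> borel_measurable M"
  shows "(\<lambda>x. normd d (F x)) \<in> borel_measurable M"
proof -
  have "(\<lambda>x. \<Sum>i<d. (F x i)\<^sup>2) \<in> borel_measurable M" by (intro borel_measurable_sum borel_measurable_power) (use assms in auto)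
  then show ?thesis unfolding normd_def L2_set_def by measurable
qed

lemma dotp_measurable: 
  assumes "\<And>i. i < d \<Longrightarrow> (\<lambda>x. F x i) \<in> borel_measurable M" "\<And>i. i < d \<Longrightarrow> (\<lambda>x. H x i) \<in> borel_measurable M"
  shows "(\<lambda>x. dotp d (F x) (H x)) \<in> borel_measurable M"
  unfolding dotp_def by (intro borel_measurable_sum borel_measurable_times) (use assms in auto)

lemma normd_meas[measurable]: "normd d \<in> borel_measurable (lebd d)"
  using normd_measurable[of d "\<lambda>x. x" "lebd d"] by (simp add: lebd_component)

lemma dotp_meas[measurable]: "dotp d a \<in> borel_measurable (lebd d)"
  using dotp_measurable[of d "\<lambda>_. a" "lebd d" "\<lambda>x. x"] by (simp add: lebd_component)

lemma stdg_component:
  assumes "i < d" shows "distr (stdg d) borel (\<lambda>z. z i) = gauss1"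
proof -
  have "distr (Pi\<^sub>M {..<d} (\<lambda>_. gauss1)) gauss1 (\<lambda>\<omega>. \<omega> i) = gauss1"
    by (rule distr_PiM_component) (use assms prob_gauss1 in auto)
  moreover have "distr (stdg d) borel (\<lambda>z. z i) = distr (stdg d) gauss1 (\<lambda>z. z i)"
    by (rule distr_cong) auto
  ultimately show ?thesis by (simp add: stdg_def)
qed

lemma gauss1_moment: "integrable gauss1 (\<lambda>x. x ^ k)"
  unfolding gauss1_def using integrable_std_normal_moment[of k]
  by (subst integrable_density) auto

lemma gauss1_mean: "(\<integral>x. x \<partial>gauss1) = 0"
  unfolding gauss1_def using integral_std_normal_moment_odd[of 0]
  by (subst integral_density) auto

lemma gauss1_var: "(\<integral>x. x\<^sup>2 \<partial>gauss1) = 1"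
  unfolding gauss1_def using integral_std_normal_moment_even[of 1]
  by (subst integral_density) (auto simp: power2_eq_square)

lemma stdg_comp_meas: "i < d \<Longrightarrow> (\<lambda>z. z i) \<in> borel_measurable (stdg d)"
  by (simp add: lebd_component measurable_cong_sets[OF sets_stdg refl])

lemma stdg_comp_moment: "i < d \<Longrightarrow> integrable (stdg d) (\<lambda>z. z i ^ k)"
  using integrable_distr_eq[OF stdg_comp_meas, of i d "\<lambda>x. x ^ k"] gauss1_moment[of k]
  by (simp add: stdg_component)

lemma stdg_comp_mean: "i < d \<Longrightarrow> (\<integral>z. z i \<partial>stdg d) = 0"
  using integral_distr[OF stdg_comp_meas, of i d "\<lambda>x. x"] by (simp add: stdg_component gauss1_mean)

lemma stdg_comp_integrable: "i < d \<Longrightarrow> integrable (stdg d) (\<lambda>z. z i)"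
  using stdg_comp_moment[of i d 1] by simp

lemma stdg_normd_moment4: "integrable (stdg d) (\<lambda>z. (normd d z) ^ 4)"
proof (rule Bochner_Integration.integrable_bound)
  show "integrable (stdg d) (\<lambda>z. real d * (\<Sum>i<d. (z i) ^ 4))"
    by (intro integrable_mult_right Bochner_Integration.integrable_sum stdg_comp_moment) auto
  have "(normd d z) ^ 4 \<le> real d * (\<Sum>i<d. (z i) ^ 4)" for z
  proof -
    have "(normd d z) ^ 4 = (\<Sum>i<d. (z i)\<^sup>2 * 1)\<^sup>2"
      by (simp add: normd_sq[symmetric] power_mult[symmetric])
    also have "\<dots> \<le> (\<Sum>i<d. ((z i)\<^sup>2)\<^sup>2) * (\<Sum>i<d. 1\<^sup>2)"
      by (rule Cauchy_Schwarz_ineq_sum)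
    finally show ?thesis by (simp add: power_mult[symmetric] mult.commute)
  qed
  moreover have "0 \<le> (\<Sum>i<d. (z i) ^ 4)" for z :: "nat \<Rightarrow> real" by (intro sum_nonneg) auto
  ultimately show "AE z in stdg d. norm ((normd d z) ^ 4) \<le> norm (real d * (\<Sum>i<d. (z i) ^ 4))"
    by (intro AE_I2) (simp add: abs_mult)
qed measurable

lemma stdg_normd_moment: 
  assumes "k \<le> 4" shows "integrable (stdg d) (\<lambda>z. (normd d z) ^ k)"
proof (rule Bochner_Integration.integrable_bound)
  show "integrable (stdg d) (\<lambda>z. 1 + (normd d z) ^ 4)"
    by (intro Bochner_Integration.integrable_add stdg_normd_moment4 SG.integrable_const)
  have "x ^ k \<le> 1 + x ^ 4" if "0 \<le> x" for x :: real
  proof (cases "x \<le> 1")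
    case True then have "x ^ k \<le> 1" using that by (simp add: power_le_one)
    moreover have "0 \<le> x ^ 4" by simp
    ultimately show ?thesis by linarith
  next
    case False then have "x ^ k \<le> x ^ 4" using assms by (intro power_increasing) auto
    then show ?thesis by linarith
  qed
  then show "AE z in stdg d. norm ((normd d z) ^ k) \<le> norm (1 + (normd d z) ^ 4)"
    by (intro AE_I2) simp
qed measurable

lemma stdg_normd1: "integrable (stdg d) (normd d)"
  using stdg_normd_moment[of 1 d] by simp

lemma dotp_integrable: "integrable (stdg d) (dotp d a)"
  unfolding dotp_def by (intro Bochner_Integration.integrable_sum integrable_mult_right stdg_comp_integrable) auto

lemma dotp_mean: "(\<integral>z. dotp d a z \<partial>stdg d) = 0"
  unfolding dotp_def
  by (subst Bochner_Integration.integral_sum) (auto intro: stdg_comp_integrable simp: stdg_comp_mean)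

lemma dotp_sq_integrable: "integrable (stdg d) (\<lambda>z. (dotp d a z)\<^sup>2)"
proof (rule Bochner_Integration.integrable_bound)
  show "integrable (stdg d) (\<lambda>z. (normd d a)\<^sup>2 * (normd d z)\<^sup>2)"
    by (intro integrable_mult_right stdg_normd_moment) auto
  show "AE z in stdg d. norm ((dotp d a z)\<^sup>2) \<le> norm ((normd d a)\<^sup>2 * (normd d z)\<^sup>2)"
  proof (intro AE_I2)
    fix z
    have "\<bar>dotp d a z\<bar>\<^sup>2 \<le> (normd d a * normd d z)\<^sup>2"
      using dotp_le by (rule power_mono) simp
    then show "norm ((dotp d a z)\<^sup>2) \<le> norm ((normd d a)\<^sup>2 * (normd d z)\<^sup>2)"
      by (simp add: power_mult_distrib)
  qed
qed measurable

text \<open>Completing the square in the Gaussian density. The formula moves a translation of the argument of a function to a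
  smooth weight, which makes the average of a merely bounded function differentiable.\<close>

lemma cameron_martin:
  assumes a: "a \<in> Rd d"
  shows "distr (stdg d) (lebd d) (mv d a 1) = density (stdg d) (\<lambda>z. ennreal (exp (dotp d a z - (normd d a)\<^sup>2 / 2)))"
proof -
  have e: "normal_density (a i) 1 y = std_normal_density y * exp (a i * y - (a i)\<^sup>2 / 2)" for i y
    by (simp add: normal_density_def mult_exp_exp power2_eq_square field_simps)
  have "distr (stdg d) (lebd d) (mv d a 1) = gauss d a 1"
    using gauss_eq_distr[of 1 d a] by simp
  also have "\<dots> = density (lebd d) (\<lambda>z. ennreal (\<Prod>i<d. std_normal_density (z i)) * ennreal (exp (dotp d a z - (normd d a)\<^sup>2 / 2)))"
    unfolding gauss_def
  proof (rule arg_cong[where f = "density (lebd d)"], rule ext)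
    fix z :: "nat \<Rightarrow> real"
    have "(\<Prod>i<d. normal_density (a i) 1 (z i)) = (\<Prod>i<d. std_normal_density (z i)) * exp (dotp d a z - (normd d a)\<^sup>2 / 2)"
      by (simp add: e prod.distrib exp_sum[symmetric] dotp_def normd_sq sum_subtractf sum_divide_distrib)
    then show "ennreal (\<Prod>i<d. normal_density (a i) (sqrt 1) (z i)) = ennreal (\<Prod>i<d. std_normal_density (z i)) * ennreal (exp (dotp d a z - (normd d a)\<^sup>2 / 2))"
      by (simp add: ennreal_mult prod_nonneg)
  qed
  also have "\<dots> = density (stdg d) (\<lambda>z. ennreal (exp (dotp d a z - (normd d a)\<^sup>2 / 2)))"
  proof -
    have "(\<lambda>z. ennreal (\<Prod>i<d. std_normal_density (z i))) \<in> borel_measurable (lebd d)"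
      by (intro measurable_compose[OF _ measurable_ennreal] borel_measurable_prod measurable_compose[OF lebd_component]) auto
    then show ?thesis unfolding stdg_eq_density by (subst density_density_eq) auto
  qed
  finally show ?thesis .
qed

lemma cameron_martin_integral:
  assumes a: "a \<in> Rd d" and [measurable]: "F \<in> borel_measurable (lebd d)"
  shows "(\<integral>z. F (mv d a 1 z) \<partial>stdg d) = (\<integral>z. exp (dotp d a z - (normd d a)\<^sup>2 / 2) * F z \<partial>stdg d)" (is ?A)
    and "integrable (stdg d) (\<lambda>z. F (mv d a 1 z)) \<longleftrightarrow> integrable (stdg d) (\<lambda>z. exp (dotp d a z - (normd d a)\<^sup>2 / 2) * F z)" (is ?B)
proof -
  have "(\<integral>z. F (mv d a 1 z) \<partial>stdg d) = (\<integral>y. F y \<partial>distr (stdg d) (lebd d) (mv d a 1))"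
    by (rule integral_distr[symmetric]) simp_all
  also have "\<dots> = (\<integral>z. exp (dotp d a z - (normd d a)\<^sup>2 / 2) * F z \<partial>stdg d)"
    unfolding cameron_martin[OF a] by (subst integral_density) simp_all
  finally show ?A .
  have "integrable (stdg d) (\<lambda>z. F (mv d a 1 z)) \<longleftrightarrow> integrable (distr (stdg d) (lebd d) (mv d a 1)) F"
    by (rule integrable_distr_eq[symmetric]) simp_all
  also have "\<dots> \<longleftrightarrow> integrable (stdg d) (\<lambda>z. exp (dotp d a z - (normd d a)\<^sup>2 / 2) * F z)"
    unfolding cameron_martin[OF a] by (subst integrable_density) simp_all
  finally show ?B .
qed

lemma dotp_mv: "dotp d a (mv d b s z) = dotp d a b + s * dotp d a z"
  by (simp add: dotp_def mv_nth distrib_left sum.distrib sum_distrib_left mult_ac)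

lemma dotp_self: "dotp d a a = (normd d a)\<^sup>2"
  by (simp add: normd_sq dotp_def) (simp add: power2_eq_square)

lemma cm_weight:
  assumes a: "a \<in> Rd d"
  defines "e \<equiv> \<lambda>z. exp (dotp d a z - (normd d a)\<^sup>2 / 2)"
  shows "integrable (stdg d) e" "(\<integral>z. e z \<partial>stdg d) = 1"
    "integrable (stdg d) (\<lambda>z. e z * dotp d a z)" "(\<integral>z. e z * dotp d a z \<partial>stdg d) = (normd d a)\<^sup>2"
    "integrable (stdg d) (\<lambda>z. e z * e z)" "(\<integral>z. e z * e z \<partial>stdg d) = exp ((normd d a)\<^sup>2)"
proof -
  note c = cameron_martin_integral[OF a]
  show 1: "integrable (stdg d) e" using c(2)[of "\<lambda>_. 1"] by (simp add: e_def)
  show 2: "(\<integral>z. e z \<partial>stdg d) = 1" using c(1)[of "\<lambda>_. 1"] by (simp add: e_def SG.prob_space)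
  show "integrable (stdg d) (\<lambda>z. e z * dotp d a z)"
    unfolding e_def by (subst c(2)[symmetric]) (auto simp: dotp_mv intro!: dotp_integrable)
  have "(\<integral>z. e z * dotp d a z \<partial>stdg d) = (\<integral>z. (normd d a)\<^sup>2 + dotp d a z \<partial>stdg d)"
    unfolding e_def by (subst c(1)[symmetric]) (auto simp: dotp_mv dotp_self)
  also have "\<dots> = (normd d a)\<^sup>2"
    by (subst Bochner_Integration.integral_add) (auto simp: dotp_mean dotp_integrable SG.prob_space)
  finally show "(\<integral>z. e z * dotp d a z \<partial>stdg d) = (normd d a)\<^sup>2" .
  have em: "e (mv d a 1 z) = exp ((normd d a)\<^sup>2) * e z" for z
    by (simp add: e_def dotp_mv dotp_self mult_exp_exp)
  have [measurable]: "e \<in> borel_measurable (lebd d)" unfolding e_def by measurable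
  show "integrable (stdg d) (\<lambda>z. e z * e z)"
    using c(2)[of e] 1 by (simp add: em) (simp add: e_def)
  show "(\<integral>z. e z * e z \<partial>stdg d) = exp ((normd d a)\<^sup>2)"
    using c(1)[of e] 2 by (simp add: em) (simp add: e_def)
qed

section \<open>Gradients of the heat semigroup\<close>

lemma stdg_cov:
  assumes "i < d" "j < d"
  shows "integrable (stdg d) (\<lambda>z. z i * z j)" "(\<integral>z. z i * z j \<partial>stdg d) = (if i = j then 1 else 0)"
proof -
  show "integrable (stdg d) (\<lambda>z. z i * z j)"
  proof (rule Bochner_Integration.integrable_bound)
    show "integrable (stdg d) (\<lambda>z. z i ^ 2 + z j ^ 2)"
      using assms by (intro Bochner_Integration.integrable_add stdg_comp_moment)
    have "\<bar>x * y\<bar> \<le> x\<^sup>2 + y\<^sup>2" for x y :: real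
    proof -
      have "2 * \<bar>x * y\<bar> \<le> x\<^sup>2 + y\<^sup>2"
        using sum_squares_bound[of "\<bar>x\<bar>" "\<bar>y\<bar>"] by (simp add: abs_mult)
      then show ?thesis by simp
    qed
    then show "AE z in stdg d. norm (z i * z j) \<le> norm (z i ^ 2 + z j ^ 2)" by (intro AE_I2) simp
  qed (use assms in \<open>auto intro!: borel_measurable_times stdg_comp_meas\<close>)
  show "(\<integral>z. z i * z j \<partial>stdg d) = (if i = j then 1 else 0)"
  proof (cases "i = j")
    case True
    have "(\<integral>z. z i * z i \<partial>stdg d) = (\<integral>x. x * x \<partial>distr (stdg d) borel (\<lambda>z. z i))"
      using assms by (subst integral_distr) (auto intro: stdg_comp_meas)
    then show ?thesis using assms True by (simp add: stdg_component gauss1_var power2_eq_square[symmetric])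
  next
    case False
    define F where "F = (\<lambda>k x. if k = i \<or> k = j then x else (1::real))"
    have "(\<integral>z. z i * z j \<partial>stdg d) = (\<integral>z. (\<Prod>k<d. F k (z k)) \<partial>stdg d)"
    proof (rule Bochner_Integration.integral_cong[OF refl])
      fix z :: "nat \<Rightarrow> real"
      have "(\<Prod>k<d. F k (z k)) = (\<Prod>k\<in>{i, j}. F k (z k))"
        by (rule prod.mono_neutral_right) (use assms in \<open>auto simp: F_def\<close>)
      then show "z i * z j = (\<Prod>k<d. F k (z k))" using False by (simp add: F_def)
    qed
    also have "\<dots> = (\<Prod>k<d. \<integral>x. F k x \<partial>gauss1)"
    proof -
      have iF1: "integrable gauss1 (F k)" for k
        using gauss1_moment[of 1] by (cases "k = i \<or> k = j") (simp_all add: F_def)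
      show ?thesis
        unfolding stdg_def by (rule PG.product_integral_prod) (simp_all add: iF1)
    qed
    also have "\<dots> = 0"
      by (rule prod_zero) (use assms in \<open>auto intro!: bexI[of _ i] simp: F_def gauss1_mean\<close>)
    finally show ?thesis using False by simp
  qed
qed

lemma dotp_var: "(\<integral>z. (dotp d a z)\<^sup>2 \<partial>stdg d) = (normd d a)\<^sup>2"
proof -
  have "(\<integral>z. (dotp d a z)\<^sup>2 \<partial>stdg d) = (\<integral>z. (\<Sum>i<d. \<Sum>j<d. (a i * a j) * (z i * z j)) \<partial>stdg d)"
    by (simp add: dotp_def power2_eq_square sum_product mult_ac)
  also have "\<dots> = (\<Sum>i<d. \<integral>z. (\<Sum>j<d. (a i * a j) * (z i * z j)) \<partial>stdg d)"
    by (rule Bochner_Integration.integral_sum) (auto intro!: Bochner_Integration.integrable_sum integrable_mult_right stdg_cov)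
  also have "\<dots> = (\<Sum>i<d. \<Sum>j<d. (a i * a j) * (\<integral>z. z i * z j \<partial>stdg d))"
    by (intro sum.cong refl, subst Bochner_Integration.integral_sum) (auto intro!: stdg_cov)
  also have "\<dots> = (\<Sum>i<d. \<Sum>j<d. (if i = j then a i * a j else 0))"
    by (intro sum.cong refl) (simp add: stdg_cov)
  also have "\<dots> = (normd d a)\<^sup>2" by (simp add: normd_sq) (simp add: power2_eq_square)
  finally show ?thesis .
qed

text \<open>The weight is 1 + dotp a z up to an error that is quadratic in a in mean. For small a its
  second moment is computed from the exponential moments; for large a the trivial bound by the three separate means is
  already quadratic.\<close>

lemma cm_remainder:
  assumes a: "a \<in> Rd d"
  defines "D \<equiv> \<lambda>z. exp (dotp d a z - (normd d a)\<^sup>2 / 2) - 1 - dotp d a z"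
  shows "integrable (stdg d) D" "(\<integral>z. \<bar>D z\<bar> \<partial>stdg d) \<le> 3 * (normd d a)\<^sup>2"
proof -
  define s where "s = (normd d a)\<^sup>2"
  define e where "e = (\<lambda>z. exp (dotp d a z - s / 2))"
  have w: "integrable (stdg d) e" "(\<integral>z. e z \<partial>stdg d) = 1"
    "integrable (stdg d) (\<lambda>z. e z * dotp d a z)" "(\<integral>z. e z * dotp d a z \<partial>stdg d) = s"
    "integrable (stdg d) (\<lambda>z. e z * e z)" "(\<integral>z. e z * e z \<partial>stdg d) = exp s"
    using cm_weight[OF a] by (simp_all only: e_def s_def)
  have De: "D = (\<lambda>z. e z - 1 - dotp d a z)" by (simp add: D_def e_def s_def)
  show iD: "integrable (stdg d) D"
    unfolding De by (intro Bochner_Integration.integrable_diff w dotp_integrable SG.integrable_const)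
  show "(\<integral>z. \<bar>D z\<bar> \<partial>stdg d) \<le> 3 * (normd d a)\<^sup>2"
  proof (cases "normd d a \<le> 1")
    case True
    show ?thesis
    proof (cases "normd d a = 0")
      case True
      have "dotp d a z = 0" for z using dotp_le[of d a z] True by simp
      then have "D z = 0" for z by (simp add: D_def True)
      then show ?thesis by (simp add: True)
    next
      case False
      then have s0: "0 < s" by (simp add: s_def)
      have s1: "s \<le> 1" unfolding s_def using True by (simp add: power_le_one)
      have D2: "(D z)\<^sup>2 = e z * e z + 1 + (dotp d a z)\<^sup>2 - 2 * e z - 2 * (e z * dotp d a z) + 2 * dotp d a z" for z
        by (simp add: De power2_eq_square algebra_simps)
      have iD2: "integrable (stdg d) (\<lambda>z. (D z)\<^sup>2)"
        unfolding D2 by (intro Bochner_Integration.integrable_diff Bochner_Integration.integrable_add w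
            dotp_integrable dotp_sq_integrable SG.integrable_const integrable_mult_right)
      have "(\<integral>z. (D z)\<^sup>2 \<partial>stdg d) = exp s + 1 + s - 2 * 1 - 2 * s + 2 * 0"
        unfolding D2 using w(1) w(3) w(5)
        by (simp add: w(2,4,6) dotp_integrable dotp_sq_integrable dotp_mean dotp_var SG.prob_space s_def[symmetric])
      also have "\<dots> \<le> s\<^sup>2" using exp_bound[of s] s0 s1 by simp
      finally have ED2: "(\<integral>z. (D z)\<^sup>2 \<partial>stdg d) \<le> s\<^sup>2" .
      have "(\<integral>z. \<bar>D z\<bar> \<partial>stdg d) \<le> (\<integral>z. (D z)\<^sup>2 / s + s \<partial>stdg d)"
      proof (rule integral_mono)
        show "integrable (stdg d) (\<lambda>z. (D z)\<^sup>2 / s + s)"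
          by (intro Bochner_Integration.integrable_add integrable_divide iD2 SG.integrable_const)
        fix z
        have "0 \<le> \<bar>D z\<bar> * s" using s0 by simp
        then have "\<bar>D z\<bar> * s \<le> (D z)\<^sup>2 + s\<^sup>2"
          using sum_squares_bound[of "\<bar>D z\<bar>" s] by simp
        then show "\<bar>D z\<bar> \<le> (D z)\<^sup>2 / s + s" using s0 by (simp add: field_simps power2_eq_square)
      qed (use iD in simp)
      also have "\<dots> = (\<integral>z. (D z)\<^sup>2 \<partial>stdg d) / s + s"
        using iD2 by (simp add: SG.prob_space)
      also have "\<dots> \<le> 3 * s"
        using divide_right_mono[OF ED2, of s] s0 by (simp add: power2_eq_square)
      finally show ?thesis by (simp add: s_def)
    qed
  next
    case False
    let ?n = "normd d a"
    have n1: "1 < ?n" using False by simp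
    have "(\<integral>z. \<bar>D z\<bar> \<partial>stdg d) \<le> (\<integral>z. e z + 1 + ((dotp d a z)\<^sup>2 / ?n + ?n) / 2 \<partial>stdg d)"
    proof (rule integral_mono)
      show "integrable (stdg d) (\<lambda>z. e z + 1 + ((dotp d a z)\<^sup>2 / ?n + ?n) / 2)"
        by (intro Bochner_Integration.integrable_add integrable_divide dotp_sq_integrable w SG.integrable_const)
      fix z
      have "2 * \<bar>dotp d a z\<bar> * ?n \<le> (dotp d a z)\<^sup>2 + ?n\<^sup>2"
        using sum_squares_bound[of "\<bar>dotp d a z\<bar>" ?n] by simp
      then have "\<bar>dotp d a z\<bar> \<le> ((dotp d a z)\<^sup>2 / ?n + ?n) / 2"
        using n1 by (simp add: field_simps power2_eq_square)
      moreover have "0 < e z" by (simp add: e_def)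
      ultimately show "\<bar>D z\<bar> \<le> e z + 1 + ((dotp d a z)\<^sup>2 / ?n + ?n) / 2" unfolding De by linarith
    qed (use iD in simp)
    also have "\<dots> = 2 + ?n"
      using n1 by (simp add: w dotp_sq_integrable dotp_var SG.prob_space) (simp add: power2_eq_square field_simps)
    also have "\<dots> \<le> 3 * ?n\<^sup>2"
    proof -
      have "1 * ?n \<le> ?n * ?n" using n1 by (intro mult_right_mono) auto
      then show ?thesis using n1 unfolding power2_eq_square by linarith
    qed
    finally show ?thesis .
  qed
qed

text \<open>First-order expansion with a uniform quadratic remainder. Besides identifying G as the gradient, it survives
  averaging over Gaussian increments without any differentiation under the integral sign.\<close>

definition qapx :: "nat \<Rightarrow> real \<Rightarrow> ((nat \<Rightarrow> real) \<Rightarrow> real) \<Rightarrow> ((nat \<Rightarrow> real) \<Rightarrow> nat \<Rightarrow> real) \<Rightarrow> bool" where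
  "qapx d L v G \<longleftrightarrow> (\<forall>x\<in>Rd d. \<forall>w\<in>Rd d. \<bar>v (mv d x 1 w) - v x - dotp d (G x) w\<bar> \<le> L * (normd d w)\<^sup>2)"

text \<open>The gradient of the heat average in Gaussian integration by parts form; it makes sense without any regularity of
  u.\<close>

definition hgrad :: "nat \<Rightarrow> real \<Rightarrow> ((nat \<Rightarrow> real) \<Rightarrow> real) \<Rightarrow> (nat \<Rightarrow> real) \<Rightarrow> nat \<Rightarrow> real" where
  "hgrad d t u x i = (\<integral>z. u (mv d x (sqrt t) z) * z i \<partial>stdg d) / sqrt t"

text \<open>Averaging commutes with gradients: if v has gradient G, this is the gradient of heat d t v.\<close>

definition heatG :: "nat \<Rightarrow> real \<Rightarrow> ((nat \<Rightarrow> real) \<Rightarrow> nat \<Rightarrow> real) \<Rightarrow> (nat \<Rightarrow> real) \<Rightarrow> nat \<Rightarrow> real" where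
  "heatG d t G x i = heat d t (\<lambda>y. G y i) x"

lemma heat_mult_integrable:
  assumes u: "bdd_meas d M u" and F: "integrable (stdg d) F"
  shows "integrable (stdg d) (\<lambda>z. u (mv d x s z) * F z)"
proof (rule Bochner_Integration.integrable_bound)
  show "integrable (stdg d) (\<lambda>z. M * F z)" using F by simp
  have "(\<lambda>z. u (mv d x s z)) \<in> borel_measurable (stdg d)"
    by (rule measurable_compose[OF _ bdd_measD(1)[OF u]]) simp
  then show "(\<lambda>z. u (mv d x s z) * F z) \<in> borel_measurable (stdg d)"
    using borel_measurable_integrable[OF F] by (rule borel_measurable_times)
  show "AE z in stdg d. norm (u (mv d x s z) * F z) \<le> norm (M * F z)"
    using bdd_measD(2)[OF u mv_Rd] bdd_meas_nonneg[OF u] by (intro AE_I2) (auto simp: abs_mult intro!: mult_right_mono)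
qed

text \<open>By the Cameron-Martin formula, translating the argument multiplies the integrand by a weight whose linear part
  produces hgrad and whose remainder is quadratic in the translation.\<close>

lemma qapx_heat_bounded:
  assumes u: "bdd_meas d M u" and t: "0 < t"
  shows "qapx d (3 * M / t) (heat d t u) (hgrad d t u)"
  unfolding qapx_def
proof (intro ballI)
  fix x w assume x: "x \<in> Rd d" and w: "w \<in> Rd d"
  define a where "a = mv d (zer d) (1 / sqrt t) w"
  have a: "a \<in> Rd d" by (simp add: a_def)
  have na: "(normd d a)\<^sup>2 = (normd d w)\<^sup>2 / t"
    using t by (simp add: normd_sq a_def mv_nth zer_def power_mult_distrib power_divide sum_divide_distrib)
  define F where "F = (\<lambda>z. u (mv d x (sqrt t) z))"
  have [measurable]: "u \<in> borel_measurable (lebd d)" using u by (rule bdd_measD)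
  have Fm: "F \<in> borel_measurable (lebd d)" unfolding F_def by measurable
  define e where "e = (\<lambda>z. exp (dotp d a z - (normd d a)\<^sup>2 / 2))"
  have iF: "integrable (stdg d) (\<lambda>z. F z * H z)" if "integrable (stdg d) H" for H
    unfolding F_def by (rule heat_mult_integrable[OF u that])
  have ie: "integrable (stdg d) e" unfolding e_def by (rule cm_weight(1)[OF a])
  have D: "integrable (stdg d) (\<lambda>z. e z - 1 - dotp d a z)" "(\<integral>z. \<bar>e z - 1 - dotp d a z\<bar> \<partial>stdg d) \<le> 3 * (normd d a)\<^sup>2"
    using cm_remainder[OF a] by (auto simp: e_def)
  have "heat d t u (mv d x 1 w) = (\<integral>z. F (mv d a 1 z) \<partial>stdg d)"
    unfolding heat_def F_def using t
    by (intro Bochner_Integration.integral_cong refl arg_cong[of _ _ u] Rd_eqI[of _ d]) (auto simp: mv_nth a_def zer_def field_simps)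
  also have "\<dots> = (\<integral>z. F z * e z \<partial>stdg d)"
    using cameron_martin_integral(1)[OF a Fm] by (simp add: e_def mult.commute)
  finally have 1: "heat d t u (mv d x 1 w) = (\<integral>z. F z * e z \<partial>stdg d)" .
  have 2: "heat d t u x = (\<integral>z. F z * 1 \<partial>stdg d)" by (simp add: heat_def F_def)
  have "dotp d (hgrad d t u x) w = (\<Sum>i<d. (\<integral>z. F z * (a i * z i) \<partial>stdg d))"
    unfolding dotp_def hgrad_def
  proof (intro sum.cong refl)
    fix i assume "i \<in> {..<d}"
    then have "(\<integral>z. F z * (a i * z i) \<partial>stdg d) = (\<integral>z. (F z * z i) * (w i / sqrt t) \<partial>stdg d)"
      by (intro Bochner_Integration.integral_cong) (auto simp: a_def mv_nth zer_def)
    then show "(\<integral>z. u (mv d x (sqrt t) z) * z i \<partial>stdg d) / sqrt t * w i = (\<integral>z. F z * (a i * z i) \<partial>stdg d)"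
      by (simp add: F_def)
  qed
  also have "\<dots> = (\<integral>z. (\<Sum>i<d. F z * (a i * z i)) \<partial>stdg d)"
  proof (rule Bochner_Integration.integral_sum[symmetric])
    fix i assume "i \<in> {..<d}"
    then have "integrable (stdg d) (\<lambda>z. a i * z i)" by (intro integrable_mult_right stdg_comp_integrable) auto
    then show "integrable (stdg d) (\<lambda>z. F z * (a i * z i))"
      unfolding F_def by (rule heat_mult_integrable[OF u])
  qed
  also have "\<dots> = (\<integral>z. F z * dotp d a z \<partial>stdg d)"
    by (simp add: dotp_def sum_distrib_left)
  finally have 3: "dotp d (hgrad d t u x) w = (\<integral>z. F z * dotp d a z \<partial>stdg d)" .
  have "heat d t u (mv d x 1 w) - heat d t u x - dotp d (hgrad d t u x) w = (\<integral>z. F z * (e z - 1 - dotp d a z) \<partial>stdg d)"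
  proof -
    have "(\<integral>z. F z * (e z - 1 - dotp d a z) \<partial>stdg d) = (\<integral>z. (F z * e z - F z * 1) - F z * dotp d a z \<partial>stdg d)"
      by (intro Bochner_Integration.integral_cong refl) (simp add: algebra_simps)
    also have "\<dots> = (\<integral>z. F z * e z - F z * 1 \<partial>stdg d) - (\<integral>z. F z * dotp d a z \<partial>stdg d)"
      by (rule Bochner_Integration.integral_diff[OF Bochner_Integration.integrable_diff[OF iF[OF ie] iF[OF SG.integrable_const]] iF[OF dotp_integrable]])
    also have "(\<integral>z. F z * e z - F z * 1 \<partial>stdg d) = (\<integral>z. F z * e z \<partial>stdg d) - (\<integral>z. F z * 1 \<partial>stdg d)"
      by (rule Bochner_Integration.integral_diff[OF iF[OF ie] iF[OF SG.integrable_const]])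
    finally show ?thesis unfolding 1 2 3 by simp
  qed
  also have "\<bar>\<dots>\<bar> \<le> (\<integral>z. \<bar>F z * (e z - 1 - dotp d a z)\<bar> \<partial>stdg d)" by (rule integral_abs_bound)
  also have "\<dots> \<le> (\<integral>z. M * \<bar>e z - 1 - dotp d a z\<bar> \<partial>stdg d)"
  proof (rule integral_mono)
    show "integrable (stdg d) (\<lambda>z. \<bar>F z * (e z - 1 - dotp d a z)\<bar>)" by (intro integrable_abs iF D)
    show "integrable (stdg d) (\<lambda>z. M * \<bar>e z - 1 - dotp d a z\<bar>)" by (intro integrable_mult_right integrable_abs D)
    show "\<bar>F z * (e z - 1 - dotp d a z)\<bar> \<le> M * \<bar>e z - 1 - dotp d a z\<bar>" for z
      using bdd_measD(2)[OF u mv_Rd] by (simp add: abs_mult F_def mult_right_mono)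
  qed
  also have "\<dots> \<le> M * (3 * (normd d a)\<^sup>2)"
    using D(2) bdd_meas_nonneg[OF u] by (simp add: mult_left_mono)
  finally show "\<bar>heat d t u (mv d x 1 w) - heat d t u x - dotp d (hgrad d t u x) w\<bar> \<le> 3 * M / t * (normd d w)\<^sup>2"
    by (simp add: na mult_ac)
qed

text \<open>The mean absolute value of a standard normal coordinate is at most one, since \<bar>t\<bar> \<le> (1 + t^2)/2.\<close>

lemma hgrad_bdd:
  assumes u: "bdd_meas d M u" and t: "0 < t" and i: "i < d"
  shows "bdd_meas d (M / sqrt t) (\<lambda>x. hgrad d t u x i)"
  unfolding bdd_meas_def
proof (intro conjI ballI)
  have um: "u \<in> borel_measurable (lebd d)" using u by (rule bdd_measD)
  have "(\<lambda>(x, z). u (mv d x (sqrt t) z) * z i) \<in> borel_measurable (lebd d \<Otimes>\<^sub>M stdg d)"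
    unfolding split_beta'
  proof (rule borel_measurable_times)
    show "(\<lambda>w. u (mv d (fst w) (sqrt t) (snd w))) \<in> borel_measurable (lebd d \<Otimes>\<^sub>M stdg d)"
      by (rule measurable_compose[OF _ um]) measurable
    show "(\<lambda>w. snd w i) \<in> borel_measurable (lebd d \<Otimes>\<^sub>M stdg d)"
      by (rule measurable_compose[OF measurable_snd stdg_comp_meas[OF i]])
  qed
  then have "(\<lambda>x. \<integral>z. u (mv d x (sqrt t) z) * z i \<partial>stdg d) \<in> borel_measurable (lebd d)"
    by (rule SG.borel_measurable_lebesgue_integral)
  then show "(\<lambda>x. hgrad d t u x i) \<in> borel_measurable (lebd d)"
    unfolding hgrad_def by measurable
  fix x assume "x \<in> Rd d"
  have M0: "0 \<le> M" using u by (rule bdd_meas_nonneg)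
  have z1: "(\<integral>z. \<bar>z i\<bar> \<partial>stdg d) \<le> 1"
  proof -
    have "(\<integral>z. \<bar>z i\<bar> \<partial>stdg d) \<le> (\<integral>z. (1 + z i * z i) / 2 \<partial>stdg d)"
    proof (rule integral_mono)
      show "\<bar>z i\<bar> \<le> (1 + z i * z i) / 2" for z :: "nat \<Rightarrow> real"
        using sum_squares_bound[of "\<bar>z i\<bar>" 1] by (simp add: power2_eq_square)
    qed (use i in \<open>auto intro!: stdg_comp_integrable Bochner_Integration.integrable_add stdg_cov\<close>)
    also have "\<dots> = 1" using i by (simp add: stdg_cov SG.prob_space)
    finally show ?thesis .
  qed
  have "\<bar>\<integral>z. u (mv d x (sqrt t) z) * z i \<partial>stdg d\<bar> \<le> (\<integral>z. \<bar>u (mv d x (sqrt t) z) * z i\<bar> \<partial>stdg d)"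
    by (rule integral_abs_bound)
  also have "\<dots> \<le> (\<integral>z. M * \<bar>z i\<bar> \<partial>stdg d)"
  proof (rule integral_mono)
    show "integrable (stdg d) (\<lambda>z. \<bar>u (mv d x (sqrt t) z) * z i\<bar>)"
      by (intro integrable_abs heat_mult_integrable[OF u] stdg_comp_integrable i)
    show "integrable (stdg d) (\<lambda>z. M * \<bar>z i\<bar>)"
      by (intro integrable_mult_right integrable_abs stdg_comp_integrable i)
    show "\<bar>u (mv d x (sqrt t) z) * z i\<bar> \<le> M * \<bar>z i\<bar>" for z
      using bdd_measD(2)[OF u mv_Rd] by (simp add: abs_mult mult_right_mono)
  qed
  also have "\<dots> \<le> M" using mult_left_mono[OF z1 M0] by simp
  finally show "\<bar>hgrad d t u x i\<bar> \<le> M / sqrt t"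
    using t by (simp add: hgrad_def divide_right_mono)
qed

lemma qapx_heat:
  assumes q: "qapx d L v G" and v: "bdd_meas d M v" and G: "\<And>i. i < d \<Longrightarrow> bdd_meas d K (\<lambda>x. G x i)"
  shows "qapx d L (heat d t v) (heatG d t G)"
  unfolding qapx_def
proof (intro ballI)
  fix x w assume x: "x \<in> Rd d" and w: "w \<in> Rd d"
  let ?X = "\<lambda>z. mv d x (sqrt t) z"
  have 1: "heat d t v (mv d x 1 w) = (\<integral>z. v (mv d (?X z) 1 w) \<partial>stdg d)"
    unfolding heat_def by (intro Bochner_Integration.integral_cong refl arg_cong[of _ _ v] Rd_eqI[of _ d]) (auto simp: mv_nth)
  have 3: "dotp d (heatG d t G x) w = (\<integral>z. dotp d (G (?X z)) w \<partial>stdg d)"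
    unfolding dotp_def heatG_def heat_def
    by (subst Bochner_Integration.integral_sum) (auto intro!: heat_integrable G)
  have i1: "integrable (stdg d) (\<lambda>z. v (mv d (?X z) 1 w))"
    by (rule bdd_meas_integrable[OF v prob_stdg]) (use w x in \<open>intro mv_measurable measurable_const; simp\<close>)
  have i2: "integrable (stdg d) (\<lambda>z. v (?X z))" by (rule heat_integrable[OF v])
  have i3: "integrable (stdg d) (\<lambda>z. dotp d (G (?X z)) w)"
    unfolding dotp_def by (intro Bochner_Integration.integrable_sum integrable_mult_left heat_integrable[OF G]) auto
  have "heat d t v (mv d x 1 w) - heat d t v x - dotp d (heatG d t G x) w
     = (\<integral>z. v (mv d (?X z) 1 w) - v (?X z) - dotp d (G (?X z)) w \<partial>stdg d)"
    unfolding 1 3 using i1 i2 i3 by (simp add: heat_def)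
  then have "\<bar>heat d t v (mv d x 1 w) - heat d t v x - dotp d (heatG d t G x) w\<bar>
     = \<bar>\<integral>z. v (mv d (?X z) 1 w) - v (?X z) - dotp d (G (?X z)) w \<partial>stdg d\<bar>" by (rule arg_cong)
  also have "\<dots> \<le> (\<integral>z. \<bar>v (mv d (?X z) 1 w) - v (?X z) - dotp d (G (?X z)) w\<bar> \<partial>stdg d)"
    by (rule integral_abs_bound)
  also have "\<dots> \<le> (\<integral>z. L * (normd d w)\<^sup>2 \<partial>stdg d)"
    by (rule integral_mono) (use q w i1 i2 i3 in \<open>auto simp: qapx_def\<close>)
  finally show "\<bar>heat d t v (mv d x 1 w) - heat d t v x - dotp d (heatG d t G x) w\<bar> \<le> L * (normd d w)\<^sup>2"
    by simp
qed

lemma normd_le_comp: "(\<And>i. i < d \<Longrightarrow> \<bar>a i\<bar> \<le> K) \<Longrightarrow> normd d a \<le> real d * K"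
  by (rule order_trans[OF normd_le_sum]) (use sum_bounded_above[of "{..<d}" "\<lambda>i. \<bar>a i\<bar>" K] in simp)

text \<open>For increments of norm at most one the quadratic remainder is dominated by the norm; for longer ones boundedness of
  v suffices.\<close>

lemma qapx_lipschitz:
  assumes q: "qapx d L v G" and v: "bdd_meas d M v" and G: "\<And>i. i < d \<Longrightarrow> bdd_meas d K (\<lambda>x. G x i)"
    and x: "x \<in> Rd d" and w: "w \<in> Rd d" and L: "0 \<le> L"
  shows "\<bar>v (mv d x 1 w) - v x\<bar> \<le> (2 * M + real d * K + L) * normd d w"
proof -
  have M: "0 \<le> M" using v by (rule bdd_meas_nonneg)
  have nG: "normd d (G x) \<le> real d * K"
    using bdd_measD(2)[OF G x] by (intro normd_le_comp) auto
  have K: "0 \<le> real d * K" using nG normd_nonneg[of d "G x"] by linarith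
  show ?thesis
  proof (cases "normd d w \<le> 1")
    case True
    have "\<bar>v (mv d x 1 w) - v x - dotp d (G x) w\<bar> \<le> L * (normd d w)\<^sup>2"
      using q x w by (auto simp: qapx_def)
    moreover have "L * (normd d w)\<^sup>2 \<le> L * normd d w"
      using True L by (intro mult_left_mono) (auto simp: power2_eq_square mult_left_le)
    moreover have "\<bar>dotp d (G x) w\<bar> \<le> (real d * K) * normd d w"
      using dotp_le[of d "G x" w] mult_right_mono[OF nG normd_nonneg[of d w]] by linarith
    ultimately have "\<bar>v (mv d x 1 w) - v x\<bar> \<le> (real d * K + L) * normd d w"
      by (simp add: distrib_right)
    moreover have "0 \<le> 2 * M * normd d w" using M by simp
    ultimately show ?thesis by (simp add: distrib_right)
  next
    case False
    have "\<bar>v (mv d x 1 w) - v x\<bar> \<le> 2 * M * 1"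
      using bdd_measD(2)[OF v x] bdd_measD(2)[OF v mv_Rd[of d x 1 w]] by linarith
    also have "\<dots> \<le> (2 * M + real d * K + L) * normd d w"
      by (rule mult_mono) (use False M K L in auto)
    finally show ?thesis .
  qed
qed

lemma qapx_has_partial:
  assumes q: "qapx d L v G" and x: "x \<in> Rd d" and i: "i < d" and L: "0 \<le> L"
  shows "((\<lambda>t. v (x(i := t))) has_real_derivative G x i) (at (x i))"
proof -
  have b: "\<bar>v (x(i := x i + h)) - v x - G x i * h\<bar> \<le> L * h\<^sup>2" for h
  proof -
    define w where "w = (\<lambda>j\<in>{..<d}. if j = i then h else 0)"
    have w: "w \<in> Rd d" by (auto simp: w_def)
    have "x(i := x i + h) \<in> Rd d" using x i by (auto simp: PiE_iff extensional_def)
    then have "mv d x 1 w = x(i := x i + h)"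
      by (rule Rd_eqI[OF mv_Rd]) (use i in \<open>auto simp: mv_nth w_def\<close>)
    moreover have "dotp d (G x) w = G x i * h"
    proof -
      have "dotp d (G x) w = (\<Sum>j<d. if j = i then G x i * h else 0)"
        unfolding dotp_def by (rule sum.cong) (auto simp: w_def)
      then show ?thesis using i by simp
    qed
    moreover have "(normd d w)\<^sup>2 = h\<^sup>2"
    proof -
      have "(normd d w)\<^sup>2 = (\<Sum>j<d. if j = i then h\<^sup>2 else 0)"
        unfolding normd_sq by (rule sum.cong) (auto simp: w_def)
      then show ?thesis using i by simp
    qed
    ultimately show ?thesis using q[unfolded qapx_def, rule_format, OF x w] by simp
  qed
  have "(\<lambda>h. (v (x(i := x i + h)) - v (x(i := x i))) / h - G x i) \<midarrow>0\<rightarrow> 0"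
  proof (rule Lim_null_comparison)
    show "\<forall>\<^sub>F h in at 0. norm ((v (x(i := x i + h)) - v (x(i := x i))) / h - G x i) \<le> L * \<bar>h\<bar>"
      unfolding eventually_at
    proof (intro exI[of _ 1] conjI ballI impI)
      fix h :: real assume "h \<noteq> 0 \<and> dist h 0 < 1"
      then have h: "h \<noteq> 0" by simp
      have "\<bar>(v (x(i := x i + h)) - v x) / h - G x i\<bar> = \<bar>v (x(i := x i + h)) - v x - G x i * h\<bar> / \<bar>h\<bar>"
        using h by (simp add: abs_divide[symmetric] diff_divide_distrib)
      also have "\<dots> \<le> L * h\<^sup>2 / \<bar>h\<bar>" using b by (rule divide_right_mono) simp
      also have "\<dots> = L * \<bar>h\<bar>" using h by (simp add: power2_eq_square abs_mult_self_eq[of h, symmetric] del: abs_mult_self_eq)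
      finally show "norm ((v (x(i := x i + h)) - v (x(i := x i))) / h - G x i) \<le> L * \<bar>h\<bar>" by simp
    qed simp
    show "(\<lambda>h. L * \<bar>h\<bar>) \<midarrow>0\<rightarrow> 0" by (rule tendsto_eq_intros refl | simp)+
  qed
  then have "(\<lambda>h. (v (x(i := x i + h)) - v (x(i := x i))) / h) \<midarrow>0\<rightarrow> G x i"
    by (simp add: LIM_zero_iff)
  then show ?thesis by (simp add: DERIV_def)
qed

lemma qapx_gradd:
  assumes q: "qapx d L v G" and L: "0 \<le> L"
  shows "has_partials d v" "x \<in> Rd d \<Longrightarrow> gradd d v x = (\<lambda>i\<in>{..<d}. G x i)"
proof -
  note d = qapx_has_partial[OF q _ _ L]
  show "has_partials d v"
    unfolding has_partials_def real_differentiable_def using d by blast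
  show "gradd d v x = (\<lambda>i\<in>{..<d}. G x i)" if x: "x \<in> Rd d"
    unfolding gradd_def by (rule restrict_ext) (use d[OF x] in \<open>auto intro: DERIV_imp_deriv\<close>)
qed

section \<open>Smoothness of the heat semigroup\<close>

lemma openin_box:
  fixes d :: nat
  assumes "0 < e"
  shows "openin (product_topology (\<lambda>_. euclideanreal) {..<d}) (PiE {..<d} (\<lambda>i. ball (x i) e))"
proof -
  have "finite {i. i < d \<and> ball (x i) e \<noteq> UNIV}" by (rule finite_subset[of _ "{..<d}"]) auto
  then show ?thesis using assms by (simp add: openin_PiE_gen)
qed

lemma continuous_map_of_local_lipschitz:
  assumes lip: "\<And>x. x \<in> Rd d \<Longrightarrow> \<exists>C. \<forall>w\<in>Rd d. normd d w \<le> 1 \<longrightarrow> \<bar>v (mv d x 1 w) - v x\<bar> \<le> C * normd d w"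
  shows "continuous_map (product_topology (\<lambda>_. euclideanreal) {..<d}) euclideanreal v"
  unfolding continuous_map_eq_topcontinuous_at topcontinuous_at_def
proof (intro ballI conjI allI impI)
  fix x V assume "x \<in> topspace (product_topology (\<lambda>_. euclideanreal) {..<d})"
    and V: "openin euclideanreal V \<and> v x \<in> V"
  then have x: "x \<in> Rd d" by simp
  from lip[OF x] obtain C where C: "\<And>w. w \<in> Rd d \<Longrightarrow> normd d w \<le> 1 \<Longrightarrow> \<bar>v (mv d x 1 w) - v x\<bar> \<le> C * normd d w" by blast
  from V obtain r where r: "0 < r" "ball (v x) r \<subseteq> V" by (auto simp: open_contains_ball)
  define e where "e = min (r / (\<bar>C\<bar> + 1)) 1 / (real d + 1)"
  have Cp: "0 < \<bar>C\<bar> + 1" by simp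
  have e: "0 < e" using r Cp by (simp add: e_def)
  have e1: "(real d + 1) * e \<le> 1" "(real d + 1) * e \<le> r / (\<bar>C\<bar> + 1)" by (auto simp: e_def)
  let ?U = "PiE {..<d} (\<lambda>i. ball (x i) e)"
  have "v y \<in> V" if y: "y \<in> ?U" for y
  proof -
    have yR: "y \<in> Rd d" using y by (auto simp: PiE_iff)
    define w where "w = mv d y (-1) x"
    have w: "w \<in> Rd d" by (simp add: w_def)
    have y': "y = mv d x 1 w" by (rule Rd_eqI[OF yR mv_Rd]) (simp add: mv_nth w_def)
    have "normd d w \<le> real d * e"
      by (rule normd_le_comp) (use y in \<open>auto simp: w_def mv_nth PiE_iff dist_real_def abs_minus_commute intro: less_imp_le\<close>)
    then have nw: "normd d w < (real d + 1) * e" using e by (simp add: algebra_simps)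
    then have "\<bar>v y - v x\<bar> \<le> C * normd d w" using C[OF w] e1(1) by (simp add: y')
    also have "\<dots> \<le> (\<bar>C\<bar> + 1) * normd d w" by (intro mult_right_mono) auto
    also have "\<dots> < (\<bar>C\<bar> + 1) * ((real d + 1) * e)" using nw Cp by (intro mult_strict_left_mono) auto
    also have "\<dots> \<le> (\<bar>C\<bar> + 1) * (r / (\<bar>C\<bar> + 1))" using e1(2) Cp by (intro mult_left_mono) auto
    also have "\<dots> = r" using Cp by simp
    finally show ?thesis using r by (auto simp: dist_real_def abs_minus_commute subset_iff)
  qed
  moreover have "x \<in> ?U" using x e by (auto simp: PiE_iff)
  ultimately show "\<exists>U. openin (product_topology (\<lambda>_. euclideanreal) {..<d}) U \<and> x \<in> U \<and> (\<forall>y\<in>U. v y \<in> V)"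
    using openin_box[OF e, where x = x and d = d] by blast
qed auto

lemma continuous_map_of_lipschitz:
  assumes lip: "\<And>x w. x \<in> Rd d \<Longrightarrow> w \<in> Rd d \<Longrightarrow> \<bar>v (mv d x 1 w) - v x\<bar> \<le> C * normd d w"
  shows "continuous_map (product_topology (\<lambda>_. euclideanreal) {..<d}) euclideanreal v"
  by (rule continuous_map_of_local_lipschitz) (use lip in blast)

lemma upd_Rd: "x \<in> Rd d \<Longrightarrow> i < d \<Longrightarrow> x(i := t) \<in> Rd d"
  by (auto simp: PiE_iff extensional_def)

lemma has_partials_cong: "(\<And>x. x \<in> Rd d \<Longrightarrow> f x = g x) \<Longrightarrow> has_partials d f = has_partials d g"
  unfolding has_partials_def by (simp add: upd_Rd cong: ball_cong)

lemma gradd_cong: "(\<And>x. x \<in> Rd d \<Longrightarrow> f x = g x) \<Longrightarrow> x \<in> Rd d \<Longrightarrow> gradd d f x = gradd d g x"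
  unfolding gradd_def by (simp add: upd_Rd cong: restrict_cong)

lemma Ck_cong: "(\<And>x. x \<in> Rd d \<Longrightarrow> f x = g x) \<Longrightarrow> Ck d k f = Ck d k g"
proof (induction k arbitrary: f g)
  case 0
  then show ?case by (auto intro!: iffI elim!: continuous_map_eq)
next
  case (Suc k)
  have "continuous_map (product_topology (\<lambda>_. euclideanreal) {..<d}) euclideanreal f
    = continuous_map (product_topology (\<lambda>_. euclideanreal) {..<d}) euclideanreal g"
    using Suc.prems by (auto intro!: iffI elim!: continuous_map_eq)
  moreover have "Ck d k (\<lambda>x. gradd d f x i) = Ck d k (\<lambda>x. gradd d g x i)" for i
    by (rule Suc.IH) (simp add: gradd_cong[OF Suc.prems])
  ultimately show ?case using has_partials_cong[OF Suc.prems] by simp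
qed

lemma Ck_SucD: "Ck d (Suc k) f \<Longrightarrow> Ck d k f"
  by (induction k arbitrary: f) auto

lemma Ck_partial:
  assumes "Ck d (Suc k) f" "x \<in> Rd d" "i < d"
  shows "((\<lambda>t. f (x(i := t))) has_real_derivative gradd d f x i) (at (x i))"
proof -
  have "(\<lambda>t. f (x(i := t))) differentiable at (x i)"
    using assms by (auto simp: has_partials_def)
  then show ?thesis using assms(3)
    by (simp add: gradd_def DERIV_deriv_iff_real_differentiable)
qed

lemma Ck_SucI:
  assumes "continuous_map (product_topology (\<lambda>_. euclideanreal) {..<d}) euclideanreal f"
    and d: "\<And>x i. x \<in> Rd d \<Longrightarrow> i < d \<Longrightarrow> ((\<lambda>t. f (x(i := t))) has_real_derivative G i x) (at (x i))"
    and c: "\<And>i. i < d \<Longrightarrow> Ck d k (G i)"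
  shows "Ck d (Suc k) f"
proof -
  have "Ck d k (\<lambda>x. gradd d f x i)" if "i < d" for i
  proof -
    have "Ck d k (\<lambda>x. gradd d f x i) = Ck d k (G i)"
      by (rule Ck_cong) (use d that in \<open>auto simp: gradd_def intro!: DERIV_imp_deriv\<close>)
    then show ?thesis using c that by simp
  qed
  moreover have "has_partials d f"
    unfolding has_partials_def real_differentiable_def using d by blast
  ultimately show ?thesis using assms(1) by simp
qed

lemma Ck_const: "Ck d k (\<lambda>_. c)"
proof (induction k arbitrary: c)
  case (Suc k)
  show ?case by (rule Ck_SucI[where G = "\<lambda>_ _. 0"]) (use Suc in auto)
qed simp

lemma Ck_add: "Ck d k f \<Longrightarrow> Ck d k g \<Longrightarrow> Ck d k (\<lambda>x. f x + g x)"
proof (induction k arbitrary: f g)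
  case 0
  then show ?case by (auto intro!: continuous_map_add)
next
  case (Suc k)
  show ?case
  proof (rule Ck_SucI[where G = "\<lambda>i x. gradd d f x i + gradd d g x i"])
    show "continuous_map (product_topology (\<lambda>_. euclideanreal) {..<d}) euclideanreal (\<lambda>x. f x + g x)"
      using Suc.prems by (intro continuous_map_add) auto
    show "((\<lambda>t. f (x(i := t)) + g (x(i := t))) has_real_derivative gradd d f x i + gradd d g x i) (at (x i))"
      if "x \<in> Rd d" "i < d" for x i
      using Suc.prems that by (intro DERIV_add Ck_partial)
    show "Ck d k (\<lambda>x. gradd d f x i + gradd d g x i)" if "i < d" for i
      using Suc.prems that by (intro Suc.IH) auto
  qed
qed

lemma Ck_mult: "Ck d k f \<Longrightarrow> Ck d k g \<Longrightarrow> Ck d k (\<lambda>x. f x * g x)"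
proof (induction k arbitrary: f g)
  case 0
  then show ?case by (auto intro!: continuous_map_real_mult)
next
  case (Suc k)
  show ?case
  proof (rule Ck_SucI[where G = "\<lambda>i x. gradd d f x i * g x + gradd d g x i * f x"])
    show "continuous_map (product_topology (\<lambda>_. euclideanreal) {..<d}) euclideanreal (\<lambda>x. f x * g x)"
      using Suc.prems by (intro continuous_map_real_mult) auto
    show "((\<lambda>t. f (x(i := t)) * g (x(i := t))) has_real_derivative gradd d f x i * g x + gradd d g x i * f x) (at (x i))"
      if "x \<in> Rd d" "i < d" for x i
      using DERIV_mult[OF Ck_partial[OF Suc.prems(1) that] Ck_partial[OF Suc.prems(2) that]]
      unfolding fun_upd_triv .
    show "Ck d k (\<lambda>x. gradd d f x i * g x + gradd d g x i * f x)" if "i < d" for i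
      using Suc.prems[THEN Ck_SucD] Suc.prems that by (intro Ck_add Suc.IH) auto
  qed
qed

lemma continuous_map_powr:
  assumes f: "continuous_map X euclideanreal f" and pos: "\<And>x. x \<in> topspace X \<Longrightarrow> 0 < f x"
  shows "continuous_map X euclideanreal (\<lambda>x. f x powr a)"
proof -
  have "continuous_map X (top_of_set {0<..}) f"
    using f pos by (simp add: continuous_map_in_subtopology image_subset_iff)
  moreover have "continuous_map (top_of_set {0<..}) euclideanreal (\<lambda>y::real. y powr a)"
    unfolding continuous_map_iff_continuous by (intro continuous_intros) auto
  ultimately have "continuous_map X euclideanreal ((\<lambda>y. y powr a) \<circ> f)"
    by (rule continuous_map_compose)
  then show ?thesis by (simp only: o_def)
qed

lemma Ck_powr: "Ck d k f \<Longrightarrow> (\<And>x. x \<in> Rd d \<Longrightarrow> 0 < f x) \<Longrightarrow> Ck d k (\<lambda>x. f x powr a)"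
proof (induction k arbitrary: a)
  case 0
  then show ?case by (auto intro!: continuous_map_powr)
next
  case (Suc k)
  show ?case
  proof (rule Ck_SucI[where G = "\<lambda>i x. a * (f x powr (a - 1) * gradd d f x i)"])
    show "continuous_map (product_topology (\<lambda>_. euclideanreal) {..<d}) euclideanreal (\<lambda>x. f x powr a)"
      using Suc.prems by (intro continuous_map_powr) auto
    show "((\<lambda>t. f (x(i := t)) powr a) has_real_derivative a * (f x powr (a - 1) * gradd d f x i)) (at (x i))"
      if "x \<in> Rd d" "i < d" for x i
      using DERIV_fun_powr[OF Ck_partial[OF Suc.prems(1) that], of a] Suc.prems(2)[OF that(1)]
      unfolding fun_upd_triv by (simp only: of_nat_1 mult.assoc)
    show "Ck d k (\<lambda>x. a * (f x powr (a - 1) * gradd d f x i))" if "i < d" for i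
      using Suc.prems(2) Ck_SucD[OF Suc.prems(1)] Suc.prems(1) that
      by (intro Ck_mult Ck_const Suc.IH) auto
  qed
qed

lemma heat_split:
  assumes u: "bdd_meas d M u" and t: "0 < t" and x: "x \<in> Rd d"
  shows "heat d t u x = heat d (t / 2) (heat d (t / 2) u) x"
  using heat_semigroup[OF u, of "t / 2" "t / 2" x] t x by simp

lemma qapx_heat_split:
  assumes u: "bdd_meas d M u" and t: "0 < t"
  shows "qapx d (6 * M / t) (heat d t u) (heatG d (t / 2) (hgrad d (t / 2) u))"
proof -
  have "qapx d (3 * M / (t / 2)) (heat d (t/2) (heat d (t/2) u)) (heatG d (t/2) (hgrad d (t/2) u))"
    by (rule qapx_heat[OF qapx_heat_bounded[OF u] heat_bdd[OF u] hgrad_bdd[OF u]]) (use t in auto)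
  then show ?thesis by (simp add: qapx_def heat_split[OF u t])
qed

lemma heat_lipschitz:
  assumes u: "bdd_meas d M u" and t: "0 < t" and x: "x \<in> Rd d" and w: "w \<in> Rd d"
  shows "\<bar>heat d t u (mv d x 1 w) - heat d t u x\<bar> \<le> (2 * M + real d * (M / sqrt t) + 3 * M / t) * normd d w"
  by (rule qapx_lipschitz[OF qapx_heat_bounded[OF u t] heat_bdd[OF u] hgrad_bdd[OF u t] x w])
     (use bdd_meas_nonneg[OF u] t in auto)

text \<open>Half of the time is spent on producing a gradient, which is again the heat average over the other half of a bounded
  function, so the induction hypothesis applies to each partial derivative.\<close>

lemma Ck_heat: "bdd_meas d M u \<Longrightarrow> 0 < t \<Longrightarrow> Ck d k (heat d t u)"
proof (induction k arbitrary: M u t)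
  case 0
  then show ?case
    unfolding Ck.simps by (intro continuous_map_of_lipschitz[OF heat_lipschitz])
next
  case (Suc k)
  have "0 \<le> 6 * M / t" using bdd_meas_nonneg[OF Suc.prems(1)] Suc.prems(2) by simp
  show ?case
  proof (rule Ck_SucI[where G = "\<lambda>i. heat d (t / 2) (\<lambda>y. hgrad d (t / 2) u y i)"])
    show "continuous_map (product_topology (\<lambda>_. euclideanreal) {..<d}) euclideanreal (heat d t u)"
      by (rule continuous_map_of_lipschitz[OF heat_lipschitz[OF Suc.prems]])
    show "((\<lambda>s. heat d t u (x(i := s))) has_real_derivative heat d (t / 2) (\<lambda>y. hgrad d (t / 2) u y i) x) (at (x i))"
      if "x \<in> Rd d" "i < d" for x i
      using qapx_has_partial[OF qapx_heat_split[OF Suc.prems] that \<open>0 \<le> 6 * M / t\<close>] unfolding heatG_def .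
    show "Ck d k (heat d (t / 2) (\<lambda>y. hgrad d (t / 2) u y i))" if "i < d" for i
      by (rule Suc.IH[OF hgrad_bdd[OF Suc.prems(1) _ that]]) (use Suc.prems(2) in auto)
  qed
qed

lemma Cinf_heat_powr:
  assumes "bdd_meas d M u" "0 < t" "\<And>x. x \<in> Rd d \<Longrightarrow> 0 < heat d t u x"
  shows "Cinf d (\<lambda>x. heat d t u x powr a)"
  unfolding Cinf_def using assms by (auto intro!: Ck_powr Ck_heat)

section \<open>Inequalities for powers and sums of small increments\<close>

lemma powr_le_linear:
  fixes y s :: real assumes "0 \<le> y" "0 \<le> s" "s \<le> 1"
  shows "y powr s \<le> 1 + s * (y - 1)"
proof (cases "y = 0")
  case False
  then show ?thesis using Youngs_inequality_0[of s "1 - s" y 1] assms by (simp add: algebra_simps)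
qed (use assms in simp)

lemma powr_ge_linear:
  fixes y q :: real assumes "0 \<le> y" "1 \<le> q"
  shows "1 + q * (y - 1) \<le> y powr q"
proof -
  have "(y powr q) powr (1 / q) \<le> 1 + (1 / q) * (y powr q - 1)"
    by (rule powr_le_linear) (use assms in auto)
  moreover have "(y powr q) powr (1 / q) = y" using assms by (simp add: powr_powr)
  ultimately show ?thesis using assms by (simp add: field_simps)
qed

lemma powr_tangent_below:
  fixes y m q :: real assumes "0 \<le> y" "0 < m" "1 \<le> q"
  shows "m powr q + q * m powr (q - 1) * (y - m) \<le> y powr q"
proof -
  have "m powr q * (1 + q * (y / m - 1)) \<le> m powr q * (y / m) powr q"
    by (intro mult_left_mono powr_ge_linear) (use assms in auto)
  also have "\<dots> = y powr q" using assms by (simp add: powr_divide)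
  finally show ?thesis using assms by (simp add: powr_diff field_simps)
qed

lemma powr_tangent_above:
  fixes y m s :: real assumes "0 \<le> y" "0 < m" "0 \<le> s" "s \<le> 1"
  shows "y powr s \<le> m powr s + s * m powr (s - 1) * (y - m)"
proof -
  have "m powr s * (y / m) powr s \<le> m powr s * (1 + s * (y / m - 1))"
    by (intro mult_left_mono powr_le_linear) (use assms in auto)
  moreover have "m powr s * (y / m) powr s = y powr s" using assms by (simp add: powr_divide)
  ultimately show ?thesis using assms by (simp add: powr_diff field_simps)
qed

text \<open>Write y^(1+s) = y y^s and bound the concave factor by its tangent at m; the product of the linear
  terms is the quadratic one.\<close>

lemma powr_quadratic_above:
  fixes y m s :: real assumes "0 < y" "0 < m" "0 \<le> s" "s \<le> 1"
  shows "y powr (1 + s) \<le> m powr (1 + s) + (1 + s) * m powr s * (y - m) + s * m powr (s - 1) * (y - m)\<^sup>2"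
proof -
  have "y * y powr s \<le> y * (m powr s + s * m powr (s - 1) * (y - m))"
    by (intro mult_left_mono powr_tangent_above) (use assms in auto)
  moreover have "m powr s = m * m powr (s - 1)" using assms by (simp add: powr_diff)
  ultimately show ?thesis using assms by (simp add: powr_add power2_eq_square algebra_simps)
qed

text \<open>Integrate the tangent of the concave power at the mean.\<close>

lemma jensen_powr:
  fixes X :: "'a \<Rightarrow> real"
  assumes P: "prob_space P" and X: "integrable P X" and Xs: "integrable P (\<lambda>w. X w powr s)"
    and nn: "\<And>w. w \<in> space P \<Longrightarrow> 0 \<le> X w" and m: "0 < (\<integral>w. X w \<partial>P)" and s: "0 \<le> s" "s \<le> 1"
  shows "(\<integral>w. X w powr s \<partial>P) \<le> (\<integral>w. X w \<partial>P) powr s"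
proof -
  interpret prob_space P by fact
  let ?m = "\<integral>w. X w \<partial>P"
  have "(\<integral>w. X w powr s \<partial>P) \<le> (\<integral>w. ?m powr s + s * ?m powr (s - 1) * (X w - ?m) \<partial>P)"
    by (rule integral_mono) (use X Xs nn m s in \<open>auto intro!: powr_tangent_above\<close>)
  also have "\<dots> = ?m powr s" using X by (simp add: prob_space)
  finally show ?thesis .
qed

lemma jensen_powr_ge:
  fixes X :: "'a \<Rightarrow> real"
  assumes P: "prob_space P" and X: "integrable P X" and Xs: "integrable P (\<lambda>w. X w powr q)"
    and nn: "\<And>w. w \<in> space P \<Longrightarrow> 0 \<le> X w" and q: "1 \<le> q"
  shows "(\<integral>w. X w \<partial>P) powr q \<le> (\<integral>w. X w powr q \<partial>P)"
proof -
  interpret prob_space P by fact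
  let ?m = "\<integral>w. X w \<partial>P"
  have m0: "0 \<le> ?m" using nn by (rule Bochner_Integration.integral_nonneg)
  show ?thesis
  proof (cases "?m = 0")
    case True
    then show ?thesis using q by (simp add: integral_nonneg)
  next
    case False
    with m0 have m: "0 < ?m" by simp
    have "?m powr q = (\<integral>w. ?m powr q + q * ?m powr (q - 1) * (X w - ?m) \<partial>P)"
      using X by (simp add: prob_space)
    also have "\<dots> \<le> (\<integral>w. X w powr q \<partial>P)"
      by (rule integral_mono) (use X Xs nn m q in \<open>auto intro!: powr_tangent_below\<close>)
    finally show ?thesis .
  qed
qed

text \<open>A bound for the power on [\<delta>, K] that is valid for either sign of the exponent.\<close>

definition powr_ub :: "real \<Rightarrow> real \<Rightarrow> real \<Rightarrow> real" where "powr_ub \<delta> K b = \<delta> powr b + K powr b"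

lemma powr_ub_nonneg[simp]: "0 \<le> powr_ub \<delta> K b" by (simp add: powr_ub_def)

lemma powr_bound:
  assumes "0 < \<delta>" "\<delta> \<le> x" "x \<le> K" shows "x powr b \<le> powr_ub \<delta> K b"
proof (cases "0 \<le> b")
  case True
  then have "x powr b \<le> K powr b" using assms by (intro powr_mono2) auto
  then show ?thesis by (simp add: powr_ub_def add_increasing)
next
  case False
  then have "x powr b \<le> \<delta> powr b" using assms by (intro powr_mono2') auto
  then show ?thesis by (simp add: powr_ub_def add_increasing2)
qed

text \<open>The m-th derivative of t powr a.\<close>

definition powr_deriv :: "real \<Rightarrow> nat \<Rightarrow> real \<Rightarrow> real" where
  "powr_deriv a m t = (\<Prod>j<m. a - real j) * t powr (a - real m)"

lemma powr_deriv_DERIV: "0 < t \<Longrightarrow> DERIV (powr_deriv a m) t :> powr_deriv a (Suc m) t"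
proof -
  assume t: "0 < t"
  have "DERIV (\<lambda>t. (\<Prod>j<m. a - real j) * t powr (a - real m)) t :> (\<Prod>j<m. a - real j) * ((a - real m) * t powr (a - real m - 1))"
    by (rule DERIV_cmult[OF has_real_derivative_powr[OF t]])
  moreover have "(\<Prod>j<m. a - real j) * ((a - real m) * t powr (a - real m - 1)) = powr_deriv a (Suc m) t"
    by (simp add: powr_deriv_def algebra_simps)
  ultimately show ?thesis by (simp add: powr_deriv_def[abs_def])
qed

lemma powr_taylor:
  assumes d: "0 < \<delta>" and x: "\<delta> \<le> x" "x \<le> K" and y: "\<delta> \<le> y" "y \<le> K" and n: "0 < n"
  shows "\<bar>y powr a - (\<Sum>m<n. powr_deriv a m x / fact m * (y - x) ^ m)\<bar> \<le> \<bar>\<Prod>j<n. a - real j\<bar> * powr_ub \<delta> K (a - real n) * \<bar>y - x\<bar> ^ n"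
proof (cases "y = x")
  case True
  have "(\<Sum>m<n. powr_deriv a m x / fact m * 0 ^ m) = powr_deriv a 0 x"
    using n by (simp add: power_0_left if_distrib[of "\<lambda>c. _ * c"] cong: if_cong)
  then show ?thesis using n by (simp add: True powr_deriv_def)
next
  case False
  have "\<exists>t. (if y < x then y < t \<and> t < x else x < t \<and> t < y) \<and>
     powr_deriv a 0 y = (\<Sum>m<n. (powr_deriv a m x / fact m) * (y - x) ^ m) + (powr_deriv a n t / fact n) * (y - x) ^ n"
    by (rule Taylor[of n "powr_deriv a" "powr_deriv a 0" \<delta> K x y]) (use d x y n False in \<open>auto intro: powr_deriv_DERIV\<close>)
  then obtain t where t: "if y < x then y < t \<and> t < x else x < t \<and> t < y"
    and e: "powr_deriv a 0 y = (\<Sum>m<n. (powr_deriv a m x / fact m) * (y - x) ^ m) + (powr_deriv a n t / fact n) * (y - x) ^ n" by blast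
  have tb: "\<delta> \<le> t" "t \<le> K" using t x y by (auto split: if_splits)
  have "\<bar>powr_deriv a n t / fact n\<bar> \<le> \<bar>powr_deriv a n t\<bar>"
    by (simp add: field_simps mult_left_le)
       (metis abs_ge_zero fact_ge_1 mult.commute mult.right_neutral mult_left_mono)
  also have "\<dots> \<le> \<bar>\<Prod>j<n. a - real j\<bar> * powr_ub \<delta> K (a - real n)"
    unfolding powr_deriv_def abs_mult using powr_bound[OF d tb] by (intro mult_left_mono) auto
  finally have "\<bar>powr_deriv a n t / fact n * (y - x) ^ n\<bar> \<le> \<bar>\<Prod>j<n. a - real j\<bar> * powr_ub \<delta> K (a - real n) * \<bar>y - x\<bar> ^ n"
    unfolding abs_mult power_abs by (intro mult_right_mono) auto
  then show ?thesis using e by (simp add: powr_deriv_def)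
qed

lemma powr_lip:
  assumes "0 < \<delta>" "\<delta> \<le> x" "x \<le> K" "\<delta> \<le> y" "y \<le> K"
  shows "\<bar>y powr a - x powr a\<bar> \<le> \<bar>a\<bar> * powr_ub \<delta> K (a - 1) * \<bar>y - x\<bar>"
  using powr_taylor[OF assms, of 1 a] by (simp add: powr_deriv_def)

lemma powr_quad:
  assumes "0 < \<delta>" "\<delta> \<le> x" "x \<le> K" "\<delta> \<le> y" "y \<le> K"
  shows "\<bar>y powr a - x powr a - a * x powr (a - 1) * (y - x)\<bar> \<le> \<bar>a * (a - 1)\<bar> * powr_ub \<delta> K (a - 2) * (y - x)\<^sup>2"
  using powr_taylor[OF assms, of 2 a] by (simp add: powr_deriv_def numeral_2_eq_2 diff_diff_eq)

lemma powr_cubic: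
  assumes "0 < \<delta>" "\<delta> \<le> x" "x \<le> K" "\<delta> \<le> y" "y \<le> K"
  shows "x powr a + a * x powr (a - 1) * (y - x) + a * (a - 1) / 2 * x powr (a - 2) * (y - x)\<^sup>2
    - \<bar>a * (a - 1) * (a - 2)\<bar> * powr_ub \<delta> K (a - 3) * \<bar>y - x\<bar> ^ 3 \<le> y powr a"
  using powr_taylor[OF assms, of 3 a] by (simp add: powr_deriv_def numeral_3_eq_3 numeral_2_eq_2 abs_le_iff)

text \<open>A function whose increments over time e are at most of order e^(3/2) has nonpositive upper derivative.
  This replaces the monotonicity criterion by derivatives, and only needs one-sided estimates of increments.\<close>

lemma increments_le:
  fixes \<phi> :: "real \<Rightarrow> real"
  assumes ab: "a \<le> b" and C: "0 \<le> C"
    and inc: "\<And>s e. a \<le> s \<Longrightarrow> 0 < e \<Longrightarrow> e \<le> 1 \<Longrightarrow> s + e \<le> b \<Longrightarrow> \<phi> (s + e) \<le> \<phi> s + C * (e * sqrt e)"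
  shows "\<phi> b \<le> \<phi> a"
proof (cases "a = b")
  case False
  with ab have h: "0 < b - a" by simp
  define h where "h = b - a"
  have h0: "0 < h" using h by (simp add: h_def)
  have bound: "\<phi> b \<le> \<phi> a + C * (h * sqrt (h * inverse (real (Suc n))))" if n: "h \<le> real (Suc n)" for n
  proof -
    (* with n + 1 equal steps the accumulated error is C h sqrt (h / (n + 1)) *)
    define e where "e = h / real (Suc n)"
    have e: "0 < e" "e \<le> 1" using h0 n by (auto simp: e_def divide_le_eq)
    have ne: "real (Suc n) * e = h" by (simp add: e_def)
    have "k \<le> Suc n \<Longrightarrow> \<phi> (a + real k * e) \<le> \<phi> a + real k * (C * (e * sqrt e))" for k :: nat
    proof (induction k)
      case (Suc k)
      have "real (Suc k) * e \<le> real (Suc n) * e" using Suc.prems e by (intro mult_right_mono) auto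
      then have "a + real k * e + e \<le> b" using ne by (simp add: h_def algebra_simps)
      then have "\<phi> (a + real k * e + e) \<le> \<phi> (a + real k * e) + C * (e * sqrt e)"
        using e by (intro inc) auto
      moreover have "a + real (Suc k) * e = a + real k * e + e" by (simp add: algebra_simps)
      ultimately show ?case using Suc by (simp add: algebra_simps)
    qed simp
    from this[of "Suc n"] have "\<phi> (a + h) \<le> \<phi> a + C * (real (Suc n) * e * sqrt e)"
      unfolding ne by (simp add: ne[symmetric] mult_ac del: of_nat_Suc)
    then show ?thesis unfolding ne by (simp add: h_def e_def divide_inverse del: of_nat_Suc)
  qed
  have "(\<lambda>n. \<phi> a + C * (h * sqrt (h * inverse (real (Suc n))))) \<longlonglongrightarrow> \<phi> a + C * (h * sqrt (h * 0))"
    by (intro tendsto_intros LIMSEQ_inverse_real_of_nat)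
  then have "(\<lambda>n. \<phi> a + C * (h * sqrt (h * inverse (real (Suc n))))) \<longlonglongrightarrow> \<phi> a" by simp
  moreover obtain N where N: "h \<le> real N" using real_arch_simple by blast
  have "\<forall>\<^sub>F n in sequentially. \<phi> b \<le> \<phi> a + C * (h * sqrt (h * inverse (real (Suc n))))"
    using eventually_ge_at_top[of N] by eventually_elim (rule bound, use N in linarith)
  ultimately show ?thesis using tendsto_lowerbound by (metis sequentially_bot)
qed simp

section \<open>Functions stable under the semigroup and powers\<close>

definition lipd :: "nat \<Rightarrow> real \<Rightarrow> ((nat \<Rightarrow> real) \<Rightarrow> real) \<Rightarrow> bool" where
  "lipd d C v \<longleftrightarrow> (\<forall>x\<in>Rd d. \<forall>w\<in>Rd d. \<bar>v (mv d x 1 w) - v x\<bar> \<le> C * normd d w)"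

text \<open>Functions between two positive constants that are Lipschitz with a Lipschitz gradient G. A single constant
  K controls all bounds, because heat averages satisfy them with the same K; the expansions below are then
  uniform along the semigroup.\<close>

definition nice :: "nat \<Rightarrow> real \<Rightarrow> real \<Rightarrow> ((nat \<Rightarrow> real) \<Rightarrow> real) \<Rightarrow> ((nat \<Rightarrow> real) \<Rightarrow> nat \<Rightarrow> real) \<Rightarrow> bool" where
  "nice d \<delta> K v G \<longleftrightarrow> 0 < \<delta> \<and> v \<in> borel_measurable (lebd d) \<and> (\<forall>x\<in>Rd d. \<delta> \<le> v x \<and> v x \<le> K)
     \<and> (\<forall>i<d. bdd_meas d K (\<lambda>x. G x i)) \<and> qapx d K v G \<and> lipd d K v \<and> (\<forall>i<d. lipd d K (\<lambda>x. G x i))"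

lemma niceD:
  assumes "nice d \<delta> K v G"
  shows "0 < \<delta>" "v \<in> borel_measurable (lebd d)" "x \<in> Rd d \<Longrightarrow> \<delta> \<le> v x" "x \<in> Rd d \<Longrightarrow> v x \<le> K"
    "i < d \<Longrightarrow> bdd_meas d K (\<lambda>x. G x i)" "qapx d K v G" "lipd d K v" "i < d \<Longrightarrow> lipd d K (\<lambda>x. G x i)"
  using assms by (auto simp: nice_def)

lemma nice_bdd: assumes n: "nice d \<delta> K v G" shows "bdd_meas d K v"
  unfolding bdd_meas_def
proof (intro conjI ballI niceD(2)[OF n])
  fix x assume "x \<in> Rd d"
  with niceD(1)[OF n] niceD(3,4)[OF n, of x] show "\<bar>v x\<bar> \<le> K" by simp
qed

lemma nice_K: "nice d \<delta> K v G \<Longrightarrow> 0 < \<delta> \<and> \<delta> \<le> K"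
  using niceD(1)[of d \<delta> K v G] niceD(3,4)[of d \<delta> K v G "zer d", OF _ zer_Rd] by linarith

lemma nice_pos: assumes n: "nice d \<delta> K v G" "x \<in> Rd d" shows "0 < v x"
  using niceD(1,3)[OF n(1)] n(2) by (meson less_le_trans)

lemma lipd_heat:
  assumes l: "lipd d C v" and v: "bdd_meas d M v"
  shows "lipd d C (heat d t v)"
  unfolding lipd_def
proof (intro ballI)
  fix x w assume x: "x \<in> Rd d" and w: "w \<in> Rd d"
  let ?X = "\<lambda>z. mv d x (sqrt t) z"
  have 1: "heat d t v (mv d x 1 w) = (\<integral>z. v (mv d (?X z) 1 w) \<partial>stdg d)"
    unfolding heat_def by (intro Bochner_Integration.integral_cong refl arg_cong[of _ _ v] Rd_eqI[of _ d]) (auto simp: mv_nth)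
  have i1: "integrable (stdg d) (\<lambda>z. v (mv d (?X z) 1 w))"
    by (rule bdd_meas_integrable[OF v prob_stdg]) (use w x in \<open>intro mv_measurable measurable_const; simp\<close>)
  have i2: "integrable (stdg d) (\<lambda>z. v (?X z))" by (rule heat_integrable[OF v])
  have "heat d t v (mv d x 1 w) - heat d t v x = (\<integral>z. v (mv d (?X z) 1 w) - v (?X z) \<partial>stdg d)"
    unfolding 1 using i1 i2 by (simp add: heat_def)
  then have "\<bar>heat d t v (mv d x 1 w) - heat d t v x\<bar> = \<bar>\<integral>z. v (mv d (?X z) 1 w) - v (?X z) \<partial>stdg d\<bar>"
    by (rule arg_cong)
  also have "\<dots> \<le> (\<integral>z. \<bar>v (mv d (?X z) 1 w) - v (?X z)\<bar> \<partial>stdg d)"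
    by (rule integral_abs_bound)
  also have "\<dots> \<le> (\<integral>z. C * normd d w \<partial>stdg d)"
  proof (rule integral_mono)
    show "integrable (stdg d) (\<lambda>z. \<bar>v (mv d (?X z) 1 w) - v (?X z)\<bar>)"
      by (intro integrable_abs Bochner_Integration.integrable_diff i1 i2)
    show "\<bar>v (mv d (?X z) 1 w) - v (?X z)\<bar> \<le> C * normd d w" for z
      using l[unfolded lipd_def, rule_format, OF mv_Rd w] .
  qed simp
  finally show "\<bar>heat d t v (mv d x 1 w) - heat d t v x\<bar> \<le> C * normd d w" by simp
qed

lemma lipd_mono: "lipd d C v \<Longrightarrow> C \<le> C' \<Longrightarrow> lipd d C' v"
  unfolding lipd_def by (meson mult_right_mono normd_nonneg order_trans)

lemma qapx_mono: "qapx d C v G \<Longrightarrow> C \<le> C' \<Longrightarrow> qapx d C' v G"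
  unfolding qapx_def by (meson mult_right_mono zero_le_power2 order_trans)

lemma bdd_meas_mono: "bdd_meas d C v \<Longrightarrow> C \<le> C' \<Longrightarrow> bdd_meas d C' v"
  unfolding bdd_meas_def by fastforce

lemma nice_heat:
  assumes n: "nice d \<delta> K v G"
  shows "nice d \<delta> K (heat d t v) (heatG d t G)"
  unfolding nice_def
proof (intro conjI ballI allI impI)
  note b = nice_bdd[OF n]
  have K: "0 < \<delta>" "\<delta> \<le> K" using nice_K[OF n] by auto
  show "0 < \<delta>" by (rule K)
  show "heat d t v \<in> borel_measurable (lebd d)" using niceD(2)[OF n] by (rule heat_measurable)
  fix x assume "x \<in> Rd d"
  have "heat d t (\<lambda>_. \<delta>) x \<le> heat d t v x"
    by (rule heat_mono[OF bdd_meas_const[of \<delta> \<delta>] b]) (use K niceD(3)[OF n] in auto)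
  then show "\<delta> \<le> heat d t v x" by (simp add: heat_const)
  have "heat d t v x \<le> heat d t (\<lambda>_. K) x"
    by (rule heat_mono[OF b bdd_meas_const[of K K]]) (use K niceD(4)[OF n] in auto)
  then show "heat d t v x \<le> K" by (simp add: heat_const)
next
  fix i assume i: "i < d"
  show "bdd_meas d K (\<lambda>x. heatG d t G x i)" unfolding heatG_def by (rule heat_bdd[OF niceD(5)[OF n i]])
  show "lipd d K (\<lambda>x. heatG d t G x i)"
    unfolding heatG_def by (rule lipd_heat[OF niceD(8)[OF n i] niceD(5)[OF n i]])
next
  show "qapx d K (heat d t v) (heatG d t G)"
    by (rule qapx_heat[OF niceD(6)[OF n] nice_bdd[OF n] niceD(5)[OF n]])
  show "lipd d K (heat d t v)" by (rule lipd_heat[OF niceD(7)[OF n] nice_bdd[OF n]])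
qed

text \<open>Regularization: the second half of the heat flow makes the gradient produced by the first half Lipschitz.\<close>

lemma nice_heat_bounded:
  assumes u: "u \<in> borel_measurable (lebd d)" and ub: "\<And>x. x \<in> Rd d \<Longrightarrow> \<delta> \<le> u x \<and> u x \<le> M" and d: "0 < \<delta>" and t: "0 < t"
  shows "\<exists>K G. nice d \<delta> K (heat d t u) G"
proof -
  have bu: "bdd_meas d M u" unfolding bdd_meas_def using u ub d by fastforce
  have M: "0 \<le> M" "\<delta> \<le> M" using bdd_meas_nonneg[OF bu] ub[of "zer d"] by (auto simp del: zer_def)
  let ?G = "heatG d (t / 2) (hgrad d (t / 2) u)"
  have t2: "0 < t / 2" using t by simp
  have G: "bdd_meas d (M / sqrt (t / 2)) (\<lambda>x. ?G x i)" if "i < d" for i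
    unfolding heatG_def by (rule heat_bdd[OF hgrad_bdd[OF bu t2 that]])
  have q: "qapx d (6 * M / t) (heat d t u) ?G" by (rule qapx_heat_split[OF bu t])
  have l: "lipd d (2 * M + real d * (M / sqrt t) + 3 * M / t) (heat d t u)"
    unfolding lipd_def using heat_lipschitz[OF bu t] by blast
  let ?N = "M / sqrt (t / 2)"
  have lG: "lipd d (2 * ?N + real d * (?N / sqrt (t / 2)) + 3 * ?N / (t / 2)) (\<lambda>x. ?G x i)" if "i < d" for i
    unfolding lipd_def heatG_def using heat_lipschitz[OF hgrad_bdd[OF bu t2 that] t2] by blast
  define K where "K = Max {M, ?N, 6 * M / t, 2 * M + real d * (M / sqrt t) + 3 * M / t, 2 * ?N + real d * (?N / sqrt (t / 2)) + 3 * ?N / (t / 2)}"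
  have Kge: "M \<le> K" "?N \<le> K" "6 * M / t \<le> K" "2 * M + real d * (M / sqrt t) + 3 * M / t \<le> K"
    "2 * ?N + real d * (?N / sqrt (t / 2)) + 3 * ?N / (t / 2) \<le> K"
    unfolding K_def by (rule Max_ge; simp)+
  have "nice d \<delta> K (heat d t u) ?G"
    unfolding nice_def
  proof (intro conjI ballI allI impI)
    show "0 < \<delta>" by fact
    show "heat d t u \<in> borel_measurable (lebd d)" by (rule heat_measurable[OF u])
    show "bdd_meas d K (\<lambda>x. ?G x i)" if "i < d" for i by (rule bdd_meas_mono[OF G[OF that] Kge(2)])
    show "qapx d K (heat d t u) ?G" by (rule qapx_mono[OF q Kge(3)])
    show "lipd d K (heat d t u)" by (rule lipd_mono[OF l Kge(4)])
    show "lipd d K (\<lambda>x. ?G x i)" if "i < d" for i by (rule lipd_mono[OF lG[OF that] Kge(5)])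
    fix x assume "x \<in> Rd d"
    have "heat d t (\<lambda>_. \<delta>) x \<le> heat d t u x"
      by (rule heat_mono[OF bdd_meas_const[of \<delta> \<delta>] bu]) (use d ub in auto)
    then show "\<delta> \<le> heat d t u x" by (simp add: heat_const)
    show "heat d t u x \<le> K" using bdd_measD(2)[OF heat_bdd[OF bu] \<open>x \<in> Rd d\<close>, of t] Kge(1) by linarith
  qed
  then show ?thesis by blast
qed

lemma lipd_bounded_mult:
  assumes "lipd d C f" "lipd d D g" "\<And>x. x \<in> Rd d \<Longrightarrow> \<bar>f x\<bar> \<le> A" "\<And>x. x \<in> Rd d \<Longrightarrow> \<bar>g x\<bar> \<le> B"
  shows "lipd d (A * D + C * B) (\<lambda>x. f x * g x)"
  unfolding lipd_def
proof (intro ballI)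
  fix x w assume x: "x \<in> Rd d" and w: "w \<in> Rd d"
  let ?y = "mv d x 1 w"
  have A: "0 \<le> A" and B: "0 \<le> B" using assms(3)[OF x] assms(4)[OF x] by linarith+
  have "\<bar>f ?y * g ?y - f x * g x\<bar> = \<bar>f ?y * (g ?y - g x) + (f ?y - f x) * g x\<bar>" by (simp add: algebra_simps)
  also have "\<dots> \<le> \<bar>f ?y\<bar> * \<bar>g ?y - g x\<bar> + \<bar>f ?y - f x\<bar> * \<bar>g x\<bar>" by (metis abs_mult abs_triangle_ineq)
  also have "\<dots> \<le> A * (D * normd d w) + (C * normd d w) * B"
  proof (intro add_mono mult_mono)
    show "\<bar>g ?y - g x\<bar> \<le> D * normd d w" "\<bar>f ?y - f x\<bar> \<le> C * normd d w"
      using assms(1,2) x w by (auto simp: lipd_def)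
    then show "0 \<le> C * normd d w" by linarith
  qed (use assms(3,4) x A B in auto)
  finally show "\<bar>f ?y * g ?y - f x * g x\<bar> \<le> (A * D + C * B) * normd d w" by (simp add: algebra_simps)
qed

text \<open>Chain rule. On [\<delta>, K] every power and its derivatives are bounded, so the constants stay finite.\<close>

lemma nice_powr:
  assumes n: "nice d \<delta> K v G"
  shows "\<exists>\<delta>' K'. nice d \<delta>' K' (\<lambda>x. v x powr a) (\<lambda>x i. a * v x powr (a - 1) * G x i)"
proof -
  have K: "0 < \<delta>" "\<delta> \<le> K" using nice_K[OF n] by auto
  note b = niceD(3)[OF n] niceD(4)[OF n]
  note pos = nice_pos[OF n]
  define B0 B1 B2 where B: "B0 = powr_ub \<delta> K a" "B1 = \<bar>a\<bar> * powr_ub \<delta> K (a - 1)" "B2 = \<bar>a * (a - 1)\<bar> * powr_ub \<delta> K (a - 2)"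
  have Bn: "0 \<le> B0" "0 \<le> B1" "0 \<le> B2" by (auto simp: B)
  define \<delta>' where "\<delta>' = min (\<delta> powr a) (K powr a)"
  let ?G = "\<lambda>x i. a * v x powr (a - 1) * G x i"
  have vm: "v \<in> borel_measurable (lebd d)" by (rule niceD[OF n])
  have b1: "\<bar>a * v x powr (a - 1)\<bar> \<le> B1" if "x \<in> Rd d" for x
    unfolding B abs_mult using powr_bound[OF K(1) b[OF that], of "a - 1"] by (intro mult_left_mono) auto
  have lv: "lipd d (B1 * K) (\<lambda>x. v x powr a)"
    unfolding lipd_def
  proof (intro ballI)
    fix x w assume x: "x \<in> Rd d" and w: "w \<in> Rd d"
    have "\<bar>v (mv d x 1 w) powr a - v x powr a\<bar> \<le> B1 * \<bar>v (mv d x 1 w) - v x\<bar>"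
      unfolding B by (rule powr_lip) (use K b[OF x] b[OF mv_Rd] in auto)
    also have "\<dots> \<le> B1 * (K * normd d w)"
      using niceD(7)[OF n] x w Bn by (intro mult_left_mono) (auto simp: lipd_def)
    finally show "\<bar>v (mv d x 1 w) powr a - v x powr a\<bar> \<le> B1 * K * normd d w" by simp
  qed
  have l1: "lipd d (B2 * K) (\<lambda>x. a * v x powr (a - 1))"
    unfolding lipd_def
  proof (intro ballI)
    fix x w assume x: "x \<in> Rd d" and w: "w \<in> Rd d"
    have "\<bar>v (mv d x 1 w) powr (a - 1) - v x powr (a - 1)\<bar> \<le> \<bar>a - 1\<bar> * powr_ub \<delta> K (a - 1 - 1) * \<bar>v (mv d x 1 w) - v x\<bar>"
      by (rule powr_lip) (use K b[OF x] b[OF mv_Rd] in auto)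
    also have "\<dots> \<le> \<bar>a - 1\<bar> * powr_ub \<delta> K (a - 1 - 1) * (K * normd d w)"
      using niceD(7)[OF n] x w by (intro mult_left_mono) (auto simp: lipd_def)
    finally have "\<bar>a\<bar> * \<bar>v (mv d x 1 w) powr (a - 1) - v x powr (a - 1)\<bar> \<le> \<bar>a\<bar> * (\<bar>a - 1\<bar> * powr_ub \<delta> K (a - 1 - 1) * (K * normd d w))"
      by (rule mult_left_mono) simp
    moreover have "a - 1 - 1 = a - 2" by simp
    ultimately show "\<bar>a * v (mv d x 1 w) powr (a - 1) - a * v x powr (a - 1)\<bar> \<le> B2 * K * normd d w"
      by (simp add: B abs_mult right_diff_distrib[symmetric] mult_ac)
  qed
  have lG: "lipd d (B1 * K + B2 * K * K) (\<lambda>x. ?G x i)" if "i < d" for i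
    by (rule lipd_bounded_mult[OF l1 niceD(8)[OF n that] b1 bdd_measD(2)[OF niceD(5)[OF n that]]])
  have q: "qapx d (B2 * K\<^sup>2 + B1 * K) (\<lambda>x. v x powr a) ?G"
    unfolding qapx_def
  proof (intro ballI)
    fix x w assume x: "x \<in> Rd d" and w: "w \<in> Rd d"
    let ?y = "mv d x 1 w" let ?p = "a * v x powr (a - 1)"
    have "dotp d (?G x) w = ?p * dotp d (G x) w"
      using dotp_scale(2)[of d ?p "G x" w] by simp
    then have "\<bar>v ?y powr a - v x powr a - dotp d (?G x) w\<bar>
      \<le> \<bar>v ?y powr a - v x powr a - ?p * (v ?y - v x)\<bar> + \<bar>?p\<bar> * \<bar>v ?y - v x - dotp d (G x) w\<bar>"
      unfolding abs_mult[symmetric] by (simp add: algebra_simps abs_le_iff) linarith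
    also have "\<dots> \<le> B2 * (v ?y - v x)\<^sup>2 + B1 * (K * (normd d w)\<^sup>2)"
    proof (intro add_mono mult_mono)
      show "\<bar>v ?y powr a - v x powr a - ?p * (v ?y - v x)\<bar> \<le> B2 * (v ?y - v x)\<^sup>2"
        unfolding B by (rule powr_quad) (use K b[OF x] b[OF mv_Rd] in auto)
      show "\<bar>v ?y - v x - dotp d (G x) w\<bar> \<le> K * (normd d w)\<^sup>2"
        using niceD(6)[OF n] x w by (auto simp: qapx_def)
    qed (use b1[OF x] Bn in auto)
    also have "B2 * (v ?y - v x)\<^sup>2 \<le> B2 * (K * normd d w)\<^sup>2"
    proof (rule mult_left_mono)
      have "\<bar>v ?y - v x\<bar> \<le> K * normd d w" using niceD(7)[OF n] x w by (auto simp: lipd_def)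
      then show "(v ?y - v x)\<^sup>2 \<le> (K * normd d w)\<^sup>2" using power_mono[of "\<bar>v ?y - v x\<bar>" _ 2] by fastforce
    qed (rule Bn)
    finally show "\<bar>v ?y powr a - v x powr a - dotp d (?G x) w\<bar> \<le> (B2 * K\<^sup>2 + B1 * K) * (normd d w)\<^sup>2"
      by (simp add: algebra_simps power_mult_distrib)
  qed
  define K' where "K' = Max {B0, B1 * K, B1 * K + B2 * K * K, B2 * K\<^sup>2 + B1 * K}"
  have K': "B0 \<le> K'" "B1 * K \<le> K'" "B1 * K + B2 * K * K \<le> K'" "B2 * K\<^sup>2 + B1 * K \<le> K'"
    unfolding K'_def by (rule Max_ge; simp)+
  have "nice d \<delta>' K' (\<lambda>x. v x powr a) ?G"
    unfolding nice_def
  proof (intro conjI ballI allI impI)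
    show "0 < \<delta>'" using K by (auto simp: \<delta>'_def)
    show "(\<lambda>x. v x powr a) \<in> borel_measurable (lebd d)" using vm by measurable
    show "bdd_meas d K' (\<lambda>x. ?G x i)" if "i < d" for i
    proof -
      have [measurable]: "(\<lambda>x. G x i) \<in> borel_measurable (lebd d)" "v \<in> borel_measurable (lebd d)"
        using niceD(5)[OF n that] vm by (auto simp: bdd_meas_def)
      have "\<bar>?G x i\<bar> \<le> B1 * K" if "x \<in> Rd d" for x
        unfolding abs_mult[of _ "G x i"]
        by (rule mult_mono) (use b1[OF that] bdd_measD(2)[OF niceD(5)[OF n \<open>i < d\<close>] that] Bn in auto)
      then have "bdd_meas d (B1 * K) (\<lambda>x. ?G x i)" unfolding bdd_meas_def by (intro conjI ballI) measurable
      then show ?thesis by (rule bdd_meas_mono[OF _ K'(2)])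
    qed
    show "qapx d K' (\<lambda>x. v x powr a) ?G" by (rule qapx_mono[OF q K'(4)])
    show "lipd d K' (\<lambda>x. v x powr a)" by (rule lipd_mono[OF lv K'(2)])
    show "lipd d K' (\<lambda>x. ?G x i)" if "i < d" for i by (rule lipd_mono[OF lG[OF that] K'(3)])
    fix x assume x: "x \<in> Rd d"
    show "v x powr a \<le> K'" using powr_bound[OF K(1) b[OF x], of a] K'(1) by (simp add: B)
    show "\<delta>' \<le> v x powr a"
    proof (cases "0 \<le> a")
      case True
      then have "\<delta> powr a \<le> v x powr a" using K b[OF x] by (intro powr_mono2) auto
      then show ?thesis by (simp add: \<delta>'_def)
    next
      case False
      then have "K powr a \<le> v x powr a" using K b[OF x] by (intro powr_mono2') auto
      then show ?thesis by (simp add: \<delta>'_def)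
    qed
  qed
  then show ?thesis by blast
qed

section \<open>Small-time expansion of the semigroup\<close>

definition mom :: "nat \<Rightarrow> nat \<Rightarrow> real" where "mom d k = (\<integral>z. (normd d z) ^ k \<partial>stdg d)"

lemma mom_nonneg[simp]: "0 \<le> mom d k" unfolding mom_def by (rule Bochner_Integration.integral_nonneg) simp

lemma normd_scaled: "normd d (mv d (zer d) s z) = \<bar>s\<bar> * normd d z"
proof -
  have "normd d (mv d (zer d) s z) = normd d (\<lambda>i. s * z i)"
    unfolding normd_def by (rule L2_set_cong) (auto simp: mv_nth zer_def)
  then show ?thesis by (simp add: normd_scale)
qed

lemma mv_step: "mv d y 1 (mv d (zer d) s z) = mv d y s z"
  by (rule Rd_eqI[of _ d]) (auto simp: mv_nth zer_def)

lemma dotp_scaled: "dotp d a (mv d (zer d) s z) = s * dotp d a z"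
  unfolding dotp_def by (simp add: mv_nth zer_def sum_distrib_left mult_ac)

lemma lipd_step:
  assumes "lipd d C v" "y \<in> Rd d" shows "\<bar>v (mv d y s z) - v y\<bar> \<le> C * \<bar>s\<bar> * normd d z"
  using assms(1)[unfolded lipd_def, rule_format, OF assms(2) mv_Rd[of d "zer d" s z]]
  by (simp add: mv_step normd_scaled)

lemma lipd_heat_diff:
  assumes l: "lipd d C v" and v: "bdd_meas d M v" and y: "y \<in> Rd d" and e: "0 \<le> e"
  shows "\<bar>heat d e v y - v y\<bar> \<le> C * mom d 1 * sqrt e"
proof -
  have i: "integrable (stdg d) (\<lambda>z. v (mv d y (sqrt e) z))" by (rule heat_integrable[OF v])
  have "heat d e v y - v y = (\<integral>z. v (mv d y (sqrt e) z) - v y \<partial>stdg d)"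
    using i by (simp add: heat_def)
  then have "\<bar>heat d e v y - v y\<bar> = \<bar>\<integral>z. v (mv d y (sqrt e) z) - v y \<partial>stdg d\<bar>" by (rule arg_cong)
  also have "\<dots> \<le> (\<integral>z. \<bar>v (mv d y (sqrt e) z) - v y\<bar> \<partial>stdg d)" by (rule integral_abs_bound)
  also have "\<dots> \<le> (\<integral>z. C * sqrt e * normd d z \<partial>stdg d)"
  proof (rule integral_mono)
    show "integrable (stdg d) (\<lambda>z. \<bar>v (mv d y (sqrt e) z) - v y\<bar>)"
      by (intro integrable_abs Bochner_Integration.integrable_diff i SG.integrable_const)
    show "integrable (stdg d) (\<lambda>z. C * sqrt e * normd d z)" by (intro integrable_mult_right stdg_normd1)
    show "\<bar>v (mv d y (sqrt e) z) - v y\<bar> \<le> C * sqrt e * normd d z" for z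
      using lipd_step[OF l y, of "sqrt e" z] e by simp
  qed
  also have "\<dots> = C * mom d 1 * sqrt e" by (simp add: mom_def)
  finally show ?thesis .
qed

lemma mult_self_le_mult_sqrt: "0 < (e::real) \<Longrightarrow> e \<le> 1 \<Longrightarrow> e * e \<le> e * sqrt e"
  using sqrt_le_D[of e] real_le_lsqrt[of e 1] by (intro mult_left_mono real_le_rsqrt) (auto simp: power2_eq_square mult_left_le)

lemma qapx_step:
  assumes "qapx d K v G" "y \<in> Rd d" "0 \<le> e"
  shows "\<bar>v (mv d y (sqrt e) z) - v y - sqrt e * dotp d (G y) z\<bar> \<le> K * e * (normd d z)\<^sup>2"
  using assms(1)[unfolded qapx_def, rule_format, OF assms(2) mv_Rd[of d "zer d" "sqrt e" z]] assms(3)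
  by (simp add: mv_step normd_scaled dotp_scaled power_mult_distrib)

text \<open>To leading order the increment is sqrt e times the scalar product of the gradient with a standard
  Gaussian vector, whose second moment is the squared norm of the gradient.\<close>

lemma increment_second_moment:
  assumes n: "nice d \<delta> K v G" and y: "y \<in> Rd d" and e: "0 < e" "e \<le> 1"
  shows "\<bar>(\<integral>z. (v (mv d y (sqrt e) z) - v y)\<^sup>2 \<partial>stdg d) - e * (normd d (G y))\<^sup>2\<bar>
    \<le> (2 * (real d * K) * K * mom d 3 + K * K * mom d 4) * (e * sqrt e)"
proof -
  have K: "0 \<le> K" using nice_K[OF n] by simp
  let ?b = "\<lambda>z. v (mv d y (sqrt e) z) - v y"
  let ?a = "\<lambda>z. sqrt e * dotp d (G y) z"
  have nG: "normd d (G y) \<le> real d * K"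
    using bdd_measD(2)[OF niceD(5)[OF n] y] by (intro normd_le_comp) auto
  note bv = nice_bdd[OF n]
  have ib: "integrable (stdg d) (\<lambda>z. (?b z)\<^sup>2)"
  proof (rule Bochner_Integration.integrable_bound)
    show "integrable (stdg d) (\<lambda>z. (K * sqrt e)\<^sup>2 * (normd d z)\<^sup>2)" by (intro integrable_mult_right stdg_normd_moment) simp
    have [measurable]: "(\<lambda>z. v (mv d y (sqrt e) z)) \<in> borel_measurable (stdg d)"
      using heat_integrable[OF bv] by (rule borel_measurable_integrable)
    show "(\<lambda>z. (?b z)\<^sup>2) \<in> borel_measurable (stdg d)" by measurable
    show "AE z in stdg d. norm ((?b z)\<^sup>2) \<le> norm ((K * sqrt e)\<^sup>2 * (normd d z)\<^sup>2)"
    proof (intro AE_I2)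
      fix z
      have "\<bar>?b z\<bar> \<le> K * sqrt e * normd d z" using lipd_step[OF niceD(7)[OF n] y, of "sqrt e" z] e by simp
      then have "\<bar>?b z\<bar>\<^sup>2 \<le> (K * sqrt e * normd d z)\<^sup>2" by (rule power_mono) simp
      then show "norm ((?b z)\<^sup>2) \<le> norm ((K * sqrt e)\<^sup>2 * (normd d z)\<^sup>2)" by (simp add: power_mult_distrib)
    qed
  qed
  have ia: "integrable (stdg d) (\<lambda>z. (?a z)\<^sup>2)" using dotp_sq_integrable by (simp add: power_mult_distrib)
  have Ea: "(\<integral>z. (?a z)\<^sup>2 \<partial>stdg d) = e * (normd d (G y))\<^sup>2" using e by (simp add: power_mult_distrib dotp_var)
  have pt: "\<bar>(?b z)\<^sup>2 - (?a z)\<^sup>2\<bar> \<le> (e * sqrt e) * (2 * (real d * K) * K * normd d z ^ 3 + K * K * normd d z ^ 4)" for z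
  proof -
    define r where "r = ?b z - ?a z"
    let ?n = "normd d z"
    have r: "\<bar>r\<bar> \<le> K * e * ?n\<^sup>2" using qapx_step[OF niceD(6)[OF n] y, of e z] e by (simp add: r_def)
    have a: "\<bar>?a z\<bar> \<le> sqrt e * (real d * K * ?n)"
      using dotp_le[of d "G y" z] mult_right_mono[OF nG normd_nonneg[of d z]] e by (simp add: abs_mult mult_left_mono)
    have "(?b z)\<^sup>2 - (?a z)\<^sup>2 = 2 * ?a z * r + r\<^sup>2" by (simp add: r_def power2_eq_square algebra_simps)
    then have "\<bar>(?b z)\<^sup>2 - (?a z)\<^sup>2\<bar> \<le> 2 * (\<bar>?a z\<bar> * \<bar>r\<bar>) + \<bar>r\<bar> * \<bar>r\<bar>"
      using abs_triangle_ineq[of "2 * ?a z * r" "r\<^sup>2"] by (simp add: abs_mult power2_eq_square)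
    also have "\<dots> \<le> 2 * ((sqrt e * (real d * K * ?n)) * (K * e * ?n\<^sup>2)) + (K * e * ?n\<^sup>2) * (K * e * ?n\<^sup>2)"
      using r a e K by (intro add_mono mult_left_mono mult_mono) auto
    also have "\<dots> = (e * sqrt e) * (2 * (real d * K) * K * ?n ^ 3) + (e * e) * (K * K * ?n ^ 4)"
      by (simp add: power2_eq_square power3_eq_cube power4_eq_xxxx algebra_simps)
    also have "\<dots> \<le> (e * sqrt e) * (2 * (real d * K) * K * ?n ^ 3) + (e * sqrt e) * (K * K * ?n ^ 4)"
      by (intro add_mono mult_right_mono mult_self_le_mult_sqrt e order_refl) simp
    finally show ?thesis by (simp add: distrib_left)
  qed
  have "(\<integral>z. (?b z)\<^sup>2 \<partial>stdg d) - e * (normd d (G y))\<^sup>2 = (\<integral>z. (?b z)\<^sup>2 - (?a z)\<^sup>2 \<partial>stdg d)"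
    using ia ib Ea by simp
  then have "\<bar>(\<integral>z. (?b z)\<^sup>2 \<partial>stdg d) - e * (normd d (G y))\<^sup>2\<bar> = \<bar>\<integral>z. (?b z)\<^sup>2 - (?a z)\<^sup>2 \<partial>stdg d\<bar>" by (rule arg_cong)
  also have "\<dots> \<le> (\<integral>z. \<bar>(?b z)\<^sup>2 - (?a z)\<^sup>2\<bar> \<partial>stdg d)" by (rule integral_abs_bound)
  also have "\<dots> \<le> (\<integral>z. (e * sqrt e) * (2 * (real d * K) * K * normd d z ^ 3 + K * K * normd d z ^ 4) \<partial>stdg d)"
  proof (rule integral_mono)
    show "integrable (stdg d) (\<lambda>z. \<bar>(?b z)\<^sup>2 - (?a z)\<^sup>2\<bar>)" by (intro integrable_abs Bochner_Integration.integrable_diff ia ib)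
    show "integrable (stdg d) (\<lambda>z. (e * sqrt e) * (2 * (real d * K) * K * normd d z ^ 3 + K * K * normd d z ^ 4))"
      by (intro integrable_mult_right Bochner_Integration.integrable_add stdg_normd_moment) auto
  qed (rule pt)
  also have "\<dots> = (2 * (real d * K) * K * mom d 3 + K * K * mom d 4) * (e * sqrt e)"
    by (simp add: mom_def stdg_normd_moment)
  finally show ?thesis .
qed

lemma increment_integrable:
  assumes n: "nice d \<delta> K v G"
  shows "integrable (stdg d) (\<lambda>z. (v (mv d y s z) - c) ^ k)" "integrable (stdg d) (\<lambda>z. \<bar>v (mv d y s z) - c\<bar> ^ k)"
    "integrable (stdg d) (\<lambda>z. v (mv d y s z) powr a)"
proof -
  have vm: "v \<in> borel_measurable (lebd d)" by (rule niceD[OF n])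
  have b: "bdd_meas d ((K + \<bar>c\<bar>) ^ k) (\<lambda>x. (v x - c) ^ k)" "bdd_meas d ((K + \<bar>c\<bar>) ^ k) (\<lambda>x. \<bar>v x - c\<bar> ^ k)"
  proof -
    have "\<bar>v x - c\<bar> ^ k \<le> (K + \<bar>c\<bar>) ^ k" if "x \<in> Rd d" for x
      using bdd_measD(2)[OF nice_bdd[OF n] that] by (intro power_mono) auto
    then show "bdd_meas d ((K + \<bar>c\<bar>) ^ k) (\<lambda>x. (v x - c) ^ k)" "bdd_meas d ((K + \<bar>c\<bar>) ^ k) (\<lambda>x. \<bar>v x - c\<bar> ^ k)"
      unfolding bdd_meas_def using vm by (auto simp: power_abs)
  qed
  show "integrable (stdg d) (\<lambda>z. (v (mv d y s z) - c) ^ k)" by (rule heat_integrable[OF b(1)])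
  show "integrable (stdg d) (\<lambda>z. \<bar>v (mv d y s z) - c\<bar> ^ k)" by (rule heat_integrable[OF b(2)])
  obtain \<delta>' K' where "nice d \<delta>' K' (\<lambda>x. v x powr a) (\<lambda>x i. a * v x powr (a - 1) * G x i)" using nice_powr[OF n] by blast
  from heat_integrable[OF nice_bdd[OF this]] show "integrable (stdg d) (\<lambda>z. v (mv d y s z) powr a)" .
qed

text \<open>Expand the power around the mean m of v over the increment: the linear term averages to zero and
  the quadratic term is a variance, which is e times the squared gradient up to higher order. The constant depends on
  v only through \<delta> and K.\<close>

lemma local_upper:
  assumes th: "0 < \<theta>" "\<theta> \<le> 1"
  shows "\<exists>C\<ge>0. \<forall>v G y e. nice d \<delta> K v G \<longrightarrow> y \<in> Rd d \<longrightarrow> 0 < e \<longrightarrow> e \<le> 1 \<longrightarrow>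
    heat d e (\<lambda>x. v x powr (1 + \<theta>)) y \<le> (heat d e v y) powr (1 + \<theta>)
       + \<theta> * e * (v y powr (\<theta> - 1) * (normd d (G y))\<^sup>2) + C * (e * sqrt e)"
proof -
  let ?B = "powr_ub \<delta> K (\<theta> - 1)"
  let ?L = "\<bar>\<theta> - 1\<bar> * powr_ub \<delta> K (\<theta> - 1 - 1)"
  let ?C2 = "2 * (real d * \<bar>K\<bar>) * \<bar>K\<bar> * mom d 3 + \<bar>K\<bar> * \<bar>K\<bar> * mom d 4"
  define C where "C = ?B * ?C2 + ?L * (\<bar>K\<bar> * mom d 1) * (real d * \<bar>K\<bar>)\<^sup>2"
  have C0: "0 \<le> C" unfolding C_def by (intro add_nonneg_nonneg mult_nonneg_nonneg) auto
  have "heat d e (\<lambda>x. v x powr (1 + \<theta>)) y \<le> (heat d e v y) powr (1 + \<theta>)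
       + \<theta> * e * (v y powr (\<theta> - 1) * (normd d (G y))\<^sup>2) + C * (e * sqrt e)"
    if n: "nice d \<delta> K v G" and y: "y \<in> Rd d" and e: "0 < e" "e \<le> 1" for v G y e
  proof -
    have K: "0 < \<delta>" "\<delta> \<le> K" "\<bar>K\<bar> = K" using nice_K[OF n] by auto
    define m where "m = heat d e v y"
    let ?v = "\<lambda>z. v (mv d y (sqrt e) z)"
    have mb: "\<delta> \<le> m" "m \<le> K" unfolding m_def using niceD(3,4)[OF nice_heat[OF n] y] by auto
    have m0: "0 < m" using mb K by simp
    note iv = heat_integrable[OF nice_bdd[OF n]]
    note i2 = increment_integrable(1)[OF n, of _ _ _ 2]
    have Em: "(\<integral>z. ?v z \<partial>stdg d) = m" by (simp add: m_def heat_def)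
    (* expanding around the mean m, rather than around v y, removes the linear term exactly *)
    have "heat d e (\<lambda>x. v x powr (1 + \<theta>)) y \<le>
      (\<integral>z. m powr (1 + \<theta>) + (1 + \<theta>) * m powr \<theta> * (?v z - m) + \<theta> * m powr (\<theta> - 1) * (?v z - m)\<^sup>2 \<partial>stdg d)"
      unfolding heat_def
    proof (rule integral_mono)
      show "integrable (stdg d) (\<lambda>z. m powr (1 + \<theta>) + (1 + \<theta>) * m powr \<theta> * (?v z - m) + \<theta> * m powr (\<theta> - 1) * (?v z - m)\<^sup>2)"
        by (intro Bochner_Integration.integrable_add integrable_mult_right Bochner_Integration.integrable_diff iv i2 SG.integrable_const)
      show "integrable (stdg d) (\<lambda>z. ?v z powr (1 + \<theta>))" by (rule increment_integrable[OF n])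
      show "?v z powr (1 + \<theta>) \<le> m powr (1 + \<theta>) + (1 + \<theta>) * m powr \<theta> * (?v z - m) + \<theta> * m powr (\<theta> - 1) * (?v z - m)\<^sup>2" for z
        by (rule powr_quadratic_above) (use nice_pos[OF n mv_Rd] m0 th in auto)
    qed
    also have "\<dots> = m powr (1 + \<theta>) + \<theta> * m powr (\<theta> - 1) * (\<integral>z. (?v z - m)\<^sup>2 \<partial>stdg d)"
      using iv i2 by (simp add: Em)
    also have "(\<integral>z. (?v z - m)\<^sup>2 \<partial>stdg d) = (\<integral>z. (?v z - v y)\<^sup>2 \<partial>stdg d) - (m - v y)\<^sup>2"
    proof -
      have "(\<integral>z. (?v z - v y)\<^sup>2 \<partial>stdg d) = (\<integral>z. (?v z - m)\<^sup>2 + 2 * (m - v y) * (?v z - m) + (m - v y)\<^sup>2 \<partial>stdg d)"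
        by (intro Bochner_Integration.integral_cong refl) (simp add: power2_eq_square algebra_simps)
      also have "\<dots> = (\<integral>z. (?v z - m)\<^sup>2 \<partial>stdg d) + (m - v y)\<^sup>2"
        using iv i2 by (simp add: Em)
      finally show ?thesis by simp
    qed
    also have "m powr (1 + \<theta>) + \<theta> * m powr (\<theta> - 1) * ((\<integral>z. (?v z - v y)\<^sup>2 \<partial>stdg d) - (m - v y)\<^sup>2)
      \<le> m powr (1 + \<theta>) + \<theta> * m powr (\<theta> - 1) * (e * (normd d (G y))\<^sup>2 + ?C2 * (e * sqrt e))"
    proof (intro add_left_mono mult_left_mono)
      have "(\<integral>z. (?v z - v y)\<^sup>2 \<partial>stdg d) \<le> e * (normd d (G y))\<^sup>2 + ?C2 * (e * sqrt e)"
        using increment_second_moment[OF n y e] unfolding K(3) by linarith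
      moreover have "0 \<le> (m - v y)\<^sup>2" by simp
      ultimately show "(\<integral>z. (?v z - v y)\<^sup>2 \<partial>stdg d) - (m - v y)\<^sup>2 \<le> e * (normd d (G y))\<^sup>2 + ?C2 * (e * sqrt e)" by linarith
    qed (use th in auto)
    also have "\<dots> \<le> m powr (1 + \<theta>) + (\<theta> * e * (v y powr (\<theta> - 1) * (normd d (G y))\<^sup>2) + C * (e * sqrt e))"
    proof (intro add_left_mono)
      have vb: "\<delta> \<le> v y" "v y \<le> K" using niceD(3,4)[OF n y] by auto
      have "\<bar>m powr (\<theta> - 1) - v y powr (\<theta> - 1)\<bar> \<le> ?L * \<bar>m - v y\<bar>"
        by (rule powr_lip) (use K mb vb in auto)
      also have "\<dots> \<le> ?L * (K * mom d 1 * sqrt e)"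
        using lipd_heat_diff[OF niceD(7)[OF n] nice_bdd[OF n] y, of e] e by (intro mult_left_mono) (auto simp: m_def)
      finally have 1: "m powr (\<theta> - 1) \<le> v y powr (\<theta> - 1) + ?L * (K * mom d 1) * sqrt e" by (simp add: mult_ac abs_le_iff)
      have nG: "(normd d (G y))\<^sup>2 \<le> (real d * K)\<^sup>2"
        using bdd_measD(2)[OF niceD(5)[OF n] y] by (intro power_mono normd_le_comp) auto
      have 2: "m powr (\<theta> - 1) * (normd d (G y))\<^sup>2 \<le> v y powr (\<theta> - 1) * (normd d (G y))\<^sup>2 + ?L * (K * mom d 1) * sqrt e * (real d * K)\<^sup>2"
      proof -
        have "m powr (\<theta> - 1) * (normd d (G y))\<^sup>2 \<le> (v y powr (\<theta> - 1) + ?L * (K * mom d 1) * sqrt e) * (normd d (G y))\<^sup>2"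
          by (rule mult_right_mono[OF 1]) simp
        also have "\<dots> \<le> v y powr (\<theta> - 1) * (normd d (G y))\<^sup>2 + ?L * (K * mom d 1) * sqrt e * (real d * K)\<^sup>2"
          unfolding distrib_right using nG K e by (intro add_left_mono mult_left_mono) auto
        finally show ?thesis .
      qed
      have 3: "m powr (\<theta> - 1) * ?C2 \<le> ?B * ?C2"
        using powr_bound[OF K(1) mb, of "\<theta> - 1"] by (intro mult_right_mono) auto
      have "\<theta> * m powr (\<theta> - 1) * (e * (normd d (G y))\<^sup>2 + ?C2 * (e * sqrt e))
        = \<theta> * (e * (m powr (\<theta> - 1) * (normd d (G y))\<^sup>2) + (e * sqrt e) * (m powr (\<theta> - 1) * ?C2))"
        by (simp add: algebra_simps)
      also have "\<dots> \<le> \<theta> * (e * (v y powr (\<theta> - 1) * (normd d (G y))\<^sup>2 + ?L * (K * mom d 1) * sqrt e * (real d * K)\<^sup>2) + (e * sqrt e) * (?B * ?C2))"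
        by (intro mult_left_mono add_mono 2 3) (use th e in auto)
      also have "\<dots> = \<theta> * e * (v y powr (\<theta> - 1) * (normd d (G y))\<^sup>2) + \<theta> * (C * (e * sqrt e))"
        unfolding C_def K(3) by (simp add: algebra_simps)
      also have "\<theta> * (C * (e * sqrt e)) \<le> 1 * (C * (e * sqrt e))"
        using th C0 e by (intro mult_right_mono) auto
      finally show "\<theta> * m powr (\<theta> - 1) * (e * (normd d (G y))\<^sup>2 + ?C2 * (e * sqrt e))
         \<le> \<theta> * e * (v y powr (\<theta> - 1) * (normd d (G y))\<^sup>2) + C * (e * sqrt e)" by simp
    qed
    finally show ?thesis by (simp add: m_def)
  qed
  with C0 show ?thesis by blast
qed

text \<open>The counterpart of the preceding expansion with a third-order Taylor remainder. The lower bound features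
  the averaged function and the averaged gradient, which is the form in which it is iterated along the semigroup.\<close>

lemma local_lower:
  assumes q: "2 \<le> q"
  shows "\<exists>C\<ge>0. \<forall>v G y e. nice d \<delta> K v G \<longrightarrow> y \<in> Rd d \<longrightarrow> 0 < e \<longrightarrow> e \<le> 1 \<longrightarrow>
    (heat d e v y) powr q + q * (q - 1) / 2 * e * ((heat d e v y) powr (q - 2) * (normd d (heatG d e G y))\<^sup>2) - C * (e * sqrt e)
      \<le> heat d e (\<lambda>x. v x powr q) y"
proof -
  let ?C3 = "\<bar>q * (q - 1) * (q - 2)\<bar> * powr_ub \<delta> K (q - 3)"
  let ?C2 = "2 * (real d * \<bar>K\<bar>) * \<bar>K\<bar> * mom d 3 + \<bar>K\<bar> * \<bar>K\<bar> * mom d 4"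
  let ?M3 = "8 * \<bar>K\<bar> ^ 3 * (mom d 3 + mom d 1 ^ 3)"
  let ?D = "?C2 + (\<bar>K\<bar> * mom d 2)\<^sup>2 + 2 * (real d * \<bar>K\<bar>) * (real d * (\<bar>K\<bar> * mom d 1))"
  let ?B = "powr_ub \<delta> K (q - 2)"
  define C where "C = q * (q - 1) / 2 * ?B * ?D + ?C3 * ?M3"
  have qq: "0 \<le> q * (q - 1) / 2" using q by simp
  have C0: "0 \<le> C" unfolding C_def using qq
    by (intro add_nonneg_nonneg mult_nonneg_nonneg) auto
  have "(heat d e v y) powr q + q * (q - 1) / 2 * e * ((heat d e v y) powr (q - 2) * (normd d (heatG d e G y))\<^sup>2) - C * (e * sqrt e)
      \<le> heat d e (\<lambda>x. v x powr q) y"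
    if n: "nice d \<delta> K v G" and y: "y \<in> Rd d" and e: "0 < e" "e \<le> 1" for v G y e
  proof -
    have K: "0 < \<delta>" "\<delta> \<le> K" "\<bar>K\<bar> = K" using nice_K[OF n] by auto
    have Kn: "0 \<le> K" using K by simp
    define m where "m = heat d e v y"
    let ?v = "\<lambda>z. v (mv d y (sqrt e) z)"
    have mb: "\<delta> \<le> m" "m \<le> K" unfolding m_def using niceD(3,4)[OF nice_heat[OF n] y] by auto
    have m0: "0 < m" using mb K by simp
    note iv = heat_integrable[OF nice_bdd[OF n]]
    note i2 = increment_integrable(1)[OF n, of _ _ _ 2]
    note i3 = increment_integrable(2)[OF n, of _ _ _ 3]
    have Em: "(\<integral>z. ?v z \<partial>stdg d) = m" by (simp add: m_def heat_def)
    let ?V = "\<integral>z. (?v z - m)\<^sup>2 \<partial>stdg d"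
    let ?T = "\<integral>z. \<bar>?v z - m\<bar> ^ 3 \<partial>stdg d"
    have "m powr q + q * (q - 1) / 2 * m powr (q - 2) * ?V - ?C3 * ?T =
      (\<integral>z. m powr q + q * m powr (q - 1) * (?v z - m) + q * (q - 1) / 2 * m powr (q - 2) * (?v z - m)\<^sup>2 - ?C3 * \<bar>?v z - m\<bar> ^ 3 \<partial>stdg d)"
      using iv i2 i3 by (simp add: Em)
    also have "\<dots> \<le> heat d e (\<lambda>x. v x powr q) y"
      unfolding heat_def
    proof (rule integral_mono)
      show "integrable (stdg d) (\<lambda>z. m powr q + q * m powr (q - 1) * (?v z - m) + q * (q - 1) / 2 * m powr (q - 2) * (?v z - m)\<^sup>2 - ?C3 * \<bar>?v z - m\<bar> ^ 3)"
        by (intro Bochner_Integration.integrable_add Bochner_Integration.integrable_diff integrable_mult_right iv i2 i3 SG.integrable_const)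
      show "integrable (stdg d) (\<lambda>z. ?v z powr q)" by (rule increment_integrable[OF n])
      show "m powr q + q * m powr (q - 1) * (?v z - m) + q * (q - 1) / 2 * m powr (q - 2) * (?v z - m)\<^sup>2 - ?C3 * \<bar>?v z - m\<bar> ^ 3 \<le> ?v z powr q" for z
        by (rule powr_cubic) (use K mb niceD(3,4)[OF n mv_Rd] in auto)
    qed
    finally have main: "m powr q + q * (q - 1) / 2 * m powr (q - 2) * ?V - ?C3 * ?T \<le> heat d e (\<lambda>x. v x powr q) y" .
    have mv: "\<bar>m - v y\<bar> \<le> K * mom d 1 * sqrt e"
      using lipd_heat_diff[OF niceD(7)[OF n] nice_bdd[OF n] y, of e] e by (simp add: m_def)
    have T: "?T \<le> ?M3 * (e * sqrt e)"
    proof -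
      have "?T \<le> (\<integral>z. (e * sqrt e) * (8 * K ^ 3 * (normd d z ^ 3 + mom d 1 ^ 3)) \<partial>stdg d)"
      proof (rule integral_mono)
        show "integrable (stdg d) (\<lambda>z. (e * sqrt e) * (8 * K ^ 3 * (normd d z ^ 3 + mom d 1 ^ 3)))"
          by (intro integrable_mult_right Bochner_Integration.integrable_add stdg_normd_moment SG.integrable_const) simp
        fix z
        let ?n = "normd d z"
        have "\<bar>?v z - v y\<bar> \<le> K * sqrt e * ?n" using lipd_step[OF niceD(7)[OF n] y, of "sqrt e" z] e by simp
        then have "\<bar>?v z - m\<bar> \<le> K * sqrt e * (?n + mom d 1)" using mv by (simp add: algebra_simps)
        then have "\<bar>?v z - m\<bar> ^ 3 \<le> (K * sqrt e * (?n + mom d 1)) ^ 3" by (rule power_mono) simp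
        also have "\<dots> = (e * sqrt e) * (K ^ 3 * (?n + mom d 1) ^ 3)"
        proof -
          have "sqrt e ^ 3 = e * sqrt e" using e by (simp add: power3_eq_cube)
          then show ?thesis by (simp add: power_mult_distrib)
        qed
        also have "\<dots> \<le> (e * sqrt e) * (K ^ 3 * (8 * (?n ^ 3 + mom d 1 ^ 3)))"
        proof -
          have "(a + b) ^ 3 \<le> 8 * (a ^ 3 + b ^ 3)" if "0 \<le> a" "0 \<le> b" for a b :: real
          proof (cases "a \<le> b")
            case True
            then have "(a + b) ^ 3 \<le> (2 * b) ^ 3" using that by (intro power_mono) auto
            then show ?thesis using that by (simp add: power_mult_distrib) (smt (verit) zero_le_power)
          next
            case False
            then have "(a + b) ^ 3 \<le> (2 * a) ^ 3" using that by (intro power_mono) auto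
            then show ?thesis using that by (simp add: power_mult_distrib) (smt (verit) zero_le_power)
          qed
          then show ?thesis using e Kn by (intro mult_left_mono) auto
        qed
        finally show "\<bar>?v z - m\<bar> ^ 3 \<le> (e * sqrt e) * (8 * K ^ 3 * (?n ^ 3 + mom d 1 ^ 3))" by (simp only: mult_ac)
      qed (rule i3)
      also have "\<dots> = ?M3 * (e * sqrt e)" unfolding K(3) by (simp add: mom_def stdg_normd_moment)
      finally show ?thesis .
    qed
    have V: "e * (normd d (heatG d e G y))\<^sup>2 - ?D * (e * sqrt e) \<le> ?V"
    proof -
      have "?V = (\<integral>z. (?v z - v y)\<^sup>2 \<partial>stdg d) - (m - v y)\<^sup>2"
      proof -
        have "(\<integral>z. (?v z - v y)\<^sup>2 \<partial>stdg d) = (\<integral>z. (?v z - m)\<^sup>2 + 2 * (m - v y) * (?v z - m) + (m - v y)\<^sup>2 \<partial>stdg d)"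
          by (intro Bochner_Integration.integral_cong refl) (simp add: power2_eq_square algebra_simps)
        also have "\<dots> = (\<integral>z. (?v z - m)\<^sup>2 \<partial>stdg d) + (m - v y)\<^sup>2"
          using iv i2 by (simp add: Em)
        finally show ?thesis by simp
      qed
      moreover have "e * (normd d (G y))\<^sup>2 - ?C2 * (e * sqrt e) \<le> (\<integral>z. (?v z - v y)\<^sup>2 \<partial>stdg d)"
        using increment_second_moment[OF n y e] unfolding K(3) by linarith
      moreover have "(m - v y)\<^sup>2 \<le> (K * mom d 2)\<^sup>2 * (e * sqrt e)"
      proof -
        have "m - v y = (\<integral>z. ?v z - v y - sqrt e * dotp d (G y) z \<partial>stdg d)"
          using iv by (simp add: Em dotp_integrable dotp_mean)
        then have "\<bar>m - v y\<bar> = \<bar>\<integral>z. ?v z - v y - sqrt e * dotp d (G y) z \<partial>stdg d\<bar>" by (rule arg_cong)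
        also have "\<dots> \<le> (\<integral>z. \<bar>?v z - v y - sqrt e * dotp d (G y) z\<bar> \<partial>stdg d)" by (rule integral_abs_bound)
        also have "\<dots> \<le> (\<integral>z. K * e * (normd d z)\<^sup>2 \<partial>stdg d)"
        proof (rule integral_mono)
          show "integrable (stdg d) (\<lambda>z. \<bar>?v z - v y - sqrt e * dotp d (G y) z\<bar>)"
            by (intro integrable_abs Bochner_Integration.integrable_diff integrable_mult_right iv dotp_integrable SG.integrable_const)
          show "integrable (stdg d) (\<lambda>z. K * e * (normd d z)\<^sup>2)" by (intro integrable_mult_right stdg_normd_moment) simp
          show "\<bar>?v z - v y - sqrt e * dotp d (G y) z\<bar> \<le> K * e * (normd d z)\<^sup>2" for z
            by (rule qapx_step[OF niceD(6)[OF n] y]) (use e in simp)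
        qed
        also have "\<dots> = K * mom d 2 * e" by (simp add: mom_def)
        finally have "\<bar>m - v y\<bar>\<^sup>2 \<le> (K * mom d 2 * e)\<^sup>2" by (rule power_mono) simp
        also have "\<dots> = (K * mom d 2)\<^sup>2 * (e * e)" by (simp add: power2_eq_square mult_ac)
        also have "\<dots> \<le> (K * mom d 2)\<^sup>2 * (e * sqrt e)" by (intro mult_left_mono mult_self_le_mult_sqrt e) simp
        finally show ?thesis by simp
      qed
      moreover have "(normd d (heatG d e G y))\<^sup>2 \<le> (normd d (G y))\<^sup>2 + 2 * (real d * K) * (real d * (K * mom d 1)) * sqrt e"
      proof -
        define g g' where "g = normd d (G y)" and "g' = normd d (heatG d e G y)"
        have gb: "0 \<le> g" "0 \<le> g'" "g \<le> real d * K" "g' \<le> real d * K"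
          unfolding g_def g'_def using bdd_measD(2)[OF niceD(5)[OF n] y] bdd_measD(2)[OF niceD(5)[OF nice_heat[OF n]] y]
          by (auto intro!: normd_le_comp)
        have "g' \<le> g + normd d (\<lambda>i. heatG d e G y i - G y i)"
          unfolding g_def g'_def normd_def
          using L2_set_triangle_ineq[of "G y" "\<lambda>i. heatG d e G y i - G y i" "{..<d}"] by simp
        also have "normd d (\<lambda>i. heatG d e G y i - G y i) \<le> real d * (K * mom d 1 * sqrt e)"
          unfolding heatG_def
          by (intro normd_le_comp lipd_heat_diff[OF niceD(8)[OF n] niceD(5)[OF n] y]) (use e in auto)
        finally have gg: "g' - g \<le> real d * (K * mom d 1) * sqrt e" by (simp add: mult_ac)
        have "g'\<^sup>2 - g\<^sup>2 = (g' - g) * (g' + g)" by (simp add: power2_eq_square algebra_simps)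
        also have "\<dots> \<le> (real d * (K * mom d 1) * sqrt e) * (g' + g)" using gg gb by (intro mult_right_mono) auto
        also have "\<dots> \<le> (real d * (K * mom d 1) * sqrt e) * (2 * (real d * K))" using gb Kn e by (intro mult_left_mono) auto
        finally show ?thesis unfolding g_def g'_def by (simp add: algebra_simps)
      qed
      then have "e * (normd d (heatG d e G y))\<^sup>2 \<le> e * ((normd d (G y))\<^sup>2 + 2 * (real d * K) * (real d * (K * mom d 1)) * sqrt e)"
        using e by (intro mult_left_mono) auto
      ultimately show ?thesis unfolding K(3) by (simp add: algebra_simps)
    qed
    let ?g = "(normd d (heatG d e G y))\<^sup>2"
    have mB: "m powr (q - 2) \<le> ?B" by (rule powr_bound[OF K(1) mb])
    have D0: "0 \<le> ?D" by (intro add_nonneg_nonneg mult_nonneg_nonneg) auto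
    have "m powr (q - 2) * (e * ?g) - ?B * (?D * (e * sqrt e)) \<le> m powr (q - 2) * ?V"
    proof -
      have "m powr (q - 2) * (e * ?g - ?D * (e * sqrt e)) \<le> m powr (q - 2) * ?V" by (rule mult_left_mono[OF V]) simp
      moreover have "m powr (q - 2) * (?D * (e * sqrt e)) \<le> ?B * (?D * (e * sqrt e))"
        using mB D0 e by (intro mult_right_mono) auto
      ultimately show ?thesis unfolding right_diff_distrib by linarith
    qed
    then have "q * (q - 1) / 2 * (m powr (q - 2) * (e * ?g) - ?B * (?D * (e * sqrt e))) \<le> q * (q - 1) / 2 * (m powr (q - 2) * ?V)"
      using qq by (rule mult_left_mono)
    moreover have "?C3 * ?T \<le> ?C3 * (?M3 * (e * sqrt e))" by (rule mult_left_mono[OF T]) simp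
    ultimately have "m powr q + (q * (q - 1) / 2 * (m powr (q - 2) * (e * ?g) - ?B * (?D * (e * sqrt e)))) - ?C3 * (?M3 * (e * sqrt e))
       \<le> heat d e (\<lambda>x. v x powr q) y" using main unfolding mult.assoc by linarith
    moreover have "m powr q + (q * (q - 1) / 2 * (m powr (q - 2) * (e * ?g) - ?B * (?D * (e * sqrt e)))) - ?C3 * (?M3 * (e * sqrt e))
      = m powr q + q * (q - 1) / 2 * e * (m powr (q - 2) * ?g) - C * (e * sqrt e)"
      unfolding C_def by (simp only: right_diff_distrib distrib_right mult.assoc mult.left_commute[of e] diff_diff_eq)
    ultimately show ?thesis by (simp only: m_def)
  qed
  with C0 show ?thesis by blast
qed

section \<open>The Beckner inequality for Gaussian measures\<close>

lemma cauchy_schwarz_integral: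
  fixes a b :: "'a \<Rightarrow> real"
  assumes a: "integrable P (\<lambda>w. (a w)\<^sup>2)" and b: "integrable P (\<lambda>w. (b w)\<^sup>2)" and ab: "integrable P (\<lambda>w. a w * b w)"
    and pos: "0 < (\<integral>w. (a w)\<^sup>2 \<partial>P)"
  shows "(\<integral>w. a w * b w \<partial>P)\<^sup>2 \<le> (\<integral>w. (a w)\<^sup>2 \<partial>P) * (\<integral>w. (b w)\<^sup>2 \<partial>P)"
proof -
  let ?X = "\<integral>w. (a w)\<^sup>2 \<partial>P" and ?Y = "\<integral>w. (b w)\<^sup>2 \<partial>P" and ?I = "\<integral>w. a w * b w \<partial>P"
  have "0 \<le> (\<integral>w. (?X * b w - ?I * a w)\<^sup>2 \<partial>P)" by (rule Bochner_Integration.integral_nonneg) simp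
  also have "\<dots> = (\<integral>w. ?X\<^sup>2 * (b w)\<^sup>2 - 2 * ?X * ?I * (a w * b w) + ?I\<^sup>2 * (a w)\<^sup>2 \<partial>P)"
    by (intro Bochner_Integration.integral_cong refl) (simp add: power2_eq_square algebra_simps)
  also have "\<dots> = ?X\<^sup>2 * ?Y - 2 * ?X * ?I * ?I + ?I\<^sup>2 * ?X"
    using a b ab by simp
  also have "\<dots> = ?X * (?X * ?Y - ?I\<^sup>2)" by (simp add: power2_eq_square algebra_simps)
  finally have "0 \<le> ?X * (?X * ?Y - ?I\<^sup>2)" .
  then show ?thesis using pos by (simp add: zero_le_mult_iff)
qed

lemma nice_normd_bdd:
  assumes n: "nice d \<delta> K v G"
  shows "bdd_meas d (real d * K) (\<lambda>y. normd d (G y))" "bdd_meas d ((real d * K)\<^sup>2) (\<lambda>y. (normd d (G y))\<^sup>2)"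
proof -
  have m: "(\<lambda>y. normd d (G y)) \<in> borel_measurable (lebd d)"
    by (rule normd_measurable) (use niceD(5)[OF n] in \<open>auto simp: bdd_meas_def\<close>)
  have b: "normd d (G y) \<le> real d * K" if "y \<in> Rd d" for y
    using bdd_measD(2)[OF niceD(5)[OF n] that] by (intro normd_le_comp) auto
  show "bdd_meas d (real d * K) (\<lambda>y. normd d (G y))" unfolding bdd_meas_def using m b by simp
  have "\<bar>(normd d (G y))\<^sup>2\<bar> \<le> (real d * K)\<^sup>2" if "y \<in> Rd d" for y
    using power_mono[OF b[OF that], of 2] by simp
  then show "bdd_meas d ((real d * K)\<^sup>2) (\<lambda>y. (normd d (G y))\<^sup>2)"
    unfolding bdd_meas_def using borel_measurable_power[OF m, of 2] by blast
qed

lemma heat_pos: assumes n: "nice d \<delta> K v G" "x \<in> Rd d" shows "0 < heat d t v x"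
  by (rule nice_pos[OF nice_heat[OF n(1)] n(2)])

text \<open>The gradient of the average of \<psi>^p is the average of p \<psi>^(p-1) G. Cauchy-Schwarz separates the
  two factors, and since 2 (p - 1) \<le> p Jensen bounds the average of \<psi>^(2(p-1)) by a power of the average
  of \<psi>^p.\<close>

lemma grad_power_bound:
  assumes n: "nice d \<delta> K \<psi> G" and p: "1 < p" "p < 2" and x: "x \<in> Rd d"
  shows "(normd d (heatG d t (\<lambda>y i. p * \<psi> y powr (p - 1) * G y i) x))\<^sup>2
    \<le> p\<^sup>2 * (heat d t (\<lambda>y. \<psi> y powr p) x) powr (2 * (p - 1) / p) * heat d t (\<lambda>y. (normd d (G y))\<^sup>2) x"
proof -
  let ?X = "\<lambda>z. mv d x (sqrt t) z"
  obtain \<delta>1 K1 where n1: "nice d \<delta>1 K1 (\<lambda>x. \<psi> x powr p) (\<lambda>x i. p * \<psi> x powr (p - 1) * G x i)"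
    using nice_powr[OF n] by blast
  obtain \<delta>2 K2 where n2: "nice d \<delta>2 K2 (\<lambda>x. \<psi> x powr (p - 1)) (\<lambda>x i. (p - 1) * \<psi> x powr (p - 1 - 1) * G x i)"
    using nice_powr[OF n] by blast
  obtain \<delta>3 K3 where n3: "nice d \<delta>3 K3 (\<lambda>x. \<psi> x powr (2 * (p - 1))) (\<lambda>x i. (2 * (p - 1)) * \<psi> x powr (2 * (p - 1) - 1) * G x i)"
    using nice_powr[OF n] by blast
  define A where "A = heatG d t (\<lambda>y i. p * \<psi> y powr (p - 1) * G y i) x"
  define S where "S = normd d A"
  define I where "I = (\<integral>z. \<psi> (?X z) powr (p - 1) * normd d (G (?X z)) \<partial>stdg d)"
  note bG = nice_normd_bdd[OF n]
  have iI: "integrable (stdg d) (\<lambda>z. \<psi> (?X z) powr (p - 1) * normd d (G (?X z)))"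
    using heat_mult_integrable[OF nice_bdd[OF n2] heat_integrable[OF bG(1)]] .
  have iG: "integrable (stdg d) (\<lambda>z. p * \<psi> (?X z) powr (p - 1) * G (?X z) i)" if "i < d" for i
    by (rule heat_integrable[OF niceD(5)[OF n1 that]])
  (* duality: S is recovered by testing the averaged vector field with its own value A *)
  have "S\<^sup>2 = (\<Sum>i<d. A i * (\<integral>z. p * \<psi> (?X z) powr (p - 1) * G (?X z) i \<partial>stdg d))"
    unfolding S_def normd_sq by (rule sum.cong) (simp_all add: power2_eq_square A_def heatG_def heat_def)
  also have "\<dots> = (\<integral>z. (\<Sum>i<d. A i * (p * \<psi> (?X z) powr (p - 1) * G (?X z) i)) \<partial>stdg d)"
    by (subst Bochner_Integration.integral_sum) (auto intro!: integrable_mult_right iG)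
  also have "\<dots> \<le> (\<integral>z. p * S * (\<psi> (?X z) powr (p - 1) * normd d (G (?X z))) \<partial>stdg d)"
  proof (rule integral_mono)
    show "integrable (stdg d) (\<lambda>z. \<Sum>i<d. A i * (p * \<psi> (?X z) powr (p - 1) * G (?X z) i))"
      by (intro Bochner_Integration.integrable_sum integrable_mult_right iG) auto
    show "integrable (stdg d) (\<lambda>z. p * S * (\<psi> (?X z) powr (p - 1) * normd d (G (?X z))))"
      by (intro integrable_mult_right iI)
    fix z
    have "(\<Sum>i<d. A i * (p * \<psi> (?X z) powr (p - 1) * G (?X z) i)) = p * \<psi> (?X z) powr (p - 1) * dotp d A (G (?X z))"
      by (simp add: dotp_def sum_distrib_left mult_ac)
    also have "\<dots> \<le> p * \<psi> (?X z) powr (p - 1) * (S * normd d (G (?X z)))"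
      using dotp_le[of d A "G (?X z)"] p by (intro mult_left_mono) (auto simp: S_def)
    finally show "(\<Sum>i<d. A i * (p * \<psi> (?X z) powr (p - 1) * G (?X z) i)) \<le> p * S * (\<psi> (?X z) powr (p - 1) * normd d (G (?X z)))"
      by (simp add: mult_ac)
  qed
  also have "\<dots> = S * (p * I)" by (simp add: I_def)
  finally have SI: "S * S \<le> S * (p * I)" by (simp add: power2_eq_square)
  have I0: "0 \<le> I" unfolding I_def by (rule Bochner_Integration.integral_nonneg) simp
  have "S \<le> p * I"
  proof (cases "S = 0")
    case True then show ?thesis using I0 p by simp
  next
    case False then have "0 < S" by (simp add: S_def less_le)
    then show ?thesis using SI by simp
  qed
  then have "S\<^sup>2 \<le> (p * I)\<^sup>2" by (rule power_mono) (simp add: S_def)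
  also have "\<dots> = p\<^sup>2 * I\<^sup>2" by (simp add: power_mult_distrib)
  also have "\<dots> \<le> p\<^sup>2 * ((heat d t (\<lambda>y. \<psi> y powr p) x) powr (2 * (p - 1) / p) * heat d t (\<lambda>y. (normd d (G y))\<^sup>2) x)"
  proof (rule mult_left_mono)
    have sq: "(\<psi> y powr (p - 1))\<^sup>2 = \<psi> y powr (2 * (p - 1))" if "y \<in> Rd d" for y
      using nice_pos[OF n that] by (simp add: power2_eq_square powr_add[symmetric])
    have e: "(\<integral>z. (\<psi> (?X z) powr (p - 1))\<^sup>2 \<partial>stdg d) = heat d t (\<lambda>y. \<psi> y powr (2 * (p - 1))) x"
      unfolding heat_def by (intro Bochner_Integration.integral_cong refl) (simp add: sq)
    have i1: "integrable (stdg d) (\<lambda>z. (\<psi> (?X z) powr (p - 1))\<^sup>2)"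
      using heat_integrable[OF nice_bdd[OF n3], of x "sqrt t"] by (simp add: sq)
    have "I\<^sup>2 \<le> (\<integral>z. (\<psi> (?X z) powr (p - 1))\<^sup>2 \<partial>stdg d) * (\<integral>z. (normd d (G (?X z)))\<^sup>2 \<partial>stdg d)"
      unfolding I_def
      by (rule cauchy_schwarz_integral[OF i1 heat_integrable[OF bG(2)] iI]) (use heat_pos[OF n3 x] e in simp)
    also have "\<dots> = heat d t (\<lambda>y. \<psi> y powr (2 * (p - 1))) x * heat d t (\<lambda>y. (normd d (G y))\<^sup>2) x"
      unfolding e by (simp add: heat_def)
    also have "\<dots> \<le> (heat d t (\<lambda>y. \<psi> y powr p) x) powr (2 * (p - 1) / p) * heat d t (\<lambda>y. (normd d (G y))\<^sup>2) x"
    proof (rule mult_right_mono)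
      have pp: "\<psi> y powr (2 * (p - 1)) = (\<psi> y powr p) powr (2 * (p - 1) / p)" for y
        using p by (simp add: powr_powr)
      show "heat d t (\<lambda>y. \<psi> y powr (2 * (p - 1))) x \<le> (heat d t (\<lambda>y. \<psi> y powr p) x) powr (2 * (p - 1) / p)"
        unfolding heat_def pp
      proof (rule jensen_powr[OF prob_stdg])
        show "integrable (stdg d) (\<lambda>w. \<psi> (?X w) powr p)" by (rule heat_integrable[OF nice_bdd[OF n1]])
        show "integrable (stdg d) (\<lambda>w. (\<psi> (?X w) powr p) powr (2 * (p - 1) / p))"
          unfolding pp[symmetric] by (rule heat_integrable[OF nice_bdd[OF n3]])
        show "0 < (\<integral>w. \<psi> (?X w) powr p \<partial>stdg d)" using heat_pos[OF n1 x] by (simp add: heat_def)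
        show "2 * (p - 1) / p \<le> 1" using p by (simp add: field_simps)
      qed (use p in auto)
      show "0 \<le> heat d t (\<lambda>y. (normd d (G y))\<^sup>2) x" unfolding heat_def by (rule Bochner_Integration.integral_nonneg) simp
    qed
    finally show "I\<^sup>2 \<le> (heat d t (\<lambda>y. \<psi> y powr p) x) powr (2 * (p - 1) / p) * heat d t (\<lambda>y. (normd d (G y))\<^sup>2) x" .
  qed simp
  finally show ?thesis by (simp add: S_def A_def mult.assoc)
qed

lemma lipd_sum:
  "finite I \<Longrightarrow> (\<And>i. i \<in> I \<Longrightarrow> lipd d (C i) (f i)) \<Longrightarrow> lipd d (\<Sum>i\<in>I. C i) (\<lambda>x. \<Sum>i\<in>I. f i x)"
proof (induction I rule: finite_induct)
  case empty
  then show ?case by (simp add: lipd_def)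
next
  case (insert j I)
  have "\<bar>(f j (mv d x 1 w) + (\<Sum>i\<in>I. f i (mv d x 1 w))) - (f j x + (\<Sum>i\<in>I. f i x))\<bar> \<le> (C j + (\<Sum>i\<in>I. C i)) * normd d w"
    if "x \<in> Rd d" "w \<in> Rd d" for x w
  proof -
    have "\<bar>f j (mv d x 1 w) - f j x\<bar> \<le> C j * normd d w" using insert.prems[of j] that by (auto simp: lipd_def)
    moreover have "\<bar>(\<Sum>i\<in>I. f i (mv d x 1 w)) - (\<Sum>i\<in>I. f i x)\<bar> \<le> (\<Sum>i\<in>I. C i) * normd d w"
      using insert.IH insert.prems that by (auto simp: lipd_def)
    ultimately show ?thesis unfolding distrib_right by linarith
  qed
  then show ?case using insert.hyps by (simp add: lipd_def)
qed

lemma nice_normd_lipd: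
  assumes n: "nice d \<delta> K v G"
  shows "lipd d (\<Sum>i<d. K * K + K * K) (\<lambda>y. (normd d (G y))\<^sup>2)"
  unfolding normd_sq unfolding power2_eq_square
proof (rule lipd_sum)
  fix i assume "i \<in> {..<d}"
  then have i: "i < d" by simp
  note l = niceD(8)[OF n i] and b = bdd_measD(2)[OF niceD(5)[OF n i]]
  show "lipd d (K * K + K * K) (\<lambda>x. G x i * G x i)" by (rule lipd_bounded_mult[OF l l b b])
qed simp

text \<open>Interpolate with \<phi>(s) = Q_s ((Q_(t-s) \<psi>^p)^(2/p)), where Q is the heat semigroup. The increments of
  \<phi> are controlled by local_upper, and grad_power_bound turns the resulting energy of Q_(t-s) \<psi>^p
  into the average of \<bar>G\<bar>^2: the exponents of Q_(t-s) \<psi>^p cancel.\<close>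

lemma heat_beckner:
  assumes n: "nice d \<delta> K \<psi> G" and p: "1 < p" "p < 2" and x: "x \<in> Rd d" and t: "0 \<le> t"
  shows "heat d t (\<lambda>y. (\<psi> y)\<^sup>2) x - (heat d t (\<lambda>y. \<psi> y powr p) x) powr (2 / p)
    \<le> 2 * (2 - p) * t * heat d t (\<lambda>y. (normd d (G y))\<^sup>2) x"
proof -
  (* so that 1 + \<theta> = 2 / p *)
  define \<theta> where "\<theta> = 2 / p - 1"
  have th: "0 < \<theta>" "\<theta> \<le> 1" using p by (auto simp: \<theta>_def field_simps)
  define g where "g = (\<lambda>x. \<psi> x powr p)"
  define Gg where "Gg = (\<lambda>x i. p * \<psi> x powr (p - 1) * G x i)"
  define N where "N = (\<lambda>y. (normd d (G y))\<^sup>2)"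
  obtain \<delta>1 K1 where ng: "nice d \<delta>1 K1 g Gg"
    using nice_powr[OF n] unfolding g_def Gg_def by blast
  obtain C where C: "0 \<le> C" and up: "\<And>v G y e. nice d \<delta>1 K1 v G \<Longrightarrow> y \<in> Rd d \<Longrightarrow> 0 < e \<Longrightarrow> e \<le> 1 \<Longrightarrow>
    heat d e (\<lambda>x. v x powr (1 + \<theta>)) y \<le> (heat d e v y) powr (1 + \<theta>)
       + \<theta> * e * (v y powr (\<theta> - 1) * (normd d (G y))\<^sup>2) + C * (e * sqrt e)"
    using local_upper[OF th, of d \<delta>1 K1] by blast
  have bN: "bdd_meas d ((real d * K)\<^sup>2) N" unfolding N_def by (rule nice_normd_bdd[OF n])
  have lN: "lipd d (\<Sum>i<d. K * K + K * K) N" unfolding N_def by (rule nice_normd_lipd[OF n])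
  define LN where "LN = (\<Sum>i<d. K * K + K * K) * mom d 1"
  have LN0: "0 \<le> LN" unfolding LN_def by (intro mult_nonneg_nonneg sum_nonneg) auto
  define \<phi> where "\<phi> = (\<lambda>s. heat d s (\<lambda>y. (heat d (t - s) g y) powr (1 + \<theta>)) x - s * (\<theta> * p\<^sup>2 * heat d t N x))"
  have "\<phi> t \<le> \<phi> 0"
  proof (rule increments_le[OF t])
    show "0 \<le> C + \<theta> * p\<^sup>2 * LN" using C th LN0 by simp
    fix s e assume s: "0 \<le> s" and e: "0 < e" "e \<le> (1::real)" and se: "s + e \<le> t"
    define r where "r = t - s - e"
    have r: "0 \<le> r" using se by (simp add: r_def)
    define v where "v = heat d r g"
    define Gv where "Gv = heatG d r Gg"
    have nv: "nice d \<delta>1 K1 v Gv" unfolding v_def Gv_def by (rule nice_heat[OF ng])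
    obtain \<delta>2 K2 where nv2: "nice d \<delta>2 K2 (\<lambda>x. v x powr (1 + \<theta>)) (\<lambda>x i. (1 + \<theta>) * v x powr (1 + \<theta> - 1) * Gv x i)"
      using nice_powr[OF nv] by blast
    have nh: "nice d \<delta>1 K1 (heat d (t - s) g) (heatG d (t - s) Gg)" by (rule nice_heat[OF ng])
    obtain \<delta>3 K3 where nh2: "nice d \<delta>3 K3 (\<lambda>x. heat d (t - s) g x powr (1 + \<theta>)) (\<lambda>x i. (1 + \<theta>) * heat d (t - s) g x powr (1 + \<theta> - 1) * heatG d (t - s) Gg x i)"
      using nice_powr[OF nh] by blast
    have hv: "heat d e v y = heat d (t - s) g y" if "y \<in> Rd d" for y
      unfolding v_def using heat_semigroup[OF nice_bdd[OF ng], of e r y] e r that by (simp add: r_def)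
    have pt: "heat d e (\<lambda>x. v x powr (1 + \<theta>)) y \<le> (heat d (t - s) g y powr (1 + \<theta>) + \<theta> * p\<^sup>2 * e * heat d r N y) + C * (e * sqrt e)"
      if y: "y \<in> Rd d" for y
    proof -
      have vp: "0 < v y" by (rule nice_pos[OF nv y])
      have "v y powr (\<theta> - 1) * (normd d (Gv y))\<^sup>2 \<le> v y powr (\<theta> - 1) * (p\<^sup>2 * v y powr (2 * (p - 1) / p) * heat d r N y)"
        unfolding Gv_def Gg_def v_def g_def N_def by (intro mult_left_mono grad_power_bound[OF n p y]) auto
      also have "\<dots> = (v y powr (\<theta> - 1) * v y powr (2 * (p - 1) / p)) * (p\<^sup>2 * heat d r N y)" by (simp add: mult_ac)
      (* the exponents of v add up to zero; this is where the choice of \<theta> matters *)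
      also have "v y powr (\<theta> - 1) * v y powr (2 * (p - 1) / p) = 1"
      proof -
        have "\<theta> - 1 + 2 * (p - 1) / p = 0" using p by (simp add: \<theta>_def field_simps)
        then show ?thesis using vp by (simp add: powr_add[symmetric])
      qed
      finally have "\<theta> * e * (v y powr (\<theta> - 1) * (normd d (Gv y))\<^sup>2) \<le> \<theta> * e * (1 * (p\<^sup>2 * heat d r N y))"
        using th e by (intro mult_left_mono) auto
      with up[OF nv y e] show ?thesis by (simp add: hv[OF y] mult_ac)
    qed
    have "heat d (s + e) (\<lambda>x. v x powr (1 + \<theta>)) x = heat d s (heat d e (\<lambda>x. v x powr (1 + \<theta>))) x"
      using heat_semigroup[OF nice_bdd[OF nv2], of s e x] s e x by simp
    also have "\<dots> \<le> heat d s (\<lambda>y. (heat d (t - s) g y powr (1 + \<theta>) + \<theta> * p\<^sup>2 * e * heat d r N y) + C * (e * sqrt e)) x"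
    proof (rule heat_mono[OF heat_bdd[OF nice_bdd[OF nv2]] _ pt])
      have 1: "bdd_meas d K3 (\<lambda>x. heat d (t - s) g x powr (1 + \<theta>))" by (rule nice_bdd[OF nh2])
      have 2: "bdd_meas d ((real d * K)\<^sup>2) (heat d r N)" by (rule heat_bdd[OF bN])
      show "bdd_meas d (K3 + \<theta> * p\<^sup>2 * e * (real d * K)\<^sup>2 + C * (e * sqrt e)) (\<lambda>y. (heat d (t - s) g y powr (1 + \<theta>) + \<theta> * p\<^sup>2 * e * heat d r N y) + C * (e * sqrt e))"
        unfolding bdd_meas_def
      proof (intro conjI ballI)
        show "(\<lambda>y. (heat d (t - s) g y powr (1 + \<theta>) + \<theta> * p\<^sup>2 * e * heat d r N y) + C * (e * sqrt e)) \<in> borel_measurable (lebd d)"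
          by (intro borel_measurable_add borel_measurable_times borel_measurable_const bdd_measD(1)[OF 1] bdd_measD(1)[OF 2])
        fix y assume y: "y \<in> Rd d"
        have "\<bar>\<theta> * p\<^sup>2 * e * heat d r N y\<bar> \<le> \<theta> * p\<^sup>2 * e * (real d * K)\<^sup>2"
          unfolding abs_mult[of _ "heat d r N y"] using bdd_measD(2)[OF 2 y] th e p by (simp add: mult_left_mono)
        moreover have "0 \<le> C * (e * sqrt e)" using C e by simp
        ultimately show "\<bar>(heat d (t - s) g y powr (1 + \<theta>) + \<theta> * p\<^sup>2 * e * heat d r N y) + C * (e * sqrt e)\<bar> \<le> K3 + \<theta> * p\<^sup>2 * e * (real d * K)\<^sup>2 + C * (e * sqrt e)"
          using bdd_measD(2)[OF 1 y] by linarith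
      qed
    qed
    also have "\<dots> = heat d s (\<lambda>y. heat d (t - s) g y powr (1 + \<theta>)) x + \<theta> * p\<^sup>2 * e * heat d s (heat d r N) x + C * (e * sqrt e)"
      unfolding heat_def[of d s]
      by (simp add: heat_integrable[OF nice_bdd[OF nh2]] heat_integrable[OF heat_bdd[OF bN]])
    also have "heat d s (heat d r N) x = heat d (t - e) N x"
      using heat_semigroup[OF bN s r x] by (simp add: r_def)
    also have "\<theta> * p\<^sup>2 * e * heat d (t - e) N x \<le> \<theta> * p\<^sup>2 * e * (heat d t N x + LN * sqrt e)"
    proof (rule mult_left_mono)
      have te: "0 \<le> t - e" using se s by simp
      have "heat d t N x = heat d e (heat d (t - e) N) x"
        using heat_semigroup[OF bN, of e "t - e" x] e te x by simp
      moreover have "\<bar>heat d e (heat d (t - e) N) x - heat d (t - e) N x\<bar> \<le> LN * sqrt e"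
        unfolding LN_def by (rule lipd_heat_diff[OF lipd_heat[OF lN bN] heat_bdd[OF bN] x]) (use e in simp)
      ultimately show "heat d (t - e) N x \<le> heat d t N x + LN * sqrt e" by linarith
    qed (use th e in auto)
    finally have *: "heat d (s + e) (\<lambda>x. v x powr (1 + \<theta>)) x \<le> heat d s (\<lambda>y. heat d (t - s) g y powr (1 + \<theta>)) x
        + \<theta> * p\<^sup>2 * e * (heat d t N x + LN * sqrt e) + C * (e * sqrt e)" by simp
    have "v = heat d (t - (s + e)) g" by (simp add: v_def r_def diff_diff_eq)
    then show "\<phi> (s + e) \<le> \<phi> s + (C + \<theta> * p\<^sup>2 * LN) * (e * sqrt e)"
      using * unfolding \<phi>_def by (simp add: algebra_simps)
  qed
  moreover have "\<phi> 0 = (heat d t g x) powr (2 / p)" using x by (simp add: \<phi>_def heat_0 \<theta>_def)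
  moreover have "\<phi> t = heat d t (\<lambda>y. (\<psi> y)\<^sup>2) x - t * (\<theta> * p\<^sup>2 * heat d t N x)"
  proof -
    have "heat d t (\<lambda>y. (heat d (t - t) g y) powr (1 + \<theta>)) x = heat d t (\<lambda>y. (\<psi> y)\<^sup>2) x"
    proof (rule heat_cong)
      fix y assume y: "y \<in> Rd d"
      have "(\<psi> y powr p) powr (2 / p) = (\<psi> y)\<^sup>2"
        using p nice_pos[OF n y] by (simp add: powr_powr)
      then show "(heat d (t - t) g y) powr (1 + \<theta>) = (\<psi> y)\<^sup>2"
        using y by (simp add: heat_0 g_def \<theta>_def)
    qed
    then show ?thesis by (simp add: \<phi>_def)
  qed
  ultimately have "heat d t (\<lambda>y. (\<psi> y)\<^sup>2) x - (heat d t g x) powr (2 / p) \<le> (\<theta> * p\<^sup>2) * (t * heat d t N x)"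
    by (simp add: mult_ac)
  also have "\<dots> \<le> (2 * (2 - p)) * (t * heat d t N x)"
  proof (rule mult_right_mono)
    have "\<theta> * p\<^sup>2 = (2 - p) * p" using p by (simp add: \<theta>_def field_simps power2_eq_square)
    also have "\<dots> \<le> (2 - p) * 2" using p by (intro mult_left_mono) auto
    finally show "\<theta> * p\<^sup>2 \<le> 2 * (2 - p)" by simp
    have "0 \<le> heat d t N x" unfolding heat_def N_def by (rule Bochner_Integration.integral_nonneg) simp
    then show "0 \<le> t * heat d t N x" using t by simp
  qed
  finally show ?thesis by (simp add: g_def N_def mult_ac)
qed

section \<open>Functional inequalities along the heat flow\<close>

text \<open>The expectation under the convolution of \<pi> with a Gaussian of variance t.\<close>

definition EH :: "(nat \<Rightarrow> real) measure \<Rightarrow> nat \<Rightarrow> real \<Rightarrow> ((nat \<Rightarrow> real) \<Rightarrow> real) \<Rightarrow> real" where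
  "EH \<pi> d t g = (\<integral>x. heat d t g x \<partial>\<pi>)"

lemma bdd_meas_add: "bdd_meas d M f \<Longrightarrow> bdd_meas d N g \<Longrightarrow> bdd_meas d (M + N) (\<lambda>x. f x + g x)"
  unfolding bdd_meas_def by (auto intro!: borel_measurable_add order_trans[OF abs_triangle_ineq] add_mono)

lemma bdd_meas_cmult: "bdd_meas d M f \<Longrightarrow> bdd_meas d (\<bar>c\<bar> * M) (\<lambda>x. c * f x)"
  unfolding bdd_meas_def by (auto simp: abs_mult intro!: mult_left_mono)

locale rd_prob =
  fixes d :: nat and \<pi> :: "(nat \<Rightarrow> real) measure"
  assumes prob: "prob_space \<pi>" and sets_pi: "sets \<pi> = sets (lebd d)"
begin

lemma space_pi: "space \<pi> = Rd d"
  using sets_eq_imp_space_eq[OF sets_pi] by simp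

lemma id_meas: "(\<lambda>x. x) \<in> measurable \<pi> (lebd d)"
  by (rule measurable_ident_sets[OF sets_pi])

lemma bdd_integrable: assumes "bdd_meas d M g" shows "integrable \<pi> g"
  using bdd_meas_integrable[OF assms prob id_meas] by simp

lemma EH_integrable: "bdd_meas d M g \<Longrightarrow> integrable \<pi> (heat d t g)"
  by (rule bdd_integrable[OF heat_bdd])

lemma integral_mono_Rd:
  fixes f g :: "(nat \<Rightarrow> real) \<Rightarrow> real"
  shows
  "integrable \<pi> f \<Longrightarrow> integrable \<pi> g \<Longrightarrow> (\<And>x. x \<in> Rd d \<Longrightarrow> f x \<le> g x) \<Longrightarrow> (\<integral>x. f x \<partial>\<pi>) \<le> (\<integral>x. g x \<partial>\<pi>)"
  by (rule integral_mono) (auto simp: space_pi)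

lemma integral_cong_Rd: "(\<And>x. x \<in> Rd d \<Longrightarrow> f x = g x) \<Longrightarrow> (\<integral>x. f x \<partial>\<pi>) = (\<integral>x. g x \<partial>\<pi>)"
  by (rule Bochner_Integration.integral_cong) (auto simp: space_pi)

lemma integral_nonneg_Rd: "(\<And>x. x \<in> Rd d \<Longrightarrow> 0 \<le> f x) \<Longrightarrow> 0 \<le> (\<integral>x. f x \<partial>\<pi> :: real)"
  by (rule Bochner_Integration.integral_nonneg) (auto simp: space_pi)

lemma EH_mono:
  "bdd_meas d M f \<Longrightarrow> bdd_meas d N g \<Longrightarrow> (\<And>x. x \<in> Rd d \<Longrightarrow> f x \<le> g x) \<Longrightarrow> EH \<pi> d t f \<le> EH \<pi> d t g"
  unfolding EH_def by (intro integral_mono_Rd EH_integrable heat_mono)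

lemma EH_cong: "(\<And>x. x \<in> Rd d \<Longrightarrow> f x = g x) \<Longrightarrow> EH \<pi> d t f = EH \<pi> d t g"
  unfolding EH_def by (intro integral_cong_Rd heat_cong)

lemma EH_add: "bdd_meas d M f \<Longrightarrow> bdd_meas d N g \<Longrightarrow> EH \<pi> d t (\<lambda>x. f x + g x) = EH \<pi> d t f + EH \<pi> d t g"
  unfolding EH_def
  by (subst Bochner_Integration.integral_add[symmetric, OF EH_integrable EH_integrable], assumption+)
     (intro integral_cong_Rd heat_add)

lemma EH_cmult: "EH \<pi> d t (\<lambda>x. c * f x) = c * EH \<pi> d t f"
  unfolding EH_def integral_mult_right_zero[symmetric] by (intro integral_cong_Rd heat_cmult)

lemma prob_Rd[simp]: "measure \<pi> (Rd d) = 1"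
  using prob_space.prob_space[OF prob] by (simp add: space_pi)

lemma EH_const: "EH \<pi> d t (\<lambda>_. c) = c"
proof -
  have "EH \<pi> d t (\<lambda>_. c) = (\<integral>x. c \<partial>\<pi>)" unfolding EH_def by (intro integral_cong_Rd heat_const)
  then show ?thesis by (simp add: space_pi)
qed

lemma EH_semigroup: "bdd_meas d M g \<Longrightarrow> 0 \<le> s \<Longrightarrow> 0 \<le> t \<Longrightarrow> EH \<pi> d s (heat d t g) = EH \<pi> d (s + t) g"
  unfolding EH_def by (intro integral_cong_Rd heat_semigroup)

text \<open>Interpolation between the exponents 1 and q: Jensen's inequality for the concave power of h^(q-1) under
  the measure weighted by h, which has mass one. Integrating the tangent inequality avoids introducing that measure.\<close>

lemma EH_holder:
  assumes n: "nice d \<delta> K h G" and one: "EH \<pi> d t h = 1" and a: "1 \<le> a" "a \<le> q" and q: "1 < q"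
    and V: "0 < EH \<pi> d t (\<lambda>x. h x powr q)"
  shows "EH \<pi> d t (\<lambda>x. h x powr a) \<le> (EH \<pi> d t (\<lambda>x. h x powr q)) powr ((a - 1) / (q - 1))"
proof -
  let ?V = "EH \<pi> d t (\<lambda>x. h x powr q)"
  define s where "s = (a - 1) / (q - 1)"
  have s: "0 \<le> s" "s \<le> 1" using a q by (auto simp: s_def)
  obtain K1 where b1: "bdd_meas d K1 (\<lambda>x. h x powr a)" using nice_powr[OF n, of a] nice_bdd by blast
  obtain K2 where b2: "bdd_meas d K2 (\<lambda>x. h x powr q)" using nice_powr[OF n, of q] nice_bdd by blast
  note b0 = nice_bdd[OF n]
  (* coefficients of the tangent at V of the concave power, after multiplication by h *)
  define c1 c2 where "c1 = ?V powr s - s * ?V powr (s - 1) * ?V" and "c2 = s * ?V powr (s - 1)"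
  have "EH \<pi> d t (\<lambda>x. h x powr a) \<le> EH \<pi> d t (\<lambda>x. c1 * h x + c2 * h x powr q)"
  proof (rule EH_mono[OF b1 bdd_meas_add[OF bdd_meas_cmult[OF b0] bdd_meas_cmult[OF b2]]])
    fix x assume x: "x \<in> Rd d"
    have hp: "0 < h x" by (rule nice_pos[OF n x])
    have "h x * (h x powr (q - 1)) powr s \<le> h x * (?V powr s + s * ?V powr (s - 1) * (h x powr (q - 1) - ?V))"
      by (intro mult_left_mono powr_tangent_above) (use hp V s in auto)
    moreover have "h x * (h x powr (q - 1)) powr s = h x powr a"
    proof -
      have "(q - 1) * s = a - 1" using q by (simp add: s_def)
      then have "(h x powr (q - 1)) powr s = h x powr (a - 1)" by (simp add: powr_powr)
      then show ?thesis using hp by (simp add: powr_diff)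
    qed
    moreover have "h x * h x powr (q - 1) = h x powr q" using hp by (simp add: powr_diff)
    moreover have "h x * (?V powr s + s * ?V powr (s - 1) * (h x powr (q - 1) - ?V))
       = c1 * h x + c2 * (h x * h x powr (q - 1))"
      unfolding c1_def c2_def by (simp add: algebra_simps)
    ultimately show "h x powr a \<le> c1 * h x + c2 * h x powr q" by simp
  qed
  also have "\<dots> = c1 * 1 + c2 * ?V"
    by (subst EH_add[OF bdd_meas_cmult[OF b0] bdd_meas_cmult[OF b2]]) (simp add: EH_cmult one)
  also have "\<dots> = ?V powr s" by (simp add: c1_def c2_def)
  finally show ?thesis by (simp add: s_def)
qed

lemma LOI_apply:
  assumes L: "LOI d r \<alpha> \<pi>" and p: "1 < p" "p < 2" and C: "Cinf d \<Psi>"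
    and nn: "\<And>x. x \<in> Rd d \<Longrightarrow> 0 \<le> \<Psi> x" and B: "\<And>x. x \<in> Rd d \<Longrightarrow> \<Psi> x \<le> B"
    and D: "0 \<le> D" "(\<integral>\<^sup>+x. ennreal ((normd d (gradd d \<Psi> x))\<^sup>2) \<partial>\<pi>) \<le> ennreal D"
  shows "(\<integral>x. (\<Psi> x)\<^sup>2 \<partial>\<pi>) - (\<integral>x. \<Psi> x powr p \<partial>\<pi>) powr (2 / p) \<le> (2 - p) powr (2 * (1 - 1 / r)) / \<alpha> * D"
proof -
  let ?X = "(\<integral>x. (\<Psi> x)\<^sup>2 \<partial>\<pi>) - (\<integral>x. \<Psi> x powr p \<partial>\<pi>) powr (2 / p)"
  let ?w = "(2 - p) powr (2 * (1 - 1 / r))"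
  have al: "0 < \<alpha>" and sup: "(SUP p\<in>{1<..<2}. ennreal (((\<integral>x. (\<Psi> x)\<^sup>2 \<partial>\<pi>) - (\<integral>x. \<Psi> x powr p \<partial>\<pi>) powr (2 / p)) / (2 - p) powr (2 * (1 - 1 / r))))
       \<le> ennreal (1 / \<alpha>) * (\<integral>\<^sup>+x. ennreal ((normd d (gradd d \<Psi> x))\<^sup>2) \<partial>\<pi>)"
    using L C nn B unfolding LOI_def by blast+
  have "ennreal (?X / ?w) \<le> ennreal (1 / \<alpha>) * (\<integral>\<^sup>+x. ennreal ((normd d (gradd d \<Psi> x))\<^sup>2) \<partial>\<pi>)"
    by (rule order_trans[OF _ sup]) (rule SUP_upper, use p in simp)
  also have "\<dots> \<le> ennreal (1 / \<alpha>) * ennreal D" by (rule mult_left_mono[OF D(2)]) simp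
  also have "\<dots> = ennreal (D / \<alpha>)" using al D by (simp add: ennreal_mult'[symmetric])
  finally have "?X / ?w \<le> D / \<alpha>" using al D by simp
  moreover have "0 < ?w" using p by simp
  ultimately show ?thesis by (simp add: field_simps)
qed

text \<open>The convolved measure inherits the inequality with an additional term linear in t. The deficit splits into the
  mean of the Gaussian deficits, handled by heat_beckner, and the deficit of
  \<Psi> = (Q_t \<psi>^p)^(1/p) under \<pi>. The gradient of \<Psi> satisfies
  \<bar>grad \<Psi>\<bar>^2 \<le> Q_t \<bar>G\<bar>^2, and \<Psi> is smooth because of the convolution.\<close>

lemma LOI_heat:
  assumes L: "LOI d r \<alpha> \<pi>" and n: "nice d \<delta> K \<psi> G" and p: "1 < p" "p < 2" and t: "0 < t"
  shows "EH \<pi> d t (\<lambda>x. (\<psi> x)\<^sup>2) - (EH \<pi> d t (\<lambda>x. \<psi> x powr p)) powr (2 / p)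
     \<le> (2 * (2 - p) * t + (2 - p) powr (2 * (1 - 1 / r)) / \<alpha>) * EH \<pi> d t (\<lambda>x. (normd d (G x))\<^sup>2)"
proof -
  define g where "g = (\<lambda>x. \<psi> x powr p)"
  define Gg where "Gg = (\<lambda>x i. p * \<psi> x powr (p - 1) * G x i)"
  define N where "N = (\<lambda>y. (normd d (G y))\<^sup>2)"
  obtain \<delta>1 K1 where ng: "nice d \<delta>1 K1 g Gg" using nice_powr[OF n] unfolding g_def Gg_def by blast
  have bN: "bdd_meas d ((real d * K)\<^sup>2) N" unfolding N_def by (rule nice_normd_bdd[OF n])
  define F where "F = heat d t g"
  have nF: "nice d \<delta>1 K1 F (heatG d t Gg)" unfolding F_def by (rule nice_heat[OF ng])
  define \<Psi> where "\<Psi> = (\<lambda>x. F x powr (1 / p))"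
  obtain \<delta>2 K2 where n2: "nice d \<delta>2 K2 \<Psi> (\<lambda>x i. (1 / p) * F x powr (1 / p - 1) * heatG d t Gg x i)"
    using nice_powr[OF nF] unfolding \<Psi>_def by blast
  obtain \<delta>3 K3 where n3: "nice d \<delta>3 K3 (\<lambda>x. F x powr (2 / p)) (\<lambda>x i. (2 / p) * F x powr (2 / p - 1) * heatG d t Gg x i)"
    using nice_powr[OF nF] by blast
  have Fpos: "0 < F x" if "x \<in> Rd d" for x by (rule nice_pos[OF nF that])
  have EN0: "0 \<le> heat d t N x" for x unfolding heat_def N_def by (rule Bochner_Integration.integral_nonneg) simp
  have grad: "(normd d (gradd d \<Psi> x))\<^sup>2 \<le> heat d t N x" if x: "x \<in> Rd d" for x
  proof -
    let ?c = "(1 / p) * F x powr (1 / p - 1)"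
    have K2: "0 \<le> K2" using nice_K[OF n2] by simp
    have "gradd d \<Psi> x = (\<lambda>i\<in>{..<d}. ?c * heatG d t Gg x i)"
      using qapx_gradd(2)[OF niceD(6)[OF n2] K2 x] by simp
    then have "normd d (gradd d \<Psi> x) = normd d (\<lambda>i. ?c * heatG d t Gg x i)"
      unfolding normd_def by (auto intro!: L2_set_cong)
    then have "(normd d (gradd d \<Psi> x))\<^sup>2 = ?c\<^sup>2 * (normd d (heatG d t Gg x))\<^sup>2"
      unfolding normd_scale by (simp add: power_mult_distrib power_divide)
    also have "\<dots> \<le> ?c\<^sup>2 * (p\<^sup>2 * F x powr (2 * (p - 1) / p) * heat d t N x)"
      unfolding F_def g_def Gg_def N_def by (rule mult_left_mono[OF grad_power_bound[OF n p x]]) simp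
    also have "\<dots> = (F x powr (1 / p - 1) * F x powr (1 / p - 1) * F x powr (2 * (p - 1) / p)) * heat d t N x"
      using p by (simp add: power2_eq_square)
    also have "F x powr (1 / p - 1) * F x powr (1 / p - 1) * F x powr (2 * (p - 1) / p) = 1"
    proof -
      have "1 / p - 1 + (1 / p - 1) + 2 * (p - 1) / p = 0" using p by (simp add: field_simps)
      then show ?thesis using Fpos[OF x] by (simp add: powr_add[symmetric])
    qed
    finally show ?thesis by simp
  qed
  have "(\<integral>x. (\<Psi> x)\<^sup>2 \<partial>\<pi>) - (\<integral>x. \<Psi> x powr p \<partial>\<pi>) powr (2 / p) \<le> (2 - p) powr (2 * (1 - 1 / r)) / \<alpha> * EH \<pi> d t N"
  proof (rule LOI_apply[OF L p])
    show "Cinf d \<Psi>" unfolding \<Psi>_def F_def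
      by (rule Cinf_heat_powr[OF nice_bdd[OF ng] t]) (use Fpos in \<open>simp add: F_def\<close>)
    show "0 \<le> \<Psi> x" for x by (simp add: \<Psi>_def)
    show "\<Psi> x \<le> K2" if "x \<in> Rd d" for x using niceD(4)[OF n2 that] .
    show "0 \<le> EH \<pi> d t N" unfolding EH_def by (rule integral_nonneg_Rd) (rule EN0)
    have "(\<integral>\<^sup>+x. ennreal ((normd d (gradd d \<Psi> x))\<^sup>2) \<partial>\<pi>) \<le> (\<integral>\<^sup>+x. ennreal (heat d t N x) \<partial>\<pi>)"
      by (intro nn_integral_mono ennreal_leI grad) (simp add: space_pi)
    also have "\<dots> = ennreal (EH \<pi> d t N)"
      unfolding EH_def by (rule nn_integral_eq_integral) (auto intro!: EH_integrable[OF bN] AE_I2 EN0)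
    finally show "(\<integral>\<^sup>+x. ennreal ((normd d (gradd d \<Psi> x))\<^sup>2) \<partial>\<pi>) \<le> ennreal (EH \<pi> d t N)" .
  qed
  moreover have "(\<integral>x. \<Psi> x powr p \<partial>\<pi>) = EH \<pi> d t g"
    unfolding EH_def
  proof (rule integral_cong_Rd)
    fix x assume x: "x \<in> Rd d"
    show "\<Psi> x powr p = heat d t g x" using Fpos[OF x] p by (simp add: \<Psi>_def powr_powr F_def)
  qed
  moreover have "(\<integral>x. (\<Psi> x)\<^sup>2 \<partial>\<pi>) = (\<integral>x. F x powr (2 / p) \<partial>\<pi>)"
  proof (rule integral_cong_Rd)
    fix x assume x: "x \<in> Rd d"
    show "(\<Psi> x)\<^sup>2 = F x powr (2 / p)" using Fpos[OF x] p by (simp add: \<Psi>_def power2_eq_square powr_add[symmetric])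
  qed
  moreover have "EH \<pi> d t (\<lambda>x. (\<psi> x)\<^sup>2) - (\<integral>x. F x powr (2 / p) \<partial>\<pi>) \<le> 2 * (2 - p) * t * EH \<pi> d t N"
  proof -
    have b2: "bdd_meas d (K\<^sup>2) (\<lambda>x. (\<psi> x)\<^sup>2)"
      unfolding bdd_meas_def
    proof (intro conjI ballI)
      show "(\<lambda>x. (\<psi> x)\<^sup>2) \<in> borel_measurable (lebd d)" using niceD(2)[OF n] by measurable
      show "\<bar>(\<psi> x)\<^sup>2\<bar> \<le> K\<^sup>2" if "x \<in> Rd d" for x
        using power_mono[of "\<bar>\<psi> x\<bar>" K 2] bdd_measD(2)[OF nice_bdd[OF n] that] by simp
    qed
    have "EH \<pi> d t (\<lambda>x. (\<psi> x)\<^sup>2) \<le> (\<integral>x. F x powr (2 / p) + 2 * (2 - p) * t * heat d t N x \<partial>\<pi>)"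
      unfolding EH_def
    proof (rule integral_mono_Rd)
      show "integrable \<pi> (heat d t (\<lambda>x. (\<psi> x)\<^sup>2))" by (rule EH_integrable[OF b2])
      show "integrable \<pi> (\<lambda>x. F x powr (2 / p) + 2 * (2 - p) * t * heat d t N x)"
        by (intro Bochner_Integration.integrable_add integrable_mult_right EH_integrable[OF bN] bdd_integrable[OF nice_bdd[OF n3]])
      show "heat d t (\<lambda>x. (\<psi> x)\<^sup>2) x \<le> F x powr (2 / p) + 2 * (2 - p) * t * heat d t N x" if x: "x \<in> Rd d" for x
        using heat_beckner[OF n p x, of t] t unfolding F_def g_def N_def by simp
    qed
    also have "\<dots> = (\<integral>x. F x powr (2 / p) \<partial>\<pi>) + 2 * (2 - p) * t * EH \<pi> d t N"
      unfolding EH_def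
      by (simp add: EH_integrable[OF bN] bdd_integrable[OF nice_bdd[OF n3]])
    finally show ?thesis by simp
  qed
  ultimately show ?thesis by (simp add: g_def[symmetric] N_def[symmetric] algebra_simps)
qed

text \<open>Apply LOI_heat to \<psi> = h^(q/2) with p = 2 - w. The squared gradient of \<psi> is q^2/4 h^(q-2) \<bar>G\<bar>^2,
  and EH_holder bounds the power 2/p of the mean of \<psi>^p by V^(1 - w/(2(q-1))), where V is the moment of h of
  order q.\<close>

lemma fisher_lower:
  assumes L: "LOI d r \<alpha> \<pi>" and n: "nice d \<delta> K h G" and one: "EH \<pi> d t h = 1"
    and t: "0 < t" "t \<le> \<eta>" and q: "2 \<le> q" and w: "0 < w" "w < 1"
    and V0: "1 \<le> V0" "V0 \<le> EH \<pi> d t (\<lambda>x. h x powr q)"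
  defines "lam0 \<equiv> (1 - V0 powr (- w / (2 * (q - 1)))) / (2 * w * \<eta> + w powr (2 * (1 - 1 / r)) / \<alpha>)"
  shows "lam0 * EH \<pi> d t (\<lambda>x. h x powr q) \<le> EH \<pi> d t (\<lambda>x. q * (q - 1) / 2 * (h x powr (q - 2) * (normd d (G x))\<^sup>2))"
proof -
  define p where "p = 2 - w"
  have p: "1 < p" "p < 2" using w by (auto simp: p_def)
  define V where "V = EH \<pi> d t (\<lambda>x. h x powr q)"
  have V1: "1 \<le> V" using V0 by (simp add: V_def)
  define \<psi> where "\<psi> = (\<lambda>x. h x powr (q / 2))"
  define G\<psi> where "G\<psi> = (\<lambda>x i. (q / 2) * h x powr (q / 2 - 1) * G x i)"
  obtain \<delta>1 K1 where n1: "nice d \<delta>1 K1 \<psi> G\<psi>" using nice_powr[OF n] unfolding \<psi>_def G\<psi>_def by blast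
  define A where "A = 2 * w * \<eta> + w powr (2 * (1 - 1 / r)) / \<alpha>"
  have al: "0 < \<alpha>" using L by (simp add: LOI_def)
  have A0: "0 < A" unfolding A_def using w t al by (intro add_pos_pos) auto
  define \<Gamma> where "\<Gamma> = EH \<pi> d t (\<lambda>x. (normd d (G\<psi> x))\<^sup>2)"
  have \<Gamma>0: "0 \<le> \<Gamma>" unfolding \<Gamma>_def EH_def heat_def
    by (intro integral_nonneg_Rd Bochner_Integration.integral_nonneg) simp
  have "EH \<pi> d t (\<lambda>x. (\<psi> x)\<^sup>2) - (EH \<pi> d t (\<lambda>x. \<psi> x powr p)) powr (2 / p) \<le> (2 * (2 - p) * t + (2 - p) powr (2 * (1 - 1 / r)) / \<alpha>) * \<Gamma>"
    unfolding \<Gamma>_def by (rule LOI_heat[OF L n1 p t(1)])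
  also have "\<dots> \<le> A * \<Gamma>"
    using t w \<Gamma>0 by (intro mult_right_mono) (auto simp: A_def p_def)
  finally have main: "EH \<pi> d t (\<lambda>x. (\<psi> x)\<^sup>2) - (EH \<pi> d t (\<lambda>x. \<psi> x powr p)) powr (2 / p) \<le> A * \<Gamma>" .
  have e1: "EH \<pi> d t (\<lambda>x. (\<psi> x)\<^sup>2) = V"
    unfolding V_def
  proof (rule EH_cong)
    fix x assume "x \<in> Rd d"
    then show "(\<psi> x)\<^sup>2 = h x powr q" using nice_pos[OF n] by (simp add: \<psi>_def power2_eq_square powr_add[symmetric])
  qed
  define a where "a = q / 2 * p"
  have a: "1 \<le> a" "a \<le> q"
  proof -
    have "1 * 1 \<le> q / 2 * p" using q p by (intro mult_mono) auto
    then show "1 \<le> a" by (simp add: a_def)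
    have "q / 2 * p \<le> q / 2 * 2" using q p by (intro mult_left_mono) auto
    then show "a \<le> q" by (simp add: a_def)
  qed
  have e2: "EH \<pi> d t (\<lambda>x. \<psi> x powr p) \<le> V powr ((a - 1) / (q - 1))"
  proof -
    have "EH \<pi> d t (\<lambda>x. \<psi> x powr p) = EH \<pi> d t (\<lambda>x. h x powr a)"
      by (rule EH_cong) (simp add: \<psi>_def powr_powr a_def)
    also have "\<dots> \<le> V powr ((a - 1) / (q - 1))"
      unfolding V_def by (rule EH_holder[OF n one a]) (use q V1 in \<open>auto simp: V_def\<close>)
    finally show ?thesis .
  qed
  (* the exact Hoelder exponent is 1 - w / (p (q - 1)); since p \<le> 2 and V \<ge> 1 it may be weakened to 1 - k *)
  define k where "k = w / (2 * (q - 1))"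
  have k0: "0 \<le> k" using w q by (simp add: k_def)
  have "(EH \<pi> d t (\<lambda>x. \<psi> x powr p)) powr (2 / p) \<le> (V powr ((a - 1) / (q - 1))) powr (2 / p)"
  proof (rule powr_mono2[OF _ _ e2])
    show "0 \<le> EH \<pi> d t (\<lambda>x. \<psi> x powr p)" unfolding EH_def heat_def
      by (intro integral_nonneg_Rd Bochner_Integration.integral_nonneg) simp
  qed (use p in simp)
  also have "\<dots> = V powr ((a - 1) / (q - 1) * (2 / p))" by (simp add: powr_powr)
  also have "\<dots> \<le> V powr (1 - k)"
  proof (rule powr_mono[OF _ V1])
    have "(a - 1) / (q - 1) * (2 / p) = 1 - w / p / (q - 1)"
    proof -
      have "w = 2 - p" by (simp add: p_def)
      then have "(a - 1) * (2 / p) = (q - 1) - w / p" using p by (simp add: a_def field_simps)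
      then have "(a - 1) * (2 / p) / (q - 1) = ((q - 1) - w / p) / (q - 1)" by simp
      then show ?thesis using q by (simp add: diff_divide_distrib mult.commute)
    qed
    moreover have "w / 2 / (q - 1) \<le> w / p / (q - 1)" using w p q by (intro divide_right_mono divide_left_mono) auto
    ultimately show "(a - 1) / (q - 1) * (2 / p) \<le> 1 - k" by (simp add: k_def)
  qed
  also have "\<dots> = V * V powr (- k)" using V1 by (simp add: powr_diff powr_minus divide_inverse)
  also have "\<dots> \<le> V * V0 powr (- k)"
    using V0 V1 k0 by (intro mult_left_mono powr_mono2') (auto simp: V_def)
  finally have "V - V * V0 powr (- k) \<le> A * \<Gamma>" using main e1 by linarith
  then have "lam0 * V \<le> \<Gamma>"
    using A0 unfolding lam0_def A_def[symmetric] k_def by (simp add: field_simps)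
  also have "\<Gamma> \<le> EH \<pi> d t (\<lambda>x. q * (q - 1) / 2 * (h x powr (q - 2) * (normd d (G x))\<^sup>2))"
  proof -
    have e: "q * (q - 1) / 2 * (h x powr (q - 2) * (normd d (G x))\<^sup>2) = (2 * (q - 1) / q) * (normd d (G\<psi> x))\<^sup>2" if "x \<in> Rd d" for x
    proof -
      have "(normd d (G\<psi> x))\<^sup>2 = (q / 2 * h x powr (q / 2 - 1))\<^sup>2 * (normd d (G x))\<^sup>2"
        unfolding G\<psi>_def normd_scale by (simp add: power_mult_distrib power_divide)
      also have "(q / 2 * h x powr (q / 2 - 1))\<^sup>2 = q\<^sup>2 / 4 * h x powr (q - 2)"
        by (simp add: power2_eq_square powr_add[symmetric])
      finally show ?thesis using q by (simp add: power2_eq_square field_simps)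
    qed
    have "\<Gamma> \<le> (2 * (q - 1) / q) * \<Gamma>"
    proof -
      have "1 \<le> 2 * (q - 1) / q" using q by (simp add: field_simps)
      from mult_right_mono[OF this \<Gamma>0] show ?thesis by simp
    qed
    also have "\<dots> = EH \<pi> d t (\<lambda>x. q * (q - 1) / 2 * (h x powr (q - 2) * (normd d (G x))\<^sup>2))"
      unfolding \<Gamma>_def EH_cmult[symmetric] by (rule EH_cong) (rule e[symmetric])
    finally show ?thesis .
  qed
  finally show ?thesis by (simp add: V_def)
qed

end

section \<open>Growth of power means along the heat flow\<close>

context rd_prob
begin

lemma heat_jensen:
  assumes n: "nice d \<delta> K v G" and q: "1 \<le> q"
  shows "(heat d t v x) powr q \<le> heat d t (\<lambda>y. v y powr q) x"
proof -
  obtain K1 where b1: "bdd_meas d K1 (\<lambda>x. v x powr q)" using nice_powr[OF n, of q] nice_bdd by blast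
  show ?thesis unfolding heat_def
    by (rule jensen_powr_ge[OF prob_stdg heat_integrable[OF nice_bdd[OF n]] heat_integrable[OF b1] _ q])
       (rule less_imp_le[OF nice_pos[OF n mv_Rd]])
qed

lemma exp_times_linear: fixes x :: real assumes "0 \<le> x" shows "1 - x\<^sup>2 \<le> exp (- x) * (1 + x)"
proof -
  have "(1 - x) * (1 + x) \<le> exp (- x) * (1 + x)"
    using exp_ge_add_one_self[of "- x"] assms by (intro mult_right_mono) auto
  then show ?thesis by (simp add: power2_eq_square algebra_simps)
qed

text \<open>The moment V(t) of order q of the partially averaged function grows at least exponentially with rate
  lam0, by local_lower and fisher_lower. Only the times t between \<eta>/4 and \<eta>/2 are used: up to \<eta>/2 the
  bounded function u has been averaged for a time of at least \<eta>/2 and is regular, and the inequality for the convolved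
  measure needs t > 0. Jensen's inequality covers the remaining times.\<close>

lemma heat_growth:
  assumes L: "LOI d r \<alpha> \<pi>"
    and um: "u \<in> borel_measurable (lebd d)" and ub: "\<And>x. x \<in> Rd d \<Longrightarrow> \<delta> \<le> u x \<and> u x \<le> M" and \<delta>: "0 < \<delta>"
    and one: "EH \<pi> d \<eta> u = 1" and \<eta>: "0 < \<eta>" and q: "2 \<le> q" and w: "0 < w" "w < 1"
  defines "V0 \<equiv> \<integral>x. heat d \<eta> u x powr q \<partial>\<pi>"
  defines "lam0 \<equiv> (1 - V0 powr (- w / (2 * (q - 1)))) / (2 * w * \<eta> + w powr (2 * (1 - 1 / r)) / \<alpha>)"
  shows "1 \<le> V0" "exp (\<eta> / 4 * lam0) * V0 \<le> EH \<pi> d \<eta> (\<lambda>x. u x powr q)"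
proof -
  have al: "0 < \<alpha>" using L by (simp add: LOI_def)
  have bu: "bdd_meas d M u" unfolding bdd_meas_def using um ub \<delta> by fastforce
  obtain K G0 where n0: "nice d \<delta> K (heat d (\<eta> / 2) u) G0"
    using nice_heat_bounded[OF um ub \<delta>, of "\<eta> / 2"] \<eta> by auto
  define v0 where "v0 = heat d (\<eta> / 2) u"
  define h where "h = (\<lambda>t. heat d (\<eta> / 2 - t) v0)"
  define G where "G = (\<lambda>t. heatG d (\<eta> / 2 - t) G0)"
  have nh: "nice d \<delta> K (h t) (G t)" for t unfolding h_def G_def v0_def by (rule nice_heat[OF n0])
  have nv0: "nice d \<delta> K v0 G0" unfolding v0_def by (rule n0)
  note bv0 = nice_bdd[OF nv0]
  define B where "B = powr_ub \<delta> K q"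
  have K: "0 < \<delta>" "\<delta> \<le> K" using nice_K[OF nv0] by auto
  have bpow: "bdd_meas d B (\<lambda>x. v x powr q)" if n: "nice d \<delta> K v Gv" for v Gv
    unfolding bdd_meas_def
  proof (intro conjI ballI)
    show "(\<lambda>x. v x powr q) \<in> borel_measurable (lebd d)" using niceD(2)[OF n] by measurable
    show "\<bar>v x powr q\<bar> \<le> B" if "x \<in> Rd d" for x
      using powr_bound[OF K(1) niceD(3,4)[OF n that], of q] by (simp add: B_def)
  qed
  define V where "V = (\<lambda>t. EH \<pi> d t (\<lambda>x. h t x powr q))"
  have hh: "heat d t (h t) x = heat d \<eta> u x" if "0 \<le> t" "t \<le> \<eta> / 2" "x \<in> Rd d" for t x
  proof -
    have "heat d t (h t) x = heat d (\<eta> / 2) v0 x"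
      unfolding h_def using heat_semigroup[OF bv0, of t "\<eta> / 2 - t" x] that by simp
    also have "\<dots> = heat d \<eta> u x"
      unfolding v0_def using heat_semigroup[OF bu, of "\<eta> / 2" "\<eta> / 2" x] that \<eta> by simp
    finally show ?thesis .
  qed
  have n\<eta>: "nice d \<delta> K (heat d (\<eta> / 2) v0) (heatG d (\<eta> / 2) G0)" by (rule nice_heat[OF nv0])
  have hv: "heat d (\<eta> / 2) v0 x = heat d \<eta> u x" if "x \<in> Rd d" for x
    using hh[of 0 x] that \<eta> by (simp add: heat_0 h_def)
  have VV0: "V0 \<le> V t" if t: "0 \<le> t" "t \<le> \<eta> / 2" for t
    unfolding V0_def V_def EH_def
  proof (rule integral_mono_Rd)
    have "integrable \<pi> (\<lambda>x. heat d (\<eta> / 2) v0 x powr q)" by (rule bdd_integrable[OF bpow[OF n\<eta>]])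
    then show "integrable \<pi> (\<lambda>x. heat d \<eta> u x powr q)"
      by (rule Bochner_Integration.integrable_cong[THEN iffD1, OF refl, rotated]) (simp add: hv space_pi)
    show "integrable \<pi> (heat d t (\<lambda>x. h t x powr q))" by (rule EH_integrable[OF bpow[OF nh]])
    show "heat d \<eta> u x powr q \<le> heat d t (\<lambda>x. h t x powr q) x" if x: "x \<in> Rd d" for x
      using heat_jensen[OF nh, of q t t x] q unfolding hh[OF t x] by simp
  qed
  have VB: "V t \<le> B" for t
  proof -
    have "EH \<pi> d t (\<lambda>x. h t x powr q) \<le> EH \<pi> d t (\<lambda>_. B)"
      by (rule EH_mono[OF bpow[OF nh] bdd_meas_const[of B "\<bar>B\<bar>"]])
         (use bdd_measD(2)[OF bpow[OF nh]] abs_le_D1 in auto)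
    then show ?thesis by (simp add: V_def EH_const)
  qed
  have one': "EH \<pi> d t (h t) = 1" if "0 \<le> t" "t \<le> \<eta> / 2" for t
    using one unfolding EH_def by (metis (no_types, lifting) hh[OF that] integral_cong_Rd)
  show V01: "1 \<le> V0"
  proof -
    have "1 = (\<integral>x. heat d \<eta> u x \<partial>\<pi>) powr q" using one by (simp add: EH_def)
    also have "\<dots> \<le> V0"
      unfolding V0_def
    proof (rule jensen_powr_ge[OF prob])
      show "integrable \<pi> (heat d \<eta> u)" by (rule EH_integrable[OF bu])
      have "integrable \<pi> (\<lambda>x. heat d (\<eta> / 2) v0 x powr q)" by (rule bdd_integrable[OF bpow[OF n\<eta>]])
      then show "integrable \<pi> (\<lambda>x. heat d \<eta> u x powr q)"
        by (rule Bochner_Integration.integrable_cong[THEN iffD1, OF refl, rotated]) (simp add: hv space_pi)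
      show "0 \<le> heat d \<eta> u x" if "x \<in> space \<pi>" for x
        using nice_pos[OF n\<eta>, of x] hv[of x] that by (simp add: space_pi)
    qed (use q in simp)
    finally show ?thesis .
  qed
  define A where "A = 2 * w * \<eta> + w powr (2 * (1 - 1 / r)) / \<alpha>"
  have A0: "0 < A" unfolding A_def using w \<eta> al by (intro add_pos_pos) auto
  have lam: "0 \<le> lam0"
  proof -
    have "V0 powr (- w / (2 * (q - 1))) \<le> V0 powr 0"
      using V01 w q by (intro powr_mono) auto
    then have "V0 powr (- w / (2 * (q - 1))) \<le> 1" using V01 by simp
    then show ?thesis unfolding lam0_def A_def[symmetric] using A0 by simp
  qed
  obtain C where C: "0 \<le> C" and low: "\<And>v G y e. nice d \<delta> K v G \<Longrightarrow> y \<in> Rd d \<Longrightarrow> 0 < e \<Longrightarrow> e \<le> 1 \<Longrightarrow>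
    (heat d e v y) powr q + q * (q - 1) / 2 * e * ((heat d e v y) powr (q - 2) * (normd d (heatG d e G y))\<^sup>2) - C * (e * sqrt e)
      \<le> heat d e (\<lambda>x. v x powr q) y"
    using local_lower[OF q, of d \<delta> K] by blast
  have inc: "V t + e * (lam0 * V t) - C * (e * sqrt e) \<le> V (t + e)"
    if t: "0 < t" and e: "0 < e" "e \<le> 1" and te: "t + e \<le> \<eta> / 2" for t e
  proof -
    define v where "v = h (t + e)"
    define Gv where "Gv = G (t + e)"
    have nv: "nice d \<delta> K v Gv" unfolding v_def Gv_def by (rule nh)
    have hv': "heat d e v y = h t y" if "y \<in> Rd d" for y
      unfolding v_def h_def using heat_semigroup[OF bv0, of e "\<eta> / 2 - (t + e)" y] e te that
      by simp
    have hG: "normd d (heatG d e Gv y) = normd d (G t y)" if y: "y \<in> Rd d" for y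
      unfolding normd_def
    proof (rule L2_set_cong[OF refl])
      fix i assume i: "i \<in> {..<d}"
      then have "bdd_meas d K (\<lambda>x. G0 x i)" using niceD(5)[OF nv0] by auto
      from heat_semigroup[OF this, of e "\<eta> / 2 - (t + e)" y] e te y
      show "heatG d e Gv y i = G t y i" by (simp add: Gv_def G_def heatG_def)
    qed
    define E where "E = (\<lambda>y. q * (q - 1) / 2 * (h t y powr (q - 2) * (normd d (G t y))\<^sup>2))"
    obtain K2 where bE: "bdd_meas d K2 E"
    proof -
      obtain K1 where b1: "bdd_meas d K1 (\<lambda>x. h t x powr (q - 2))" using nice_powr[OF nh, of t "q - 2"] nice_bdd by blast
      note b2 = nice_normd_bdd(2)[OF nh[of t]]
      have "bdd_meas d (K1 * (real d * K)\<^sup>2) (\<lambda>y. h t y powr (q - 2) * (normd d (G t y))\<^sup>2)"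
        unfolding bdd_meas_def
      proof (intro conjI ballI)
        show "(\<lambda>y. h t y powr (q - 2) * (normd d (G t y))\<^sup>2) \<in> borel_measurable (lebd d)"
          by (intro borel_measurable_times bdd_measD(1)[OF b1] bdd_measD(1)[OF b2])
        show "\<bar>h t y powr (q - 2) * (normd d (G t y))\<^sup>2\<bar> \<le> K1 * (real d * K)\<^sup>2" if "y \<in> Rd d" for y
          unfolding abs_mult using bdd_measD(2)[OF b1 that] bdd_measD(2)[OF b2 that] bdd_meas_nonneg[OF b1]
          by (intro mult_mono) auto
      qed
      then show ?thesis using that bdd_meas_cmult unfolding E_def by blast
    qed
    have bS: "bdd_meas d (B + \<bar>e\<bar> * K2 + \<bar>- C * (e * sqrt e)\<bar>) (\<lambda>y. h t y powr q + e * E y + - C * (e * sqrt e))"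
      by (rule bdd_meas_add[OF bdd_meas_add[OF bpow[OF nh] bdd_meas_cmult[OF bE]] bdd_meas_const[OF order_refl]])
    have "EH \<pi> d t (\<lambda>y. h t y powr q + e * E y + - C * (e * sqrt e)) \<le> EH \<pi> d t (heat d e (\<lambda>x. v x powr q))"
    proof (rule EH_mono[OF bS heat_bdd[OF bpow[OF nv]]])
      fix y assume y: "y \<in> Rd d"
      have "q * (q - 1) / 2 * e * (h t y powr (q - 2) * (normd d (G t y))\<^sup>2) = e * E y" by (simp add: E_def)
      then show "h t y powr q + e * E y + - C * (e * sqrt e) \<le> heat d e (\<lambda>x. v x powr q) y"
        using low[OF nv y e] unfolding hv'[OF y] hG[OF y] by linarith
    qed
    also have "EH \<pi> d t (heat d e (\<lambda>x. v x powr q)) = V (t + e)"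
      unfolding V_def v_def by (rule EH_semigroup[OF bpow[OF nh]]) (use t e in auto)
    also have "EH \<pi> d t (\<lambda>y. h t y powr q + e * E y + - C * (e * sqrt e)) = V t + e * EH \<pi> d t E - C * (e * sqrt e)"
      by (subst EH_add[OF bdd_meas_add[OF bpow[OF nh] bdd_meas_cmult[OF bE]] bdd_meas_const[OF order_refl]],
          subst EH_add[OF bpow[OF nh] bdd_meas_cmult[OF bE]]) (simp add: EH_cmult EH_const V_def)
    finally have 1: "V t + e * EH \<pi> d t E - C * (e * sqrt e) \<le> V (t + e)" .
    have "lam0 * V t \<le> EH \<pi> d t E"
      unfolding lam0_def V_def E_def
      by (rule fisher_lower[OF L nh one' _ _ q w V01]) (use VV0[of t] t e te \<eta> in \<open>auto simp: V_def\<close>)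
    then have "e * (lam0 * V t) \<le> e * EH \<pi> d t E" using e by (intro mult_left_mono) auto
    with 1 show ?thesis by linarith
  qed
  (* Gronwall in the form that the discounted moment is nondecreasing *)
  define \<phi> where "\<phi> = (\<lambda>t. - (exp (- lam0 * t) * V t))"
  have "\<phi> (\<eta> / 2) \<le> \<phi> (\<eta> / 4)"
  proof (rule increments_le[where \<phi> = \<phi> and a = "\<eta> / 4" and b = "\<eta> / 2" and C = "C + lam0\<^sup>2 * B"])
    show "\<eta> / 4 \<le> \<eta> / 2" using \<eta> by simp
    have B0: "0 \<le> B" by (simp add: B_def)
    show "0 \<le> C + lam0\<^sup>2 * B" using C B0 by simp
    fix t e assume t: "\<eta> / 4 \<le> t" and e: "0 < e" "e \<le> (1::real)" and te: "t + e \<le> \<eta> / 2"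
    have t0: "0 < t" using t \<eta> by linarith
    let ?x = "lam0 * e" let ?c = "exp (- lam0 * t)"
    have x0: "0 \<le> ?x" using lam e by simp
    have Vt: "0 \<le> V t" using VV0[of t] V01 t0 te e by simp
    have c1: "?c \<le> 1" using lam t0 by simp
    have e1: "exp (- lam0 * (t + e)) = ?c * exp (- ?x)" by (simp add: exp_add[symmetric] algebra_simps)
    have ex1: "exp (- ?x) \<le> 1" using x0 by simp
    have "exp (- lam0 * (t + e)) * (V t * (1 + ?x) - C * (e * sqrt e)) \<le> exp (- lam0 * (t + e)) * V (t + e)"
      using inc[OF t0 e te] by (intro mult_left_mono) (auto simp: algebra_simps)
    moreover have "?c * V t - (C + lam0\<^sup>2 * B) * (e * sqrt e) \<le> exp (- lam0 * (t + e)) * (V t * (1 + ?x) - C * (e * sqrt e))"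
    proof -
      have "(?c * V t) * (1 - ?x\<^sup>2) \<le> (?c * V t) * (exp (- ?x) * (1 + ?x))"
        using Vt by (intro mult_left_mono exp_times_linear x0) auto
      moreover have "(?c * V t) * ?x\<^sup>2 \<le> (1 * B) * (lam0\<^sup>2 * (e * sqrt e))"
      proof (intro mult_mono)
        show "?x\<^sup>2 \<le> lam0\<^sup>2 * (e * sqrt e)"
          using mult_left_mono[OF mult_self_le_mult_sqrt[OF e], of "lam0\<^sup>2"] by (simp add: power_mult_distrib power2_eq_square mult_ac)
      qed (use c1 VB Vt B0 in auto)
      moreover have "(?c * exp (- ?x)) * (C * (e * sqrt e)) \<le> 1 * (C * (e * sqrt e))"
        using c1 ex1 C e by (intro mult_right_mono mult_le_one) auto
      ultimately show ?thesis unfolding e1 by (simp add: algebra_simps)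
    qed
    ultimately show "\<phi> (t + e) \<le> \<phi> t + (C + lam0\<^sup>2 * B) * (e * sqrt e)"
      unfolding \<phi>_def by linarith
  qed
  then have "exp (- lam0 * (\<eta> / 4)) * V (\<eta> / 4) \<le> exp (- lam0 * (\<eta> / 2)) * V (\<eta> / 2)" by (simp add: \<phi>_def)
  then have m: "exp (lam0 * (\<eta> / 2)) * (exp (- lam0 * (\<eta> / 4)) * V (\<eta> / 4)) \<le> exp (lam0 * (\<eta> / 2)) * (exp (- lam0 * (\<eta> / 2)) * V (\<eta> / 2))"
    by (intro mult_left_mono) auto
  have e1: "exp (lam0 * (\<eta> / 2)) * exp (- lam0 * (\<eta> / 4)) = exp (\<eta> / 4 * lam0)"
    unfolding exp_add[symmetric] by (rule arg_cong[of _ _ exp]) (simp add: field_simps)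
  have e2: "exp (lam0 * (\<eta> / 2)) * exp (- lam0 * (\<eta> / 2)) = 1"
    unfolding exp_add[symmetric] by simp
  have "exp (\<eta> / 4 * lam0) * V (\<eta> / 4) \<le> V (\<eta> / 2)"
    using m unfolding mult.assoc[symmetric] e1 e2 by (simp only: mult_1_left)
  moreover have "exp (\<eta> / 4 * lam0) * V0 \<le> exp (\<eta> / 4 * lam0) * V (\<eta> / 4)"
    using VV0[of "\<eta> / 4"] \<eta> by (intro mult_left_mono) auto
  moreover have "V (\<eta> / 2) \<le> EH \<pi> d \<eta> (\<lambda>x. u x powr q)"
  proof -
    have bq: "bdd_meas d (powr_ub \<delta> M q) (\<lambda>x. u x powr q)"
      unfolding bdd_meas_def
    proof (intro conjI ballI)
      show "(\<lambda>x. u x powr q) \<in> borel_measurable (lebd d)" using um by measurable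
      show "\<bar>u x powr q\<bar> \<le> powr_ub \<delta> M q" if "x \<in> Rd d" for x
        using powr_bound[OF \<delta>, of "u x" M q] ub[OF that] by simp
    qed
    have h0: "h (\<eta> / 2) x = v0 x" if "x \<in> Rd d" for x using that by (simp add: h_def heat_0)
    have "V (\<eta> / 2) = EH \<pi> d (\<eta> / 2) (\<lambda>x. v0 x powr q)"
      unfolding V_def by (rule EH_cong) (simp add: h0)
    also have "\<dots> \<le> EH \<pi> d (\<eta> / 2) (heat d (\<eta> / 2) (\<lambda>x. u x powr q))"
    proof (rule EH_mono[OF bpow[OF nv0] heat_bdd[OF bq]])
      fix x assume "x \<in> Rd d"
      show "v0 x powr q \<le> heat d (\<eta> / 2) (\<lambda>x. u x powr q) x"
        unfolding v0_def heat_def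
        by (rule jensen_powr_ge[OF prob_stdg heat_integrable[OF bu] heat_integrable[OF bq]])
           (use ub[OF mv_Rd] \<delta> q in \<open>auto intro: order_trans[OF less_imp_le]\<close>)
    qed
    also have "\<dots> = EH \<pi> d \<eta> (\<lambda>x. u x powr q)"
      using EH_semigroup[OF bq, of "\<eta> / 2" "\<eta> / 2"] \<eta> by simp
    finally show ?thesis .
  qed
  ultimately show "exp (\<eta> / 4 * lam0) * V0 \<le> EH \<pi> d \<eta> (\<lambda>x. u x powr q)" by linarith
qed

end

section \<open>Functions with a Lipschitz gradient\<close>

lemma has_deriv_of_quadratic:
  fixes F :: "real \<Rightarrow> real"
  assumes b: "\<And>h. \<bar>h\<bar> \<le> 1 \<Longrightarrow> \<bar>F (t + h) - F t - D * h\<bar> \<le> L * h\<^sup>2"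
  shows "(F has_real_derivative D) (at t)"
proof -
  have "(\<lambda>h. (F (t + h) - F t) / h - D) \<midarrow>0\<rightarrow> 0"
  proof (rule Lim_null_comparison)
    show "\<forall>\<^sub>F h in at 0. norm ((F (t + h) - F t) / h - D) \<le> L * \<bar>h\<bar>"
      unfolding eventually_at
    proof (intro exI[of _ 1] conjI ballI impI)
      fix h :: real assume "h \<noteq> 0 \<and> dist h 0 < 1"
      then have h: "h \<noteq> 0" "\<bar>h\<bar> \<le> 1" by simp_all
      have "\<bar>(F (t + h) - F t) / h - D\<bar> = \<bar>F (t + h) - F t - D * h\<bar> / \<bar>h\<bar>"
        using h by (simp add: abs_divide[symmetric] diff_divide_distrib)
      also have "\<dots> \<le> L * h\<^sup>2 / \<bar>h\<bar>" using b[OF h(2)] by (rule divide_right_mono) simp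
      also have "\<dots> = L * \<bar>h\<bar>" using h by (simp add: power2_eq_square abs_mult_self_eq[of h, symmetric] del: abs_mult_self_eq)
      finally show "norm ((F (t + h) - F t) / h - D) \<le> L * \<bar>h\<bar>" by simp
    qed simp
    show "(\<lambda>h. L * \<bar>h\<bar>) \<midarrow>0\<rightarrow> 0" by (rule tendsto_eq_intros refl | simp)+
  qed
  then have "(\<lambda>h. (F (t + h) - F t) / h) \<midarrow>0\<rightarrow> D" by (simp add: LIM_zero_iff)
  then show ?thesis by (simp add: DERIV_def)
qed

lemma distd_normd: "distd d x y = normd d (\<lambda>i. x i - y i)"
  by (simp add: distd_def normd_def)

lemma distd_mv: "distd d (mv d x s w) x = \<bar>s\<bar> * normd d w"
proof -
  have "distd d (mv d x s w) x = normd d (\<lambda>i. s * w i)"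
    unfolding distd_def normd_def by (rule L2_set_cong) (auto simp: mv_nth)
  then show ?thesis by (simp add: normd_scale)
qed

lemma normd_mono: "(\<And>i. i < d \<Longrightarrow> \<bar>a i\<bar> \<le> \<bar>b i\<bar>) \<Longrightarrow> normd d a \<le> normd d b"
  unfolding normd_def L2_set_def by (intro real_sqrt_le_mono sum_mono) (simp add: abs_le_square_iff)

lemma Rd_diff: "x \<in> Rd d \<Longrightarrow> y \<in> Rd d \<Longrightarrow> mv d x 1 (mv d y (-1) x) = y"
  by (rule Rd_eqI[OF mv_Rd]) (simp_all add: mv_nth)

text \<open>A crude constant, obtained by changing one coordinate at a time; it shows that f is differentiable along
  lines, from which the sharp constant follows.\<close>

lemma smooth_grad_qapx:
  assumes s: "smooth_grad d \<beta> f" and \<beta>: "0 \<le> \<beta>"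
  shows "qapx d (real d * \<beta>) f (gradd d f)"
  unfolding qapx_def
proof (intro ballI)
  fix x w assume x: "x \<in> Rd d" and w: "w \<in> Rd d"
  define y where "y = (\<lambda>k. \<lambda>i\<in>{..<d}. if i < k then x i + w i else x i)"
  have yR: "y k \<in> Rd d" for k by (auto simp: y_def)
  let ?G = "gradd d f x"
  have step: "\<bar>f (y (Suc k)) - f (y k) - ?G k * w k\<bar> \<le> \<beta> * (normd d w)\<^sup>2" if k: "k < d" for k
  proof -
    let ?F = "\<lambda>t. f ((y k)(k := t)) - ?G k * t"
    let ?S = "closed_segment (x k) (x k + w k)"
    have "norm (?F (x k + w k) - ?F (x k)) \<le> (\<beta> * normd d w) * norm (x k + w k - x k)"
    proof (rule field_differentiable_bound[where S = ?S and f = ?F and f' = "\<lambda>t. gradd d f ((y k)(k := t)) k - ?G k"])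
      fix t assume t: "t \<in> ?S"
      let ?z = "(y k)(k := t)"
      have z: "?z \<in> Rd d" by (rule upd_Rd[OF yR k])
      have "(\<lambda>s. f (?z(k := s))) differentiable at (?z k)"
        using s z k unfolding smooth_grad_def has_partials_def by blast
      then have "((\<lambda>s. f (?z(k := s))) has_real_derivative gradd d f ?z k) (at (?z k))"
        using k by (simp add: gradd_def DERIV_deriv_iff_real_differentiable)
      then have "((\<lambda>s. f ((y k)(k := s))) has_real_derivative gradd d f ?z k) (at t)" by (simp add: fun_upd_upd)
      then have "(?F has_real_derivative gradd d f ?z k - ?G k) (at t)"
        by (auto intro!: derivative_eq_intros)
      then show "(?F has_real_derivative gradd d f ?z k - ?G k) (at t within ?S)"
        by (rule has_field_derivative_at_within)
      have "\<bar>gradd d f ?z k - ?G k\<bar> \<le> distd d (gradd d f ?z) ?G"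
        unfolding distd_normd using abs_le_normd[OF k, of "\<lambda>i. gradd d f ?z i - ?G i"] by simp
      also have "\<dots> \<le> \<beta> * distd d ?z x" using s z x unfolding smooth_grad_def by blast
      also have "\<dots> \<le> \<beta> * normd d w"
      proof (rule mult_left_mono[OF _ \<beta>])
        have tk: "\<bar>t - x k\<bar> \<le> \<bar>w k\<bar>" using t by (auto simp: closed_segment_eq_real_ivl split: if_splits)
        show "distd d ?z x \<le> normd d w"
          unfolding distd_normd by (rule normd_mono) (use tk in \<open>auto simp: y_def\<close>)
      qed
      finally show "norm (gradd d f ?z k - ?G k) \<le> \<beta> * normd d w" by simp
    qed auto
    also have "\<dots> \<le> (\<beta> * normd d w) * normd d w"
      using abs_le_normd[OF k, of w] \<beta> by (intro mult_left_mono) auto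
    finally have "\<bar>?F (x k + w k) - ?F (x k)\<bar> \<le> \<beta> * (normd d w)\<^sup>2" by (simp add: power2_eq_square)
    moreover have "(y k)(k := x k + w k) = y (Suc k)" "(y k)(k := x k) = y k"
      by (rule Rd_eqI[OF upd_Rd[OF yR k] yR]; use k in \<open>auto simp: y_def\<close>)+
    ultimately show ?thesis by (simp add: algebra_simps)
  qed
  have "k \<le> d \<Longrightarrow> \<bar>f (y k) - f x - (\<Sum>i<k. ?G i * w i)\<bar> \<le> real k * (\<beta> * (normd d w)\<^sup>2)" for k
  proof (induction k)
    case 0
    have "y 0 = x" by (rule Rd_eqI[OF yR x]) (simp add: y_def)
    then show ?case by simp
  next
    case (Suc k)
    then have "\<bar>f (y k) - f x - (\<Sum>i<k. ?G i * w i)\<bar> \<le> real k * (\<beta> * (normd d w)\<^sup>2)" by simp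
    with step[of k] Suc.prems have "\<bar>f (y (Suc k)) - f x - ((\<Sum>i<k. ?G i * w i) + ?G k * w k)\<bar> \<le> \<beta> * (normd d w)\<^sup>2 + real k * (\<beta> * (normd d w)\<^sup>2)"
      by linarith
    then show ?case by (simp add: algebra_simps)
  qed
  from this[of d] have "\<bar>f (y d) - f x - dotp d ?G w\<bar> \<le> real d * (\<beta> * (normd d w)\<^sup>2)" by (simp add: dotp_def)
  moreover have "y d = mv d x 1 w" by (rule Rd_eqI[OF yR mv_Rd]) (simp add: y_def mv_nth)
  ultimately show "\<bar>f (mv d x 1 w) - f x - dotp d ?G w\<bar> \<le> real d * \<beta> * (normd d w)\<^sup>2" by simp
qed

lemma dotp_diff_left: "dotp d a z - dotp d b z = dotp d (\<lambda>i. a i - b i) z"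
  by (simp add: dotp_def sum_subtractf left_diff_distrib)

text \<open>Along the segment, f minus its linearization minus (plus) the quadratic bound has a nonpositive (nonnegative)
  derivative, by the Lipschitz bound for the gradient.\<close>

lemma smooth_quadratic:
  assumes s: "smooth_grad d \<beta> f" and \<beta>: "0 \<le> \<beta>" and x: "x \<in> Rd d" and w: "w \<in> Rd d"
  shows "\<bar>f (mv d x 1 w) - f x - dotp d (gradd d f x) w\<bar> \<le> \<beta> / 2 * (normd d w)\<^sup>2"
proof -
  let ?G = "gradd d f"
  define n where "n = (normd d w)\<^sup>2"
  define \<phi> where "\<phi> = (\<lambda>t. f (mv d x t w))"
  note q = smooth_grad_qapx[OF s \<beta>]
  have d: "(\<phi> has_real_derivative dotp d (?G (mv d x t w)) w) (at t)" for t
  proof (rule has_deriv_of_quadratic)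
    fix h :: real
    have e: "mv d (mv d x t w) 1 (mv d (zer d) h w) = mv d x (t + h) w"
      by (rule Rd_eqI[OF mv_Rd mv_Rd]) (simp add: mv_nth zer_def algebra_simps)
    have "\<bar>f (mv d (mv d x t w) 1 (mv d (zer d) h w)) - f (mv d x t w) - dotp d (?G (mv d x t w)) (mv d (zer d) h w)\<bar>
       \<le> real d * \<beta> * (normd d (mv d (zer d) h w))\<^sup>2"
      by (rule q[unfolded qapx_def, rule_format, OF mv_Rd mv_Rd])
    then show "\<bar>\<phi> (t + h) - \<phi> t - dotp d (?G (mv d x t w)) w * h\<bar> \<le> (real d * \<beta> * n) * h\<^sup>2"
      unfolding e dotp_scaled normd_scaled by (simp add: \<phi>_def n_def power_mult_distrib mult_ac)
  qed
  have G: "\<bar>dotp d (?G (mv d x t w)) w - dotp d (?G x) w\<bar> \<le> \<beta> * t * n" if t: "0 \<le> t" for t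
  proof -
    have "\<bar>dotp d (?G (mv d x t w)) w - dotp d (?G x) w\<bar> \<le> distd d (?G (mv d x t w)) (?G x) * normd d w"
      unfolding dotp_diff_left distd_normd by (rule dotp_le)
    also have "\<dots> \<le> (\<beta> * distd d (mv d x t w) x) * normd d w"
      using s x mv_Rd unfolding smooth_grad_def by (intro mult_right_mono) auto
    also have "\<dots> = \<beta> * t * n" using t by (simp add: distd_mv n_def power2_eq_square)
    finally show ?thesis .
  qed
  have 1: "\<phi> 1 - dotp d (?G x) w * 1 - \<beta> * n * 1\<^sup>2 / 2 \<le> \<phi> 0 - dotp d (?G x) w * 0 - \<beta> * n * 0\<^sup>2 / 2"
  proof (rule DERIV_nonpos_imp_nonincreasing[of 0 1 "\<lambda>t. \<phi> t - dotp d (?G x) w * t - \<beta> * n * t\<^sup>2 / 2"])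
    fix t :: real assume t: "0 \<le> t" "t \<le> 1"
    have "((\<lambda>t. \<phi> t - dotp d (?G x) w * t - \<beta> * n * t\<^sup>2 / 2) has_real_derivative
        dotp d (?G (mv d x t w)) w - dotp d (?G x) w - \<beta> * n * t) (at t)"
      by (rule derivative_eq_intros d | simp)+
    moreover have "dotp d (?G (mv d x t w)) w - dotp d (?G x) w - \<beta> * n * t \<le> 0" using G[OF t(1)] by (simp add: algebra_simps)
    ultimately show "\<exists>y. ((\<lambda>t. \<phi> t - dotp d (?G x) w * t - \<beta> * n * t\<^sup>2 / 2) has_real_derivative y) (at t) \<and> y \<le> 0" by blast
  qed simp
  have 2: "\<phi> 0 - dotp d (?G x) w * 0 + \<beta> * n * 0\<^sup>2 / 2 \<le> \<phi> 1 - dotp d (?G x) w * 1 + \<beta> * n * 1\<^sup>2 / 2"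
  proof (rule DERIV_nonneg_imp_nondecreasing[of 0 1 "\<lambda>t. \<phi> t - dotp d (?G x) w * t + \<beta> * n * t\<^sup>2 / 2"])
    fix t :: real assume t: "0 \<le> t" "t \<le> 1"
    have "((\<lambda>t. \<phi> t - dotp d (?G x) w * t + \<beta> * n * t\<^sup>2 / 2) has_real_derivative
        dotp d (?G (mv d x t w)) w - dotp d (?G x) w + \<beta> * n * t) (at t)"
      by (rule derivative_eq_intros d | simp)+
    moreover have "0 \<le> dotp d (?G (mv d x t w)) w - dotp d (?G x) w + \<beta> * n * t" using G[OF t(1)] by (simp add: algebra_simps)
    ultimately show "\<exists>y. ((\<lambda>t. \<phi> t - dotp d (?G x) w * t + \<beta> * n * t\<^sup>2 / 2) has_real_derivative y) (at t) \<and> 0 \<le> y" by blast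
  qed simp
  have "\<phi> 0 = f x" using x by (simp add: \<phi>_def mv_0)
  have c: "\<beta> / 2 * n = \<beta> * n / 2" by simp
  have "\<bar>\<phi> 1 - \<phi> 0 - dotp d (?G x) w\<bar> \<le> \<beta> / 2 * n"
    unfolding abs_le_iff c using 1 2 by simp
  then show ?thesis using \<open>\<phi> 0 = f x\<close> by (simp add: \<phi>_def n_def)
qed

lemma qapx_continuous:
  assumes q: "qapx d L v G" and L: "0 \<le> L"
  shows "continuous_map (product_topology (\<lambda>_. euclideanreal) {..<d}) euclideanreal v"
proof (rule continuous_map_of_local_lipschitz)
  fix x assume x: "x \<in> Rd d"
  show "\<exists>C. \<forall>w\<in>Rd d. normd d w \<le> 1 \<longrightarrow> \<bar>v (mv d x 1 w) - v x\<bar> \<le> C * normd d w"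
  proof (intro exI[of _ "normd d (G x) + L"] ballI impI)
    fix w assume w: "w \<in> Rd d" "normd d w \<le> 1"
    have "\<bar>v (mv d x 1 w) - v x - dotp d (G x) w\<bar> \<le> L * (normd d w)\<^sup>2" using q[unfolded qapx_def, rule_format, OF x w(1)] .
    moreover have "L * (normd d w)\<^sup>2 \<le> L * normd d w"
      using w L by (intro mult_left_mono) (auto simp: power2_eq_square mult_left_le)
    ultimately show "\<bar>v (mv d x 1 w) - v x\<bar> \<le> (normd d (G x) + L) * normd d w"
      using dotp_le[of d "G x" w] by (simp add: distrib_right)
  qed
qed

text \<open>Extending points by zero to infinite sequences is measurable into the countable product, whose product sigma-algebra
  is the Borel one; an open set is the preimage of an open set of sequences.\<close>

lemma openin_sets_lebd:
  assumes U: "openin (product_topology (\<lambda>_. euclideanreal) {..<d}) U"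
  shows "U \<in> sets (lebd d)"
proof -
  let ?r = "\<lambda>x :: nat \<Rightarrow> real. restrict x {..<d}"
  let ?T = "product_topology (\<lambda>_::nat. euclideanreal) UNIV"
  have T: "?T = euclidean"
    by (simp add: euclidean_product_topology)
  have "continuous_map ?T (product_topology (\<lambda>_. euclideanreal) {..<d}) ?r"
    unfolding continuous_map_componentwise
    by (auto intro!: continuous_map_product_projection simp: restrict_def extensional_def cong: if_cong)
  then have "openin ?T {x \<in> topspace ?T. ?r x \<in> U}"
    using U by (rule openin_continuous_map_preimage)
  then have op: "open {x. ?r x \<in> U}" unfolding T by simp
  have "{x. ?r x \<in> U} \<in> sets (Pi\<^sub>M UNIV (\<lambda>_::nat. borel :: real measure))"
    unfolding sets_PiM_equal_borel using op by (rule borel_open)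
  moreover have m: "(\<lambda>x i. if i < d then x i else 0) \<in> measurable (lebd d) (Pi\<^sub>M UNIV (\<lambda>_::nat. borel :: real measure))"
  proof (rule measurable_PiM_single')
    fix i :: nat
    show "(\<lambda>x. if i < d then x i else 0) \<in> measurable (lebd d) (borel :: real measure)"
      by (cases "i < d") (auto intro: lebd_component)
  qed auto
  ultimately have "(\<lambda>x i. if i < d then x i else 0) -` {x. ?r x \<in> U} \<inter> space (lebd d) \<in> sets (lebd d)"
    by (rule measurable_sets[rotated])
  also have "(\<lambda>x i. if i < d then x i else 0) -` {x. ?r x \<in> U} \<inter> space (lebd d) = U"
  proof -
    have "restrict (\<lambda>i. if i < d then x i else 0) {..<d} = x" if "x \<in> Rd d" for x
      by (rule Rd_eqI[OF _ that]) auto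
    moreover have "U \<subseteq> Rd d" using openin_subset[OF U] by simp
    ultimately show ?thesis by auto
  qed
  finally show ?thesis .
qed

lemma continuous_map_measurable:
  assumes c: "continuous_map (product_topology (\<lambda>_. euclideanreal) {..<d}) euclideanreal v"
  shows "v \<in> borel_measurable (lebd d)"
proof (rule borel_measurableI)
  fix S :: "real set" assume "open S"
  then have "openin (product_topology (\<lambda>_. euclideanreal) {..<d}) {x \<in> topspace (product_topology (\<lambda>_. euclideanreal) {..<d}). v x \<in> S}"
    using c by (intro openin_continuous_map_preimage) auto
  then have "{x \<in> Rd d. v x \<in> S} \<in> sets (lebd d)" using openin_sets_lebd by simp
  moreover have "v -` S \<inter> space (lebd d) = {x \<in> Rd d. v x \<in> S}" by auto
  ultimately show "v -` S \<inter> space (lebd d) \<in> sets (lebd d)" by simp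
qed

section \<open>The conditional law of the target given the noisy point\<close>

definition tiltG :: "nat \<Rightarrow> ((nat \<Rightarrow> real) \<Rightarrow> real) \<Rightarrow> real \<Rightarrow> (nat \<Rightarrow> real) \<Rightarrow> (nat \<Rightarrow> real) \<Rightarrow> nat \<Rightarrow> real" where
  "tiltG d f \<eta> y x = (\<lambda>i\<in>{..<d}. gradd d f x i + (x i - y i) / \<eta>)"

lemma distd_sq: "(distd d x y)\<^sup>2 = (\<Sum>i<d. (x i - y i)\<^sup>2)"
  by (simp add: distd_normd normd_sq)

lemma tilt_expand:
  assumes \<eta>: "0 < \<eta>" and x: "x \<in> Rd d" and w: "w \<in> Rd d"
  shows "tilt d f \<eta> y (mv d x 1 w) - tilt d f \<eta> y x - dotp d (tiltG d f \<eta> y x) w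
     = f (mv d x 1 w) - f x - dotp d (gradd d f x) w + 1 / (2 * \<eta>) * (normd d w)\<^sup>2"
proof -
  have "1 / (2 * \<eta>) * (distd d (mv d x 1 w) y)\<^sup>2
     = 1 / (2 * \<eta>) * (distd d x y)\<^sup>2 + (\<Sum>i<d. (x i - y i) / \<eta> * w i) + 1 / (2 * \<eta>) * (normd d w)\<^sup>2"
    unfolding distd_sq normd_sq sum_distrib_left sum.distrib[symmetric]
    by (rule sum.cong) (use \<eta> in \<open>simp_all add: mv_nth power2_eq_square field_simps\<close>)
  moreover have "dotp d (tiltG d f \<eta> y x) w = dotp d (gradd d f x) w + (\<Sum>i<d. (x i - y i) / \<eta> * w i)"
    unfolding dotp_def tiltG_def sum.distrib[symmetric] by (rule sum.cong) (simp_all add: distrib_right)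
  ultimately show ?thesis by (simp add: tilt_def)
qed

locale smooth_tilt =
  fixes d :: nat and f :: "(nat \<Rightarrow> real) \<Rightarrow> real" and \<beta> \<eta> :: real
  assumes d1: "1 \<le> d" and smooth: "smooth_grad d \<beta> f" and \<beta>: "0 < \<beta>" and \<eta>: "0 < \<eta>" "\<eta> * \<beta> < 1"
    and integrable_f: "integrable (lebd d) (\<lambda>x. exp (- f x))"
begin

lemma eta_beta: "\<beta> < 1 / \<eta>" using \<eta> by (simp add: field_simps)

lemma f_quadratic: "x \<in> Rd d \<Longrightarrow> w \<in> Rd d \<Longrightarrow> \<bar>f (mv d x 1 w) - f x - dotp d (gradd d f x) w\<bar> \<le> \<beta> / 2 * (normd d w)\<^sup>2"
  using smooth_quadratic[OF smooth] \<beta> by simp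

lemma f_continuous: "continuous_map (product_topology (\<lambda>_. euclideanreal) {..<d}) euclideanreal f"
  using qapx_continuous[OF smooth_grad_qapx[OF smooth]] \<beta> by simp

lemma f_measurable[measurable]: "f \<in> borel_measurable (lebd d)"
  by (rule continuous_map_measurable[OF f_continuous])

lemma tilt_bounds:
  assumes x: "x \<in> Rd d" and w: "w \<in> Rd d"
  shows "tilt d f \<eta> y x + dotp d (tiltG d f \<eta> y x) w + (1 / \<eta> - \<beta>) / 2 * (normd d w)\<^sup>2 \<le> tilt d f \<eta> y (mv d x 1 w)"
    "tilt d f \<eta> y (mv d x 1 w) \<le> tilt d f \<eta> y x + dotp d (tiltG d f \<eta> y x) w + (1 / \<eta> + \<beta>) / 2 * (normd d w)\<^sup>2"
proof -
  have 1: "(1 / \<eta> - \<beta>) / 2 * (normd d w)\<^sup>2 = 1 / (2 * \<eta>) * (normd d w)\<^sup>2 - \<beta> / 2 * (normd d w)\<^sup>2"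
    "(1 / \<eta> + \<beta>) / 2 * (normd d w)\<^sup>2 = 1 / (2 * \<eta>) * (normd d w)\<^sup>2 + \<beta> / 2 * (normd d w)\<^sup>2"
    using \<eta> by (simp_all add: field_simps)
  show "tilt d f \<eta> y x + dotp d (tiltG d f \<eta> y x) w + (1 / \<eta> - \<beta>) / 2 * (normd d w)\<^sup>2 \<le> tilt d f \<eta> y (mv d x 1 w)"
    using tilt_expand[OF \<eta>(1) x w, of f y] f_quadratic[OF x w] unfolding 1 abs_le_iff by linarith
  show "tilt d f \<eta> y (mv d x 1 w) \<le> tilt d f \<eta> y x + dotp d (tiltG d f \<eta> y x) w + (1 / \<eta> + \<beta>) / 2 * (normd d w)\<^sup>2"
    using tilt_expand[OF \<eta>(1) x w, of f y] f_quadratic[OF x w] unfolding 1 abs_le_iff by linarith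
qed

lemma tilt_qapx: "qapx d ((1 / \<eta> + \<beta>) / 2) (tilt d f \<eta> y) (tiltG d f \<eta> y)"
  unfolding qapx_def
proof (intro ballI)
  fix x w assume xw: "x \<in> Rd d" "w \<in> Rd d"
  have "(- (1 / \<eta> + \<beta>)) / 2 * (normd d w)\<^sup>2 \<le> (1 / \<eta> - \<beta>) / 2 * (normd d w)\<^sup>2"
    using \<eta> by (intro mult_right_mono) auto
  then have "- ((1 / \<eta> + \<beta>) / 2 * (normd d w)\<^sup>2) \<le> (1 / \<eta> - \<beta>) / 2 * (normd d w)\<^sup>2"
    by (simp only: minus_divide_left[symmetric] mult_minus_left)
  then show "\<bar>tilt d f \<eta> y (mv d x 1 w) - tilt d f \<eta> y x - dotp d (tiltG d f \<eta> y x) w\<bar> \<le> (1 / \<eta> + \<beta>) / 2 * (normd d w)\<^sup>2"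
    using tilt_bounds[OF xw, of y] unfolding abs_le_iff by (intro conjI; linarith)
qed

lemma tilt_continuous: "continuous_map (product_topology (\<lambda>_. euclideanreal) {..<d}) euclideanreal (tilt d f \<eta> y)"
  using qapx_continuous[OF tilt_qapx] \<beta> \<eta> by simp

lemma tilt_measurable[measurable]: "tilt d f \<eta> y \<in> borel_measurable (lebd d)"
  by (rule continuous_map_measurable[OF tilt_continuous])

text \<open>Strong convexity makes the potential coercive, so its infimum over the space is attained on a compact cube.\<close>

lemma tilt_minimizer_exists: "\<exists>x\<in>Rd d. \<forall>z\<in>Rd d. tilt d f \<eta> y x \<le> tilt d f \<eta> y z"
proof -
  let ?g = "tilt d f \<eta> y" let ?z = "zer d"
  let ?T = "product_topology (\<lambda>_. euclideanreal) {..<d}"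
  define a where "a = (1 / \<eta> - \<beta>) / 2"
  have a: "0 < a" using eta_beta by (simp add: a_def)
  define N where "N = normd d (tiltG d f \<eta> y ?z)"
  (* outside the ball of radius N / a the quadratic growth dominates the linear term *)
  define R where "R = N / a + 1"
  have N0: "0 \<le> N" by (simp add: N_def)
  have R0: "0 < R" using N0 a by (simp add: R_def add_nonneg_pos)
  let ?B = "PiE {..<d} (\<lambda>_. {- R..R})"
  have far: "?g ?z \<le> ?g x" if x: "x \<in> Rd d" and nb: "x \<notin> ?B" for x
  proof -
    from nb x obtain i where i: "i < d" "x i \<notin> {- R..R}" by (auto simp: PiE_iff)
    then have "R < \<bar>x i\<bar>" by auto
    then have nx: "R \<le> normd d x" using abs_le_normd[OF i(1), of x] by linarith
    have e: "mv d ?z 1 x = x" by (rule Rd_eqI[OF mv_Rd x]) (simp add: mv_nth zer_def)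
    have "?g ?z + dotp d (tiltG d f \<eta> y ?z) x + a * (normd d x)\<^sup>2 \<le> ?g x"
      using tilt_bounds(1)[OF zer_Rd x, of y] unfolding e a_def .
    moreover have "- (N * normd d x) \<le> dotp d (tiltG d f \<eta> y ?z) x"
      using dotp_le[of d "tiltG d f \<eta> y ?z" x] unfolding N_def abs_le_iff by linarith
    moreover have "N * normd d x \<le> a * (normd d x)\<^sup>2"
    proof -
      have "N \<le> a * R" using a by (simp add: R_def distrib_left)
      also have "\<dots> \<le> a * normd d x" using a nx by (intro mult_left_mono) auto
      finally have "N * normd d x \<le> a * normd d x * normd d x" by (intro mult_right_mono) auto
      then show ?thesis by (simp add: power2_eq_square)
    qed
    ultimately show ?thesis by linarith
  qed
  have "compactin ?T ?B" by (subst compactin_PiE) auto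
  then have "compactin euclideanreal (?g ` ?B)"
    by (rule image_compactin[OF _ tilt_continuous])
  then have cp: "compact (?g ` ?B)" by simp
  have zB: "?z \<in> ?B" using R0 by (auto simp: zer_def)
  then have "?g ` ?B \<noteq> {}" by blast
  from compact_attains_inf[OF cp this] obtain x where x: "x \<in> ?B" and m: "\<And>z. z \<in> ?B \<Longrightarrow> ?g x \<le> ?g z" by auto
  have xR: "x \<in> Rd d" using x by (auto simp: PiE_iff)
  have "?g x \<le> ?g z" if "z \<in> Rd d" for z
    using m[of z] m[OF zB] far[OF that] by (cases "z \<in> ?B") auto
  then show ?thesis using xR by blast
qed

lemma prox_Rd: "prox d f \<eta> y \<in> Rd d" and prox_min: "z \<in> Rd d \<Longrightarrow> tilt d f \<eta> y (prox d f \<eta> y) \<le> tilt d f \<eta> y z"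
proof -
  from tilt_minimizer_exists[of y] obtain x where x: "x \<in> Rd d" "\<And>z. z \<in> Rd d \<Longrightarrow> tilt d f \<eta> y x \<le> tilt d f \<eta> y z" by blast
  have "is_arg_min (tilt d f \<eta> y) (\<lambda>x. x \<in> Rd d) (prox d f \<eta> y)"
    unfolding prox_def arg_min_on_def arg_min_def
    by (rule someI[of _ x]) (use x in \<open>auto simp: is_arg_min_def not_less\<close>)
  then show "prox d f \<eta> y \<in> Rd d" "z \<in> Rd d \<Longrightarrow> tilt d f \<eta> y (prox d f \<eta> y) \<le> tilt d f \<eta> y z"
    by (auto simp: is_arg_min_def not_less)
qed

lemma prox_grad_zero:
  assumes w: "w \<in> Rd d" shows "dotp d (tiltG d f \<eta> y (prox d f \<eta> y)) w = 0"
proof (rule ccontr)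
  let ?x = "prox d f \<eta> y" let ?b = "(1 / \<eta> + \<beta>) / 2"
  let ?D = "dotp d (tiltG d f \<eta> y ?x) w"
  assume D: "?D \<noteq> 0"
  define n where "n = (normd d w)\<^sup>2"
  have b: "0 < ?b" using \<beta> \<eta> by (simp add: add_pos_pos)
  have n: "0 \<le> n" by (simp add: n_def)
  have q: "0 \<le> s * ?D + ?b * (s\<^sup>2 * n)" for s
  proof -
    let ?w = "mv d (zer d) s w"
    have "tilt d f \<eta> y ?x \<le> tilt d f \<eta> y (mv d ?x 1 ?w)" by (rule prox_min[OF mv_Rd])
    also have "\<dots> \<le> tilt d f \<eta> y ?x + dotp d (tiltG d f \<eta> y ?x) ?w + ?b * (normd d ?w)\<^sup>2"
      by (rule tilt_bounds(2)[OF prox_Rd mv_Rd])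
    finally show ?thesis by (simp add: dotp_scaled normd_scaled power_mult_distrib n_def)
  qed
  define B where "B = ?b * n + 1"
  define s where "s = - ?D / (2 * B)"
  have den: "0 < B" using b n by (simp add: B_def add_nonneg_pos)
  have "s * ?D + ?b * (s\<^sup>2 * n) \<le> s * ?D + s\<^sup>2 * B" unfolding B_def distrib_left by (simp add: mult_ac)
  also have "\<dots> = s * (?D + s * B)" by (simp add: power2_eq_square algebra_simps)
  also have "s * B = - ?D / 2" using den by (simp add: s_def)
  also have "s * (?D + - ?D / 2) = - (?D * ?D) / (4 * B)" by (simp add: s_def)
  also have "\<dots> < 0"
  proof -
    have "0 < ?D * ?D" using D by (metis not_real_square_gt_zero)
    then show ?thesis using den by (simp add: divide_neg_pos)
  qed
  finally show False using q[of s] by linarith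
qed

text \<open>Strong convexity and smoothness at a critical point, where the linear term vanishes.\<close>

lemma prox_bounds:
  assumes z: "z \<in> Rd d"
  shows "tilt d f \<eta> y (prox d f \<eta> y) + (1 / \<eta> - \<beta>) / 2 * (distd d z (prox d f \<eta> y))\<^sup>2 \<le> tilt d f \<eta> y z"
    "tilt d f \<eta> y z \<le> tilt d f \<eta> y (prox d f \<eta> y) + (1 / \<eta> + \<beta>) / 2 * (distd d z (prox d f \<eta> y))\<^sup>2"
proof -
  let ?x = "prox d f \<eta> y"
  define w where "w = mv d z (-1) ?x"
  have w: "w \<in> Rd d" by (simp add: w_def)
  have e: "mv d ?x 1 w = z" unfolding w_def by (rule Rd_diff[OF prox_Rd z])
  have n: "distd d z ?x = normd d w" using distd_mv[of d ?x 1 w] unfolding e by simp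
  show "tilt d f \<eta> y ?x + (1 / \<eta> - \<beta>) / 2 * (distd d z ?x)\<^sup>2 \<le> tilt d f \<eta> y z"
    using tilt_bounds(1)[OF prox_Rd w, of y y] unfolding e n prox_grad_zero[OF w] by simp
  show "tilt d f \<eta> y z \<le> tilt d f \<eta> y ?x + (1 / \<eta> + \<beta>) / 2 * (distd d z ?x)\<^sup>2"
    using tilt_bounds(2)[OF prox_Rd w, of y y] unfolding e n prox_grad_zero[OF w] by simp
qed

lemma tilt_joint_measurable: "(\<lambda>(y, x). tilt d f \<eta> y x) \<in> borel_measurable (lebd d \<Otimes>\<^sub>M lebd d)"
proof -
  have c: "(\<lambda>w. fst w i) \<in> borel_measurable (lebd d \<Otimes>\<^sub>M lebd d)" "(\<lambda>w. snd w i) \<in> borel_measurable (lebd d \<Otimes>\<^sub>M lebd d)" if "i < d" for i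
    using measurable_compose[OF measurable_fst lebd_component[OF that]] measurable_compose[OF measurable_snd lebd_component[OF that]] by auto
  have "(\<lambda>w. \<Sum>i<d. (snd w i - fst w i)\<^sup>2) \<in> borel_measurable (lebd d \<Otimes>\<^sub>M lebd d)"
    by (intro borel_measurable_sum borel_measurable_power borel_measurable_diff c) auto
  then show ?thesis unfolding tilt_def split_beta' distd_sq by measurable
qed

text \<open>The minimizer is a choice, but the minimum is less than c exactly on a union of open sets, one for each point
  of the space.\<close>

lemma prox_value_measurable: "(\<lambda>y. tilt d f \<eta> y (prox d f \<eta> y)) \<in> borel_measurable (lebd d)"
proof (rule borel_measurable_iff_less[THEN iffD2], rule allI)
  fix c
  let ?T = "product_topology (\<lambda>_. euclideanreal) {..<d}"
  have "continuous_map ?T euclideanreal (\<lambda>y. tilt d f \<eta> y x)" for x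
    unfolding tilt_def distd_sq unfolding power2_eq_square
    by (intro continuous_map_add continuous_map_real_mult continuous_map_sum continuous_map_diff)
       (auto intro: continuous_map_product_projection)
  then have op: "openin ?T {y \<in> topspace ?T. tilt d f \<eta> y x \<in> {..<c}}" for x
    by (intro openin_continuous_map_preimage) auto
  have "openin ?T (\<Union>x\<in>Rd d. {y \<in> topspace ?T. tilt d f \<eta> y x \<in> {..<c}})"
    by (intro openin_Union) (use op in blast)
  then have "(\<Union>x\<in>Rd d. {y \<in> topspace ?T. tilt d f \<eta> y x \<in> {..<c}}) \<in> sets (lebd d)" by (rule openin_sets_lebd)
  moreover have "{y \<in> space (lebd d). tilt d f \<eta> y (prox d f \<eta> y) < c} = (\<Union>x\<in>Rd d. {y \<in> topspace ?T. tilt d f \<eta> y x \<in> {..<c}})"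
  proof (intro set_eqI iffI)
    fix y assume "y \<in> {y \<in> space (lebd d). tilt d f \<eta> y (prox d f \<eta> y) < c}"
    then show "y \<in> (\<Union>x\<in>Rd d. {y \<in> topspace ?T. tilt d f \<eta> y x \<in> {..<c}})" using prox_Rd by auto
  next
    fix y assume "y \<in> (\<Union>x\<in>Rd d. {y \<in> topspace ?T. tilt d f \<eta> y x \<in> {..<c}})"
    then obtain x where "x \<in> Rd d" "y \<in> Rd d" "tilt d f \<eta> y x < c" by auto
    then show "y \<in> {y \<in> space (lebd d). tilt d f \<eta> y (prox d f \<eta> y) < c}" using prox_min[of x y] by auto
  qed
  ultimately show "{y \<in> space (lebd d). tilt d f \<eta> y (prox d f \<eta> y) < c} \<in> sets (lebd d)" by simp
qed

lemma pos_integral: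
  assumes i: "integrable (lebd d) g" and p: "\<And>x. x \<in> Rd d \<Longrightarrow> 0 < (g x :: real)"
  shows "0 < (\<integral>x. g x \<partial>lebd d)"
proof -
  have nn: "AE x in lebd d. 0 \<le> g x" using p by (intro AE_I2) (auto intro: less_imp_le)
  have "(\<integral>x. g x \<partial>lebd d) \<noteq> 0"
  proof
    assume "(\<integral>x. g x \<partial>lebd d) = 0"
    then have "AE x in lebd d. g x = 0" using integral_nonneg_eq_0_iff_AE[OF i nn] by simp
    moreover have "AE x in lebd d. g x \<noteq> 0" using p by (intro AE_I2) (metis less_irrefl space_lebd)
    ultimately have "AE x in lebd d. False" by eventually_elim auto
    then have "emeasure (lebd d) (space (lebd d)) = 0" by (simp only: trivial_limit_def[symmetric] ae_filter_eq_bot_iff)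
    moreover have "emeasure (lebd d) (space (lebd d)) \<noteq> 0"
    proof -
      have "emeasure (lebd d) (PiE {..<d} (\<lambda>_. {0..1})) = (\<Prod>i<d. emeasure lborel {0..1::real})"
        by (rule PL.emeasure_PiM) auto
      then have "emeasure (lebd d) (PiE {..<d} (\<lambda>_. {0..1})) = 1" by simp
      moreover have "emeasure (lebd d) (PiE {..<d} (\<lambda>_. {0..1})) \<le> emeasure (lebd d) (space (lebd d))"
        by (rule emeasure_space)
      ultimately show ?thesis by auto
    qed
    ultimately show False by simp
  qed
  moreover have "0 \<le> (\<integral>x. g x \<partial>lebd d)" using nn by (rule integral_nonneg_AE)
  ultimately show ?thesis by simp
qed

definition Zf :: real where "Zf = (\<integral>z. exp (- f z) \<partial>lebd d)"
definition Zt :: "(nat \<Rightarrow> real) \<Rightarrow> real" where "Zt y = (\<integral>z. exp (- tilt d f \<eta> y z) \<partial>lebd d)"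

lemma Zf_pos: "0 < Zf" unfolding Zf_def by (rule pos_integral[OF integrable_f]) simp

lemma tilt_integrable: "integrable (lebd d) (\<lambda>z. exp (- tilt d f \<eta> y z))"
proof (rule Bochner_Integration.integrable_bound[OF integrable_f])
  show "AE x in lebd d. norm (exp (- tilt d f \<eta> y x)) \<le> norm (exp (- f x))"
    using \<eta> by (intro AE_I2) (simp add: tilt_def)
qed measurable

lemma Zt_pos: "0 < Zt y" unfolding Zt_def by (rule pos_integral[OF tilt_integrable]) simp

lemma Zt_measurable[measurable]: "Zt \<in> borel_measurable (lebd d)"
proof -
  interpret L: sigma_finite_measure "lebd d" by (rule sigma_finite_lebd)
  have "(\<lambda>(y, z). exp (- tilt d f \<eta> y z)) \<in> borel_measurable (lebd d \<Otimes>\<^sub>M lebd d)"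
    using tilt_joint_measurable by (simp add: split_beta')
  then have "(\<lambda>y. \<integral>z. exp (- tilt d f \<eta> y z) \<partial>lebd d) \<in> borel_measurable (lebd d)"
    by (rule L.borel_measurable_lebesgue_integral)
  then show ?thesis unfolding Zt_def[abs_def] .
qed

lemma sets_gibbs[simp, measurable_cong]: "sets (gibbs d g) = sets (lebd d)" by (simp add: gibbs_def)
lemma space_gibbs[simp]: "space (gibbs d g) = Rd d" by (simp add: gibbs_def)

lemma gibbs_prob:
  assumes i: "integrable (lebd d) (\<lambda>x. exp (- g x))" shows "prob_space (gibbs d g)"
proof
  let ?Z = "\<integral>z. exp (- g z) \<partial>lebd d"
  have Z: "0 < ?Z" by (rule pos_integral[OF i]) simp
  have [measurable]: "(\<lambda>x. exp (- g x)) \<in> borel_measurable (lebd d)" using i by (rule borel_measurable_integrable)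
  have "emeasure (gibbs d g) (space (gibbs d g)) = (\<integral>\<^sup>+x. ennreal (exp (- g x) / ?Z) \<partial>lebd d)"
    unfolding gibbs_def by (simp add: emeasure_density cong: nn_integral_cong) (rule nn_integral_cong, simp add: indicator_def)
  also have "\<dots> = ennreal (\<integral>x. exp (- g x) / ?Z \<partial>lebd d)"
    using i Z by (intro nn_integral_eq_integral) auto
  also have "\<dots> = 1" using Z by simp
  finally show "emeasure (gibbs d g) (space (gibbs d g)) = 1" .
qed

lemma pi_prob: "prob_space (gibbs d f)" by (rule gibbs_prob[OF integrable_f])

lemma tilt_prob: "prob_space (gibbs d (tilt d f \<eta> y))" by (rule gibbs_prob[OF tilt_integrable])

end

section \<open>Rejection sampling over an arbitrary proposal\<close>

text \<open>Independent draws from \<nu> until the first one that falls into A; the output is F of that draw.\<close>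

locale rejection_scheme = prob_space \<nu> for \<nu> :: "'a measure" +
  fixes A :: "'a set" and F :: "'a \<Rightarrow> 'b" and N :: "'b measure"
  assumes A[measurable]: "A \<in> sets \<nu>" and F[measurable]: "F \<in> measurable \<nu> N" and p0: "0 < measure \<nu> A"
begin

definition P :: "(nat \<Rightarrow> 'a) measure" where "P = Pi\<^sub>M UNIV (\<lambda>_. \<nu>)"
definition p :: real where "p = measure \<nu> A"
definition T :: "(nat \<Rightarrow> 'a) \<Rightarrow> nat" where "T \<omega> = (LEAST j. \<omega> j \<in> A)"
definition num :: "(nat \<Rightarrow> 'a) \<Rightarrow> ennreal" where
  "num \<omega> = (if \<exists>j. \<omega> j \<in> A then of_nat (Suc (T \<omega>)) else \<infinity>)"
definition hit :: "nat \<Rightarrow> 'b set \<Rightarrow> (nat \<Rightarrow> 'a) set" where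
  "hit j B = {\<omega> \<in> space P. (\<forall>i<j. \<omega> i \<notin> A) \<and> \<omega> j \<in> A \<and> F (\<omega> j) \<in> B}"

lemma p01: "0 < p" "p \<le> 1" using p0 by (auto simp: p_def)

lemma prob_P: "prob_space P" unfolding P_def by (rule prob_space_PiM) (rule prob_space_axioms)

lemma space_P: "space P = (UNIV \<rightarrow>\<^sub>E space \<nu>)" by (simp add: P_def space_PiM)

lemma comp_P[measurable]: "(\<lambda>\<omega>. \<omega> j) \<in> measurable P \<nu>" unfolding P_def by (rule measurable_component_singleton) simp

lemma emb_eq:
  assumes "\<And>i. i \<in> J \<Longrightarrow> X i \<subseteq> space \<nu>"
  shows "prod_emb UNIV (\<lambda>_. \<nu>) J (PiE J X) = {\<omega> \<in> space P. \<forall>i\<in>J. \<omega> i \<in> X i}"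
  using assms by (auto simp: prod_emb_def space_P PiE_iff restrict_def)

lemma emeasure_box:
  assumes "finite J" "\<And>i. i \<in> J \<Longrightarrow> X i \<in> sets \<nu>"
  shows "emeasure P {\<omega> \<in> space P. \<forall>i\<in>J. \<omega> i \<in> X i} = (\<Prod>i\<in>J. emeasure \<nu> (X i))"
proof -
  have "emeasure P (prod_emb UNIV (\<lambda>_. \<nu>) J (PiE J X)) = (\<Prod>i\<in>J. emeasure \<nu> (X i))"
    unfolding P_def by (rule emeasure_PiM_emb) (use assms prob_space_axioms in auto)
  moreover have "prod_emb UNIV (\<lambda>_. \<nu>) J (PiE J X) = {\<omega> \<in> space P. \<forall>i\<in>J. \<omega> i \<in> X i}"
    by (rule emb_eq) (rule sets.sets_into_space[OF assms(2)])
  ultimately show ?thesis by simp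
qed

lemma emeasure_compl: "emeasure \<nu> (space \<nu> - A) = ennreal (1 - p)"
  by (simp add: emeasure_eq_measure prob_compl p_def)

text \<open>Independence: j failures and then a success with output in B.\<close>

lemma emeasure_hit:
  assumes B: "B \<in> sets N"
  shows "emeasure P (hit j B) = ennreal ((1 - p) ^ j) * emeasure \<nu> (A \<inter> F -` B \<inter> space \<nu>)"
proof -
  let ?X = "\<lambda>i. if i < j then space \<nu> - A else A \<inter> F -` B \<inter> space \<nu>"
  have AB: "A \<inter> F -` B \<inter> space \<nu> \<in> sets \<nu>" using B A F by (simp add: Int_assoc measurable_sets sets.Int)
  have "hit j B = {\<omega> \<in> space P. \<forall>i\<in>{..j}. \<omega> i \<in> ?X i}"
  proof (intro set_eqI iffI)
    fix \<omega> assume "\<omega> \<in> hit j B"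
    then show "\<omega> \<in> {\<omega> \<in> space P. \<forall>i\<in>{..j}. \<omega> i \<in> ?X i}"
      by (auto simp: hit_def space_P PiE_iff) (metis le_neq_implies_less)?
  next
    fix \<omega> assume w: "\<omega> \<in> {\<omega> \<in> space P. \<forall>i\<in>{..j}. \<omega> i \<in> ?X i}"
    then have 1: "\<omega> i \<notin> A" if "i < j" for i using that by (auto dest!: bspec[of _ _ i])
    have "\<omega> j \<in> ?X j" using w by blast
    then show "\<omega> \<in> hit j B" using w 1 by (auto simp: hit_def)
  qed
  then have "emeasure P (hit j B) = (\<Prod>i\<in>{..j}. emeasure \<nu> (?X i))"
    using AB by (simp only:) (rule emeasure_box, auto)
  also have "{..j} = insert j {..<j}" by auto
  also have "(\<Prod>i\<in>insert j {..<j}. emeasure \<nu> (?X i)) = emeasure \<nu> (A \<inter> F -` B \<inter> space \<nu>) * (\<Prod>i\<in>{..<j}. ennreal (1 - p))"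
    by (subst prod.insert) (auto simp: emeasure_compl intro!: arg_cong2[where f = "(*)"] prod.cong)
  finally show ?thesis using p01 by (simp add: mult.commute ennreal_power)
qed

lemma hit_sets:
  assumes [measurable]: "B \<in> sets N" shows "hit j B \<in> sets P"
  unfolding hit_def by measurable

lemma hit_disj: "disjoint_family (\<lambda>j. hit j B)"
  unfolding disjoint_family_on_def hit_def by (auto) (metis linorder_neqE_nat)

lemma geometric_ennreal: "(\<Sum>j. ennreal ((1 - p) ^ j)) = ennreal (1 / p)"
proof -
  have "(\<lambda>j. (1 - p) ^ j) sums (1 / (1 - (1 - p)))" by (rule geometric_sums) (use p01 in auto)
  then have "(\<lambda>j. ennreal ((1 - p) ^ j)) sums ennreal (1 / p)"
    using p01 by (intro sums_ennreal[THEN iffD2]) auto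
  then show ?thesis by (rule sums_unique[symmetric])
qed

lemma AE_hit: "AE \<omega> in P. \<exists>j. \<omega> j \<in> A"
proof -
  interpret P: prob_space P by (rule prob_P)
  let ?U = "\<Union>j. hit j (space N)"
  have sp: "space N \<in> sets N" by simp
  have AF: "A \<inter> F -` space N \<inter> space \<nu> = A"
    using measurable_space[OF F] sets.sets_into_space[OF A] by auto
  have "emeasure P ?U = (\<Sum>j. emeasure P (hit j (space N)))"
    by (rule suminf_emeasure[symmetric]) (use hit_sets[OF sp] hit_disj in auto)
  also have "\<dots> = (\<Sum>j. ennreal ((1 - p) ^ j) * ennreal p)"
    by (simp add: emeasure_hit[OF sp] AF emeasure_eq_measure p_def)
  also have "\<dots> = ennreal (1 / p) * ennreal p" by (simp add: ennreal_suminf_multc geometric_ennreal)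
  also have "\<dots> = 1" using p01 by (simp add: ennreal_mult'[symmetric])
  finally have "P.prob ?U = 1" by (simp add: P.emeasure_eq_measure)
  moreover have "?U \<in> sets P" using hit_sets[OF sp] by blast
  ultimately have "AE \<omega> in P. \<omega> \<in> ?U" by (simp add: P.prob_eq_1)
  then show ?thesis by eventually_elim (auto simp: hit_def)
qed

lemma T_measurable[measurable]: "T \<in> measurable P (count_space UNIV)"
  unfolding T_def[abs_def] by measurable

lemma num_measurable[measurable]: "num \<in> borel_measurable P"
  unfolding num_def[abs_def] by measurable

lemma out_measurable[measurable]: "(\<lambda>\<omega>. F (\<omega> (T \<omega>))) \<in> measurable P N"
  by (rule measurable_compose_countable[where f = "\<lambda>j \<omega>. F (\<omega> j)" and g = T]) measurable

lemma T_hit: "\<omega> \<in> space P \<Longrightarrow> \<exists>j. \<omega> j \<in> A \<Longrightarrow> F (\<omega> (T \<omega>)) \<in> B \<longleftrightarrow> \<omega> \<in> hit (T \<omega>) B"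
  unfolding hit_def T_def using LeastI_ex[of "\<lambda>j. \<omega> j \<in> A"] not_less_Least[of _ "\<lambda>j. \<omega> j \<in> A"] by blast

lemma hit_T: "\<omega> \<in> hit j B \<Longrightarrow> T \<omega> = j"
  unfolding hit_def T_def by (auto intro!: Least_equality) (metis not_le)

text \<open>Almost surely some draw is accepted, and the event splits according to the index of the first one.\<close>

lemma emeasure_out:
  assumes B: "B \<in> sets N" and C: "C \<in> sets borel"
  shows "emeasure P {\<omega> \<in> space P. F (\<omega> (T \<omega>)) \<in> B \<and> num \<omega> \<in> C}
    = (\<Sum>j. indicator C (of_nat (Suc j)) * (ennreal ((1 - p) ^ j) * emeasure \<nu> (A \<inter> F -` B \<inter> space \<nu>)))"
proof -
  let ?H = "\<lambda>j. if of_nat (Suc j) \<in> C then hit j B else {}"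
  have "emeasure P {\<omega> \<in> space P. F (\<omega> (T \<omega>)) \<in> B \<and> num \<omega> \<in> C} = emeasure P (\<Union>j. ?H j)"
  proof (rule emeasure_eq_AE)
    show "AE \<omega> in P. \<omega> \<in> {\<omega> \<in> space P. F (\<omega> (T \<omega>)) \<in> B \<and> num \<omega> \<in> C} \<longleftrightarrow> \<omega> \<in> (\<Union>j. ?H j)"
      using AE_hit AE_space
    proof eventually_elim
      case (elim \<omega>)
      have "num \<omega> = of_nat (Suc (T \<omega>))" using elim by (simp add: num_def)
      then show ?case using elim T_hit[OF elim(2,1), of B] hit_T[of \<omega> _ B] by (auto split: if_splits simp del: of_nat_Suc)
    qed
    note [measurable] = B C
    show "{\<omega> \<in> space P. F (\<omega> (T \<omega>)) \<in> B \<and> num \<omega> \<in> C} \<in> sets P" by measurable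
    show "(\<Union>j. ?H j) \<in> sets P" using hit_sets[OF B] by auto
  qed
  also have "\<dots> = (\<Sum>j. emeasure P (?H j))"
  proof (rule suminf_emeasure[symmetric])
    show "disjoint_family ?H" using hit_disj[of B] by (auto simp: disjoint_family_on_def)
  qed (use hit_sets[OF B] in auto)
  also have "\<dots> = (\<Sum>j. indicator C (of_nat (Suc j)) * (ennreal ((1 - p) ^ j) * emeasure \<nu> (A \<inter> F -` B \<inter> space \<nu>)))"
    by (rule suminf_cong) (simp add: emeasure_hit[OF B] indicator_def del: of_nat_Suc)
  finally show ?thesis .
qed

lemma emeasure_out_fst:
  assumes B: "B \<in> sets N"
  shows "emeasure P {\<omega> \<in> space P. F (\<omega> (T \<omega>)) \<in> B} = emeasure \<nu> (A \<inter> F -` B \<inter> space \<nu>) / ennreal p"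
proof -
  have "emeasure P {\<omega> \<in> space P. F (\<omega> (T \<omega>)) \<in> B} = ennreal (1 / p) * emeasure \<nu> (A \<inter> F -` B \<inter> space \<nu>)"
    using emeasure_out[OF B, of UNIV] by (simp add: ennreal_suminf_multc geometric_ennreal)
  also have "ennreal (1 / p) = inverse (ennreal p)" using p01 by (simp add: inverse_ennreal inverse_eq_divide)
  finally show ?thesis by (simp add: divide_ennreal_def mult.commute)
qed

lemma expected_num: "(\<integral>\<^sup>+\<omega>. num \<omega> \<partial>P) = ennreal (1 / p)"
proof -
  let ?R = "\<lambda>n. {\<omega> \<in> space P. \<forall>i\<in>{..<n}. \<omega> i \<in> space \<nu> - A}"
  have Rs: "?R n \<in> sets P" for n by measurable
  have "(\<integral>\<^sup>+\<omega>. num \<omega> \<partial>P) = (\<integral>\<^sup>+\<omega>. (\<Sum>n. indicator (?R n) \<omega>) \<partial>P)"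
  proof (rule nn_integral_cong_AE)
    show "AE \<omega> in P. num \<omega> = (\<Sum>n. indicator (?R n) \<omega>)"
      using AE_hit AE_space
    proof eventually_elim
      case (elim \<omega>)
      have sp: "\<omega> i \<in> space \<nu>" for i using elim(2) by (auto simp: space_P)
      have iff: "\<omega> \<in> ?R n \<longleftrightarrow> n \<le> T \<omega>" for n
      proof
        assume r: "\<omega> \<in> ?R n"
        have "\<omega> (T \<omega>) \<in> A" unfolding T_def using elim(1) by (rule LeastI_ex)
        then show "n \<le> T \<omega>" using r by (auto simp: not_less[symmetric])
      next
        assume n: "n \<le> T \<omega>"
        have "\<omega> i \<notin> A" if "i < n" for i
          using not_less_Least[of i "\<lambda>j. \<omega> j \<in> A"] that n unfolding T_def by simp
        then show "\<omega> \<in> ?R n" using elim(2) sp by auto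
      qed
      have "(\<Sum>n. indicator (?R n) \<omega> :: ennreal) = (\<Sum>n\<in>{..T \<omega>}. indicator (?R n) \<omega>)"
        by (rule suminf_finite) (use iff in \<open>auto simp: indicator_def\<close>)
      also have "\<dots> = (\<Sum>n\<in>{..T \<omega>}. 1)" by (rule sum.cong) (use iff in \<open>auto simp: indicator_def\<close>)
      also have "\<dots> = num \<omega>" using elim by (simp add: num_def)
      finally show ?case by simp
    qed
  qed
  also have "\<dots> = (\<Sum>n. \<integral>\<^sup>+\<omega>. indicator (?R n) \<omega> \<partial>P)"
    by (rule nn_integral_suminf) (use Rs in auto)
  also have "\<dots> = (\<Sum>n. ennreal ((1 - p) ^ n))"
  proof (rule suminf_cong)
    fix n
    have "emeasure P (?R n) = (\<Prod>i\<in>{..<n}. emeasure \<nu> (space \<nu> - A))" by (rule emeasure_box) auto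
    then show "(\<integral>\<^sup>+\<omega>. indicator (?R n) \<omega> \<partial>P) = ennreal ((1 - p) ^ n)"
      using Rs[of n] p01 by (simp add: emeasure_compl ennreal_power)
  qed
  finally show ?thesis by (simp add: geometric_ennreal)
qed

end

section \<open>Gaussian proposals for the conditional law\<close>

context smooth_tilt
begin

definition sc :: real where "sc = 1 / \<eta> - \<beta>"

lemma sc_pos: "0 < sc" using eta_beta by (simp add: sc_def)

abbreviation px :: "(nat \<Rightarrow> real) \<Rightarrow> nat \<Rightarrow> real" where "px y \<equiv> prox d f \<eta> y"
abbreviation gt :: "(nat \<Rightarrow> real) \<Rightarrow> (nat \<Rightarrow> real) \<Rightarrow> real" where "gt y \<equiv> tilt d f \<eta> y"

definition ratio :: "(nat \<Rightarrow> real) \<Rightarrow> (nat \<Rightarrow> real) \<Rightarrow> real" where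
  "ratio y z = exp (- gt y z + gt y (px y) + sc / 2 * (distd d z (px y))\<^sup>2)"

definition proposal :: "(nat \<Rightarrow> real) \<Rightarrow> ((nat \<Rightarrow> real) \<times> real) measure" where
  "proposal y = gauss d (px y) (1 / sc) \<Otimes>\<^sub>M uniform_measure lborel {0..1}"

definition accept_set :: "(nat \<Rightarrow> real) \<Rightarrow> ((nat \<Rightarrow> real) \<times> real) set" where
  "accept_set y = {w \<in> space (proposal y). snd w \<le> ratio y (fst w)}"

definition accept_prob :: "(nat \<Rightarrow> real) \<Rightarrow> real" where
  "accept_prob y = exp (gt y (px y)) * Zt y / sqrt (2 * pi / sc) ^ d"

lemma ratio_pos: "0 < ratio y z" by (simp add: ratio_def)

lemma ratio_le_1: "z \<in> Rd d \<Longrightarrow> ratio y z \<le> 1"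
  using prox_bounds(1)[of z y] by (simp add: ratio_def sc_def)

lemma distd_measurable: "(\<lambda>z. distd d z y) \<in> borel_measurable (lebd d)"
  unfolding distd_normd by (rule normd_measurable) (intro borel_measurable_diff lebd_component borel_measurable_const)

lemma ratio_measurable[measurable]: "ratio y \<in> borel_measurable (lebd d)"
proof -
  note [measurable] = distd_measurable
  show ?thesis unfolding ratio_def[abs_def] by measurable
qed

lemma prob_unif: "prob_space (uniform_measure lborel {0..1::real})"
  by (rule prob_space_uniform_measure) auto

lemma prob_proposal: "prob_space (proposal y)"
  unfolding proposal_def by (rule prob_space_pair[OF prob_gauss prob_unif]) (use sc_pos in simp)

lemma space_proposal: "space (proposal y) = Rd d \<times> UNIV"
  by (simp add: proposal_def space_pair_measure)

lemma mem_accept_set: "(z, u) \<in> accept_set y \<longleftrightarrow> z \<in> Rd d \<and> u \<le> ratio y z"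
  unfolding accept_set_def space_proposal mem_Collect_eq mem_Times_iff fst_conv snd_conv by blast

lemma accept_set_sets: "accept_set y \<in> sets (proposal y)"
proof -
  let ?U = "uniform_measure lborel {0..1::real}"
  have 1: "(\<lambda>w. ratio y (fst w)) \<in> borel_measurable (proposal y)"
    unfolding proposal_def
    by (rule measurable_compose[OF measurable_fst]) (simp add: measurable_cong_sets[OF sets_gauss refl])
  have "snd \<in> measurable (proposal y) ?U" unfolding proposal_def by (rule measurable_snd)
  moreover have "measurable (proposal y) ?U = measurable (proposal y) borel"
    by (rule measurable_cong_sets) simp_all
  ultimately have 2: "(\<lambda>w. snd w) \<in> borel_measurable (proposal y)" by simp
  show ?thesis unfolding accept_set_def by (rule borel_measurable_le[OF 2 1])
qed

lemma emeasure_unif: "0 \<le> c \<Longrightarrow> c \<le> 1 \<Longrightarrow> emeasure (uniform_measure lborel {0..1::real}) {u. u \<le> c} = ennreal c"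
proof -
  assume c: "0 \<le> c" "c \<le> 1"
  have "emeasure (uniform_measure lborel {0..1::real}) {u. u \<le> c} = emeasure lborel ({0..1} \<inter> {u. u \<le> c}) / emeasure lborel {0..1::real}"
    by (rule emeasure_uniform_measure) auto
  also have "{0..1} \<inter> {u. u \<le> c} = {0..c}" using c by auto
  finally show ?thesis using c divide_ennreal[of c 1] by simp
qed

text \<open>The Gaussian weight centred at the minimizer cancels the quadratic term of the acceptance ratio, and only the
  unnormalized target remains.\<close>

lemma gauss_density_px:
  "(\<Prod>i<d. normal_density (px y i) (sqrt (1 / sc)) (z i)) * ratio y z
    = accept_prob y * (exp (- gt y z) / Zt y)"
proof -
  have s: "0 < sc" by (rule sc_pos)
  have "(\<Prod>i<d. normal_density (px y i) (sqrt (1 / sc)) (z i))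
    = (\<Prod>i<d. exp (- (sc / 2 * (z i - px y i)\<^sup>2)) / sqrt (2 * pi / sc))"
    unfolding normal_density_def using s by (intro prod.cong refl) (simp add: field_simps)
  also have "\<dots> = exp (- (sc / 2 * (distd d z (px y))\<^sup>2)) / sqrt (2 * pi / sc) ^ d"
    by (simp add: prod_dividef exp_sum[symmetric] distd_sq sum_distrib_left sum_negf)
  finally have 1: "(\<Prod>i<d. normal_density (px y i) (sqrt (1 / sc)) (z i))
    = exp (- (sc / 2 * (distd d z (px y))\<^sup>2)) / sqrt (2 * pi / sc) ^ d" .
  have "exp (- S) / k * exp (- a + b + S) = exp b * Z / k * (exp (- a) / Z)" if "0 < Z" for S k a b Z :: real
  proof -
    have "exp (- S) * exp (- a + b + S) = exp b * exp (- a)" by (simp add: mult_exp_exp)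
    then show ?thesis using that by simp
  qed
  from this[OF Zt_pos[of y]] show ?thesis unfolding 1 ratio_def accept_prob_def .
qed

lemma accept_prob_pos: "0 < accept_prob y"
  using Zt_pos[of y] sc_pos by (simp add: accept_prob_def)

text \<open>Accepted proposals have the target law, up to the acceptance probability.\<close>

lemma emeasure_accept:
  assumes B: "B \<in> sets (lebd d)"
  shows "emeasure (proposal y) (accept_set y \<inter> fst -` B \<inter> space (proposal y)) = ennreal (accept_prob y) * emeasure (gibbs d (gt y)) B"
proof -
  interpret U: prob_space "uniform_measure lborel {0..1::real}" by (rule prob_unif)
  let ?g = "gauss d (px y) (1 / sc)"
  let ?S = "accept_set y \<inter> fst -` B \<inter> space (proposal y)"
  have S: "?S \<in> sets (proposal y)"
  proof -
    have "fst \<in> measurable (proposal y) ?g" unfolding proposal_def by (rule measurable_fst)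
    then have "fst -` B \<inter> space (proposal y) \<in> sets (proposal y)"
      by (rule measurable_sets) (use B in simp)
    then show ?thesis using sets.Int[OF accept_set_sets] by (simp only: Int_assoc)
  qed
  have "emeasure (proposal y) ?S = (\<integral>\<^sup>+z. emeasure (uniform_measure lborel {0..1}) (Pair z -` ?S) \<partial>?g)"
    using U.emeasure_pair_measure_alt[OF S[unfolded proposal_def]] by (simp only: proposal_def)
  also have "\<dots> = (\<integral>\<^sup>+z. ennreal (ratio y z) * indicator B z \<partial>?g)"
  proof (rule nn_integral_cong)
    fix z assume "z \<in> space ?g"
    then have z: "z \<in> Rd d" by simp
    have "Pair z -` ?S = (if z \<in> B then {u. u \<le> ratio y z} else {})"
    proof (rule set_eqI)
      fix u
      show "u \<in> Pair z -` ?S \<longleftrightarrow> u \<in> (if z \<in> B then {u. u \<le> ratio y z} else {})"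
        unfolding vimage_eq Int_iff mem_accept_set space_proposal mem_Times_iff fst_conv snd_conv using z by simp
    qed
    then show "emeasure (uniform_measure lborel {0..1}) (Pair z -` ?S) = ennreal (ratio y z) * indicator B z"
      using emeasure_unif[of "ratio y z"] ratio_pos[of y z] ratio_le_1[OF z] by (simp add: less_imp_le)
  qed
  also have "\<dots> = (\<integral>\<^sup>+z. ennreal (\<Prod>i<d. normal_density (px y i) (sqrt (1 / sc)) (z i)) * (ennreal (ratio y z) * indicator B z) \<partial>lebd d)"
    unfolding gauss_def
  proof (rule nn_integral_density)
    show "(\<lambda>z. ennreal (\<Prod>i<d. normal_density (px y i) (sqrt (1 / sc)) (z i))) \<in> borel_measurable (lebd d)"
      by (intro measurable_compose[OF _ measurable_ennreal] borel_measurable_prod measurable_compose[OF lebd_component]) auto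
    show "(\<lambda>z. ennreal (ratio y z) * indicator B z) \<in> borel_measurable (lebd d)"
      by (intro borel_measurable_times_ennreal borel_measurable_indicator B measurable_compose[OF ratio_measurable measurable_ennreal])
  qed
  also have "\<dots> = (\<integral>\<^sup>+z. ennreal (accept_prob y) * (ennreal (exp (- gt y z) / Zt y) * indicator B z) \<partial>lebd d)"
  proof (rule nn_integral_cong)
    fix z
    have "ennreal (\<Prod>i<d. normal_density (px y i) (sqrt (1 / sc)) (z i)) * ennreal (ratio y z) = ennreal (accept_prob y) * ennreal (exp (- gt y z) / Zt y)"
      using gauss_density_px[of y z] ratio_pos[of y z] accept_prob_pos[of y] Zt_pos[of y]
      by (simp add: ennreal_mult'[symmetric] ennreal_mult''[symmetric] less_imp_le prod_nonneg)
    then show "ennreal (\<Prod>i<d. normal_density (px y i) (sqrt (1 / sc)) (z i)) * (ennreal (ratio y z) * indicator B z)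
       = ennreal (accept_prob y) * (ennreal (exp (- gt y z) / Zt y) * indicator B z)"
      by (simp add: mult.assoc[symmetric])
  qed
  also have "\<dots> = ennreal (accept_prob y) * (\<integral>\<^sup>+z. ennreal (exp (- gt y z) / Zt y) * indicator B z \<partial>lebd d)"
  proof (rule nn_integral_cmult)
    have "(\<lambda>z. exp (- gt y z) / Zt y) \<in> borel_measurable (lebd d)" by measurable
    then show "(\<lambda>z. ennreal (exp (- gt y z) / Zt y) * indicator B z) \<in> borel_measurable (lebd d)"
      by (intro borel_measurable_times_ennreal borel_measurable_indicator B measurable_compose[OF _ measurable_ennreal])
  qed
  also have "(\<integral>\<^sup>+z. ennreal (exp (- gt y z) / Zt y) * indicator B z \<partial>lebd d) = emeasure (gibbs d (gt y)) B"
    unfolding gibbs_def Zt_def[symmetric] by (rule emeasure_density[symmetric, OF _ B]) measurable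
  finally show ?thesis .
qed

lemma accept_prob_eq: "measure (proposal y) (accept_set y) = accept_prob y"
proof -
  interpret p: prob_space "proposal y" by (rule prob_proposal)
  interpret t: prob_space "gibbs d (gt y)" by (rule tilt_prob)
  have "accept_set y \<inter> fst -` Rd d \<inter> space (proposal y) = accept_set y"
    by (rule set_eqI) (simp only: Int_iff vimage_eq mem_Collect_eq accept_set_def space_proposal mem_Times_iff UNIV_I, argo)
  then have "emeasure (proposal y) (accept_set y) = ennreal (accept_prob y) * emeasure (gibbs d (gt y)) (Rd d)"
    using emeasure_accept[of "Rd d" y] sets.top[of "lebd d"] by simp
  also have "emeasure (gibbs d (gt y)) (Rd d) = 1" using t.emeasure_space_1 by simp
  finally show ?thesis using accept_prob_pos[of y] by (simp add: p.emeasure_eq_measure)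
qed

lemma rejection_scheme_px: "rejection_scheme (proposal y) (accept_set y) fst (lebd d)"
proof -
  interpret p: prob_space "proposal y" by (rule prob_proposal)
  show ?thesis
  proof
    show "accept_set y \<in> sets (proposal y)" by (rule accept_set_sets)
    have "fst \<in> measurable (proposal y) (gauss d (px y) (1 / sc))" unfolding proposal_def by (rule measurable_fst)
    then show "fst \<in> measurable (proposal y) (lebd d)" by (simp add: measurable_cong_sets[OF refl sets_gauss])
    show "0 < measure (proposal y) (accept_set y)" by (simp add: accept_prob_eq accept_prob_pos)
  qed
qed

abbreviation rej :: "(nat \<Rightarrow> real) \<Rightarrow> ((nat \<Rightarrow> real) \<times> ennreal) measure" where
  "rej y \<equiv> rejection d (gt y) (1 / \<eta> - \<beta>) (px y)"

lemma rej_eq: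
  "rej y = distr (rejection_scheme.P (proposal y)) (lebd d \<Otimes>\<^sub>M borel)
     (\<lambda>\<omega>. (fst (\<omega> (rejection_scheme.T (accept_set y) \<omega>)), rejection_scheme.num (accept_set y) \<omega>))"
proof -
  interpret R: rejection_scheme "proposal y" "accept_set y" fst "lebd d" by (rule rejection_scheme_px)
  have a: "accepts d (gt y) sc (px y) \<omega> = (\<lambda>j. \<omega> j \<in> accept_set y)" if "\<omega> \<in> space R.P" for \<omega>
  proof
    fix j
    have "\<omega> j \<in> space (proposal y)" using that by (auto simp: R.space_P)
    then show "accepts d (gt y) sc (px y) \<omega> j \<longleftrightarrow> \<omega> j \<in> accept_set y"
      unfolding accepts_def accept_set_def ratio_def by simp
  qed
  have "rej y = distr R.P (lebd d \<Otimes>\<^sub>M borel)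
     (\<lambda>\<omega>. (fst (\<omega> (LEAST j. accepts d (gt y) sc (px y) \<omega> j)), num_trials d (gt y) sc (px y) \<omega>))"
    unfolding rejection_def R.P_def unfolding proposal_def sc_def ..
  also have "\<dots> = distr R.P (lebd d \<Otimes>\<^sub>M borel) (\<lambda>\<omega>. (fst (\<omega> (R.T \<omega>)), R.num \<omega>))"
    by (rule distr_cong) (simp_all add: a num_trials_def R.num_def R.T_def)
  finally show ?thesis .
qed

lemma rej_map_measurable:
  "(\<lambda>\<omega>. (fst (\<omega> (rejection_scheme.T (accept_set y) \<omega>)), rejection_scheme.num (accept_set y) \<omega>))
     \<in> measurable (rejection_scheme.P (proposal y)) (lebd d \<Otimes>\<^sub>M borel)"
proof -
  interpret R: rejection_scheme "proposal y" "accept_set y" fst "lebd d" by (rule rejection_scheme_px)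
  show ?thesis by (rule measurable_Pair[OF R.out_measurable R.num_measurable])
qed

lemma sets_rej[simp, measurable_cong]: "sets (rej y) = sets (lebd d \<Otimes>\<^sub>M borel)" by (simp add: rejection_def)

lemma rej_prob: "prob_space (rej y)"
proof -
  interpret R: rejection_scheme "proposal y" "accept_set y" fst "lebd d" by (rule rejection_scheme_px)
  show ?thesis unfolding rej_eq by (rule prob_space.prob_space_distr[OF R.prob_P rej_map_measurable])
qed

lemma rej_fst: "distr (rej y) (lebd d) fst = gibbs d (gt y)"
proof (rule measure_eqI)
  interpret R: rejection_scheme "proposal y" "accept_set y" fst "lebd d" by (rule rejection_scheme_px)
  show "sets (distr (rej y) (lebd d) fst) = sets (gibbs d (gt y))" by simp
  fix B assume "B \<in> sets (distr (rej y) (lebd d) fst)"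
  then have B: "B \<in> sets (lebd d)" by simp
  have "distr (rej y) (lebd d) fst = distr R.P (lebd d) (\<lambda>\<omega>. fst (\<omega> (R.T \<omega>)))"
    unfolding rej_eq by (subst distr_distr[OF measurable_fst rej_map_measurable]) (simp add: comp_def)
  then have "emeasure (distr (rej y) (lebd d) fst) B = emeasure R.P {\<omega> \<in> space R.P. fst (\<omega> (R.T \<omega>)) \<in> B}"
    using B by (simp add: emeasure_distr[OF R.out_measurable] vimage_def Int_def conj_commute)
  also have "\<dots> = emeasure (proposal y) (accept_set y \<inter> fst -` B \<inter> space (proposal y)) / ennreal R.p"
    by (rule R.emeasure_out_fst[OF B])
  also have "\<dots> = ennreal (accept_prob y) * emeasure (gibbs d (gt y)) B / ennreal (accept_prob y)"
    by (simp add: emeasure_accept[OF B] R.p_def accept_prob_eq)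
  also have "\<dots> = emeasure (gibbs d (gt y)) B"
    using accept_prob_pos[of y] by (subst mult.commute, subst ennreal_mult_divide_eq) auto
  finally show "emeasure (distr (rej y) (lebd d) fst) B = emeasure (gibbs d (gt y)) B" .
qed

lemma rej_expected_trials: "(\<integral>\<^sup>+w. snd w \<partial>rej y) = ennreal (1 / accept_prob y)"
proof -
  interpret R: rejection_scheme "proposal y" "accept_set y" fst "lebd d" by (rule rejection_scheme_px)
  have "(\<integral>\<^sup>+w. snd w \<partial>rej y) = (\<integral>\<^sup>+\<omega>. R.num \<omega> \<partial>R.P)"
    unfolding rej_eq by (subst nn_integral_distr[OF rej_map_measurable]) auto
  then show ?thesis by (simp add: R.expected_num R.p_def accept_prob_eq)
qed

text \<open>For Z = prox + sqrt(1/sc) W the ratio is at least exp(- \<beta>/sc \<bar>W\<bar>^2), since the upper and lower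
  quadratic bounds of the potential differ by \<beta> times the squared distance. The mean of \<bar>W\<bar>^2 is d,
  and Jensen's inequality for the exponential gives the claim.\<close>

lemma accept_prob_lower: "exp (- (\<beta> * real d / sc)) \<le> accept_prob y"
proof -
  have s: "0 < sc" by (rule sc_pos)
  let ?g = "gauss d (px y) (1 / sc)"
  interpret g: prob_space ?g by (rule prob_gauss) (use s in simp)
  have ge: "?g = distr (stdg d) (lebd d) (mv d (px y) (sqrt (1 / sc)))" by (rule gauss_eq_distr) (use s in simp)
  have "ennreal (accept_prob y) = (\<integral>\<^sup>+z. ennreal (ratio y z) \<partial>?g)"
  proof -
    have "emeasure (proposal y) (accept_set y) = (\<integral>\<^sup>+z. ennreal (ratio y z) \<partial>?g)"
    proof -
      interpret U: prob_space "uniform_measure lborel {0..1::real}" by (rule prob_unif)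
      have "emeasure (proposal y) (accept_set y) = (\<integral>\<^sup>+z. emeasure (uniform_measure lborel {0..1}) (Pair z -` accept_set y) \<partial>?g)"
        using accept_set_sets[of y] unfolding proposal_def by (rule U.emeasure_pair_measure_alt)
      also have "\<dots> = (\<integral>\<^sup>+z. ennreal (ratio y z) \<partial>?g)"
      proof (rule nn_integral_cong)
        fix z assume "z \<in> space ?g"
        then have z: "z \<in> Rd d" by simp
        have "Pair z -` accept_set y = {u. u \<le> ratio y z}"
          using z by (simp add: set_eq_iff mem_accept_set)
        then show "emeasure (uniform_measure lborel {0..1}) (Pair z -` accept_set y) = ennreal (ratio y z)"
          using emeasure_unif[of "ratio y z"] ratio_pos[of y z] ratio_le_1[OF z] by (simp add: less_imp_le)
      qed
      finally show ?thesis .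
    qed
    moreover interpret p: prob_space "proposal y" by (rule prob_proposal)
    show ?thesis using calculation by (simp add: p.emeasure_eq_measure accept_prob_eq)
  qed
  also have "\<dots> = (\<integral>\<^sup>+w. ennreal (ratio y (mv d (px y) (sqrt (1 / sc)) w)) \<partial>stdg d)"
    unfolding ge by (rule nn_integral_distr) auto
  also have "\<dots> \<ge> (\<integral>\<^sup>+w. ennreal (exp (- (\<beta> * real d / sc)) * (1 - (\<beta> / sc * (normd d w)\<^sup>2 - \<beta> * real d / sc))) \<partial>stdg d)"
  proof (rule nn_integral_mono, rule ennreal_leI)
    fix w
    let ?z = "mv d (px y) (sqrt (1 / sc)) w"
    have n: "(distd d ?z (px y))\<^sup>2 = (normd d w)\<^sup>2 / sc" using s by (simp add: distd_mv power_mult_distrib)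
    have "gt y ?z \<le> gt y (px y) + (1 / \<eta> + \<beta>) / 2 * (distd d ?z (px y))\<^sup>2" by (rule prox_bounds(2)) simp
    moreover have "(1 / \<eta> + \<beta>) / 2 * (distd d ?z (px y))\<^sup>2 = sc / 2 * (distd d ?z (px y))\<^sup>2 + \<beta> * (distd d ?z (px y))\<^sup>2"
      by (simp add: sc_def field_simps)
    ultimately have "exp (- (\<beta> * (distd d ?z (px y))\<^sup>2)) \<le> ratio y ?z"
      unfolding ratio_def exp_le_cancel_iff by linarith
    then have 1: "exp (- (\<beta> / sc * (normd d w)\<^sup>2)) \<le> ratio y ?z" by (simp add: n)
    let ?m = "\<beta> * real d / sc" let ?X = "\<beta> / sc * (normd d w)\<^sup>2"
    have "1 - (?X - ?m) \<le> exp (- (?X - ?m))"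
      using exp_ge_add_one_self[of "- (?X - ?m)"] by linarith
    then have "exp (- ?m) * (1 - (?X - ?m)) \<le> exp (- ?m) * exp (- (?X - ?m))"
      by (rule mult_left_mono) simp
    also have "\<dots> = exp (- ?X)" by (simp add: mult_exp_exp)
    finally show "exp (- ?m) * (1 - (?X - ?m)) \<le> ratio y ?z" using 1 by linarith
  qed
  finally have le: "(\<integral>\<^sup>+w. ennreal (exp (- (\<beta> * real d / sc)) * (1 - (\<beta> / sc * (normd d w)\<^sup>2 - \<beta> * real d / sc))) \<partial>stdg d) \<le> ennreal (accept_prob y)" .
  have Esq: "(\<integral>w. (normd d w)\<^sup>2 \<partial>stdg d) = real d"
    unfolding normd_sq unfolding power2_eq_square by (subst Bochner_Integration.integral_sum) (auto simp: stdg_cov)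
  have isq: "integrable (stdg d) (\<lambda>w. (normd d w)\<^sup>2)" by (rule stdg_normd_moment) simp
  let ?h = "\<lambda>w. exp (- (\<beta> * real d / sc)) * (1 - (\<beta> / sc * (normd d w)\<^sup>2 - \<beta> * real d / sc))"
  have ih: "integrable (stdg d) ?h"
    by (intro integrable_mult_right Bochner_Integration.integrable_diff SG.integrable_const isq)
  have "(\<integral>w. ?h w \<partial>stdg d) = exp (- (\<beta> * real d / sc)) * 1"
    using isq by (simp add: Esq)
  moreover have "ennreal (\<integral>w. ?h w \<partial>stdg d) \<le> (\<integral>\<^sup>+w. ennreal (?h w) \<partial>stdg d)"
  proof -
    have im: "integrable (stdg d) (\<lambda>w. max 0 (?h w))" by (intro integrable_max ih) simp
    have "(\<integral>w. ?h w \<partial>stdg d) \<le> (\<integral>w. max 0 (?h w) \<partial>stdg d)"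
      by (rule integral_mono[OF ih im]) simp
    then have "ennreal (\<integral>w. ?h w \<partial>stdg d) \<le> ennreal (\<integral>w. max 0 (?h w) \<partial>stdg d)" by (rule ennreal_leI)
    also have "\<dots> = (\<integral>\<^sup>+w. ennreal (max 0 (?h w)) \<partial>stdg d)"
      by (rule nn_integral_eq_integral[symmetric, OF im]) simp
    also have "\<dots> = (\<integral>\<^sup>+w. ennreal (?h w) \<partial>stdg d)"
      by (rule nn_integral_cong) (simp only: max_def ennreal_neg ennreal_0 not_le less_imp_le split: if_split, auto simp: ennreal_neg)
    finally show ?thesis .
  qed
  ultimately have "ennreal (exp (- (\<beta> * real d / sc))) \<le> ennreal (accept_prob y)" using le by simp
  then show ?thesis using accept_prob_pos[of y] by simp
qed

end

section \<open>Law and cost of the sampler\<close>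

context smooth_tilt
begin

lemma in_prob_algebra: "prob_space M \<Longrightarrow> sets M = sets N \<Longrightarrow> M \<in> space (prob_algebra N)"
  by (simp add: space_prob_algebra)

lemma gauss_kernel: "(\<lambda>x. gauss d x \<eta>) \<in> measurable (lebd d) (prob_algebra (lebd d))"
proof -
  have m: "(\<lambda>(x, z). mv d x (sqrt \<eta>) z) \<in> measurable (lebd d \<Otimes>\<^sub>M lebd d) (lebd d)"
    unfolding split_beta' by (intro mv_measurable measurable_fst measurable_snd borel_measurable_const)
  have "(\<lambda>x. distr (stdg d) (lebd d) (mv d x (sqrt \<eta>))) \<in> measurable (lebd d) (prob_algebra (lebd d))"
    by (rule measurable_distr_prob_space2[OF _ m]) (intro measurable_const in_prob_algebra prob_stdg sets_stdg)
  then show ?thesis by (simp only: gauss_eq_distr[OF \<eta>(1)])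
qed

lemma accept_prob_measurable: "accept_prob \<in> borel_measurable (lebd d)"
  unfolding accept_prob_def[abs_def]
  by (intro borel_measurable_divide borel_measurable_times borel_measurable_const Zt_measurable measurable_compose[OF prox_value_measurable borel_measurable_exp])

text \<open>The normalizing constant and the integral of the density over B depend measurably on the parameter by
  Fubini.\<close>

lemma gibbs_emeasure_measurable:
  assumes B: "B \<in> sets (lebd d)"
  shows "(\<lambda>y. emeasure (gibbs d (gt y)) B) \<in> borel_measurable (lebd d)"
proof -
  interpret L: sigma_finite_measure "lebd d" by (rule sigma_finite_lebd)
  have "emeasure (gibbs d (gt y)) B = (\<integral>\<^sup>+z. ennreal (exp (- gt y z) / Zt y) * indicator B z \<partial>lebd d)" for y
    unfolding gibbs_def Zt_def[symmetric] by (rule emeasure_density[OF _ B]) measurable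
  moreover have "(\<lambda>y. \<integral>\<^sup>+z. ennreal (exp (- gt y z) / Zt y) * indicator B z \<partial>lebd d) \<in> borel_measurable (lebd d)"
  proof (rule L.borel_measurable_nn_integral)
    have t: "(\<lambda>w. gt (fst w) (snd w)) \<in> borel_measurable (lebd d \<Otimes>\<^sub>M lebd d)"
      using tilt_joint_measurable by (simp add: split_beta')
    have "(\<lambda>w. exp (- gt (fst w) (snd w)) / Zt (fst w)) \<in> borel_measurable (lebd d \<Otimes>\<^sub>M lebd d)"
      by (intro borel_measurable_divide measurable_compose[OF borel_measurable_uminus[OF t] borel_measurable_exp] measurable_compose[OF measurable_fst Zt_measurable])
    moreover have "(\<lambda>w. indicator B (snd w) :: ennreal) \<in> borel_measurable (lebd d \<Otimes>\<^sub>M lebd d)"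
      by (rule measurable_compose[OF measurable_snd borel_measurable_indicator[OF B]])
    ultimately show "(\<lambda>(y, z). ennreal (exp (- gt y z) / Zt y) * indicator B z) \<in> borel_measurable (lebd d \<Otimes>\<^sub>M lebd d)"
      unfolding split_beta' by (intro borel_measurable_times_ennreal measurable_compose[OF _ measurable_ennreal])
  qed
  ultimately show ?thesis by simp
qed

lemma emeasure_rej_rect:
  assumes B: "B \<in> sets (lebd d)" and C: "C \<in> sets borel"
  shows "emeasure (rej y) (B \<times> C) = (\<Sum>j. indicator C (of_nat (Suc j)) * (ennreal ((1 - accept_prob y) ^ j) * (ennreal (accept_prob y) * emeasure (gibbs d (gt y)) B)))"
proof -
  interpret R: rejection_scheme "proposal y" "accept_set y" fst "lebd d" by (rule rejection_scheme_px)
  have "emeasure (rej y) (B \<times> C) = emeasure R.P ((\<lambda>\<omega>. (fst (\<omega> (R.T \<omega>)), R.num \<omega>)) -` (B \<times> C) \<inter> space R.P)"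
    unfolding rej_eq by (rule emeasure_distr[OF rej_map_measurable pair_measureI[OF B C]])
  also have "(\<lambda>\<omega>. (fst (\<omega> (R.T \<omega>)), R.num \<omega>)) -` (B \<times> C) \<inter> space R.P = {\<omega> \<in> space R.P. fst (\<omega> (R.T \<omega>)) \<in> B \<and> R.num \<omega> \<in> C}"
    by (rule set_eqI) (simp only: Int_iff vimage_eq mem_Collect_eq mem_Times_iff fst_conv snd_conv, argo)
  finally show ?thesis by (simp only: R.emeasure_out[OF B C] emeasure_accept[OF B] R.p_def accept_prob_eq)
qed

lemma rej_kernel: "rej \<in> measurable (lebd d) (prob_algebra (lebd d \<Otimes>\<^sub>M borel))"
proof (rule measurable_prob_algebra_generated[OF sets_pair_measure Int_stable_pair_measure_generator])
  show "{a \<times> b |a b. a \<in> sets (lebd d) \<and> b \<in> sets borel} \<subseteq> Pow (space (lebd d) \<times> space borel)"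
    by (rule pair_measure_closed)
  show "prob_space (rej y)" for y by (rule rej_prob)
  show "sets (rej y) = sets (lebd d \<Otimes>\<^sub>M borel)" for y by (rule sets_rej)
  fix S assume "S \<in> {a \<times> b |a b. a \<in> sets (lebd d) \<and> b \<in> sets (borel :: ennreal measure)}"
  then obtain B C where S: "S = B \<times> C" and B: "B \<in> sets (lebd d)" and C: "C \<in> sets (borel :: ennreal measure)" by blast
  show "(\<lambda>y. emeasure (rej y) S) \<in> borel_measurable (lebd d)"
    unfolding S emeasure_rej_rect[OF B C]
    by (intro borel_measurable_suminf_order borel_measurable_times_ennreal borel_measurable_const gibbs_emeasure_measurable[OF B]
        measurable_compose[OF _ measurable_ennreal] borel_measurable_power borel_measurable_diff accept_prob_measurable)
qed

lemma gibbs_kernel: "(\<lambda>y. gibbs d (gt y)) \<in> measurable (lebd d) (prob_algebra (lebd d))"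
  unfolding rej_fst[symmetric]
  by (rule measurable_compose[OF rej_kernel measurable_distr_prob_space[OF measurable_fst]])

lemma step_kernel: "(\<lambda>x. gauss d x \<eta> \<bind> (\<lambda>y. gibbs d (gt y))) \<in> measurable (lebd d) (prob_algebra (lebd d))"
  by (rule measurable_bind_prob_space[OF gauss_kernel gibbs_kernel])

text \<open>The accepted point together with the running number of oracle calls, starting from n; the summand 2 is the
  proximity call and the evaluation at the minimizer.\<close>

definition rejn :: "ennreal \<Rightarrow> (nat \<Rightarrow> real) \<Rightarrow> ((nat \<Rightarrow> real) \<times> ennreal) measure" where
  "rejn n y = distr (rej y) (lebd d \<Otimes>\<^sub>M borel) (\<lambda>(z, t). (z, n + (2 + t)))"

lemma shift_measurable: "(\<lambda>v. (fst (snd v), fst (fst v) + (2 + snd (snd v)))) \<in> measurable ((borel \<Otimes>\<^sub>M lebd d) \<Otimes>\<^sub>M (lebd d \<Otimes>\<^sub>M borel)) (lebd d \<Otimes>\<^sub>M (borel :: ennreal measure))"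
  by measurable

lemma shift_measurable1: "(\<lambda>(z, t). (z, n + (2 + t))) \<in> measurable (lebd d \<Otimes>\<^sub>M borel) (lebd d \<Otimes>\<^sub>M (borel :: ennreal measure))"
  by measurable

lemma rejn_kernel: "(\<lambda>(n, y). rejn n y) \<in> measurable (borel \<Otimes>\<^sub>M lebd d) (prob_algebra (lebd d \<Otimes>\<^sub>M borel))"
proof -
  have 1: "(\<lambda>w. rej (snd w)) \<in> measurable (borel \<Otimes>\<^sub>M lebd d) (prob_algebra (lebd d \<Otimes>\<^sub>M borel))"
    by (rule measurable_compose[OF measurable_snd rej_kernel])
  have "(\<lambda>w :: ennreal \<times> (nat \<Rightarrow> real). distr (rej (snd w)) (lebd d \<Otimes>\<^sub>M borel) (\<lambda>zt. (fst zt, fst w + (2 + snd zt)))) \<in> measurable (borel \<Otimes>\<^sub>M lebd d) (prob_algebra (lebd d \<Otimes>\<^sub>M borel))"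
    by (rule measurable_distr_prob_space2[OF 1]) (simp only: split_beta' shift_measurable)
  then show ?thesis by (simp add: rejn_def split_beta')
qed

definition stepn :: "(nat \<Rightarrow> real) \<times> ennreal \<Rightarrow> ((nat \<Rightarrow> real) \<times> ennreal) measure" where
  "stepn w = gauss d (fst w) \<eta> \<bind> (\<lambda>y. rejn (snd w) y)"

lemma stepn_kernel: "stepn \<in> measurable (lebd d \<Otimes>\<^sub>M borel) (prob_algebra (lebd d \<Otimes>\<^sub>M borel))"
  unfolding stepn_def[abs_def]
proof (rule measurable_bind_prob_space2)
  show "(\<lambda>w. gauss d (fst w) \<eta>) \<in> measurable (lebd d \<Otimes>\<^sub>M borel) (prob_algebra (lebd d))"
    by (rule measurable_compose[OF measurable_fst gauss_kernel])
  have "(\<lambda>v. (snd (fst v), snd v)) \<in> measurable ((lebd d \<Otimes>\<^sub>M borel) \<Otimes>\<^sub>M lebd d) (borel \<Otimes>\<^sub>M lebd d)" by measurable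
  from measurable_compose[OF this rejn_kernel]
  show "(\<lambda>(w, y). rejn (snd w) y) \<in> measurable ((lebd d \<Otimes>\<^sub>M borel) \<Otimes>\<^sub>M lebd d) (prob_algebra (lebd d \<Otimes>\<^sub>M borel))"
    by (simp add: split_beta')
qed

lemma sampler_Suc: "sampler d f \<beta> \<eta> \<rho> (Suc k) = sampler d f \<beta> \<eta> \<rho> k \<bind> stepn"
  unfolding sampler.simps stepn_def[abs_def] rejn_def by (simp add: split_beta')

lemma sampler_in:
  assumes \<rho>: "prob_space \<rho>" "sets \<rho> = sets (lebd d)"
  shows "sampler d f \<beta> \<eta> \<rho> k \<in> space (prob_algebra (lebd d \<Otimes>\<^sub>M borel))"
proof (induction k)
  case 0
  have "(\<lambda>x. (x, 0)) \<in> measurable \<rho> (lebd d \<Otimes>\<^sub>M (borel :: ennreal measure))"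
    by (rule measurable_Pair[OF measurable_ident_sets[OF \<rho>(2)] measurable_const]) simp
  then show ?case unfolding sampler.simps by (intro in_prob_algebra prob_space.prob_space_distr[OF \<rho>(1)]) simp_all
next
  case (Suc k)
  show ?case unfolding sampler_Suc
    by (intro in_prob_algebra prob_space_bind'[OF Suc stepn_kernel] sets_bind'[OF Suc stepn_kernel])
qed

lemma rejn_fst: "distr (rejn n y) (lebd d) fst = gibbs d (gt y)"
proof -
  have "distr (rejn n y) (lebd d) fst = distr (rej y) (lebd d) (fst \<circ> (\<lambda>(z, t). (z, n + (2 + t))))"
    unfolding rejn_def by (rule distr_distr[OF measurable_fst]) (use shift_measurable1 in \<open>simp add: measurable_cong_sets[OF sets_rej refl]\<close>)
  also have "fst \<circ> (\<lambda>(z, t). (z, n + (2 + t))) = (fst :: (nat \<Rightarrow> real) \<times> ennreal \<Rightarrow> _)" by (auto simp: fun_eq_iff)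
  finally show ?thesis by (simp only: rej_fst)
qed

lemma rejn_kernel1: "rejn n \<in> measurable (lebd d) (prob_algebra (lebd d \<Otimes>\<^sub>M borel))"
  using measurable_compose[OF measurable_Pair1'[of n borel "lebd d"] rejn_kernel] by simp

lemma stepn_fst: "w \<in> space (lebd d \<Otimes>\<^sub>M borel) \<Longrightarrow> distr (stepn w) (lebd d) fst = gauss d (fst w) \<eta> \<bind> (\<lambda>y. gibbs d (gt y))"
  unfolding stepn_def
  by (subst distr_bind[OF _ _ measurable_fst])
     (use measurable_prob_algebraD[OF rejn_kernel1] in \<open>simp_all add: rejn_fst measurable_cong_sets[OF sets_gauss refl] PiE_eq_empty_iff\<close>)

lemma sampler_fst:
  assumes \<rho>: "prob_space \<rho>" "sets \<rho> = sets (lebd d)"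
  shows "distr (sampler d f \<beta> \<eta> \<rho> k) (lebd d) fst = prox_law d f \<eta> \<rho> k"
proof (induction k)
  case 0
  have m: "(\<lambda>x. (x, 0)) \<in> measurable \<rho> (lebd d \<Otimes>\<^sub>M (borel :: ennreal measure))"
    by (rule measurable_Pair[OF measurable_ident_sets[OF \<rho>(2)] measurable_const]) simp
  show ?case unfolding sampler.simps prox_law.simps
    by (subst distr_distr[OF measurable_fst m]) (simp add: comp_def distr_id2[OF \<rho>(2)[symmetric]])
next
  case (Suc k)
  let ?S = "sampler d f \<beta> \<eta> \<rho> k"
  have S: "prob_space ?S" "sets ?S = sets (lebd d \<Otimes>\<^sub>M borel)"
    using sampler_in[OF \<rho>, of k] by (auto simp: space_prob_algebra)
  have ne: "space ?S \<noteq> {}" using S(1) by (rule prob_space.not_empty)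
  have sp: "space ?S = space (lebd d \<Otimes>\<^sub>M borel)" using S(2) by (rule sets_eq_imp_space_eq)
  have st: "stepn \<in> measurable ?S (subprob_algebra (lebd d \<Otimes>\<^sub>M borel))"
    using measurable_prob_algebraD[OF stepn_kernel] by (simp only: measurable_cong_sets[OF S(2) refl])
  have f: "fst \<in> measurable ?S (lebd d)" using measurable_fst by (simp only: measurable_cong_sets[OF S(2) refl])
  have "distr (sampler d f \<beta> \<eta> \<rho> (Suc k)) (lebd d) fst = ?S \<bind> (\<lambda>w. distr (stepn w) (lebd d) fst)"
    unfolding sampler_Suc by (rule distr_bind[OF st ne measurable_fst])
  also have "\<dots> = ?S \<bind> (\<lambda>w. gauss d (fst w) \<eta> \<bind> (\<lambda>y. gibbs d (gt y)))"
    by (rule bind_cong[OF refl]) (simp only: sp stepn_fst)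
  also have "\<dots> = distr ?S (lebd d) fst \<bind> (\<lambda>x. gauss d x \<eta> \<bind> (\<lambda>y. gibbs d (gt y)))"
    by (rule bind_distr[symmetric, OF f measurable_prob_algebraD[OF step_kernel] ne])
  finally show ?case by (simp only: Suc prox_law.simps)
qed

lemma rejn_snd: "(\<integral>\<^sup>+w. snd w \<partial>rejn n y) \<le> n + (2 + ennreal (exp (\<beta> * real d / sc)))"
proof -
  interpret r: prob_space "rej y" by (rule rej_prob)
  have "(\<integral>\<^sup>+w. snd w \<partial>rejn n y) = (\<integral>\<^sup>+w. n + (2 + snd w) \<partial>rej y)"
    unfolding rejn_def by (subst nn_integral_distr) (use shift_measurable1 in \<open>simp_all add: measurable_cong_sets[OF sets_rej refl] split_beta'\<close>)
  also have "\<dots> = n + (2 + (\<integral>\<^sup>+w. snd w \<partial>rej y))"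
    by (simp add: nn_integral_add measurable_cong_sets[OF sets_rej refl] r.emeasure_space_1)
  also have "(\<integral>\<^sup>+w. snd w \<partial>rej y) \<le> ennreal (exp (\<beta> * real d / sc))"
  proof -
    have "1 / accept_prob y \<le> 1 / exp (- (\<beta> * real d / sc))"
      by (rule divide_left_mono[OF accept_prob_lower]) (use accept_prob_pos in auto)
    then show ?thesis unfolding rej_expected_trials by (intro ennreal_leI) (simp add: exp_minus inverse_eq_divide)
  qed
  finally show ?thesis by (simp add: add_left_mono)
qed

lemma sampler_cost:
  assumes \<rho>: "prob_space \<rho>" "sets \<rho> = sets (lebd d)"
  shows "(\<integral>\<^sup>+w. snd w \<partial>sampler d f \<beta> \<eta> \<rho> k) \<le> of_nat k * (2 + ennreal (exp (\<beta> * real d / sc)))"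
proof (induction k)
  case 0
  have m: "(\<lambda>x. (x, 0)) \<in> measurable \<rho> (lebd d \<Otimes>\<^sub>M (borel :: ennreal measure))"
    by (rule measurable_Pair[OF measurable_ident_sets[OF \<rho>(2)] measurable_const]) simp
  show ?case unfolding sampler.simps by (subst nn_integral_distr[OF m]) simp_all
next
  case (Suc k)
  let ?S = "sampler d f \<beta> \<eta> \<rho> k" and ?c = "2 + ennreal (exp (\<beta> * real d / sc))"
  have S: "prob_space ?S" "sets ?S = sets (lebd d \<Otimes>\<^sub>M borel)"
    using sampler_in[OF \<rho>, of k] by (auto simp: space_prob_algebra)
  interpret S: prob_space ?S by (rule S)
  have st: "stepn \<in> measurable ?S (subprob_algebra (lebd d \<Otimes>\<^sub>M borel))"
    using measurable_prob_algebraD[OF stepn_kernel] by (simp only: measurable_cong_sets[OF S(2) refl])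
  have sm: "snd \<in> borel_measurable ?S" using measurable_snd by (simp only: measurable_cong_sets[OF S(2) refl])
  have "(\<integral>\<^sup>+w. snd w \<partial>sampler d f \<beta> \<eta> \<rho> (Suc k)) = (\<integral>\<^sup>+w. \<integral>\<^sup>+v. snd v \<partial>stepn w \<partial>?S)"
    unfolding sampler_Suc by (rule nn_integral_bind[OF measurable_snd st])
  also have "\<dots> \<le> (\<integral>\<^sup>+w. snd w + ?c \<partial>?S)"
  proof (rule nn_integral_mono)
    fix w :: "(nat \<Rightarrow> real) \<times> ennreal"
    interpret g: prob_space "gauss d (fst w) \<eta>" by (rule prob_gauss[OF \<eta>(1)])
    have "rejn (snd w) \<in> measurable (gauss d (fst w) \<eta>) (subprob_algebra (lebd d \<Otimes>\<^sub>M borel))"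
      using measurable_prob_algebraD[OF rejn_kernel1] by (simp only: measurable_cong_sets[OF sets_gauss refl])
    then have "(\<integral>\<^sup>+v. snd v \<partial>stepn w) = (\<integral>\<^sup>+y. \<integral>\<^sup>+v. snd v \<partial>rejn (snd w) y \<partial>gauss d (fst w) \<eta>)"
      unfolding stepn_def by (rule nn_integral_bind[OF measurable_snd])
    also have "\<dots> \<le> (\<integral>\<^sup>+y. snd w + ?c \<partial>gauss d (fst w) \<eta>)"
      by (rule nn_integral_mono) (rule rejn_snd)
    also have "\<dots> = snd w + ?c" using g.emeasure_space_1 by simp
    finally show "(\<integral>\<^sup>+v. snd v \<partial>stepn w) \<le> snd w + ?c" .
  qed
  also have "\<dots> = (\<integral>\<^sup>+w. snd w \<partial>?S) + ?c"
    using sm by (subst nn_integral_add) (simp_all add: S.emeasure_space_1)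
  also have "\<dots> \<le> of_nat k * ?c + ?c" by (rule add_right_mono[OF Suc])
  also have "\<dots> = of_nat (Suc k) * ?c" by (simp add: distrib_right add.commute)
  finally show ?case .
qed

end

section \<open>Comparison of the two constants of the target\<close>

lemma lebd_translation:
  "distr (lebd d) (lebd d) (\<lambda>x. mv d x s e) = lebd d"
proof (rule PL.PiM_eqI)
  have m: "(\<lambda>x. mv d x s e) \<in> measurable (lebd d) (lebd d)"
    unfolding mv_def by (rule measurable_into_lebd) (intro borel_measurable_add lebd_component borel_measurable_const)
  fix A :: "nat \<Rightarrow> real set" assume A: "\<And>i. i \<in> {..<d} \<Longrightarrow> A i \<in> sets lborel"
  have bx: "PiE {..<d} A \<in> sets (lebd d)" by (rule sets_PiM_I_finite) (use A in auto)
  have "emeasure (distr (lebd d) (lebd d) (\<lambda>x. mv d x s e)) (PiE {..<d} A)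
     = emeasure (lebd d) ((\<lambda>x. mv d x s e) -` PiE {..<d} A \<inter> space (lebd d))"
    by (rule emeasure_distr[OF m bx])
  also have "(\<lambda>x. mv d x s e) -` PiE {..<d} A \<inter> space (lebd d) = PiE {..<d} (\<lambda>i. (\<lambda>t. s * e i + t) -` A i)"
    by (auto simp: PiE_iff mv_def add.commute)
  also have "emeasure (lebd d) \<dots> = (\<Prod>i<d. emeasure lborel ((\<lambda>t. s * e i + t) -` A i))"
  proof (rule PL.emeasure_PiM)
    fix i assume "i \<in> {..<d}"
    then show "(\<lambda>t. s * e i + t) -` A i \<in> sets lborel"
      using measurable_sets[of "\<lambda>t. s * e i + t" borel borel "A i"] A by simp
  qed simp
  also have "\<dots> = (\<Prod>i<d. emeasure lborel (A i))"
  proof (rule prod.cong[OF refl])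
    fix i assume "i \<in> {..<d}"
    then have Ai: "A i \<in> sets borel" using A by simp
    have "emeasure lborel (A i) = emeasure (distr lborel borel ((+) (s * e i))) (A i)" by (simp only: lborel_distr_plus)
    also have "\<dots> = emeasure lborel ((+) (s * e i) -` A i \<inter> space lborel)" by (rule emeasure_distr) (use Ai in simp_all)
    finally show "emeasure lborel ((\<lambda>t. s * e i + t) -` A i) = emeasure lborel (A i)" by simp
  qed
  finally show "emeasure (distr (lebd d) (lebd d) (\<lambda>x. mv d x s e)) (PiE {..<d} A) = (\<Prod>i<d. emeasure lborel (A i))" .
qed simp_all

lemma mv_translate_measurable: "(\<lambda>x. mv d x s e) \<in> measurable (lebd d) (lebd d)"
  unfolding mv_def by (rule measurable_into_lebd) (intro borel_measurable_add lebd_component borel_measurable_const)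

lemma lebd_integral_translate:
  assumes K: "K \<in> borel_measurable (lebd d)"
  shows "(\<integral>x. K (mv d x s e) \<partial>lebd d) = (\<integral>x. K x \<partial>lebd d :: real)"
    and "integrable (lebd d) K \<Longrightarrow> integrable (lebd d) (\<lambda>x. K (mv d x s e) :: real)"
  using integral_distr[OF mv_translate_measurable K, of s e] integrable_distr_eq[OF mv_translate_measurable K, of s e]
  by (simp_all only: lebd_translation)

context smooth_tilt
begin

abbreviation tgt :: "(nat \<Rightarrow> real) measure" where "tgt \<equiv> gibbs d f"

sublocale tg: rd_prob d tgt
  by (rule rd_prob.intro[OF pi_prob]) (rule sets_gibbs)

lemma tgt_integral:
  assumes "g \<in> borel_measurable (lebd d)"
  shows "(\<integral>x. g x \<partial>tgt) = (\<integral>x. exp (- f x) / Zf * g x \<partial>lebd d :: real)"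
  unfolding gibbs_def Zf_def[symmetric] by (subst integral_density) (use assms Zf_pos in \<open>auto intro: less_imp_le\<close>)

definition e0 :: "nat \<Rightarrow> real" where "e0 = (\<lambda>i\<in>{..<d}. if i = 0 then 1 else 0)"

lemma normd_e0: "normd d e0 = 1"
proof -
  have "(normd d e0)\<^sup>2 = (\<Sum>i<d. if i = 0 then 1 else 0)"
    unfolding normd_sq by (rule sum.cong) (auto simp: e0_def)
  then have "(normd d e0)\<^sup>2 = 1" using d1 by simp
  then show ?thesis using normd_nonneg[of d e0] by (simp add: power2_eq_1_iff)
qed

text \<open>Smoothness of f bounds the second difference along a coordinate, and convexity of the exponential transfers
  the bound to the density: the density cannot drop quickly on both sides of a point.\<close>

lemma shift_density:
  assumes x: "x \<in> Rd d"
  shows "exp (- (\<beta> * s\<^sup>2 / 2)) * exp (- f x) \<le> (exp (- f (mv d x s e0)) + exp (- f (mv d x (- s) e0))) / 2"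
proof -
  define D where "D = dotp d (gradd d f x) e0"
  have b: "f (mv d x t e0) \<le> f x + t * D + \<beta> * t\<^sup>2 / 2" for t
  proof -
    have "\<bar>f (mv d x t e0) - f x - t * D\<bar> \<le> \<beta> / 2 * t\<^sup>2"
      using f_quadratic[OF x mv_Rd[of d "zer d" t e0]]
      by (simp add: mv_step dotp_scaled normd_scaled normd_e0 D_def)
    then show ?thesis unfolding abs_le_iff by simp
  qed
  have 1: "exp (- f x - \<beta> * s\<^sup>2 / 2) * exp (- (s * D)) \<le> exp (- f (mv d x s e0))"
    using b[of s] by (simp add: mult_exp_exp)
  have 2: "exp (- f x - \<beta> * s\<^sup>2 / 2) * exp (s * D) \<le> exp (- f (mv d x (- s) e0))"
    using b[of "- s"] by (simp add: mult_exp_exp)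
  have "2 \<le> exp (- u) + exp u" for u :: real
    using exp_ge_add_one_self[of u] exp_ge_add_one_self[of "- u"] by linarith
  from this[of "s * D"] have "1 \<le> (exp (- (s * D)) + exp (s * D)) / 2" by simp
  then have "exp (- f x - \<beta> * s\<^sup>2 / 2) * 1 \<le> exp (- f x - \<beta> * s\<^sup>2 / 2) * ((exp (- (s * D)) + exp (s * D)) / 2)"
    by (rule mult_left_mono) simp
  also have "\<dots> \<le> (exp (- f (mv d x s e0)) + exp (- f (mv d x (- s) e0))) / 2"
    using 1 2 by (simp add: distrib_left)
  finally have "exp (- f x - \<beta> * s\<^sup>2 / 2) * 1 \<le> (exp (- f (mv d x s e0)) + exp (- f (mv d x (- s) e0))) / 2" .
  moreover have "exp (- (\<beta> * s\<^sup>2 / 2)) * exp (- f x) = exp (- f x - \<beta> * s\<^sup>2 / 2)"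
    unfolding mult_exp_exp by (rule arg_cong[of _ _ exp]) simp
  ultimately show ?thesis by simp
qed

lemma shift_expectation:
  assumes F: "bdd_meas d M F" and nn: "\<And>x. x \<in> Rd d \<Longrightarrow> 0 \<le> F x"
  shows "exp (- (\<beta> * s\<^sup>2 / 2)) * (\<integral>x. F x \<partial>tgt) \<le> (\<integral>x. (F (mv d x s e0) + F (mv d x (- s) e0)) / 2 \<partial>tgt)"
proof -
  define H where "H = (\<lambda>x. exp (- f x) / Zf)"
  have Fm: "F \<in> borel_measurable (lebd d)" using F by (rule bdd_measD)
  have Hm: "H \<in> borel_measurable (lebd d)" unfolding H_def by measurable
  have iH: "integrable (lebd d) H" unfolding H_def using integrable_f by simp
  have H0: "0 \<le> H x" for x using Zf_pos by (simp add: H_def)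
  have FM: "integrable (lebd d) (\<lambda>x. G x * F' x)" if "integrable (lebd d) G" "bdd_meas d M F'" for G F' :: "(nat \<Rightarrow> real) \<Rightarrow> real"
  proof (rule Bochner_Integration.integrable_bound)
    show "integrable (lebd d) (\<lambda>x. M * G x)" using that by simp
    show "(\<lambda>x. G x * F' x) \<in> borel_measurable (lebd d)" using that by (intro borel_measurable_times borel_measurable_integrable bdd_measD)
    show "AE x in lebd d. norm (G x * F' x) \<le> norm (M * G x)"
      using bdd_measD(2)[OF that(2)] bdd_meas_nonneg[OF F] by (intro AE_I2) (simp add: abs_mult mult.commute mult_right_mono)
  qed
  have Fs: "bdd_meas d M (\<lambda>x. F (mv d x t e0))" for t
    unfolding bdd_meas_def using bdd_measD(2)[OF F mv_Rd] measurable_compose[OF mv_translate_measurable Fm] by auto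
  have iHs: "integrable (lebd d) (\<lambda>x. H (mv d x t e0))" for t by (rule lebd_integral_translate(2)[OF Hm iH])
  have tr: "(\<integral>x. H x * F (mv d x t e0) \<partial>lebd d) = (\<integral>x. H (mv d x (- t) e0) * F x \<partial>lebd d)" for t
  proof -
    have "(\<lambda>x. H (mv d x (- t) e0) * F x) \<in> borel_measurable (lebd d)"
      by (rule borel_measurable_times[OF borel_measurable_integrable[OF iHs] Fm])
    from lebd_integral_translate(1)[OF this, of t e0]
    have "(\<integral>x. H (mv d (mv d x t e0) (- t) e0) * F (mv d x t e0) \<partial>lebd d) = (\<integral>x. H (mv d x (- t) e0) * F x \<partial>lebd d)" .
    moreover have "mv d (mv d x t e0) (- t) e0 = x" if "x \<in> Rd d" for x
      by (rule Rd_eqI[OF mv_Rd that]) (simp add: mv_nth)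
    then have "(\<integral>x. H (mv d (mv d x t e0) (- t) e0) * F (mv d x t e0) \<partial>lebd d) = (\<integral>x. H x * F (mv d x t e0) \<partial>lebd d)"
      by (intro Bochner_Integration.integral_cong refl) simp
    ultimately show ?thesis by simp
  qed
  let ?k = "exp (- (\<beta> * s\<^sup>2 / 2))"
  have "?k * (\<integral>x. F x \<partial>tgt) = (\<integral>x. ?k * (H x * F x) \<partial>lebd d)"
    unfolding tgt_integral[OF Fm] H_def by simp
  also have "\<dots> \<le> (\<integral>x. (H (mv d x (- s) e0) * F x + H (mv d x s e0) * F x) / 2 \<partial>lebd d)"
  proof (rule integral_mono)
    show "integrable (lebd d) (\<lambda>x. ?k * (H x * F x))" by (intro integrable_mult_right FM iH F)
    show "integrable (lebd d) (\<lambda>x. (H (mv d x (- s) e0) * F x + H (mv d x s e0) * F x) / 2)"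
      by (intro integrable_divide Bochner_Integration.integrable_add FM iHs F)
    fix x assume "x \<in> space (lebd d)"
    then have x: "x \<in> Rd d" by simp
    have "?k * H x \<le> (H (mv d x (- s) e0) + H (mv d x s e0)) / 2"
      using divide_right_mono[OF shift_density[OF x, of s], of Zf] Zf_pos by (simp add: H_def add_divide_distrib add.commute)
    then have "?k * H x * F x \<le> (H (mv d x (- s) e0) + H (mv d x s e0)) / 2 * F x" by (rule mult_right_mono) (rule nn[OF x])
    then show "?k * (H x * F x) \<le> (H (mv d x (- s) e0) * F x + H (mv d x s e0) * F x) / 2" by (simp add: algebra_simps)
  qed
  also have "\<dots> = ((\<integral>x. H (mv d x (- s) e0) * F x \<partial>lebd d) + (\<integral>x. H (mv d x s e0) * F x \<partial>lebd d)) / 2"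
    by (simp add: FM[OF iHs F])
  also have "\<dots> = ((\<integral>x. H x * F (mv d x s e0) \<partial>lebd d) + (\<integral>x. H x * F (mv d x (- s) e0) \<partial>lebd d)) / 2"
    using tr[of s] tr[of "- s"] by simp
  also have "\<dots> = ((\<integral>x. F (mv d x s e0) \<partial>tgt) + (\<integral>x. F (mv d x (- s) e0) \<partial>tgt)) / 2"
    unfolding tgt_integral[OF bdd_measD(1)[OF Fs]] H_def ..
  also have "\<dots> = (\<integral>x. (F (mv d x s e0) + F (mv d x (- s) e0)) / 2 \<partial>tgt)"
    by (simp add: tg.bdd_integrable[OF Fs])
  finally show ?thesis .
qed

lemma trig_bdd: "bdd_meas d 1 (\<lambda>x. cos (\<omega> * x 0))"
  unfolding bdd_meas_def using d1 by (auto intro!: measurable_compose[OF _ borel_measurable_cos] borel_measurable_times lebd_component)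

text \<open>A shift by s reverses the sign of cos(\<pi> t / s). The averaged density of the two shifts dominates the
  density up to a factor close to one, so applying this to the nonnegative functions 1 + cos and 1 - cos forces
  the mean of the cosine to be small.\<close>

lemma characteristic_small:
  assumes s: "0 < s"
  shows "\<bar>\<integral>x. cos (pi / s * x 0) \<partial>tgt\<bar> \<le> \<beta> * s\<^sup>2 / 2"
proof -
  interpret tp: prob_space tgt by (rule pi_prob)
  let ?c = "\<lambda>x. cos (pi / s * x 0)" let ?k = "exp (- (\<beta> * s\<^sup>2 / 2))"
  define m where "m = (\<integral>x. ?c x \<partial>tgt)"
  have ic: "integrable tgt ?c" by (rule tg.bdd_integrable[OF trig_bdd])
  have sh: "cos (pi / s * mv d x t e0 0) = - ?c x" if "t = s \<or> t = - s" for x t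
  proof -
    have "pi / s * mv d x t e0 0 = pi / s * x 0 + pi \<or> pi / s * mv d x t e0 0 = pi / s * x 0 - pi"
      using that s d1 by (auto simp: mv_nth e0_def field_simps)
    then show ?thesis by (auto simp: cos_diff)
  qed
  have key: "?k * (1 + a * m) \<le> 1 - a * m" if a: "a = 1 \<or> a = - 1" for a :: real
  proof -
    have b: "bdd_meas d 2 (\<lambda>x. 1 + a * ?c x)"
    proof -
      have e: "(2::real) = 1 + \<bar>a\<bar> * 1" using a by auto
      show ?thesis unfolding e by (rule bdd_meas_add[OF bdd_meas_const bdd_meas_cmult[OF trig_bdd]]) simp
    qed
    have nn: "0 \<le> 1 + a * ?c x" for x
      using a cos_le_one[of "pi / s * x 0"] cos_ge_minus_one[of "pi / s * x 0"] by (elim disjE) (hypsubst, linarith)+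
    have "?k * (\<integral>x. 1 + a * ?c x \<partial>tgt) \<le> (\<integral>x. ((1 + a * cos (pi / s * mv d x s e0 0)) + (1 + a * cos (pi / s * mv d x (- s) e0 0))) / 2 \<partial>tgt)"
      by (rule shift_expectation[OF b]) (rule nn)
    also have "\<dots> = (\<integral>x. 1 - a * ?c x \<partial>tgt)"
    proof (rule Bochner_Integration.integral_cong[OF refl])
      fix x
      have s1: "cos (pi / s * mv d x s e0 0) = - ?c x" "cos (pi / s * mv d x (- s) e0 0) = - ?c x" by (rule sh, simp)+
      show "((1 + a * cos (pi / s * mv d x s e0 0)) + (1 + a * cos (pi / s * mv d x (- s) e0 0))) / 2 = 1 - a * ?c x"
        unfolding s1 by simp
    qed
    finally show ?thesis using ic tg.prob_Rd by (simp add: m_def)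
  qed
  have k1: "1 - \<beta> * s\<^sup>2 / 2 \<le> ?k" using exp_ge_add_one_self[of "- (\<beta> * s\<^sup>2 / 2)"] by simp
  have k2: "?k \<le> 1" "0 < ?k" using \<beta> by simp_all
  have m1: "\<bar>m\<bar> \<le> 1"
    unfolding m_def by (rule bdd_meas_integral_le[OF trig_bdd[of "pi / s"] tg.prob tg.id_meas])
  have "a * m * (1 + ?k) \<le> 1 - ?k" if "a = 1 \<or> a = - 1" for a using key[OF that] by (simp add: algebra_simps)
  then have "a * m \<le> 1 - ?k" if a: "a = 1 \<or> a = - 1" for a
  proof (cases "0 \<le> a * m")
    case True
    then have "a * m * 1 \<le> a * m * (1 + ?k)" using k2 by (intro mult_left_mono) auto
    then show ?thesis using \<open>\<And>a. a = 1 \<or> a = - 1 \<Longrightarrow> a * m * (1 + ?k) \<le> 1 - ?k\<close>[OF a] by linarith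
  next
    case False then show ?thesis using k2 by linarith
  qed
  from this[of 1] this[of "-1"] have "\<bar>m\<bar> \<le> 1 - ?k" by simp
  then show ?thesis using k1 by (simp add: m_def)
qed

lemma Ck_trig: "Ck d k (\<lambda>x. A * cos (\<omega> * x 0) + B * sin (\<omega> * x 0))"
proof (induction k arbitrary: A B)
  have c: "continuous_map (product_topology (\<lambda>_. euclideanreal) {..<d}) euclideanreal (\<lambda>x. A * cos (\<omega> * x 0) + B * sin (\<omega> * x 0))" for A B
  proof -
    have "continuous_map (product_topology (\<lambda>_. euclideanreal) {..<d}) euclideanreal (\<lambda>x. x 0)"
      using d1 by (intro continuous_map_product_projection) auto
    moreover have "continuous_map euclideanreal euclideanreal (\<lambda>t. A * cos (\<omega> * t) + B * sin (\<omega> * t))"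
      by (auto intro!: continuous_intros)
    ultimately have "continuous_map (product_topology (\<lambda>_. euclideanreal) {..<d}) euclideanreal ((\<lambda>t. A * cos (\<omega> * t) + B * sin (\<omega> * t)) \<circ> (\<lambda>x. x 0))"
      by (rule continuous_map_compose)
    then show ?thesis by (simp only: o_def)
  qed
  {
    case 0
    show ?case unfolding Ck.simps by (rule c)
  next
    case (Suc k)
    show ?case
    proof (rule Ck_SucI[where G = "\<lambda>i x. (if i = 0 then \<omega> * B else 0) * cos (\<omega> * x 0) + (if i = 0 then - (\<omega> * A) else 0) * sin (\<omega> * x 0)"])
      show "continuous_map (product_topology (\<lambda>_. euclideanreal) {..<d}) euclideanreal (\<lambda>x. A * cos (\<omega> * x 0) + B * sin (\<omega> * x 0))" by (rule c)
      show "((\<lambda>t. A * cos (\<omega> * (x(i := t)) 0) + B * sin (\<omega> * (x(i := t)) 0)) has_real_derivative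
         (if i = 0 then \<omega> * B else 0) * cos (\<omega> * x 0) + (if i = 0 then - (\<omega> * A) else 0) * sin (\<omega> * x 0)) (at (x i))" for x i
        by (cases "i = 0") (auto intro!: derivative_eq_intros)
    qed (rule Suc)
  }
qed

text \<open>Test the inequality with p = 3/2 and \<psi> = 1 + cos(\<omega> x) in one coordinate. At a frequency of order
  sqrt \<beta> the law of \<omega> x modulo a period is nearly uniform, so the left-hand side is at least a positive
  constant, whereas the squared gradient is at most \<omega>^2.\<close>

lemma alpha_le_beta:
  assumes L: "LOI d r \<alpha> tgt"
  shows "\<alpha> \<le> 2048 * \<beta>"
proof -
  interpret tp: prob_space tgt by (rule pi_prob)
  have al: "0 < \<alpha>" and r: "1 \<le> r" using L by (auto simp: LOI_def)
  (* with \<beta> s^2 = 1/8 the means of cos (\<omega> x) and cos (2 \<omega> x) are at most 1/16 and 1/64 *)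
  define s where "s = sqrt (1 / (8 * \<beta>))"
  have s: "0 < s" "\<beta> * s\<^sup>2 = 1 / 8" using \<beta> by (auto simp: s_def)
  define \<omega> where "\<omega> = pi / s"
  have om2: "\<omega>\<^sup>2 = 8 * pi\<^sup>2 * \<beta>"
  proof -
    have "s\<^sup>2 = 1 / (8 * \<beta>)" using \<beta> by (simp add: s_def)
    then show ?thesis using \<beta> by (simp add: \<omega>_def power_divide)
  qed
  let ?c = "\<lambda>x::nat\<Rightarrow>real. cos (\<omega> * x 0)"
  define c1 where "c1 = (\<integral>x. ?c x \<partial>tgt)"
  define c2 where "c2 = (\<integral>x. cos (2 * \<omega> * x 0) \<partial>tgt)"
  have c1: "\<bar>c1\<bar> \<le> 1 / 16" using characteristic_small[OF s(1)] s(2) by (simp add: c1_def \<omega>_def)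
  have c2: "\<bar>c2\<bar> \<le> 1 / 64"
  proof -
    have "pi / (s / 2) = 2 * \<omega>" using s by (simp add: \<omega>_def)
    then show ?thesis using characteristic_small[of "s / 2"] s by (simp add: c2_def power_divide)
  qed
  define \<psi> where "\<psi> = (\<lambda>x::nat\<Rightarrow>real. 1 + ?c x)"
  have b: "bdd_meas d 2 \<psi>" unfolding \<psi>_def using bdd_meas_add[OF bdd_meas_const[of 1 1] trig_bdd] by simp
  have p0: "0 \<le> \<psi> x" for x unfolding \<psi>_def using cos_ge_minus_one[of "\<omega> * x 0"] by linarith
  have p2: "\<psi> x \<le> 2" for x unfolding \<psi>_def using cos_le_one[of "\<omega> * x 0"] by linarith
  have pm: "\<psi> \<in> borel_measurable (lebd d)" using b by (rule bdd_measD)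
  have bd: "bdd_meas d B g" if "g \<in> borel_measurable (lebd d)" "\<And>x. \<bar>g x\<bar> \<le> B" for g B using that by (simp add: bdd_meas_def)
  have b2: "integrable tgt (\<lambda>x. (\<psi> x)\<^sup>2)"
  proof -
    have "(\<psi> x)\<^sup>2 \<le> 2\<^sup>2" for x by (rule power_mono[OF p2 p0])
    then show ?thesis by (intro tg.bdd_integrable[OF bd[of "\<lambda>x. (\<psi> x)\<^sup>2" "2\<^sup>2"]]) (use pm in simp_all)
  qed
  have b32: "integrable tgt (\<lambda>x. \<psi> x powr (3 / 2))"
    by (rule tg.bdd_integrable, rule bd[of _ "2 powr (3 / 2)"]) (use pm p0 p2 in \<open>auto intro!: powr_mono2\<close>)
  note b1 = tg.bdd_integrable[OF b]
  define m v where "m = (\<integral>x. \<psi> x \<partial>tgt)" and "v = (\<integral>x. (\<psi> x)\<^sup>2 \<partial>tgt)"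
  have ic: "integrable tgt (\<lambda>x. cos (a * x 0))" for a by (rule tg.bdd_integrable[OF trig_bdd])
  have m: "m = 1 + c1" unfolding m_def \<psi>_def using ic[of \<omega>] tg.prob_Rd by (simp add: c1_def)
  have v: "v = 3 / 2 + 2 * c1 + c2 / 2"
  proof -
    have "v = (\<integral>x. 3 / 2 + 2 * ?c x + cos (2 * \<omega> * x 0) / 2 \<partial>tgt)"
      unfolding v_def \<psi>_def
    proof (rule Bochner_Integration.integral_cong[OF refl])
      fix x :: "nat \<Rightarrow> real"
      have "cos (2 * \<omega> * x 0) = 2 * (?c x)\<^sup>2 - 1" using cos_double_cos[of "\<omega> * x 0"] by (simp add: mult.assoc)
      then show "(1 + ?c x)\<^sup>2 = 3 / 2 + 2 * ?c x + cos (2 * \<omega> * x 0) / 2" by (simp add: power2_eq_square algebra_simps)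
    qed
    also have "\<dots> = 3 / 2 + 2 * c1 + c2 / 2"
      using ic[of \<omega>] ic[of "2 * \<omega>"] tg.prob_Rd by (simp add: c1_def c2_def)
    finally show ?thesis .
  qed
  have mb: "0 < m" "m \<le> 17 / 16" and vb: "136 / 100 \<le> v" using c1 c2 by (auto simp: m v)
  let ?E = "\<integral>x. \<psi> x powr (3 / 2) \<partial>tgt"
  have E0: "0 \<le> ?E" by (rule Bochner_Integration.integral_nonneg) simp
  have cs: "?E\<^sup>2 \<le> m * v"
  proof -
    have s1: "(sqrt (\<psi> x))\<^sup>2 = \<psi> x" for x using p0 by simp
    have s2: "sqrt (\<psi> x) * \<psi> x = \<psi> x powr (3 / 2)" for x
    proof (cases "\<psi> x = 0")
      case False
      then have "0 < \<psi> x" using p0[of x] by simp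
      then show ?thesis by (simp add: powr_half_sqrt[symmetric] powr_mult_base mult.commute)
    qed simp
    have "(\<integral>x. sqrt (\<psi> x) * \<psi> x \<partial>tgt)\<^sup>2 \<le> (\<integral>x. (sqrt (\<psi> x))\<^sup>2 \<partial>tgt) * (\<integral>x. (\<psi> x)\<^sup>2 \<partial>tgt)"
      by (rule cauchy_schwarz_integral) (use b1 b2 b32 mb in \<open>simp_all add: s1 s2 m_def\<close>)
    then show ?thesis by (simp add: s1 s2 m_def v_def)
  qed
  have "?E powr (2 / (3 / 2)) = (?E\<^sup>2) powr (2 / 3)"
    using E0 by (cases "?E = 0") (simp_all add: powr_powr flip: powr_numeral)
  also have "\<dots> \<le> (m * v) powr (2 / 3)" by (rule powr_mono2) (use cs in auto)
  also have "\<dots> \<le> 1 + 2 / 3 * (m * v - 1)" by (rule powr_le_linear) (use mb vb in auto)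
  also have "\<dots> \<le> 1 + 2 / 3 * (17 / 16 * v - 1)"
    using mb vb mult_right_mono[OF mb(2), of v] by simp
  finally have E43: "?E powr (2 / (3 / 2)) \<le> 1 + 2 / 3 * (17 / 16 * v - 1)" .
  have "1 / 16 \<le> v - X" if "X \<le> 1 + 2 / 3 * (17 / 16 * v - 1)" for X
    using that vb by (simp add: field_simps)
  from this[OF E43] have gap: "1 / 16 \<le> v - ?E powr (2 / (3 / 2))" .
  have "v - ?E powr (2 / (3 / 2)) \<le> (2 - 3 / 2) powr (2 * (1 - 1 / r)) / \<alpha> * \<omega>\<^sup>2"
    unfolding v_def
  proof (rule tg.LOI_apply[OF L])
    have "Ck d k (\<lambda>x. 1 + (1 * ?c x + 0 * sin (\<omega> * x 0)))" for k by (intro Ck_add Ck_const Ck_trig)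
    then show C: "Cinf d \<psi>" by (simp add: Cinf_def \<psi>_def)
    have gr: "(normd d (gradd d \<psi> x))\<^sup>2 \<le> \<omega>\<^sup>2" if x: "x \<in> Rd d" for x
    proof -
      have g: "gradd d \<psi> x i = (if i = 0 then - (\<omega> * sin (\<omega> * x 0)) else 0)" if "i < d" for i
      proof -
        have "((\<lambda>t. \<psi> (x(i := t))) has_real_derivative (if i = 0 then - (\<omega> * sin (\<omega> * x 0)) else 0)) (at (x i))"
          unfolding \<psi>_def by (cases "i = 0") (auto intro!: derivative_eq_intros)
        then show ?thesis using that by (simp add: gradd_def DERIV_imp_deriv)
      qed
      have "(normd d (gradd d \<psi> x))\<^sup>2 = (\<Sum>i<d. if i = 0 then (\<omega> * sin (\<omega> * x 0))\<^sup>2 else 0)"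
        unfolding normd_sq by (rule sum.cong) (simp_all add: g)
      also have "\<dots> = (\<omega> * sin (\<omega> * x 0))\<^sup>2" using d1 by simp
      also have "\<dots> \<le> \<omega>\<^sup>2 * 1"
        unfolding power_mult_distrib by (rule mult_left_mono) (simp_all add: abs_square_le_1)
      finally show ?thesis by simp
    qed
    have "(\<integral>\<^sup>+x. ennreal ((normd d (gradd d \<psi> x))\<^sup>2) \<partial>tgt) \<le> (\<integral>\<^sup>+x. ennreal (\<omega>\<^sup>2) \<partial>tgt)"
      by (intro nn_integral_mono ennreal_leI gr) simp
    also have "\<dots> = ennreal (\<omega>\<^sup>2)" using prob_space.emeasure_space_1[OF pi_prob] by simp
    finally show "(\<integral>\<^sup>+x. ennreal ((normd d (gradd d \<psi> x))\<^sup>2) \<partial>tgt) \<le> ennreal (\<omega>\<^sup>2)" .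
  qed (use p0 p2 in auto)
  also have "\<dots> \<le> 1 / \<alpha> * \<omega>\<^sup>2"
  proof (intro mult_right_mono divide_right_mono)
    have "(2 - 3 / 2 :: real) powr (2 * (1 - 1 / r)) \<le> 1 powr (2 * (1 - 1 / r))"
      by (rule powr_mono2) (use r in \<open>auto simp: field_simps\<close>)
    then show "(2 - 3 / 2 :: real) powr (2 * (1 - 1 / r)) \<le> 1" by simp
  qed (use al in auto)
  finally have "1 / 16 \<le> 8 * pi\<^sup>2 * \<beta> / \<alpha>" using gap by (simp add: om2)
  then have "\<alpha> \<le> 128 * pi\<^sup>2 * \<beta>" using al by (simp add: field_simps)
  also have "\<dots> \<le> 128 * 4\<^sup>2 * \<beta>"
    using \<beta> pi_less_4 pi_gt_zero by (intro mult_right_mono mult_left_mono power_mono) auto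
  finally show ?thesis by simp
qed

end

section \<open>Densities along one iteration\<close>

context smooth_tilt
begin

definition gdens :: "(nat \<Rightarrow> real) \<Rightarrow> (nat \<Rightarrow> real) \<Rightarrow> real" where
  "gdens x y = (\<Prod>i<d. normal_density (x i) (sqrt \<eta>) (y i))"

text \<open>The density of Y under the joint target, that is, the target convolved with the Gaussian.\<close>

definition mdens :: "(nat \<Rightarrow> real) \<Rightarrow> real" where
  "mdens y = Zt y / (Zf * sqrt (2 * pi * \<eta>) ^ d)"

definition marg :: "(nat \<Rightarrow> real) measure" where
  "marg = density (lebd d) (\<lambda>y. ennreal (mdens y))"

lemma gdens_eq: "gdens x y = exp (- (1 / (2 * \<eta>) * (distd d x y)\<^sup>2)) / sqrt (2 * pi * \<eta>) ^ d"
proof -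
  have "gdens x y = (\<Prod>i<d. exp (- (1 / (2 * \<eta>) * (x i - y i)\<^sup>2)) / sqrt (2 * pi * \<eta>))"
    unfolding gdens_def normal_density_def using \<eta> by (intro prod.cong refl) (simp add: power2_commute)
  also have "\<dots> = exp (- (1 / (2 * \<eta>) * (distd d x y)\<^sup>2)) / sqrt (2 * pi * \<eta>) ^ d"
    by (simp add: prod_dividef exp_sum[symmetric] distd_sq sum_distrib_left sum_negf sum_divide_distrib)
  finally show ?thesis .
qed

lemma joint_density: "exp (- f x) / Zf * gdens x y = mdens y * (exp (- gt y x) / Zt y)"
  using Zt_pos[of y] by (simp add: gdens_eq mdens_def tilt_def exp_add[symmetric] mult_exp_exp)

lemma mdens_pos: "0 < mdens y" using Zt_pos[of y] Zf_pos \<eta> by (simp add: mdens_def)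

lemma mdens_measurable[measurable]: "mdens \<in> borel_measurable (lebd d)"
  unfolding mdens_def[abs_def] by measurable

lemma gdens_nonneg: "0 \<le> gdens x y" unfolding gdens_def by (intro prod_nonneg) simp

lemma gdens_joint_measurable: "(\<lambda>w. gdens (fst w) (snd w)) \<in> borel_measurable (lebd d \<Otimes>\<^sub>M lebd d)"
proof -
  have c: "(\<lambda>w. fst w i) \<in> borel_measurable (lebd d \<Otimes>\<^sub>M lebd d)" "(\<lambda>w. snd w i) \<in> borel_measurable (lebd d \<Otimes>\<^sub>M lebd d)" if "i < d" for i
    using measurable_compose[OF measurable_fst lebd_component[OF that]] measurable_compose[OF measurable_snd lebd_component[OF that]] by auto
  have "(\<lambda>w. \<Sum>i<d. (fst w i - snd w i)\<^sup>2) \<in> borel_measurable (lebd d \<Otimes>\<^sub>M lebd d)"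
    by (intro borel_measurable_sum borel_measurable_power borel_measurable_diff c) auto
  then show ?thesis unfolding gdens_eq distd_sq by measurable
qed

lemma gdens_measurable: "x \<in> Rd d \<Longrightarrow> gdens x \<in> borel_measurable (lebd d)"
  using measurable_compose[OF measurable_Pair1' gdens_joint_measurable, of x] by simp

lemma gauss_gdens: "gauss d x \<eta> = density (lebd d) (\<lambda>y. ennreal (gdens x y))"
  by (simp add: gauss_def gdens_def)

lemma sets_marg[simp, measurable_cong]: "sets marg = sets (lebd d)" by (simp add: marg_def)
lemma space_marg[simp]: "space marg = Rd d" by (simp add: marg_def)

text \<open>Both sides integrate K against the joint law of X and Y, disintegrated along either coordinate.\<close>

lemma reversal:
  assumes K: "(\<lambda>w. K (fst w) (snd w)) \<in> borel_measurable (lebd d \<Otimes>\<^sub>M lebd d)"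
  shows "(\<integral>\<^sup>+x. \<integral>\<^sup>+y. K x y \<partial>gauss d x \<eta> \<partial>tgt) = (\<integral>\<^sup>+y. \<integral>\<^sup>+x. K x y \<partial>gibbs d (gt y) \<partial>marg)"
proof -
  interpret L: sigma_finite_measure "lebd d" by (rule sigma_finite_lebd)
  interpret P: pair_sigma_finite "lebd d" "lebd d" ..
  have Kx: "(\<lambda>y. K x y) \<in> borel_measurable (lebd d)" if "x \<in> Rd d" for x
    using measurable_compose[OF measurable_Pair1' K, of x] that by simp
  have Ky: "(\<lambda>x. K x y) \<in> borel_measurable (lebd d)" if "y \<in> Rd d" for y
    using measurable_compose[OF measurable_Pair2' K, of y] that by simp
  have gm: "(\<lambda>w. ennreal (gdens (fst w) (snd w)) * K (fst w) (snd w)) \<in> borel_measurable (lebd d \<Otimes>\<^sub>M lebd d)"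
    by (intro borel_measurable_times_ennreal measurable_compose[OF gdens_joint_measurable measurable_ennreal] K)
  have tm: "(\<lambda>w. ennreal (exp (- f (fst w)) / Zf)) \<in> borel_measurable (lebd d \<Otimes>\<^sub>M lebd d)"
  proof -
    have "(\<lambda>x. ennreal (exp (- f x) / Zf)) \<in> borel_measurable (lebd d)" by measurable
    then show ?thesis by (rule measurable_compose[OF measurable_fst])
  qed
  have hm: "(\<lambda>w. ennreal (exp (- f (fst w)) / Zf) * (ennreal (gdens (fst w) (snd w)) * K (fst w) (snd w))) \<in> borel_measurable (lebd d \<Otimes>\<^sub>M lebd d)"
    by (intro borel_measurable_times_ennreal tm gm)
  have in1: "(\<integral>\<^sup>+y. K x y \<partial>gauss d x \<eta>) = (\<integral>\<^sup>+y. ennreal (gdens x y) * K x y \<partial>lebd d)" if x: "x \<in> Rd d" for x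
    unfolding gauss_gdens by (rule nn_integral_density[OF measurable_compose[OF gdens_measurable[OF x] measurable_ennreal] Kx[OF x]])
  have "(\<integral>\<^sup>+x. \<integral>\<^sup>+y. K x y \<partial>gauss d x \<eta> \<partial>tgt) = (\<integral>\<^sup>+x. \<integral>\<^sup>+y. ennreal (gdens x y) * K x y \<partial>lebd d \<partial>tgt)"
    by (rule nn_integral_cong) (simp add: in1)
  also have "\<dots> = (\<integral>\<^sup>+x. ennreal (exp (- f x) / Zf) * (\<integral>\<^sup>+y. ennreal (gdens x y) * K x y \<partial>lebd d) \<partial>lebd d)"
    unfolding gibbs_def Zf_def[symmetric]
  proof (rule nn_integral_density)
    show "(\<lambda>x. \<integral>\<^sup>+y. ennreal (gdens x y) * K x y \<partial>lebd d) \<in> borel_measurable (lebd d)"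
      using L.borel_measurable_nn_integral[of "\<lambda>x y. ennreal (gdens x y) * K x y" "lebd d"] gm by (simp add: split_beta')
  qed measurable
  also have "\<dots> = (\<integral>\<^sup>+x. \<integral>\<^sup>+y. ennreal (exp (- f x) / Zf) * (ennreal (gdens x y) * K x y) \<partial>lebd d \<partial>lebd d)"
  proof (rule nn_integral_cong)
    fix x assume "x \<in> space (lebd d)"
    then have x: "x \<in> Rd d" by simp
    show "ennreal (exp (- f x) / Zf) * (\<integral>\<^sup>+y. ennreal (gdens x y) * K x y \<partial>lebd d) = (\<integral>\<^sup>+y. ennreal (exp (- f x) / Zf) * (ennreal (gdens x y) * K x y) \<partial>lebd d)"
      by (rule nn_integral_cmult[symmetric])
         (intro borel_measurable_times_ennreal measurable_compose[OF gdens_measurable[OF x] measurable_ennreal] Kx[OF x])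
  qed
  also have "\<dots> = (\<integral>\<^sup>+y. \<integral>\<^sup>+x. ennreal (exp (- f x) / Zf) * (ennreal (gdens x y) * K x y) \<partial>lebd d \<partial>lebd d)"
    by (rule P.Fubini'[symmetric]) (use hm in \<open>simp add: split_beta'\<close>)
  also have "\<dots> = (\<integral>\<^sup>+y. \<integral>\<^sup>+x. ennreal (mdens y) * (ennreal (exp (- gt y x) / Zt y) * K x y) \<partial>lebd d \<partial>lebd d)"
  proof (intro nn_integral_cong)
    fix x y
    have "ennreal (exp (- f x) / Zf) * ennreal (gdens x y) = ennreal (mdens y) * ennreal (exp (- gt y x) / Zt y)"
      using joint_density[of x y] Zf_pos gdens_nonneg[of x y] mdens_pos[of y] Zt_pos[of y]
      by (simp add: ennreal_mult'[symmetric] ennreal_mult''[symmetric] less_imp_le)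
    then show "ennreal (exp (- f x) / Zf) * (ennreal (gdens x y) * K x y) = ennreal (mdens y) * (ennreal (exp (- gt y x) / Zt y) * K x y)"
      by (simp only: mult.assoc[symmetric])
  qed
  also have "\<dots> = (\<integral>\<^sup>+y. ennreal (mdens y) * (\<integral>\<^sup>+x. K x y \<partial>gibbs d (gt y)) \<partial>lebd d)"
  proof (rule nn_integral_cong)
    fix y assume "y \<in> space (lebd d)"
    then have y: "y \<in> Rd d" by simp
    have em: "(\<lambda>x. ennreal (exp (- gt y x) / Zt y)) \<in> borel_measurable (lebd d)" by measurable
    have "(\<integral>\<^sup>+x. K x y \<partial>gibbs d (gt y)) = (\<integral>\<^sup>+x. ennreal (exp (- gt y x) / Zt y) * K x y \<partial>lebd d)"
      unfolding gibbs_def Zt_def[symmetric] by (rule nn_integral_density[OF em Ky[OF y]])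
    then show "(\<integral>\<^sup>+x. ennreal (mdens y) * (ennreal (exp (- gt y x) / Zt y) * K x y) \<partial>lebd d) = ennreal (mdens y) * (\<integral>\<^sup>+x. K x y \<partial>gibbs d (gt y))"
      using nn_integral_cmult[OF borel_measurable_times_ennreal[OF em Ky[OF y]]] by simp
  qed
  also have "\<dots> = (\<integral>\<^sup>+y. \<integral>\<^sup>+x. K x y \<partial>gibbs d (gt y) \<partial>marg)"
    unfolding marg_def
  proof (rule nn_integral_density[symmetric])
    show "(\<lambda>y. \<integral>\<^sup>+x. K x y \<partial>gibbs d (gt y)) \<in> borel_measurable (lebd d)"
      by (rule nn_integral_measurable_subprob_algebra2[OF _ measurable_prob_algebraD[OF gibbs_kernel]])
         (use measurable_compose[OF measurable_pair_swap' K] in \<open>simp add: split_beta'\<close>)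
  qed measurable
  finally show ?thesis .
qed

text \<open>The conditional mean of h given Y = y; the default value 0 at infinite integrals affects only a null set.\<close>

definition post :: "((nat \<Rightarrow> real) \<Rightarrow> real) \<Rightarrow> (nat \<Rightarrow> real) \<Rightarrow> real" where
  "post h y = enn2real (\<integral>\<^sup>+x. ennreal (h x) \<partial>gibbs d (gt y))"

lemma gauss_prob: "prob_space (gauss d x \<eta>)" by (rule prob_gauss[OF \<eta>(1)])

lemma marg_nn:
  assumes g: "g \<in> borel_measurable (lebd d)"
  shows "(\<integral>\<^sup>+x. \<integral>\<^sup>+y. g y \<partial>gauss d x \<eta> \<partial>tgt) = (\<integral>\<^sup>+y. g y \<partial>marg)"
proof -
  have "(\<integral>\<^sup>+x. \<integral>\<^sup>+y. g y \<partial>gauss d x \<eta> \<partial>tgt) = (\<integral>\<^sup>+y. \<integral>\<^sup>+x. g y \<partial>gibbs d (gt y) \<partial>marg)"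
    by (rule reversal) (rule measurable_compose[OF measurable_snd g])
  also have "\<dots> = (\<integral>\<^sup>+y. g y \<partial>marg)"
    by (rule nn_integral_cong) (use prob_space.emeasure_space_1[OF tilt_prob] in simp)
  finally show ?thesis .
qed

lemma tgt_nn:
  assumes g: "g \<in> borel_measurable (lebd d)"
  shows "(\<integral>\<^sup>+y. \<integral>\<^sup>+x. g x \<partial>gibbs d (gt y) \<partial>marg) = (\<integral>\<^sup>+x. g x \<partial>tgt)"
proof -
  have "(\<integral>\<^sup>+y. \<integral>\<^sup>+x. g x \<partial>gibbs d (gt y) \<partial>marg) = (\<integral>\<^sup>+x. \<integral>\<^sup>+y. g x \<partial>gauss d x \<eta> \<partial>tgt)"
    by (rule reversal[symmetric]) (rule measurable_compose[OF measurable_fst g])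
  also have "\<dots> = (\<integral>\<^sup>+x. g x \<partial>tgt)"
    by (rule nn_integral_cong) (use prob_space.emeasure_space_1[OF gauss_prob] in simp)
  finally show ?thesis .
qed

lemma marg_prob: "prob_space marg"
proof
  have "emeasure marg (space marg) = (\<integral>\<^sup>+y. 1 \<partial>marg)" by simp
  also have "\<dots> = (\<integral>\<^sup>+x. \<integral>\<^sup>+y. 1 \<partial>gauss d x \<eta> \<partial>tgt)" by (rule marg_nn[symmetric]) simp
  also have "\<dots> = 1"
    using prob_space.emeasure_space_1[OF gauss_prob] prob_space.emeasure_space_1[OF pi_prob] by simp
  finally show "emeasure marg (space marg) = 1" .
qed

lemma post_measurable:
  assumes h: "h \<in> borel_measurable (lebd d)" shows "post h \<in> borel_measurable (lebd d)"
proof -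
  have "(\<lambda>y. \<integral>\<^sup>+x. ennreal (h x) \<partial>gibbs d (gt y)) \<in> borel_measurable (lebd d)"
    by (rule measurable_compose[OF measurable_prob_algebraD[OF gibbs_kernel] nn_integral_measurable_subprob_algebra])
       (rule measurable_compose[OF h measurable_ennreal])
  then show ?thesis unfolding post_def[abs_def] by measurable
qed

lemma post_AE:
  assumes h: "h \<in> borel_measurable (lebd d)" and fin: "(\<integral>\<^sup>+x. ennreal (h x) \<partial>tgt) \<noteq> \<infinity>"
  shows "AE y in marg. ennreal (post h y) = (\<integral>\<^sup>+x. ennreal (h x) \<partial>gibbs d (gt y))"
proof -
  have hm: "(\<lambda>x. ennreal (h x)) \<in> borel_measurable (lebd d)" by (rule measurable_compose[OF h measurable_ennreal])
  have "(\<lambda>y. \<integral>\<^sup>+x. ennreal (h x) \<partial>gibbs d (gt y)) \<in> borel_measurable (lebd d)"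
    by (rule measurable_compose[OF measurable_prob_algebraD[OF gibbs_kernel] nn_integral_measurable_subprob_algebra[OF hm]])
  then have m: "(\<lambda>y. \<integral>\<^sup>+x. ennreal (h x) \<partial>gibbs d (gt y)) \<in> borel_measurable marg"
    by (simp add: measurable_cong_sets[OF sets_marg refl])
  have "(\<integral>\<^sup>+y. \<integral>\<^sup>+x. ennreal (h x) \<partial>gibbs d (gt y) \<partial>marg) \<noteq> \<infinity>"
    using fin by (simp only: tgt_nn[OF hm] not_False_eq_True)
  then have "AE y in marg. (\<integral>\<^sup>+x. ennreal (h x) \<partial>gibbs d (gt y)) \<noteq> \<infinity>"
    by (rule nn_integral_noteq_infinite[OF m])
  then show ?thesis
    by eventually_elim (simp add: post_def less_top)
qed

text \<open>Reversibility: testing the new law on a set and exchanging the order of conditioning replaces h by its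
  conditional mean given Y, averaged over the Gaussian noise.\<close>

lemma step_density:
  assumes h: "h \<in> borel_measurable (lebd d)" and one: "(\<integral>\<^sup>+x. ennreal (h x) \<partial>tgt) = 1"
  shows "density tgt (\<lambda>x. ennreal (h x)) \<bind> (\<lambda>x. gauss d x \<eta> \<bind> (\<lambda>y. gibbs d (gt y)))
      = density tgt (\<lambda>x. \<integral>\<^sup>+y. ennreal (post h y) \<partial>gauss d x \<eta>)" (is "?L = ?R")
proof (rule measure_eqI)
  have hm: "(\<lambda>x. ennreal (h x)) \<in> borel_measurable (lebd d)" by (rule measurable_compose[OF h measurable_ennreal])
  have pm: "(\<lambda>y. ennreal (post h y)) \<in> borel_measurable (lebd d)" by (rule measurable_compose[OF post_measurable[OF h] measurable_ennreal])
  have hmt: "(\<lambda>x. ennreal (h x)) \<in> borel_measurable tgt" using hm by (simp add: measurable_cong_sets[OF sets_gibbs refl])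
  have \<rho>: "prob_space (density tgt (\<lambda>x. ennreal (h x)))"
  proof
    show "emeasure (density tgt (\<lambda>x. ennreal (h x))) (space (density tgt (\<lambda>x. ennreal (h x)))) = 1"
    proof -
      have "emeasure (density tgt (\<lambda>x. ennreal (h x))) (space tgt) = (\<integral>\<^sup>+x. ennreal (h x) * indicator (space tgt) x \<partial>tgt)"
        by (rule emeasure_density[OF hmt sets.top])
      also have "\<dots> = (\<integral>\<^sup>+x. ennreal (h x) \<partial>tgt)" by (rule nn_integral_cong) simp
      finally show ?thesis using one by (simp only: space_density)
    qed
  qed
  have \<rho>in: "density tgt (\<lambda>x. ennreal (h x)) \<in> space (prob_algebra (lebd d))"
    by (rule in_prob_algebra[OF \<rho>]) simp
  show "sets ?L = sets ?R" using sets_bind'[OF \<rho>in step_kernel] by simp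
  fix B assume "B \<in> sets ?L"
  then have B: "B \<in> sets (lebd d)" using sets_bind'[OF \<rho>in step_kernel] by simp
  have gB: "(\<lambda>y. emeasure (gibbs d (gt y)) B) \<in> borel_measurable (lebd d)" by (rule gibbs_emeasure_measurable[OF B])
  have stepB: "emeasure (gauss d x \<eta> \<bind> (\<lambda>y. gibbs d (gt y))) B = (\<integral>\<^sup>+y. emeasure (gibbs d (gt y)) B \<partial>gauss d x \<eta>)" for x
    by (rule emeasure_bind_prob_algebra[OF in_prob_algebra[OF gauss_prob sets_gauss] gibbs_kernel B])
  have gBm: "(\<lambda>x. \<integral>\<^sup>+y. emeasure (gibbs d (gt y)) B \<partial>gauss d x \<eta>) \<in> borel_measurable (lebd d)"
    by (rule measurable_compose[OF measurable_prob_algebraD[OF gauss_kernel] nn_integral_measurable_subprob_algebra[OF gB]])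
  have "emeasure ?L B = (\<integral>\<^sup>+x. emeasure (gauss d x \<eta> \<bind> (\<lambda>y. gibbs d (gt y))) B \<partial>density tgt (\<lambda>x. ennreal (h x)))"
    by (rule emeasure_bind_prob_algebra[OF \<rho>in step_kernel B])
  also have "\<dots> = (\<integral>\<^sup>+x. \<integral>\<^sup>+y. emeasure (gibbs d (gt y)) B \<partial>gauss d x \<eta> \<partial>density tgt (\<lambda>x. ennreal (h x)))"
    by (simp only: stepB)
  also have "\<dots> = (\<integral>\<^sup>+x. ennreal (h x) * (\<integral>\<^sup>+y. emeasure (gibbs d (gt y)) B \<partial>gauss d x \<eta>) \<partial>tgt)"
    by (rule nn_integral_density[OF hmt]) (use gBm in \<open>simp add: measurable_cong_sets[OF sets_gibbs refl]\<close>)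
  also have "\<dots> = (\<integral>\<^sup>+x. \<integral>\<^sup>+y. ennreal (h x) * emeasure (gibbs d (gt y)) B \<partial>gauss d x \<eta> \<partial>tgt)"
    by (intro nn_integral_cong nn_integral_cmult[symmetric]) (use gB in \<open>simp add: measurable_cong_sets[OF sets_gauss refl]\<close>)
  also have "\<dots> = (\<integral>\<^sup>+y. \<integral>\<^sup>+x. ennreal (h x) * emeasure (gibbs d (gt y)) B \<partial>gibbs d (gt y) \<partial>marg)"
    by (rule reversal) (intro borel_measurable_times_ennreal measurable_compose[OF measurable_fst hm] measurable_compose[OF measurable_snd gB])
  also have "\<dots> = (\<integral>\<^sup>+y. (\<integral>\<^sup>+x. ennreal (h x) \<partial>gibbs d (gt y)) * emeasure (gibbs d (gt y)) B \<partial>marg)"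
    by (intro nn_integral_cong nn_integral_multc) (use hm in \<open>simp add: measurable_cong_sets[OF sets_gibbs refl]\<close>)
  also have "\<dots> = (\<integral>\<^sup>+y. ennreal (post h y) * emeasure (gibbs d (gt y)) B \<partial>marg)"
    by (rule nn_integral_cong_AE) (use post_AE[OF h] one in auto)
  also have "\<dots> = (\<integral>\<^sup>+y. \<integral>\<^sup>+x. ennreal (post h y) * indicator B x \<partial>gibbs d (gt y) \<partial>marg)"
  proof (intro nn_integral_cong)
    fix y
    have "B \<in> sets (gibbs d (gt y))" using B by simp
    then show "ennreal (post h y) * emeasure (gibbs d (gt y)) B = (\<integral>\<^sup>+x. ennreal (post h y) * indicator B x \<partial>gibbs d (gt y))"
      by (simp add: nn_integral_cmult_indicator)
  qed
  also have "\<dots> = (\<integral>\<^sup>+x. \<integral>\<^sup>+y. ennreal (post h y) * indicator B x \<partial>gauss d x \<eta> \<partial>tgt)"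
    by (rule reversal[symmetric]) (intro borel_measurable_times_ennreal measurable_compose[OF measurable_snd pm] measurable_compose[OF measurable_fst borel_measurable_indicator[OF B]])
  also have "\<dots> = (\<integral>\<^sup>+x. (\<integral>\<^sup>+y. ennreal (post h y) \<partial>gauss d x \<eta>) * indicator B x \<partial>tgt)"
    by (intro nn_integral_cong nn_integral_multc) (use pm in \<open>simp add: measurable_cong_sets[OF sets_gauss refl]\<close>)
  also have "\<dots> = emeasure ?R B"
  proof (rule emeasure_density[symmetric])
    have "(\<lambda>x. \<integral>\<^sup>+y. ennreal (post h y) \<partial>gauss d x \<eta>) \<in> borel_measurable (lebd d)"
      by (rule measurable_compose[OF measurable_prob_algebraD[OF gauss_kernel] nn_integral_measurable_subprob_algebra[OF pm]])
    then show "(\<lambda>x. \<integral>\<^sup>+y. ennreal (post h y) \<partial>gauss d x \<eta>) \<in> borel_measurable tgt" by (simp add: measurable_cong_sets[OF sets_gibbs refl])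
    show "B \<in> sets tgt" using B by simp
  qed
  finally show "emeasure ?L B = emeasure ?R B" .
qed

end

section \<open>Growth for unbounded densities\<close>

lemma integrable_of_powr_integrable:
  fixes h :: "'a \<Rightarrow> real"
  assumes P: "prob_space P" and h: "h \<in> borel_measurable P" and nn: "\<And>w. w \<in> space P \<Longrightarrow> 0 \<le> h w"
    and i: "integrable P (\<lambda>w. h w powr q)" and q: "1 \<le> q"
  shows "integrable P h"
proof -
  interpret prob_space P by fact
  show ?thesis
  proof (rule Bochner_Integration.integrable_bound)
    show "integrable P (\<lambda>w. 1 + h w powr q)" using i by simp
    show "AE w in P. norm (h w) \<le> norm (1 + h w powr q)"
    proof (rule AE_I2)
      fix w assume "w \<in> space P"
      then have h0: "0 \<le> h w" by (rule nn)
      have "h w \<le> 1 + h w powr q"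
      proof (cases "h w \<le> 1")
        case True then show ?thesis using powr_ge_zero[of "h w" q] by linarith
      next
        case False
        then have "h w powr 1 \<le> h w powr q" using q by (intro powr_mono) auto
        then show ?thesis using False by simp
      qed
      then show "norm (h w) \<le> norm (1 + h w powr q)" using h0 by simp
    qed
  qed (rule h)
qed

lemma nn_jensen_powr:
  fixes h :: "'a \<Rightarrow> real"
  assumes P: "prob_space P" and h: "h \<in> borel_measurable P" and nn: "\<And>w. w \<in> space P \<Longrightarrow> 0 \<le> h w" and q: "1 \<le> q"
  shows "ennreal (enn2real (\<integral>\<^sup>+w. ennreal (h w) \<partial>P) powr q) \<le> (\<integral>\<^sup>+w. ennreal (h w powr q) \<partial>P)"
proof (cases "(\<integral>\<^sup>+w. ennreal (h w powr q) \<partial>P) = \<infinity>")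
  case False
  have hq: "(\<lambda>w. h w powr q) \<in> borel_measurable P" using h by measurable
  have iq: "integrable P (\<lambda>w. h w powr q)"
    using False hq by (intro integrableI_nonneg) (auto simp: less_top[symmetric])
  have i: "integrable P h" by (rule integrable_of_powr_integrable[OF P h nn iq q])
  have "(\<integral>\<^sup>+w. ennreal (h w) \<partial>P) = ennreal (\<integral>w. h w \<partial>P)"
    by (rule nn_integral_eq_integral[OF i]) (simp add: nn)
  moreover have "0 \<le> (\<integral>w. h w \<partial>P)" by (rule Bochner_Integration.integral_nonneg) (rule nn)
  moreover have "(\<integral>\<^sup>+w. ennreal (h w powr q) \<partial>P) = ennreal (\<integral>w. h w powr q \<partial>P)"
    by (rule nn_integral_eq_integral[OF iq]) simp
  ultimately show ?thesis using jensen_powr_ge[OF P i iq nn q] by simp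
qed simp

lemma truncation_tendsto: "(\<lambda>n. min a (real n) + 1 / real (Suc n)) \<longlonglongrightarrow> a"
proof -
  have "eventually (\<lambda>n. min a (real n) = a) sequentially"
    using eventually_ge_at_top[of "nat \<lceil>a\<rceil>"] by eventually_elim linarith
  then have "(\<lambda>n. min a (real n)) \<longlonglongrightarrow> a" by (rule tendsto_eventually)
  from tendsto_add[OF this LIMSEQ_inverse_real_of_nat] show ?thesis by (simp add: inverse_eq_divide)
qed

text \<open>The dominating function for the truncations below.\<close>

lemma powr_shift_bound:
  fixes a b q :: real
  assumes "0 \<le> b" "b \<le> a + 1" "0 \<le> a" "0 \<le> q"
  shows "b powr q \<le> 2 powr q * (a powr q + 1)"
proof -
  have "b powr q \<le> (2 * max a 1) powr q" by (rule powr_mono2) (use assms in auto)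
  also have "\<dots> = 2 powr q * max a 1 powr q" by (rule powr_mult)
  also have "\<dots> \<le> 2 powr q * (a powr q + 1)"
    by (rule mult_left_mono) (auto simp: max_def)
  finally show ?thesis .
qed

context smooth_tilt
begin

lemma heat_gauss: "g \<in> borel_measurable (lebd d) \<Longrightarrow> heat d \<eta> g x = (\<integral>y. g y \<partial>gauss d x \<eta>)"
  unfolding heat_def gauss_eq_distr[OF \<eta>(1)] by (rule integral_distr[symmetric]) simp_all

lemma gauss_id: "(\<lambda>x. x) \<in> measurable (gauss d x \<eta>) (lebd d)" by (rule measurable_ident_sets) simp

lemma marg_id: "(\<lambda>x. x) \<in> measurable marg (lebd d)" by (rule measurable_ident_sets) simp

text \<open>The marginal law of Y is the target convolved with the Gaussian.\<close>

lemma EH_marg: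
  assumes b: "bdd_meas d M g" and nn: "\<And>x. x \<in> Rd d \<Longrightarrow> 0 \<le> g x"
  shows "EH tgt d \<eta> g = (\<integral>y. g y \<partial>marg)"
proof -
  have hn: "0 \<le> heat d \<eta> g x" for x
    unfolding heat_gauss[OF bdd_measD(1)[OF b]] by (rule Bochner_Integration.integral_nonneg) (simp add: nn)
  have g: "(\<integral>\<^sup>+y. ennreal (g y) \<partial>gauss d x \<eta>) = ennreal (heat d \<eta> g x)" for x
    unfolding heat_gauss[OF bdd_measD(1)[OF b]]
    by (rule nn_integral_eq_integral[OF bdd_meas_integrable[OF b gauss_prob gauss_id]]) (rule AE_I2, simp add: nn)
  have "ennreal (EH tgt d \<eta> g) = (\<integral>\<^sup>+x. ennreal (heat d \<eta> g x) \<partial>tgt)"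
    unfolding EH_def by (rule nn_integral_eq_integral[symmetric, OF tg.EH_integrable[OF b]]) (simp add: hn)
  also have "\<dots> = (\<integral>\<^sup>+x. \<integral>\<^sup>+y. ennreal (g y) \<partial>gauss d x \<eta> \<partial>tgt)" by (simp only: g)
  also have "\<dots> = (\<integral>\<^sup>+y. ennreal (g y) \<partial>marg)"
    by (rule marg_nn) (rule measurable_compose[OF bdd_measD(1)[OF b] measurable_ennreal])
  also have "\<dots> = ennreal (\<integral>y. g y \<partial>marg)"
    by (rule nn_integral_eq_integral[OF bdd_meas_integrable[OF b marg_prob marg_id]]) (rule AE_I2, simp add: nn)
  finally show ?thesis
    using Bochner_Integration.integral_nonneg[of tgt "heat d \<eta> g"] Bochner_Integration.integral_nonneg[of marg g] nn hn
    by (simp add: EH_def)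
qed

text \<open>Apply heat_growth to the truncations (min u n + 1/(n+1)) / m_n, normalized by their means
  m_n, and pass to the limit. All moments converge by domination: averaging contracts moments of order q,
  so finiteness of the moment of u suffices.\<close>

lemma growth_density:
  assumes L: "LOI d r \<alpha> tgt"
    and um: "u \<in> borel_measurable (lebd d)" and nn: "\<And>y. 0 \<le> u y"
    and one: "(\<integral>\<^sup>+y. ennreal (u y) \<partial>marg) = 1" and fin: "(\<integral>\<^sup>+y. ennreal (u y powr q) \<partial>marg) \<noteq> \<infinity>"
    and q: "2 \<le> q" and w: "0 < w" "w < 1"
  defines "H \<equiv> \<lambda>x. enn2real (\<integral>\<^sup>+y. ennreal (u y) \<partial>gauss d x \<eta>)"
  defines "V \<equiv> \<integral>x. H x powr q \<partial>tgt"
  defines "lam0 \<equiv> (1 - V powr (- w / (2 * (q - 1)))) / (2 * w * \<eta> + w powr (2 * (1 - 1 / r)) / \<alpha>)"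
  shows "integrable tgt (\<lambda>x. H x powr q)" "1 \<le> V" "exp (\<eta> / 4 * lam0) * V \<le> (\<integral>y. u y powr q \<partial>marg)"
    "AE x in tgt. (\<integral>\<^sup>+y. ennreal (u y) \<partial>gauss d x \<eta>) = ennreal (H x)"
    "H \<in> borel_measurable (lebd d)" 
proof -
  interpret mp: prob_space marg by (rule marg_prob)
  interpret tp: prob_space tgt by (rule pi_prob)
  have al: "0 < \<alpha>" using L by (simp add: LOI_def)
  have ume: "(\<lambda>y. ennreal (u y)) \<in> borel_measurable (lebd d)" by (rule measurable_compose[OF um measurable_ennreal])
  have uq: "(\<lambda>y. u y powr q) \<in> borel_measurable (lebd d)" using um by measurable
  have um_m: "u \<in> borel_measurable marg" and uq_m: "(\<lambda>y. u y powr q) \<in> borel_measurable marg"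
    using um uq by (simp_all only: measurable_cong_sets[OF sets_marg refl])
  have um_g: "u \<in> borel_measurable (gauss d x \<eta>)" for x
    using um by (simp only: measurable_cong_sets[OF sets_gauss refl])
  have Gm: "(\<lambda>x. \<integral>\<^sup>+y. ennreal (u y) \<partial>gauss d x \<eta>) \<in> borel_measurable (lebd d)"
    by (rule measurable_compose[OF measurable_prob_algebraD[OF gauss_kernel] nn_integral_measurable_subprob_algebra[OF ume]])
  then show Hm: "H \<in> borel_measurable (lebd d)" unfolding H_def by measurable
  have Gmt: "(\<lambda>x. \<integral>\<^sup>+y. ennreal (u y) \<partial>gauss d x \<eta>) \<in> borel_measurable tgt"
    using Gm by (simp only: measurable_cong_sets[OF sets_gibbs refl])
  have Hmt: "H \<in> borel_measurable tgt" using Hm by (simp only: measurable_cong_sets[OF sets_gibbs refl])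
  have H0: "0 \<le> H x" for x by (simp add: H_def)
  have "(\<integral>\<^sup>+x. \<integral>\<^sup>+y. ennreal (u y) \<partial>gauss d x \<eta> \<partial>tgt) \<noteq> \<infinity>" using marg_nn[OF ume] one by simp
  then have Gfin: "AE x in tgt. (\<integral>\<^sup>+y. ennreal (u y) \<partial>gauss d x \<eta>) \<noteq> \<infinity>"
    by (rule nn_integral_noteq_infinite[OF Gmt])
  then show HG: "AE x in tgt. (\<integral>\<^sup>+y. ennreal (u y) \<partial>gauss d x \<eta>) = ennreal (H x)"
    by eventually_elim (simp add: H_def less_top)
  have iu: "integrable marg u" using one um_m nn by (intro integrableI_nonneg) auto
  have iuq: "integrable marg (\<lambda>y. u y powr q)"
    using fin uq_m by (intro integrableI_nonneg) (auto simp: less_top[symmetric])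
  show iH: "integrable tgt (\<lambda>x. H x powr q)"
  proof (rule integrableI_nonneg)
    show "(\<lambda>x. H x powr q) \<in> borel_measurable tgt" using Hmt by measurable
    have "(\<integral>\<^sup>+x. ennreal (H x powr q) \<partial>tgt) \<le> (\<integral>\<^sup>+x. \<integral>\<^sup>+y. ennreal (u y powr q) \<partial>gauss d x \<eta> \<partial>tgt)"
      unfolding H_def by (intro nn_integral_mono nn_jensen_powr gauss_prob um_g nn) (use q in simp)
    also have "\<dots> = (\<integral>\<^sup>+y. ennreal (u y powr q) \<partial>marg)"
      by (rule marg_nn) (rule measurable_compose[OF uq measurable_ennreal])
    also have "\<dots> < \<infinity>" using fin by (simp add: less_top)
    finally show "(\<integral>\<^sup>+x. ennreal (H x powr q) \<partial>tgt) < \<infinity>" .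
  qed simp
  (* bounded above and away from 0, and at most u + 1 *)
  define b where "b = (\<lambda>n y. min (u y) (real n) + 1 / real (Suc n))"
  define e where "e = (\<lambda>n. 1 / real (Suc n))"
  have e: "0 < e n" "e n \<le> 1" for n by (simp_all add: e_def)
  have bm: "b n \<in> borel_measurable (lebd d)" for n using um unfolding b_def by measurable
  have bb: "e n \<le> b n y" "b n y \<le> real n + 1" "b n y \<le> u y + 1" for n y
  proof -
    have "b n y = min (u y) (real n) + e n" by (simp add: b_def e_def)
    moreover have "0 \<le> min (u y) (real n)" "min (u y) (real n) \<le> u y" "min (u y) (real n) \<le> real n" using nn[of y] by simp_all
    ultimately show "e n \<le> b n y" "b n y \<le> real n + 1" "b n y \<le> u y + 1" using e[of n] by linarith+
  qed
  have b0: "0 \<le> b n y" for n y using bb(1)[of n y] e(1)[of n] by linarith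
  have bbd: "bdd_meas d (real n + 1) (b n)" for n using bm bb b0 by (simp add: bdd_meas_def)
  have bq: "bdd_meas d ((real n + 1) powr q) (\<lambda>y. b n y powr q)" for n
    unfolding bdd_meas_def using bm[of n] bb b0 q by (auto intro!: powr_mono2)
  have blim: "(\<lambda>n. b n y) \<longlonglongrightarrow> u y" for y unfolding b_def by (rule truncation_tendsto)
  have bm_m: "b n \<in> borel_measurable marg" for n using bm by (simp only: measurable_cong_sets[OF sets_marg refl])
  have bm_g: "b n \<in> borel_measurable (gauss d x \<eta>)" for n x using bm by (simp only: measurable_cong_sets[OF sets_gauss refl])
  define m where "m = (\<lambda>n. \<integral>y. b n y \<partial>marg)"
  have "m \<longlonglongrightarrow> (\<integral>y. u y \<partial>marg)"
    unfolding m_def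
    by (rule integral_dominated_convergence[where w = "\<lambda>y. u y + 1"]) (use um_m bm_m iu blim bb b0 in auto)
  moreover have "(\<integral>y. u y \<partial>marg) = 1" using nn_integral_eq_integral[OF iu] nn one by (simp add: ennreal_eq_1)
  ultimately have mlim: "m \<longlonglongrightarrow> 1" by simp
  have me: "e n \<le> m n" for n
  proof -
    have "(\<integral>y. e n \<partial>marg) \<le> m n" unfolding m_def
      by (rule integral_mono) (use bdd_meas_integrable[OF bbd marg_prob marg_id] bb in auto)
    then show ?thesis using mp.prob_space by simp
  qed
  have mp: "0 < m n" for n using me[of n] e(1)[of n] by linarith
  define U where "U = (\<lambda>n. \<integral>y. b n y powr q \<partial>marg)"
  have Ulim: "U \<longlonglongrightarrow> (\<integral>y. u y powr q \<partial>marg)"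
    unfolding U_def
  proof (rule integral_dominated_convergence[where w = "\<lambda>y. 2 powr q * (u y powr q + 1)"])
    show "integrable marg (\<lambda>y. 2 powr q * (u y powr q + 1))" using iuq by simp
    show "AE y in marg. (\<lambda>n. b n y powr q) \<longlonglongrightarrow> u y powr q"
    proof (rule AE_I2)
      fix y show "(\<lambda>n. b n y powr q) \<longlonglongrightarrow> u y powr q"
        by (rule tendsto_powr2[OF blim tendsto_const]) (use q b0 in \<open>auto intro: always_eventually\<close>)
    qed
    show "AE y in marg. norm (b n y powr q) \<le> 2 powr q * (u y powr q + 1)" for n
    proof (rule AE_I2)
      fix y have "b n y powr q \<le> 2 powr q * (u y powr q + 1)" by (rule powr_shift_bound) (use bb b0 nn q in auto)
      then show "norm (b n y powr q) \<le> 2 powr q * (u y powr q + 1)" by simp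
    qed
    show "(\<lambda>y. b n y powr q) \<in> borel_measurable marg" for n using bm_m[of n] by measurable
  qed (rule uq_m)
  define a where "a = (\<lambda>n x. heat d \<eta> (b n) x)"
  have a_eq: "a n x = (\<integral>y. b n y \<partial>gauss d x \<eta>)" for n x unfolding a_def by (rule heat_gauss[OF bm])
  have am: "a n \<in> borel_measurable tgt" for n
    using borel_measurable_integrable[OF tg.EH_integrable[OF bbd[of n], of \<eta>]] by (simp add: a_def)
  have a0: "0 \<le> a n x" for n x unfolding a_eq by (rule Bochner_Integration.integral_nonneg) (rule b0)
  have alim: "AE x in tgt. (\<lambda>n. a n x) \<longlonglongrightarrow> H x \<and> (\<forall>n. a n x \<le> H x + 1)"
    using Gfin
  proof eventually_elim
    fix x assume fx: "(\<integral>\<^sup>+y. ennreal (u y) \<partial>gauss d x \<eta>) \<noteq> \<infinity>"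
    interpret gp: prob_space "gauss d x \<eta>" by (rule gauss_prob)
    have ig: "integrable (gauss d x \<eta>) u"
      using fx um_g nn by (intro integrableI_nonneg) (auto simp: less_top[symmetric])
    have Hx: "H x = (\<integral>y. u y \<partial>gauss d x \<eta>)"
      unfolding H_def using nn_integral_eq_integral[OF ig] nn by simp
    have "(\<lambda>n. a n x) \<longlonglongrightarrow> H x"
      unfolding a_eq Hx
      by (rule integral_dominated_convergence[where w = "\<lambda>y. u y + 1"]) (use um_g bm_g ig blim bb b0 in auto)
    moreover have "a n x \<le> H x + 1" for n
    proof -
      have "a n x \<le> (\<integral>y. u y + 1 \<partial>gauss d x \<eta>)"
        unfolding a_eq by (rule integral_mono) (use bdd_meas_integrable[OF bbd gauss_prob gauss_id] ig bb in auto)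
      also have "\<dots> = H x + 1" using ig gp.prob_space by (simp add: Hx)
      finally show ?thesis .
    qed
    ultimately show "(\<lambda>n. a n x) \<longlonglongrightarrow> H x \<and> (\<forall>n. a n x \<le> H x + 1)" by blast
  qed
  define W where "W = (\<lambda>n. \<integral>x. a n x powr q \<partial>tgt)"
  have Wlim: "W \<longlonglongrightarrow> V"
    unfolding W_def V_def
  proof (rule integral_dominated_convergence[where w = "\<lambda>x. 2 powr q * (H x powr q + 1)"])
    show "integrable tgt (\<lambda>x. 2 powr q * (H x powr q + 1))" using iH by simp
    show "AE x in tgt. (\<lambda>n. a n x powr q) \<longlonglongrightarrow> H x powr q"
      using alim
    proof eventually_elim
      fix x assume "(\<lambda>n. a n x) \<longlonglongrightarrow> H x \<and> (\<forall>n. a n x \<le> H x + 1)"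
      then show "(\<lambda>n. a n x powr q) \<longlonglongrightarrow> H x powr q"
        by (intro tendsto_powr2 tendsto_const) (use q a0 in \<open>auto intro: always_eventually\<close>)
    qed
    show "AE x in tgt. norm (a n x powr q) \<le> 2 powr q * (H x powr q + 1)" for n
      using alim
    proof eventually_elim
      fix x assume "(\<lambda>n. a n x) \<longlonglongrightarrow> H x \<and> (\<forall>n. a n x \<le> H x + 1)"
      then have "a n x powr q \<le> 2 powr q * (H x powr q + 1)"
        by (intro powr_shift_bound) (use a0 H0 q in auto)
      then show "norm (a n x powr q) \<le> 2 powr q * (H x powr q + 1)" by simp
    qed
    show "(\<lambda>x. a n x powr q) \<in> borel_measurable tgt" for n using am[of n] by measurable
    show "(\<lambda>x. H x powr q) \<in> borel_measurable tgt" using Hmt by measurable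
  qed
  define Vn where "Vn = (\<lambda>n. W n / m n powr q)"
  have Vlim: "Vn \<longlonglongrightarrow> V"
  proof -
    have "(\<lambda>n. W n / m n powr q) \<longlonglongrightarrow> V / 1 powr q"
      by (intro tendsto_divide Wlim tendsto_powr mlim tendsto_const) auto
    then show ?thesis by (simp add: Vn_def)
  qed
  define lam where "lam = (\<lambda>v. (1 - v powr (- w / (2 * (q - 1)))) / (2 * w * \<eta> + w powr (2 * (1 - 1 / r)) / \<alpha>))"
  have step: "1 \<le> Vn n \<and> exp (\<eta> / 4 * lam (Vn n)) * Vn n \<le> U n / m n powr q" for n
  proof -
    define un where "un = (\<lambda>y. b n y / m n)"
    have unm: "un \<in> borel_measurable (lebd d)" using bm[of n] unfolding un_def by measurable
    have unb: "e n / m n \<le> un y \<and> un y \<le> (real n + 1) / m n" for y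
      unfolding un_def using bb[of n y] bb(2)[of n y] mp[of n] by (simp add: divide_right_mono)
    have h: "heat d \<eta> un x = a n x / m n" for x
      using heat_cmult[of d \<eta> "1 / m n" "b n" x] by (simp add: un_def a_def)
    have one': "EH tgt d \<eta> un = 1"
    proof -
      have "EH tgt d \<eta> un = EH tgt d \<eta> (b n) / m n"
        unfolding EH_def h by (simp add: a_def)
      also have "EH tgt d \<eta> (b n) = m n" unfolding m_def by (rule EH_marg[OF bbd b0])
      finally show ?thesis using mp[of n] by simp
    qed
    have V0: "(\<integral>x. heat d \<eta> un x powr q \<partial>tgt) = Vn n"
      unfolding h Vn_def W_def using a0 mp[of n] by (simp add: powr_divide)
    have "EH tgt d \<eta> (\<lambda>x. un x powr q) = EH tgt d \<eta> (\<lambda>x. (1 / m n powr q) * b n x powr q)"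
      unfolding un_def using b0 mp[of n] by (simp add: powr_divide)
    also have "\<dots> = 1 / m n powr q * EH tgt d \<eta> (\<lambda>x. b n x powr q)" by (rule tg.EH_cmult)
    also have "EH tgt d \<eta> (\<lambda>x. b n x powr q) = U n" unfolding U_def by (rule EH_marg[OF bq]) simp
    finally have E: "EH tgt d \<eta> (\<lambda>x. un x powr q) = U n / m n powr q" by simp
    have pos: "0 < e n / m n" using e(1)[of n] mp[of n] by simp
    note hg = tg.heat_growth[OF L unm unb pos one' \<eta>(1) q w]
    show ?thesis using hg unfolding V0 E lam_def by blast
  qed
  show V1: "1 \<le> V"
    by (rule LIMSEQ_le_const[OF Vlim]) (use step in blast)
  have den: "0 < 2 * w * \<eta> + w powr (2 * (1 - 1 / r)) / \<alpha>" using w \<eta> al by (intro add_pos_pos) auto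
  have "(\<lambda>n. lam (Vn n)) \<longlonglongrightarrow> lam V"
    unfolding lam_def using V1 den by (intro tendsto_divide tendsto_diff tendsto_powr Vlim tendsto_const) auto
  then have l1: "(\<lambda>n. exp (\<eta> / 4 * lam (Vn n)) * Vn n) \<longlonglongrightarrow> exp (\<eta> / 4 * lam V) * V"
    by (intro tendsto_mult tendsto_exp tendsto_const Vlim)
  have l2: "(\<lambda>n. U n / m n powr q) \<longlonglongrightarrow> (\<integral>y. u y powr q \<partial>marg) / 1 powr q"
    by (intro tendsto_divide Ulim tendsto_powr mlim tendsto_const) auto
  have "exp (\<eta> / 4 * lam V) * V \<le> (\<integral>y. u y powr q \<partial>marg) / 1 powr q"
    by (rule LIMSEQ_le[OF l1 l2]) (use step in blast)
  then show "exp (\<eta> / 4 * lam0) * V \<le> (\<integral>y. u y powr q \<partial>marg)" by (simp add: lam0_def lam_def)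
qed


text \<open>One iteration as a map on densities: conditioning on Y does not increase the moment of order q by
  Jensen's inequality, and averaging over the noise decreases it quantitatively by growth_density.\<close>

lemma step_contraction:
  assumes L: "LOI d r \<alpha> tgt"
    and hm: "h \<in> borel_measurable (lebd d)" and nn: "\<And>x. 0 \<le> h x"
    and one: "(\<integral>\<^sup>+x. ennreal (h x) \<partial>tgt) = 1" and iq: "integrable tgt (\<lambda>x. h x powr q)"
    and q: "2 \<le> q"
  shows "\<exists>h'. h' \<in> borel_measurable (lebd d) \<and> (\<forall>x. 0 \<le> h' x) \<and> (\<integral>\<^sup>+x. ennreal (h' x) \<partial>tgt) = 1 \<and>
    integrable tgt (\<lambda>x. h' x powr q) \<and> 1 \<le> (\<integral>x. h' x powr q \<partial>tgt) \<and>
    density tgt (\<lambda>x. ennreal (h x)) \<bind> (\<lambda>x. gauss d x \<eta> \<bind> (\<lambda>y. gibbs d (gt y))) = density tgt (\<lambda>x. ennreal (h' x)) \<and>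
    (\<forall>w. 0 < w \<and> w < 1 \<longrightarrow>
      exp (\<eta> / 4 * ((1 - (\<integral>x. h' x powr q \<partial>tgt) powr (- w / (2 * (q - 1)))) / (2 * w * \<eta> + w powr (2 * (1 - 1 / r)) / \<alpha>)))
        * (\<integral>x. h' x powr q \<partial>tgt) \<le> (\<integral>x. h x powr q \<partial>tgt))"
proof -
  define u where "u = post h"
  define h' where "h' = (\<lambda>x. enn2real (\<integral>\<^sup>+y. ennreal (u y) \<partial>gauss d x \<eta>))"
  have hme: "(\<lambda>x. ennreal (h x)) \<in> borel_measurable (lebd d)" by (rule measurable_compose[OF hm measurable_ennreal])
  have um: "u \<in> borel_measurable (lebd d)" unfolding u_def by (rule post_measurable[OF hm])
  have u0: "0 \<le> u y" for y by (simp add: u_def post_def)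
  have "(\<integral>\<^sup>+y. ennreal (u y) \<partial>marg) = (\<integral>\<^sup>+y. \<integral>\<^sup>+x. ennreal (h x) \<partial>gibbs d (gt y) \<partial>marg)"
    by (rule nn_integral_cong_AE) (use post_AE[OF hm] one in \<open>simp add: u_def\<close>)
  then have u1: "(\<integral>\<^sup>+y. ennreal (u y) \<partial>marg) = 1" using tgt_nn[OF hme] one by simp
  have hqm: "(\<lambda>x. ennreal (h x powr q)) \<in> borel_measurable (lebd d)" using hm by measurable
  have "(\<integral>\<^sup>+y. ennreal (u y powr q) \<partial>marg) \<le> (\<integral>\<^sup>+y. \<integral>\<^sup>+x. ennreal (h x powr q) \<partial>gibbs d (gt y) \<partial>marg)"
    unfolding u_def post_def
  proof (intro nn_integral_mono nn_jensen_powr tilt_prob nn)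
    show "h \<in> borel_measurable (gibbs d (gt y))" for y using hm by (simp only: measurable_cong_sets[OF sets_gibbs refl])
  qed (use q in simp)
  also have "\<dots> = (\<integral>\<^sup>+x. ennreal (h x powr q) \<partial>tgt)" by (rule tgt_nn[OF hqm])
  also have "\<dots> = ennreal (\<integral>x. h x powr q \<partial>tgt)" by (rule nn_integral_eq_integral[OF iq]) simp
  finally have ule: "(\<integral>\<^sup>+y. ennreal (u y powr q) \<partial>marg) \<le> ennreal (\<integral>x. h x powr q \<partial>tgt)" .
  then have ufin: "(\<integral>\<^sup>+y. ennreal (u y powr q) \<partial>marg) \<noteq> \<infinity>" by (auto simp: top_unique)
  have uqm: "(\<lambda>y. u y powr q) \<in> borel_measurable marg"
    using um unfolding measurable_cong_sets[OF sets_marg refl] by measurable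
  have "integrable marg (\<lambda>y. u y powr q)"
    using ufin uqm by (intro integrableI_nonneg) (auto simp: less_top[symmetric])
  from nn_integral_eq_integral[OF this] ule have uint: "(\<integral>y. u y powr q \<partial>marg) \<le> (\<integral>x. h x powr q \<partial>tgt)"
    by (simp add: ennreal_le_iff Bochner_Integration.integral_nonneg)
  have half: "0 < (1/2::real)" "(1/2::real) < 1" by simp_all
  have h'x: "h' x = enn2real (\<integral>\<^sup>+y. ennreal (u y) \<partial>gauss d x \<eta>)" for x by (simp add: h'_def)
  note g = growth_density[OF L um u0 u1 ufin q, folded h'x]
  have one': "(\<integral>\<^sup>+x. ennreal (h' x) \<partial>tgt) = 1"
  proof -
    have "(\<integral>\<^sup>+x. ennreal (h' x) \<partial>tgt) = (\<integral>\<^sup>+x. \<integral>\<^sup>+y. ennreal (u y) \<partial>gauss d x \<eta> \<partial>tgt)"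
      by (rule nn_integral_cong_AE) (use g(4)[OF half] in \<open>auto elim: eventually_mono\<close>)
    also have "\<dots> = 1" using marg_nn[OF measurable_compose[OF um measurable_ennreal]] u1 by simp
    finally show ?thesis .
  qed
  have dens: "density tgt (\<lambda>x. ennreal (h x)) \<bind> (\<lambda>x. gauss d x \<eta> \<bind> (\<lambda>y. gibbs d (gt y))) = density tgt (\<lambda>x. ennreal (h' x))"
    unfolding step_density[OF hm one] u_def[symmetric]
  proof (rule density_cong[OF _ _ g(4)[OF half]])
    show "(\<lambda>x. \<integral>\<^sup>+y. ennreal (u y) \<partial>gauss d x \<eta>) \<in> borel_measurable tgt"
      unfolding measurable_cong_sets[OF sets_gibbs refl]
      by (rule measurable_compose[OF measurable_prob_algebraD[OF gauss_kernel] nn_integral_measurable_subprob_algebra[OF measurable_compose[OF um measurable_ennreal]]])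
    show "(\<lambda>x. ennreal (h' x)) \<in> borel_measurable tgt"
      unfolding measurable_cong_sets[OF sets_gibbs refl] by (rule measurable_compose[OF g(5)[OF half] measurable_ennreal])
  qed
  show ?thesis
  proof (intro exI[of _ h'] conjI allI impI)
    show "h' \<in> borel_measurable (lebd d)" by (rule g(5)[OF half])
    show "0 \<le> h' x" for x by (simp add: h'_def)
    show "integrable tgt (\<lambda>x. h' x powr q)" by (rule g(1)[OF half])
    show "1 \<le> (\<integral>x. h' x powr q \<partial>tgt)" by (rule g(2)[OF half])
    fix w :: real assume w: "0 < w \<and> w < 1"
    show "exp (\<eta> / 4 * ((1 - (\<integral>x. h' x powr q \<partial>tgt) powr (- w / (2 * (q - 1)))) / (2 * w * \<eta> + w powr (2 * (1 - 1 / r)) / \<alpha>)))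
        * (\<integral>x. h' x powr q \<partial>tgt) \<le> (\<integral>x. h x powr q \<partial>tgt)"
      using g(3)[of w] w uint by linarith
  qed (rule one' dens)+
qed

end

section \<open>Decay of the Renyi divergence\<close>

lemma one_minus_exp_ge: fixes t :: real assumes "0 \<le> t" "t \<le> 1" shows "t / 2 \<le> 1 - exp (- t)"
proof -
  have "exp (- t) = 1 / exp t" by (simp add: exp_minus inverse_eq_divide)
  also have "\<dots> \<le> 1 / (1 + t)" using exp_ge_add_one_self[of t] assms by (intro divide_left_mono) auto
  also have "\<dots> \<le> 1 - t / 2"
  proof -
    have "0 \<le> t * (1 - t)" using assms by simp
    then have "1 \<le> (1 - t / 2) * (1 + t)" by (simp add: algebra_simps)
    then show ?thesis using assms by (simp add: pos_divide_le_eq)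
  qed
  finally show ?thesis by simp
qed

text \<open>The parameter w is chosen so that w R' stays bounded and w is at most 1/2. The decrement is
  then of order R' for R' \<le> 1 and of order R'^(2-2/r) for larger R'; bounding R' by the
  initial divergence R0 makes both linear in R', at the price of the factor R0^(2/r-1).\<close>

lemma renyi_decrement:
  fixes R R' R0 :: real
  assumes q: "2 \<le> q" and \<eta>: "0 < \<eta>" and \<alpha>: "0 < \<alpha>" and K: "1 + 2 * \<alpha> * \<eta> \<le> K" and r: "1 \<le> r" "r \<le> 2"
    and R': "0 \<le> R'" and R0: "R \<le> R0"
    and dec: "\<And>w. 0 < w \<Longrightarrow> w < 1 \<Longrightarrow>
      \<eta> / 4 * ((1 - exp (- (w * R' / 2))) / (2 * w * \<eta> + w powr (2 * (1 - 1 / r)) / \<alpha>)) \<le> (q - 1) * (R - R')"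
  shows "R' * (1 + \<eta> * \<alpha> / (32 * K * q * max 1 (R0 powr (2 / r - 1)))) \<le> R"
proof -
  define b s where "b = 2 * (1 - 1 / r)" and "s = 2 / r - 1"
  have b: "0 \<le> b" "b \<le> 1" and s: "0 \<le> s" "s = 1 - b" using r by (auto simp: b_def s_def field_simps)
  define m where "m = max 1 R'"
  (* then w R' / 2 \<le> 1/4, where 1 - exp (- t) is comparable to t *)
  define w where "w = 1 / (2 * m)"
  have m: "1 \<le> m" "R' \<le> m" by (simp_all add: m_def)
  have w: "0 < w" "w < 1" using m by (simp_all add: w_def)
  have K0: "0 < K" using K \<alpha> \<eta> by (smt (verit) mult_pos_pos)
  have wb: "w \<le> w powr b" using powr_mono'[of b 1 w] b w by simp
  have wb0: "0 < w powr b" using w by simp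
  have den: "2 * w * \<eta> + w powr b / \<alpha> \<le> w powr b * (K / \<alpha>)"
  proof -
    have "2 * w * \<eta> + w powr b / \<alpha> \<le> 2 * w powr b * \<eta> + w powr b / \<alpha>" using wb \<eta> by simp
    also have "\<dots> = w powr b * ((1 + 2 * \<alpha> * \<eta>) / \<alpha>)" using \<alpha> by (simp add: field_simps)
    also have "\<dots> \<le> w powr b * (K / \<alpha>)" using K \<alpha> wb0 by (intro mult_left_mono divide_right_mono) auto
    finally show ?thesis .
  qed
  have den0: "0 < 2 * w * \<eta> + w powr b / \<alpha>" using w \<eta> \<alpha> wb0 by (intro add_pos_pos) auto
  have t: "w * R' / 2 = R' / (4 * m)" by (simp add: w_def)
  have "R' / (4 * m) \<le> 1" using m R' by (simp add: pos_divide_le_eq)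
  then have num: "R' / (8 * m) \<le> 1 - exp (- (w * R' / 2))"
    unfolding t using one_minus_exp_ge[of "R' / (4 * m)"] R' m by simp
  have n0: "0 \<le> R' / (8 * m)" using R' m by simp
  have "R' / (8 * m) / (w powr b * (K / \<alpha>)) \<le> (1 - exp (- (w * R' / 2))) / (2 * w * \<eta> + w powr b / \<alpha>)"
    by (rule frac_le) (use num n0 den den0 in linarith)+
  then have "\<eta> / 4 * (R' / (8 * m) / (w powr b * (K / \<alpha>))) \<le> \<eta> / 4 * ((1 - exp (- (w * R' / 2))) / (2 * w * \<eta> + w powr b / \<alpha>))"
    using \<eta> by (intro mult_left_mono) auto
  also have "\<dots> \<le> (q - 1) * (R - R')" using dec[OF w] by (simp add: b_def)
  finally have d1: "\<eta> / 4 * (R' / (8 * m) / (w powr b * (K / \<alpha>))) \<le> (q - 1) * (R - R')" .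
  have e1: "\<eta> / 4 * (R' / (8 * m) / (w powr b * (K / \<alpha>))) = \<eta> * \<alpha> * R' / (32 * K) / (m * w powr b)"
    using \<alpha> by (simp add: field_simps)
  have p0: "0 \<le> \<eta> * \<alpha> * R' / (32 * K)" using \<eta> \<alpha> R' K0 by simp
  have mw0: "0 < m * w powr b" using m wb0 by simp
  have "0 \<le> (q - 1) * (R - R')" using d1 e1 p0 mw0 by (smt (verit) divide_nonneg_pos)
  then have RR: "R' \<le> R" using q by (simp add: zero_le_mult_iff)
  have mM: "m * w powr b \<le> max 1 (R0 powr s)"
  proof -
    have "w powr b \<le> (1 / m) powr b" using b w m by (intro powr_mono2) (auto simp: w_def field_simps)
    then have "m * w powr b \<le> m * (1 / m) powr b" using m by simp
    also have "\<dots> = m powr s" using m s by (simp add: powr_divide powr_diff)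
    also have "\<dots> \<le> max 1 (R0 powr s)"
    proof (cases "R' \<le> 1")
      case False
      then have "m powr s \<le> R0 powr s" using RR R0 s by (intro powr_mono2) (auto simp: m_def)
      then show ?thesis by simp
    qed (simp add: m_def max_def)
    finally show ?thesis .
  qed
  have M0: "0 < max 1 (R0 powr s)" by simp
  have "\<eta> * \<alpha> * R' / (32 * K) / max 1 (R0 powr s) \<le> \<eta> * \<alpha> * R' / (32 * K) / (m * w powr b)"
    by (rule divide_left_mono) (use mM p0 mw0 M0 in \<open>auto intro!: mult_pos_pos\<close>)
  also have "\<dots> \<le> (q - 1) * (R - R')" using d1 e1 by simp
  also have "\<dots> \<le> q * (R - R')" using RR by (intro mult_right_mono) auto
  finally have "\<eta> * \<alpha> * R' / (32 * K) / max 1 (R0 powr s) \<le> (R - R') * q" by (simp only: mult.commute)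
  then have "\<eta> * \<alpha> * R' / (32 * K) / max 1 (R0 powr s) / q \<le> R - R'"
    by (rule mult_imp_div_pos_le[rotated]) (use q in simp)
  then show ?thesis unfolding s_def[symmetric] by (simp add: algebra_simps)
qed

text \<open>For \<kappa> \<le> 2 the factor 1 + \<kappa> is at least exp(\<kappa>/2).\<close>

lemma geometric_decay_time:
  fixes \<kappa> R0 \<epsilon> :: real
  assumes \<kappa>: "0 < \<kappa>" "\<kappa> \<le> 2" and \<epsilon>: "0 < \<epsilon>" and R0: "0 \<le> R0"
  defines "L \<equiv> max 0 (ln (R0 / \<epsilon>))"
  defines "k \<equiv> nat \<lceil>2 * L / \<kappa>\<rceil>"
  shows "R0 / (1 + \<kappa>) ^ k \<le> \<epsilon>" "real k \<le> 2 * L / \<kappa> + 1"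
proof -
  have L0: "0 \<le> L" by (simp add: L_def)
  then have p: "0 \<le> 2 * L / \<kappa>" using \<kappa> by simp
  then show "real k \<le> 2 * L / \<kappa> + 1" unfolding k_def by linarith
  have kk: "2 * L / \<kappa> \<le> real k" unfolding k_def by linarith
  then have L: "L \<le> \<kappa> / 2 * real k" using \<kappa> by (simp add: field_simps)
  have e: "exp (\<kappa> / 2) \<le> 1 + \<kappa>"
  proof -
    have "exp (\<kappa> / 2) \<le> 1 + \<kappa> / 2 + (\<kappa> / 2)\<^sup>2" using \<kappa> by (intro exp_bound) auto
    also have "(\<kappa> / 2)\<^sup>2 \<le> \<kappa> / 2 * 1" unfolding power2_eq_square using \<kappa> by (intro mult_left_mono) auto
    finally show ?thesis by simp
  qed
  have "R0 \<le> \<epsilon> * exp L"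
  proof (cases "R0 = 0")
    case False
    then have "R0 / \<epsilon> = exp (ln (R0 / \<epsilon>))" using R0 \<epsilon> by simp
    also have "\<dots> \<le> exp L" by (simp add: L_def)
    finally show ?thesis using \<epsilon> by (simp add: pos_divide_le_eq mult.commute)
  qed (use \<epsilon> in simp)
  also have "\<dots> \<le> \<epsilon> * exp (\<kappa> / 2) ^ k"
    using L \<epsilon> by (simp add: exp_of_nat_mult[symmetric] mult.commute)
  also have "\<dots> \<le> \<epsilon> * (1 + \<kappa>) ^ k" using e \<epsilon> by (intro mult_left_mono power_mono) auto
  finally show "R0 / (1 + \<kappa>) ^ k \<le> \<epsilon>" using \<kappa> by (simp add: pos_divide_le_eq)
qed

text \<open>If the initial divergence is at least 1/2, then its power is bounded below and the logarithm is absorbed by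
  \<Lambda>. If it is smaller, then ln R0 is negative and the logarithm is at most ln (1/\<epsilon>).\<close>

lemma iteration_count_bound:
  fixes R0 s \<epsilon> \<Lambda> :: real
  assumes R0: "0 \<le> R0" and s: "0 \<le> s" "s \<le> 1" and \<epsilon>: "0 < \<epsilon>"
    and \<Lambda>: "1 \<le> \<Lambda>" "0 < R0 \<Longrightarrow> ln R0 \<le> \<Lambda>" "ln (1 / \<epsilon>) \<le> \<Lambda>"
  shows "max 1 (R0 powr s) * max 0 (ln (R0 / \<epsilon>)) \<le> 4 * \<Lambda> * max (rpow R0 s) (ln (1 / \<epsilon>))"
proof -
  define X where "X = max (rpow R0 s) (ln (1 / \<epsilon>))"
  have X: "rpow R0 s \<le> X" "ln (1 / \<epsilon>) \<le> X" by (simp_all add: X_def)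
  have X0: "0 \<le> X" using X(1) by (smt (verit) rpow_def powr_ge_zero)
  have sp: "ln (R0 / \<epsilon>) = ln R0 + ln (1 / \<epsilon>)" if "0 < R0" using that \<epsilon> by (simp add: ln_div)
  have L2: "max 0 (ln (R0 / \<epsilon>)) \<le> 2 * \<Lambda>"
    using \<Lambda> sp R0 by (cases "R0 = 0") auto
  have rp: "R0 powr s \<le> rpow R0 s"
    using R0 by (simp add: rpow_def)
  have "max 1 (R0 powr s) * max 0 (ln (R0 / \<epsilon>)) \<le> 4 * \<Lambda> * X"
  proof (cases "1/2 \<le> R0")
    case True
    have half: "1 / 2 \<le> rpow R0 s"
    proof (cases "1 \<le> R0")
      case True
      then have "1 \<le> R0 powr s" using s by (simp add: ge_one_powr_ge_zero)
      then show ?thesis using rp by simp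
    next
      case False
      then have "R0 powr 1 \<le> R0 powr s" using s True by (intro powr_mono') auto
      then show ?thesis using rp True by simp
    qed
    have "max 1 (R0 powr s) \<le> 2 * X" using rp half X by auto
    then have "max 1 (R0 powr s) * max 0 (ln (R0 / \<epsilon>)) \<le> 2 * X * (2 * \<Lambda>)"
      using L2 X0 by (intro mult_mono) auto
    then show ?thesis by (simp add: mult.assoc mult.left_commute mult.commute)
  next
    case False
    then have one: "max 1 (R0 powr s) = 1" using R0 s powr_mono2[of s R0 1] by simp
    have "max 0 (ln (R0 / \<epsilon>)) \<le> X"
    proof (cases "R0 = 0")
      case False
      then have pos: "0 < R0" using R0 by simp
      then have "ln R0 \<le> 0" using \<open>\<not> 1/2 \<le> R0\<close> by simp
      then have "ln (R0 / \<epsilon>) \<le> X" using sp[OF pos] X(2) by linarith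
      then show ?thesis using X0 by simp
    qed (use X0 in simp)
    also have "\<dots> \<le> 4 * \<Lambda> * X" using X0 \<Lambda>(1) mult_right_mono[of 1 "4 * \<Lambda>" X] by simp
    finally show ?thesis unfolding one by simp
  qed
  then show ?thesis by (simp add: X_def)
qed

context smooth_tilt
begin

text \<open>Radon-Nikodym derivatives are determined almost everywhere, so they may be replaced by the explicit Lebesgue densities; the
  density of the target is positive and cancels.\<close>

lemma renyi_density:
  assumes hm: "h \<in> borel_measurable (lebd d)" and nn: "\<And>x. 0 \<le> h x" and q: "1 < q"
  shows "renyi d q tgt (density tgt (\<lambda>x. ennreal (h x))) =
    (if (\<integral>\<^sup>+x. ennreal (h x powr q) \<partial>tgt) \<noteq> \<infinity> then ereal (ln (enn2real (\<integral>\<^sup>+x. ennreal (h x powr q) \<partial>tgt)) / (q - 1)) else \<infinity>)"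
proof -
  interpret L: sigma_finite_measure "lebd d" by (rule sigma_finite_lebd)
  define p where "p = (\<lambda>x. exp (- f x) / Zf)"
  have p0: "0 < p x" for x using Zf_pos by (simp add: p_def)
  have pm: "p \<in> borel_measurable (lebd d)" unfolding p_def by measurable
  have tp: "tgt = density (lebd d) (\<lambda>x. ennreal (p x))" by (simp add: gibbs_def p_def Zf_def)
  have pme: "(\<lambda>x. ennreal (p x)) \<in> borel_measurable (lebd d)" by (rule measurable_compose[OF pm measurable_ennreal])
  have hme: "(\<lambda>x. ennreal (h x)) \<in> borel_measurable (lebd d)" by (rule measurable_compose[OF hm measurable_ennreal])
  have phm: "(\<lambda>x. ennreal (p x * h x)) \<in> borel_measurable (lebd d)" using pm hm by measurable
  have hq: "(\<lambda>x. ennreal (h x powr q)) \<in> borel_measurable (lebd d)" using hm by measurable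
  have dd: "density tgt (\<lambda>x. ennreal (h x)) = density (lebd d) (\<lambda>x. ennreal (p x * h x))"
    unfolding tp by (subst density_density_eq[OF pme hme]) (simp add: ennreal_mult' p0 less_imp_le)
  have r1: "AE x in lebd d. ennreal (p x) = RN_deriv (lebd d) tgt x"
    by (rule L.RN_deriv_unique[OF pme tp[symmetric]])
  have r2: "AE x in lebd d. ennreal (p x * h x) = RN_deriv (lebd d) (density tgt (\<lambda>x. ennreal (h x))) x"
    by (rule L.RN_deriv_unique[OF phm dd[symmetric]])
  have "(\<integral>\<^sup>+x. ennreal (enn2real (RN_deriv (lebd d) (density tgt (\<lambda>x. ennreal (h x))) x) powr q
                          / enn2real (RN_deriv (lebd d) tgt x) powr (q - 1)) \<partial>lebd d)
      = (\<integral>\<^sup>+x. ennreal (p x) * ennreal (h x powr q) \<partial>lebd d)"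
  proof (rule nn_integral_cong_AE, use r1 r2 in eventually_elim)
    fix x assume a: "ennreal (p x) = RN_deriv (lebd d) tgt x" "ennreal (p x * h x) = RN_deriv (lebd d) (density tgt (\<lambda>x. ennreal (h x))) x"
    have "(p x * h x) powr q / p x powr (q - 1) = p x powr q / p x powr (q - 1) * h x powr q"
      using p0[of x] nn[of x] by (simp add: powr_mult)
    also have "p x powr q / p x powr (q - 1) = p x powr 1" unfolding powr_diff[symmetric] by simp
    finally have e: "(p x * h x) powr q / p x powr (q - 1) = p x * h x powr q" using p0[of x] by simp
    show "ennreal (enn2real (RN_deriv (lebd d) (density tgt (\<lambda>x. ennreal (h x))) x) powr q
                          / enn2real (RN_deriv (lebd d) tgt x) powr (q - 1)) = ennreal (p x) * ennreal (h x powr q)"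
      unfolding a[symmetric] using p0[of x] nn[of x] e by (simp add: ennreal_mult'[symmetric] less_imp_le)
  qed
  also have "\<dots> = (\<integral>\<^sup>+x. ennreal (h x powr q) \<partial>tgt)"
    unfolding tp by (rule nn_integral_density[symmetric, OF pme hq])
  finally have I: "(\<integral>\<^sup>+x. ennreal (enn2real (RN_deriv (lebd d) (density tgt (\<lambda>x. ennreal (h x))) x) powr q
                          / enn2real (RN_deriv (lebd d) tgt x) powr (q - 1)) \<partial>lebd d)
      = (\<integral>\<^sup>+x. ennreal (h x powr q) \<partial>tgt)" .
  have ac: "absolutely_continuous tgt (density tgt (\<lambda>x. ennreal (h x)))"
    by (rule absolutely_continuousI_density) (simp only: measurable_cong_sets[OF sets_gibbs refl] hme)
  show ?thesis unfolding renyi_def Let_def I using ac by simp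
qed

text \<open>A finite divergence includes absolute continuity, so the Radon-Nikodym theorem provides the density.\<close>

lemma renyi_finite_density:
  assumes \<rho>: "prob_space \<rho>" "sets \<rho> = sets (lebd d)" and q: "1 < q" and R: "renyi d q tgt \<rho> = ereal R0"
  shows "\<exists>h. h \<in> borel_measurable (lebd d) \<and> (\<forall>x. 0 \<le> h x) \<and> (\<integral>\<^sup>+x. ennreal (h x) \<partial>tgt) = 1 \<and>
    integrable tgt (\<lambda>x. h x powr q) \<and> \<rho> = density tgt (\<lambda>x. ennreal (h x))"
proof -
  interpret tp: prob_space tgt by (rule pi_prob)
  interpret rp: prob_space \<rho> by (rule \<rho>)
  have ss: "sets \<rho> = sets tgt" using \<rho> by simp
  have ac: "absolutely_continuous tgt \<rho>" using R by (auto simp: renyi_def Let_def split: if_splits)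
  define h where "h = (\<lambda>x. enn2real (RN_deriv tgt \<rho> x))"
  have Fm: "RN_deriv tgt \<rho> \<in> borel_measurable tgt" by simp
  have hmt: "h \<in> borel_measurable tgt" unfolding h_def using Fm by measurable
  then have hm: "h \<in> borel_measurable (lebd d)" by (simp only: measurable_cong_sets[OF sets_gibbs refl])
  have "AE x in tgt. RN_deriv tgt \<rho> x \<noteq> \<infinity>"
    by (rule tp.RN_deriv_finite[OF rp.sigma_finite_measure_axioms ac ss])
  then have ae: "AE x in tgt. RN_deriv tgt \<rho> x = ennreal (h x)"
    by eventually_elim (simp add: h_def less_top)
  have "density tgt (\<lambda>x. ennreal (h x)) = density tgt (RN_deriv tgt \<rho>)"
    by (rule density_cong[OF measurable_compose[OF hmt measurable_ennreal] Fm]) (use ae in \<open>auto elim: eventually_mono\<close>)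
  also have "\<dots> = \<rho>" by (rule tp.density_RN_deriv[OF ac ss])
  finally have dens: "\<rho> = density tgt (\<lambda>x. ennreal (h x))" by simp
  have nn: "0 \<le> h x" for x by (simp add: h_def)
  have one: "(\<integral>\<^sup>+x. ennreal (h x) \<partial>tgt) = 1"
  proof -
    have "(\<integral>\<^sup>+x. ennreal (h x) \<partial>tgt) = (\<integral>\<^sup>+x. ennreal (h x) * 1 \<partial>tgt)" by simp
    also have "\<dots> = (\<integral>\<^sup>+x. 1 \<partial>\<rho>)"
      unfolding dens by (rule nn_integral_density[symmetric, OF measurable_compose[OF hmt measurable_ennreal]]) simp
    also have "\<dots> = 1" using rp.emeasure_space_1 by simp
    finally show ?thesis .
  qed
  have fin: "(\<integral>\<^sup>+x. ennreal (h x powr q) \<partial>tgt) \<noteq> \<infinity>"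
    using R unfolding dens renyi_density[OF hm nn q] by (auto split: if_splits)
  have "(\<lambda>x. h x powr q) \<in> borel_measurable tgt" using hmt by measurable
  then have "integrable tgt (\<lambda>x. h x powr q)"
    using fin by (intro integrableI_nonneg) (auto simp: less_top[symmetric])
  then show ?thesis using hm nn one dens by blast
qed

lemma renyi_density_integrable:
  assumes hm: "h \<in> borel_measurable (lebd d)" and nn: "\<And>x. 0 \<le> h x" and q: "1 < q" and i: "integrable tgt (\<lambda>x. h x powr q)"
  shows "renyi d q tgt (density tgt (\<lambda>x. ennreal (h x))) = ereal (ln (\<integral>x. h x powr q \<partial>tgt) / (q - 1))"
  unfolding renyi_density[OF hm nn q] by (subst (1 2) nn_integral_eq_integral[OF i]) (simp_all add: Bochner_Integration.integral_nonneg)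

lemma power_mean_ge_one:
  assumes hm: "h \<in> borel_measurable (lebd d)" and nn: "\<And>x. 0 \<le> h x" and q: "1 < q" and i: "integrable tgt (\<lambda>x. h x powr q)"
    and one: "(\<integral>\<^sup>+x. ennreal (h x) \<partial>tgt) = 1"
  shows "1 \<le> (\<integral>x. h x powr q \<partial>tgt)"
proof -
  have "ennreal (enn2real (\<integral>\<^sup>+x. ennreal (h x) \<partial>tgt) powr q) \<le> (\<integral>\<^sup>+x. ennreal (h x powr q) \<partial>tgt)"
    by (rule nn_jensen_powr[OF pi_prob _ nn]) (use hm q in \<open>simp_all only: measurable_cong_sets[OF sets_gibbs refl] less_imp_le\<close>)
  also have "\<dots> = ennreal (\<integral>x. h x powr q \<partial>tgt)" by (rule nn_integral_eq_integral[OF i]) simp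
  finally show ?thesis by (simp add: one)
qed

text \<open>Taking logarithms in step_contraction gives the hypothesis of renyi_decrement. The rate depends on the
  initial divergence, which dominates the divergence at all later times.\<close>

lemma renyi_decay:
  assumes L: "LOI d r \<alpha> tgt" and \<rho>: "prob_space \<rho>" "sets \<rho> = sets (lebd d)" and q: "2 \<le> q"
    and R: "renyi d q tgt \<rho> = ereal R0" and K: "1 + 2 * \<alpha> * \<eta> \<le> K"
  defines "\<kappa> \<equiv> \<eta> * \<alpha> / (32 * K * q * max 1 (R0 powr (2 / r - 1)))"
  shows "0 \<le> R0" "renyi d q tgt (prox_law d f \<eta> \<rho> k) \<le> ereal (R0 / (1 + \<kappa>) ^ k)"
proof -
  have al: "0 < \<alpha>" and r: "1 \<le> r" "r \<le> 2" using L by (auto simp: LOI_def)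
  have q1: "1 < q" using q by simp
  have "0 < \<alpha> * \<eta>" using al \<eta> by simp
  then have K0: "0 < K" using K by linarith
  have k0: "0 \<le> \<kappa>" unfolding \<kappa>_def using \<eta> al K0 q by (intro divide_nonneg_nonneg mult_nonneg_nonneg) auto
  define good where "good = (\<lambda>\<rho> h. h \<in> borel_measurable (lebd d) \<and> (\<forall>x. 0 \<le> h x) \<and> (\<integral>\<^sup>+x. ennreal (h x) \<partial>tgt) = 1 \<and>
    integrable tgt (\<lambda>x. h x powr q) \<and> \<rho> = density tgt (\<lambda>x. ennreal (h x)))"
  define ren where "ren = (\<lambda>h. ln (\<integral>x. h x powr q \<partial>tgt) / (q - 1))"
  have good_ren: "renyi d q tgt \<rho> = ereal (ren h)" and ren0: "0 \<le> ren h" if "good \<rho> h" for \<rho> h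
  proof -
    have g: "h \<in> borel_measurable (lebd d)" "\<And>x. 0 \<le> h x" "(\<integral>\<^sup>+x. ennreal (h x) \<partial>tgt) = 1"
        "integrable tgt (\<lambda>x. h x powr q)" "\<rho> = density tgt (\<lambda>x. ennreal (h x))"
      using that by (simp_all add: good_def)
    show "renyi d q tgt \<rho> = ereal (ren h)"
      unfolding g(5) ren_def by (rule renyi_density_integrable[OF g(1,2) q1 g(4)])
    show "0 \<le> ren h" using power_mean_ge_one[OF g(1,2) q1 g(4,3)] q1 by (simp add: ren_def)
  qed
  obtain h0 where h0: "good \<rho> h0" using renyi_finite_density[OF \<rho> q1 R] by (auto simp: good_def)
  have R0: "R0 = ren h0" using good_ren[OF h0] R by simp
  then show R00: "0 \<le> R0" using ren0[OF h0] by simp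
  have "\<exists>h. good (prox_law d f \<eta> \<rho> k) h \<and> ren h \<le> R0 / (1 + \<kappa>) ^ k"
  proof (induction k)
    case 0 then show ?case using h0 R0 by auto
  next
    case (Suc k)
    then obtain h where gh: "good (prox_law d f \<eta> \<rho> k) h" and le: "ren h \<le> R0 / (1 + \<kappa>) ^ k" by blast
    have g: "h \<in> borel_measurable (lebd d)" "\<And>x. 0 \<le> h x" "(\<integral>\<^sup>+x. ennreal (h x) \<partial>tgt) = 1"
        "integrable tgt (\<lambda>x. h x powr q)" "prox_law d f \<eta> \<rho> k = density tgt (\<lambda>x. ennreal (h x))"
      using gh by (simp_all add: good_def)
    obtain h' where h': "h' \<in> borel_measurable (lebd d)" "\<And>x. 0 \<le> h' x" "(\<integral>\<^sup>+x. ennreal (h' x) \<partial>tgt) = 1"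
        "integrable tgt (\<lambda>x. h' x powr q)" and V': "1 \<le> (\<integral>x. h' x powr q \<partial>tgt)"
      and st: "density tgt (\<lambda>x. ennreal (h x)) \<bind> (\<lambda>x. gauss d x \<eta> \<bind> (\<lambda>y. gibbs d (gt y))) = density tgt (\<lambda>x. ennreal (h' x))"
      and dec: "\<And>w. 0 < w \<Longrightarrow> w < 1 \<Longrightarrow>
      exp (\<eta> / 4 * ((1 - (\<integral>x. h' x powr q \<partial>tgt) powr (- w / (2 * (q - 1)))) / (2 * w * \<eta> + w powr (2 * (1 - 1 / r)) / \<alpha>)))
        * (\<integral>x. h' x powr q \<partial>tgt) \<le> (\<integral>x. h x powr q \<partial>tgt)"
      using step_contraction[OF L g(1,2,3,4) q] by blast
    have gh': "good (prox_law d f \<eta> \<rho> (Suc k)) h'"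
      unfolding good_def prox_law.simps g(5) st using h' by blast
    define V V1 where "V = (\<integral>x. h x powr q \<partial>tgt)" and "V1 = (\<integral>x. h' x powr q \<partial>tgt)"
    have V1: "1 \<le> V1" using V' by (simp add: V1_def)
    have "R0 / (1 + \<kappa>) ^ k \<le> R0 / 1" using R00 k0 by (intro divide_left_mono) auto
    then have hR0: "ren h \<le> R0" using le by simp
    have "ren h' * (1 + \<kappa>) \<le> ren h"
      unfolding \<kappa>_def
    proof (rule renyi_decrement[OF q \<eta>(1) al K r ren0[OF gh'] hR0])
      fix w :: real assume w: "0 < w" "w < 1"
      let ?E = "\<eta> / 4 * ((1 - V1 powr (- w / (2 * (q - 1)))) / (2 * w * \<eta> + w powr (2 * (1 - 1 / r)) / \<alpha>))"
      have d: "exp ?E * V1 \<le> V" using dec[OF w] by (simp add: V_def V1_def)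
      have pos: "0 < exp ?E * V1" using V1 by simp
      have "?E + ln V1 = ln (exp ?E * V1)" using V1 by (simp add: ln_mult)
      also have "\<dots> \<le> ln V" using d pos by (intro ln_mono) auto
      finally have "?E \<le> ln V - ln V1" by simp
      also have "\<dots> = (q - 1) * (ren h - ren h')" using q1 by (simp add: ren_def V_def V1_def right_diff_distrib)
      also have "V1 powr (- w / (2 * (q - 1))) = exp (- (w * ren h' / 2))"
        using V1 q1 by (simp add: powr_def ren_def V1_def)
      finally show "\<eta> / 4 * ((1 - exp (- (w * ren h' / 2))) / (2 * w * \<eta> + w powr (2 * (1 - 1 / r)) / \<alpha>)) \<le> (q - 1) * (ren h - ren h')" .
    qed
    then have "ren h' \<le> ren h / (1 + \<kappa>)" using k0 by (simp add: pos_le_divide_eq)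
    also have "\<dots> \<le> R0 / (1 + \<kappa>) ^ k / (1 + \<kappa>)" using le k0 by (intro divide_right_mono) auto
    finally have "ren h' \<le> R0 / (1 + \<kappa>) ^ Suc k" by (simp add: mult.commute)
    then show ?case using gh' by blast
  qed
  then show "renyi d q tgt (prox_law d f \<eta> \<rho> k) \<le> ereal (R0 / (1 + \<kappa>) ^ k)" using good_ren by auto
qed

end

section \<open>Number of oracle calls\<close>

lemma log_factor_bounds:
  assumes "0 < \<alpha>" "0 < \<beta>" "0 \<le> q" "0 < \<epsilon>" "0 \<le> R"
  shows "1 \<le> log_factor d \<alpha> \<beta> q \<epsilon> R" "0 < R \<Longrightarrow> ln R \<le> log_factor d \<alpha> \<beta> q \<epsilon> R"
    "ln (1 / \<epsilon>) \<le> log_factor d \<alpha> \<beta> q \<epsilon> R"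
proof -
  have p: "0 \<le> \<beta> / \<alpha>" "0 < 1 / \<epsilon>" "0 < exp (1::real)" using assms by auto
  let ?A = "exp 1 + \<beta> / \<alpha> + real d + q + R + 1 / \<epsilon>"
  have b: "exp 1 \<le> ?A" "R \<le> ?A" "1 / \<epsilon> \<le> ?A" using p assms by linarith+
  have "ln (exp 1) \<le> ln ?A" using b(1) p(3) by (intro ln_mono) auto
  then show "1 \<le> log_factor d \<alpha> \<beta> q \<epsilon> R" by (simp add: log_factor_def)
  show "ln R \<le> log_factor d \<alpha> \<beta> q \<epsilon> R" if "0 < R" unfolding log_factor_def using b(2) that by (intro ln_mono) auto
  show "ln (1 / \<epsilon>) \<le> log_factor d \<alpha> \<beta> q \<epsilon> R" unfolding log_factor_def using b(3) p(2) by (intro ln_mono) auto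
qed

text \<open>The number of iterations is about 2 ln(R0/\<epsilon>)/\<kappa>, and each of them costs at most 2 + e \<le> 5 calls on
  average for c \<le> 1/2. The single extra iteration from rounding is absorbed by the lower bound on the complexity.\<close>

lemma (in smooth_tilt) sampler_complexity:
  assumes L: "LOI d r \<alpha> tgt" and \<rho>: "prob_space \<rho>" "sets \<rho> = sets (lebd d)" and q: "2 \<le> q" and \<epsilon>: "0 < \<epsilon>"
    and R: "renyi d q tgt \<rho> = ereal R0"
    and \<eta>c: "\<eta> = c / (\<beta> * real d)" and c: "0 < c" "c \<le> 1 / 2" and \<delta>: "0 < \<delta>" "\<delta> \<le> complexity d \<alpha> \<beta> r q \<epsilon> R0"
  shows "\<exists>k. renyi d q tgt (prox_law d f \<eta> \<rho> k) \<le> ereal \<epsilon> \<and>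
    (\<integral>\<^sup>+\<omega>. snd \<omega> \<partial>sampler d f \<beta> \<eta> \<rho> k)
      \<le> ennreal ((5 / \<delta> + 2622720 / c) * log_factor d \<alpha> \<beta> q \<epsilon> R0 * complexity d \<alpha> \<beta> r q \<epsilon> R0)"
proof -
  have al: "0 < \<alpha>" and r: "1 \<le> r" "r \<le> 2" using L by (auto simp: LOI_def)
  have dpos: "1 \<le> real d" using d1 by simp
  define s where "s = 2 / r - 1"
  have s: "0 \<le> s" "s \<le> 1" using r by (auto simp: s_def field_simps)
  define M where "M = max 1 (R0 powr s)"
  have M: "1 \<le> M" by (simp add: M_def)
  have "\<alpha> * \<eta> \<le> 2048 * \<beta> * \<eta>" using alpha_le_beta[OF L] \<eta> by (intro mult_right_mono) auto
  also have "\<beta> * \<eta> = c / real d" using \<beta> by (simp add: \<eta>c)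
  then have "2048 * \<beta> * \<eta> = 2048 * (c / real d)" by simp
  also have "c / real d \<le> c / 1" using dpos c by (intro divide_left_mono) auto
  finally have ae: "\<alpha> * \<eta> \<le> 1024" using c by simp
  (* 2049 bounds 1 + 2 \<alpha> \<eta>, because \<alpha> \<eta> \<le> 2048 c / d \<le> 1024 *)
  define \<kappa> where "\<kappa> = \<eta> * \<alpha> / (32 * 2049 * q * max 1 (R0 powr (2 / r - 1)))"
  have \<kappa>M: "\<kappa> = \<eta> * \<alpha> / (65568 * q * M)" by (simp add: \<kappa>_def M_def s_def)
  have qM: "2 \<le> q * M" using mult_mono[of 2 q 1 M] q M by simp
  have \<kappa>: "0 < \<kappa>" unfolding \<kappa>M using \<eta> al q M by (intro divide_pos_pos mult_pos_pos) auto
  have "\<kappa> \<le> 2" unfolding \<kappa>M using ae qM by (simp add: pos_divide_le_eq mult.commute mult.assoc mult.left_commute)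
  note decay = renyi_decay[OF L \<rho> q R, of 2049, folded \<kappa>_def]
  have K: "1 + 2 * \<alpha> * \<eta> \<le> 2049" using ae by simp
  have R00: "0 \<le> R0" by (rule decay(1)[OF K])
  define Lg where "Lg = max 0 (ln (R0 / \<epsilon>))"
  define k where "k = nat \<lceil>2 * Lg / \<kappa>\<rceil>"
  have gd: "R0 / (1 + \<kappa>) ^ k \<le> \<epsilon>" "real k \<le> 2 * Lg / \<kappa> + 1"
    using geometric_decay_time[OF \<kappa> \<open>\<kappa> \<le> 2\<close> \<epsilon> R00] by (simp_all add: k_def Lg_def)
  have ren: "renyi d q tgt (prox_law d f \<eta> \<rho> k) \<le> ereal \<epsilon>"
    using order_trans[OF decay(2)[OF K]] gd(1) by simp
  define \<Lambda> where "\<Lambda> = log_factor d \<alpha> \<beta> q \<epsilon> R0"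
  define X where "X = max (rpow R0 s) (ln (1 / \<epsilon>))"
  define Y where "Y = complexity d \<alpha> \<beta> r q \<epsilon> R0"
  have q0: "0 \<le> q" using q by simp
  note lf = log_factor_bounds[OF al \<beta> q0 \<epsilon> R00, of d, folded \<Lambda>_def]
  have LM: "M * Lg \<le> 4 * \<Lambda> * X"
    using iteration_count_bound[OF R00 s \<epsilon> lf] by (simp add: M_def Lg_def X_def)
  have Y: "Y = \<beta> * real d * q / \<alpha> * X" by (simp add: Y_def complexity_def X_def s_def)
  (* the constants are 65568 = 32 * 2049, doubled for the number of iterations, then multiplied by the 4 of the logarithmic bound and the 5 calls per iteration *)
  have k1: "2 * Lg / \<kappa> = 131136 / c * (\<beta> * real d * q / \<alpha>) * (M * Lg)"
    unfolding \<kappa>M \<eta>c using \<beta> dpos c al q M by (simp add: field_simps)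
  also have "\<dots> \<le> 131136 / c * (\<beta> * real d * q / \<alpha>) * (4 * \<Lambda> * X)"
    by (rule mult_left_mono[OF LM]) (use \<beta> c al q in simp)
  also have "\<dots> = 524544 / c * \<Lambda> * Y" by (simp add: Y)
  finally have k2: "2 * Lg / \<kappa> \<le> 524544 / c * \<Lambda> * Y" .
  have "1 * \<delta> \<le> \<Lambda> * Y" using lf(1) \<delta> by (intro mult_mono) (auto simp: Y_def)
  then have "1 \<le> 1 / \<delta> * \<Lambda> * Y" using \<delta> by (simp add: field_simps)
  then have "real k \<le> 1 / \<delta> * \<Lambda> * Y + 524544 / c * \<Lambda> * Y" using gd(2) k2 by linarith
  then have "real k * 5 \<le> (1 / \<delta> * \<Lambda> * Y + 524544 / c * \<Lambda> * Y) * 5" by (rule mult_right_mono) simp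
  moreover have "(5 / \<delta> + 2622720 / c) * \<Lambda> * Y = (1 / \<delta> * \<Lambda> * Y + 524544 / c * \<Lambda> * Y) * 5"
    by (simp add: algebra_simps)
  ultimately have kb: "real k * 5 \<le> (5 / \<delta> + 2622720 / c) * \<Lambda> * Y" by simp
  have scd: "\<beta> * real d / sc \<le> 1"
  proof -
    have sc: "sc = \<beta> * (real d / c - 1)" unfolding sc_def unfolding \<eta>c using \<beta> c dpos by (simp add: right_diff_distrib)
    have "2 * real d \<le> real d / c" using c dpos by (simp add: pos_le_divide_eq)
    then have dc: "real d \<le> real d / c - 1" using dpos by linarith
    then have p: "0 < real d / c - 1" using dpos by linarith
    show ?thesis unfolding sc using dc p \<beta> by (simp add: pos_divide_le_eq)
  qed
  have "exp (\<beta> * real d / sc) \<le> exp 1" using scd by simp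
  then have e3: "exp (\<beta> * real d / sc) \<le> 3" using exp_le by linarith
  have "(\<integral>\<^sup>+\<omega>. snd \<omega> \<partial>sampler d f \<beta> \<eta> \<rho> k) \<le> of_nat k * (2 + ennreal (exp (\<beta> * real d / sc)))"
    by (rule sampler_cost[OF \<rho>])
  also have "\<dots> \<le> of_nat k * (2 + ennreal 3)" by (intro mult_left_mono add_left_mono ennreal_leI e3) simp
  also have "\<dots> = ennreal (real k * 5)" by (simp add: ennreal_mult' ennreal_of_nat_eq_real_of_nat)
  also have "\<dots> \<le> ennreal ((5 / \<delta> + 2622720 / c) * \<Lambda> * Y)" by (rule ennreal_leI[OF kb])
  finally show ?thesis using ren unfolding \<Lambda>_def Y_def by blast
qed

theorem corollary7:
  shows "\<exists>c0::real. 0 < c0 \<and> c0 < 1 \<and>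
    (\<forall>(c::real) (\<delta>::real). 0 < c \<and> c \<le> c0 \<and> 0 < \<delta> \<longrightarrow>
      (\<exists>(C::real) (m::nat). 0 < C \<and>
        (\<forall>(d::nat) (f::(nat \<Rightarrow> real) \<Rightarrow> real) (\<alpha>::real) (\<beta>::real) (r::real) (q::real)
            (\<epsilon>::real) (\<rho>0::(nat \<Rightarrow> real) measure) (R0::real) (\<eta>::real).
          1 \<le> d \<and> 0 < \<beta> \<and> smooth_grad d \<beta> f \<and>
          integrable (lebd d) (\<lambda>x. exp (- f x)) \<and>
          integrable (gibbs d f) (\<lambda>x. (normd d x)\<^sup>2) \<and>
          LOI d r \<alpha> (gibbs d f) \<and>
          2 \<le> q \<and> 0 < \<epsilon> \<and>
          prob_space \<rho>0 \<and> sets \<rho>0 = sets (lebd d) \<and>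
          renyi d q (gibbs d f) \<rho>0 = ereal R0 \<and>
          \<eta> = c / (\<beta> * real d) \<and>
          \<delta> \<le> complexity d \<alpha> \<beta> r q \<epsilon> R0
          \<longrightarrow>
          (\<exists>k::nat.
            distr (sampler d f \<beta> \<eta> \<rho>0 k) (lebd d) fst = prox_law d f \<eta> \<rho>0 k \<and>
            renyi d q (gibbs d f) (prox_law d f \<eta> \<rho>0 k) \<le> ereal \<epsilon> \<and>
            (\<integral>\<^sup>+\<omega>. snd \<omega> \<partial>sampler d f \<beta> \<eta> \<rho>0 k)
              \<le> ennreal (C * log_factor d \<alpha> \<beta> q \<epsilon> R0 ^ m * complexity d \<alpha> \<beta> r q \<epsilon> R0)))))"
proof (rule exI[of _ "1 / 2 :: real"], intro conjI allI impI)
  fix c \<delta> :: real assume c\<delta>: "0 < c \<and> c \<le> 1 / 2 \<and> 0 < \<delta>"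
  show "\<exists>(C::real) (m::nat). 0 < C \<and>
        (\<forall>(d::nat) (f::(nat \<Rightarrow> real) \<Rightarrow> real) (\<alpha>::real) (\<beta>::real) (r::real) (q::real)
            (\<epsilon>::real) (\<rho>0::(nat \<Rightarrow> real) measure) (R0::real) (\<eta>::real).
          1 \<le> d \<and> 0 < \<beta> \<and> smooth_grad d \<beta> f \<and>
          integrable (lebd d) (\<lambda>x. exp (- f x)) \<and>
          integrable (gibbs d f) (\<lambda>x. (normd d x)\<^sup>2) \<and>
          LOI d r \<alpha> (gibbs d f) \<and>
          2 \<le> q \<and> 0 < \<epsilon> \<and>
          prob_space \<rho>0 \<and> sets \<rho>0 = sets (lebd d) \<and>
          renyi d q (gibbs d f) \<rho>0 = ereal R0 \<and>
          \<eta> = c / (\<beta> * real d) \<and>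
          \<delta> \<le> complexity d \<alpha> \<beta> r q \<epsilon> R0
          \<longrightarrow>
          (\<exists>k::nat.
            distr (sampler d f \<beta> \<eta> \<rho>0 k) (lebd d) fst = prox_law d f \<eta> \<rho>0 k \<and>
            renyi d q (gibbs d f) (prox_law d f \<eta> \<rho>0 k) \<le> ereal \<epsilon> \<and>
            (\<integral>\<^sup>+\<omega>. snd \<omega> \<partial>sampler d f \<beta> \<eta> \<rho>0 k)
              \<le> ennreal (C * log_factor d \<alpha> \<beta> q \<epsilon> R0 ^ m * complexity d \<alpha> \<beta> r q \<epsilon> R0)))"
  proof (rule exI[of _ "5 / \<delta> + 2622720 / c"], rule exI[of _ 1], intro conjI allI impI, goal_cases)
    case 1 then show ?case using c\<delta> by (simp add: add_pos_pos)
  next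
    case (2 d f \<alpha> \<beta> r q \<epsilon> \<rho>0 R0 \<eta>)
    then have as: "1 \<le> d" "0 < \<beta>" "smooth_grad d \<beta> f" "integrable (lebd d) (\<lambda>x. exp (- f x))"
        "LOI d r \<alpha> (gibbs d f)" "2 \<le> q" "0 < \<epsilon>" "prob_space \<rho>0" "sets \<rho>0 = sets (lebd d)"
        "renyi d q (gibbs d f) \<rho>0 = ereal R0" and eta_eq: "\<eta> = c / (\<beta> * real d)" and delta_le: "\<delta> \<le> complexity d \<alpha> \<beta> r q \<epsilon> R0"
      by blast+
    have c: "0 < c" "c \<le> 1 / 2" "0 < \<delta>" using c\<delta> by auto
    interpret smooth_tilt d f \<beta> \<eta>
    proof
      have d: "1 \<le> real d" using as(1) by simp
      show "0 < \<eta>" using eta_eq c as(2) d by simp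
      have "\<eta> * \<beta> = c / real d" using as(2) by (simp add: eta_eq)
      also have "\<dots> < 1" using c d by (simp add: pos_divide_less_eq)
      finally show "\<eta> * \<beta> < 1" .
    qed (use as in simp_all)
    show ?case
      using sampler_complexity[OF as(5,8,9,6,7,10) eta_eq c(1,2,3) delta_le] sampler_fst[OF as(8,9)] by (simp only: power_one_right) blast
  qed
qed simp_all

end
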